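(* Let $g\in L^2(\mathbb{R}^n)$ and let $f:\mathbb{R}^n\times\mathbb{R}\to\mathbb{R}$ be a smooth function satisfying, for all $x\in\mathbb{R}^n$ and $s\in\mathbb{R}$, $$f(x,s)s\le-\alpha_1|s|^p+\psi_1(x),\quad |f(x,s)|\le\alpha_2|s|^{p-1}+\psi_2(x),\quad \frac{\partial f}{\partial s}(x,s)\le\beta,\quad \Big|\frac{\partial f}{\partial x}(x,s)\Big|\le\psi_3(x),$$ $$\Big|\frac{\partial f}{\partial s}(x,s)\Big|\le\alpha_3|s|^{p-2}+\psi_4(x),$$ where $\alpha_1,\alpha_2,\alpha_3,\beta>0$, $\psi_1\in L^1(\mathbb{R}^n)\cap L^\infty(\mathbb{R}^n)$, $\psi_2\in L^2(\mathbb{R}^n)\cap L^q(\mathbb{R}^n)$ with $\frac1q+\frac1p=1$, $\psi_3\in L^2(\mathbb{R}^n)$, and $\psi_4\in L^\infty(\mathbb{R}^n)$ if $p=2$, $\psi_4\in L^{\frac{p}{p-2}}(\mathbb{R}^n)$ if $p>2$. Let $\{\mathcal{A}_\epsilon(\omega)\}_{\omega\in\Omega}$ be the $\mathcal{D}$-random attractor of the random dynamical system $\Phi_\epsilon$ generated by the stochastic equation $du+(\lambda u-\Delta u)dt=(f(x,u)+g(x))dt+\epsilon h\,dW$ on $\mathbb{R}^n$, and let $\mathcal{A}$ be the global attractor in $L^2(\mathbb{R}^n)$ of the deterministic equation $\frac{du}{dt}+\lambda u-\Delta u=f(x,u)+g(x)$ on $\mathbb{R}^n$. Then for $P$-a.e.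 $\omega\in\Omega$, $$\lim_{\epsilon\to0}\mathrm{dist}_{L^2(\mathbb{R}^n)}(\mathcal{A}_\epsilon(\omega),\mathcal{A})=0,$$ where $\mathrm{dist}_{L^2(\mathbb{R}^n)}(\mathcal{A}_\epsilon(\omega),\mathcal{A})=\sup_{a\in\mathcal{A}_\epsilon(\omega)}\inf_{b\in\mathcal{A}}\|a-b\|_{L^2(\mathbb{R}^n)}$.
   Context: Fixed data: $\lambda>0$, $p\ge2$, $h\in H^2(\mathbb{R}^n)\cap W^{2,p}(\mathbb{R}^n)$; $\|\cdot\|$ is the norm of $L^2(\mathbb{R}^n)$. $W$ is a two-sided real-valued Wiener process on a complete probability space $(\Omega,\mathcal{F},P)$, where $P$ is the Wiener distribution, $\Omega\subseteq\{\omega\in C(\mathbb{R},\mathbb{R}):\omega(0)=0\}$ with $P(\Omega)=1$, and the space is invariant under the Wiener shift $\theta_t\omega(\cdot)=\omega(\cdot+t)-\omega(t)$, so that $(\Omega,\mathcal{F},P,(\theta_t)_{t\in\mathbb{R}})$ is a metric dynamical system. Let $y(\theta_t\omega)=-\lambda\int_{-\infty}^0e^{\lambda\tau}(\theta_t\omega)(\tau)\,d\tau$, the stationary solution of $dy+\lambda y\,dt=dW(t)$, and $z(\theta_t\omega)=h\,y(\theta_t\omega)$. For $\epsilon>0$, the stochastic equation with $u(x,0)=u_0(x)$ is solved through $v=u-\epsilon z(\theta_t\omega)$, which satisfies $$\frac{\partial v}{\partial t}+\lambda v-\Delta v=f(x,v+\epsilon z(\theta_t\omega))+g+\epsilon\Delta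 z(\theta_t\omega).$$ For $P$-a.e. $\omega$ and all $v_0\in L^2(\mathbb{R}^n)$ this has a unique solution $v(\cdot,\omega,v_0)\in C([0,\infty),L^2(\mathbb{R}^n))\cap L^2((0,T),H^1(\mathbb{R}^n))$ for every $T>0$, with $v(0,\omega,v_0)=v_0$, continuous in $v_0$. Set $u(t,\omega,u_0)=v(t,\omega,u_0-\epsilon z(\omega))+\epsilon z(\theta_t\omega)$ and $\Phi_\epsilon(t,\omega,u_0)=u(t,\omega,u_0)$; this is a continuous random dynamical system on $L^2(\mathbb{R}^n)$ over $(\Omega,\mathcal{F},P,(\theta_t)_{t\in\mathbb{R}})$. For $\epsilon=0$ the deterministic equation generates a continuous dynamical system $\Phi$ on $L^2(\mathbb{R}^n)$, which has a unique global attractor $\mathcal{A}$ (compact, invariant, attracting every bounded set uniformly). $\mathcal{D}$ is the collection of random subsets $D=\{D(\omega)\}_{\omega\in\Omega}$ of $L^2(\mathbb{R}^n)$ such that (for $P$-a.e. $\omega$) $e^{-\frac12\lambda t}\|D(\theta_{-t}\omega)\|\to0$ as $t\to\infty$, where $\|D(\theta_{-t}\omega)\|=\sup_{u\in D(\theta_{-t}\omega)}\|u\|$. A $\mathcal{D}$-random attractor for $\Phi_\epsilon$ is a random set $\{\mathcal{A}_\epsilon(\omega)\}$ such that for $P$-a.e. $\omega$: $\mathcal{A}_\epsilon(\omega)$ is compact and $\omega\mapsto d(x,\mathcal{A}_\epsilon(\omega))$ is measurable for every $x\in L^2(\mathbb{R}^n)$; $\Phi_\epsilon(t,\omega,\mathcal{A}_\epsilon(\omega))=\mathcal{A}_\epsilon(\theta_t\omega)$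 for all $t\ge0$; and for every $B\in\mathcal{D}$, $\lim_{t\to\infty}\mathrm{dist}_{L^2(\mathbb{R}^n)}(\Phi_\epsilon(t,\theta_{-t}\omega,B(\theta_{-t}\omega)),\mathcal{A}_\epsilon(\omega))=0$. Under the stated conditions $\Phi_\epsilon$ has a unique $\mathcal{D}$-random attractor, which belongs to $\mathcal{D}$.
   Formalization: The conditions "for P-a.e. ω" on the systems Φ_ε and attractors A_ε are assumed to hold outside one null set common to all ε>0; with a separate null set for each ε the claim fails, since A_ε could be altered on a null set depending on ε. *)

theory Defs
  imports "HOL-Probability.Probability"
begin

section \<open>Lebesgue classes on a Euclidean space\<close>

definition Lp :: "real \<Rightarrow> ('a::euclidean_space \<Rightarrow> real) set" where
  "Lp p = {u \<in> borel_measurable lebesgue. integrable lebesgue (\<lambda>x. \<bar>u x\<bar> powr p)}"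

definition Linf :: "('a::euclidean_space \<Rightarrow> real) set" where
  "Linf = {u \<in> borel_measurable lebesgue. \<exists>C. AE x in lebesgue. \<bar>u x\<bar> \<le> C}"

lemma Lp_2_iff:
  "u \<in> Lp 2 \<longleftrightarrow> u \<in> borel_measurable lebesgue \<and> integrable lebesgue (\<lambda>x. (u x)\<^sup>2)"
  by (simp add: Lp_def)

lemma Lp_2_measurable: "u \<in> Lp 2 \<Longrightarrow> u \<in> borel_measurable lebesgue"
  by (simp add: Lp_2_iff)

lemma Lp_2_mult_integrable:
  assumes "u \<in> Lp 2" "w \<in> Lp 2"
  shows "integrable lebesgue (\<lambda>x. u x * w x)"
proof (rule Bochner_Integration.integrable_bound)
  show "integrable lebesgue (\<lambda>x. (u x)\<^sup>2 + (w x)\<^sup>2)"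
    using assms by (simp add: Lp_2_iff)
  show "(\<lambda>x. u x * w x) \<in> borel_measurable lebesgue"
    using assms by (intro borel_measurable_times) (simp_all add: Lp_2_iff)
  have "\<bar>a * b\<bar> \<le> a\<^sup>2 + b\<^sup>2" for a b :: real
  proof -
    have "2 * (\<bar>a\<bar> * \<bar>b\<bar>) \<le> a\<^sup>2 + b\<^sup>2"
      using sum_squares_bound[of "\<bar>a\<bar>" "\<bar>b\<bar>"] by (simp add: mult.assoc)
    moreover have "0 \<le> \<bar>a\<bar> * \<bar>b\<bar>" by simp
    ultimately show ?thesis unfolding abs_mult by linarith
  qed
  then show "AE x in lebesgue. norm (u x * w x) \<le> norm ((u x)\<^sup>2 + (w x)\<^sup>2)"
    by simp
qed

lemma Lp_2_add:
  assumes "u \<in> Lp 2" "w \<in> Lp 2"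
  shows "(\<lambda>x. u x + w x) \<in> Lp 2"
proof -
  have "integrable lebesgue (\<lambda>x. (u x)\<^sup>2 + (w x)\<^sup>2 + 2 * (u x * w x))"
    using assms Lp_2_mult_integrable[OF assms] by (simp add: Lp_2_iff)
  then show ?thesis
    using assms unfolding Lp_2_iff power2_sum mult.assoc
    by (intro conjI borel_measurable_add) simp_all
qed

lemma Lp_2_cmult: "u \<in> Lp 2 \<Longrightarrow> (\<lambda>x. c * u x) \<in> Lp 2"
  unfolding Lp_2_iff power_mult_distrib
  by (intro conjI borel_measurable_times integrable_mult_right) simp_all

lemma Lp_2_uminus: "u \<in> Lp 2 \<Longrightarrow> (\<lambda>x. - u x) \<in> Lp 2"
  by (simp add: Lp_2_iff)

lemma Lp_2_diff: "u \<in> Lp 2 \<Longrightarrow> w \<in> Lp 2 \<Longrightarrow> (\<lambda>x. u x - w x) \<in> Lp 2"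
  using Lp_2_add[of u "\<lambda>x. - w x"] by (simp add: Lp_2_uminus)

lemma Lp_2_zero: "(\<lambda>x. 0) \<in> Lp 2"
  by (simp add: Lp_2_iff)


section \<open>The inner product space $L^2$ of classes modulo almost everywhere equality\<close>

definition L2_rel :: "('a::euclidean_space \<Rightarrow> real) \<Rightarrow> ('a \<Rightarrow> real) \<Rightarrow> bool" where
  "L2_rel u w \<longleftrightarrow> u \<in> Lp 2 \<and> w \<in> Lp 2 \<and> (AE x in lebesgue. u x = w x)"

lemma part_equivp_L2_rel: "part_equivp L2_rel"
proof (rule part_equivpI)
  show "\<exists>u. L2_rel u u"
    using Lp_2_zero by (auto simp: L2_rel_def)
  show "symp L2_rel"
    by (auto simp: symp_def L2_rel_def elim: AE_mp)
  show "transp L2_rel"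
    unfolding transp_def L2_rel_def by (auto elim!: AE_mp)
qed

quotient_type (overloaded) 'a L2 = "'a::euclidean_space \<Rightarrow> real" / partial: L2_rel
  by (rule part_equivp_L2_rel)

definition L2_of :: "('a::euclidean_space \<Rightarrow> real) \<Rightarrow> 'a L2" where
  "L2_of u = abs_L2 u"

text \<open>A representative; every use below depends on its almost everywhere class only.\<close>

definition L2_fun :: "'a::euclidean_space L2 \<Rightarrow> 'a \<Rightarrow> real" where
  "L2_fun u = rep_L2 u"

instantiation L2 :: (euclidean_space) real_inner
begin

lift_definition zero_L2 :: "'a L2" is "\<lambda>x. 0"
  by (simp add: L2_rel_def Lp_2_zero)

lift_definition plus_L2 :: "'a L2 \<Rightarrow> 'a L2 \<Rightarrow> 'a L2" is "\<lambda>u w x. u x + w x"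
  by (auto simp: L2_rel_def Lp_2_add elim!: AE_mp)

lift_definition minus_L2 :: "'a L2 \<Rightarrow> 'a L2 \<Rightarrow> 'a L2" is "\<lambda>u w x. u x - w x"
  by (auto simp: L2_rel_def Lp_2_diff elim!: AE_mp)

lift_definition uminus_L2 :: "'a L2 \<Rightarrow> 'a L2" is "\<lambda>u x. - u x"
  by (auto simp: L2_rel_def Lp_2_uminus elim!: AE_mp)

lift_definition scaleR_L2 :: "real \<Rightarrow> 'a L2 \<Rightarrow> 'a L2" is "\<lambda>c u x. c * u x"
  by (auto simp: L2_rel_def Lp_2_cmult elim!: AE_mp)

lift_definition inner_L2 :: "'a L2 \<Rightarrow> 'a L2 \<Rightarrow> real" is
  "\<lambda>u w. \<integral>x. u x * w x \<partial>lebesgue"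
  by (rule integral_cong_AE)
    (auto simp: L2_rel_def intro!: borel_measurable_times dest!: Lp_2_measurable elim!: AE_mp)

definition norm_L2 :: "'a L2 \<Rightarrow> real" where "norm_L2 u = sqrt (inner u u)"
definition dist_L2 :: "'a L2 \<Rightarrow> 'a L2 \<Rightarrow> real" where "dist_L2 u w = norm (u - w)"
definition sgn_L2 :: "'a L2 \<Rightarrow> 'a L2" where "sgn_L2 u = inverse (norm u) *\<^sub>R u"
definition uniformity_L2 :: "('a L2 \<times> 'a L2) filter" where
  "uniformity_L2 = (INF e\<in>{0<..}. principal {(u, w). dist u w < e})"
definition open_L2 :: "'a L2 set \<Rightarrow> bool" where
  "open_L2 U \<longleftrightarrow> (\<forall>u\<in>U. eventually (\<lambda>(u', w). u' = u \<longrightarrow> w \<in> U) uniformity)"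

instance
proof
  fix u v w :: "'a L2" and a b :: real and U :: "'a L2 set"
  show "u + v + w = u + (v + w)"
    by transfer (auto simp: L2_rel_def Lp_2_add add.assoc)
  show "u + v = v + u"
    by transfer (auto simp: L2_rel_def Lp_2_add add.commute)
  show "0 + u = u"
    by transfer (auto simp: L2_rel_def)
  show "- u + u = 0"
    by transfer (auto simp: L2_rel_def Lp_2_zero)
  show "u - v = u + - v"
    by transfer (auto simp: L2_rel_def Lp_2_diff)
  show "a *\<^sub>R (u + v) = a *\<^sub>R u + a *\<^sub>R v"
    by transfer (auto simp: L2_rel_def Lp_2_add Lp_2_cmult distrib_left)
  show "(a + b) *\<^sub>R u = a *\<^sub>R u + b *\<^sub>R u"
    by transfer (auto simp: L2_rel_def Lp_2_add Lp_2_cmult distrib_right)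
  show "a *\<^sub>R b *\<^sub>R u = (a * b) *\<^sub>R u"
    by transfer (auto simp: L2_rel_def Lp_2_cmult mult.assoc)
  show "1 *\<^sub>R u = u"
    by transfer (auto simp: L2_rel_def)
  show "sgn u = inverse (norm u) *\<^sub>R u" by (rule sgn_L2_def)
  show "dist u v = norm (u - v)" by (rule dist_L2_def)
  show "uniformity = (INF e\<in>{0<..}. principal {(u::'a L2, w). dist u w < e})"
    by (rule uniformity_L2_def)
  show "open U = (\<forall>u\<in>U. \<forall>\<^sub>F (u', w) in uniformity. u' = u \<longrightarrow> w \<in> U)"
    by (rule open_L2_def)
  show "inner u v = inner v u"
    by transfer (simp add: mult.commute)
  show "inner (u + v) w = inner u w + inner v w"
    by transfer (auto simp: L2_rel_def distrib_right Lp_2_mult_integrable)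
  show "inner (a *\<^sub>R u) v = a * inner u v"
    by transfer (simp add: mult.assoc)
  show "0 \<le> inner u u"
    by transfer simp
  show "(inner u u = 0) = (u = 0)"
  proof (transfer)
    fix u :: "'a \<Rightarrow> real" assume "L2_rel u u"
    then have u: "u \<in> Lp 2" by (simp add: L2_rel_def)
    have "(\<integral>x. u x * u x \<partial>lebesgue) = 0 \<longleftrightarrow> (AE x in lebesgue. u x * u x = 0)"
      by (intro integral_nonneg_eq_0_iff_AE Lp_2_mult_integrable u) simp
    then show "(\<integral>x. u x * u x \<partial>lebesgue) = 0 \<longleftrightarrow> L2_rel u (\<lambda>x. 0)"
      using u by (simp add: L2_rel_def Lp_2_zero)
  qed
  show "norm u = sqrt (inner u u)" by (rule norm_L2_def)
qed

end


section \<open>Smooth functions, weak derivatives, Sobolev spaces\<close>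

definition partial_deriv :: "'a \<Rightarrow> ('a::euclidean_space \<Rightarrow> real) \<Rightarrow> 'a \<Rightarrow> real" where
  "partial_deriv b u x = frechet_derivative u (at x) b"

primrec Ck :: "nat \<Rightarrow> ('a::euclidean_space \<Rightarrow> real) \<Rightarrow> bool" where
  "Ck 0 u \<longleftrightarrow> continuous_on UNIV u"
| "Ck (Suc k) u \<longleftrightarrow> (\<forall>x. u differentiable (at x)) \<and> (\<forall>b\<in>Basis. Ck k (partial_deriv b u))"

definition smooth :: "('a::euclidean_space \<Rightarrow> real) \<Rightarrow> bool" where
  "smooth u \<longleftrightarrow> (\<forall>k. Ck k u)"

definition test_function :: "('a::euclidean_space \<Rightarrow> real) \<Rightarrow> bool" where
  "test_function \<phi> \<longleftrightarrow> smooth \<phi> \<and> (\<exists>R. \<forall>x. \<phi> x \<noteq> 0 \<longrightarrow> norm x \<le> R)"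

definition laplacian :: "('a::euclidean_space \<Rightarrow> real) \<Rightarrow> 'a \<Rightarrow> real" where
  "laplacian \<phi> x = (\<Sum>b\<in>Basis. partial_deriv b (partial_deriv b \<phi>) x)"

definition locally_integrable :: "('a::euclidean_space \<Rightarrow> real) \<Rightarrow> bool" where
  "locally_integrable u \<longleftrightarrow> (\<forall>R. set_integrable lebesgue (cball 0 R) u)"

definition weak_partial :: "'a \<Rightarrow> ('a::euclidean_space \<Rightarrow> real) \<Rightarrow> ('a \<Rightarrow> real) \<Rightarrow> bool" where
  "weak_partial b u w \<longleftrightarrow> locally_integrable u \<and> locally_integrable w \<and>
     (\<forall>\<phi>. test_function \<phi> \<longrightarrow>
        (\<integral>x. u x * partial_deriv b \<phi> x \<partial>lebesgue) = - (\<integral>x. w x * \<phi> x \<partial>lebesgue))"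

primrec sobolev :: "nat \<Rightarrow> real \<Rightarrow> ('a::euclidean_space \<Rightarrow> real) set" where
  "sobolev 0 p = Lp p"
| "sobolev (Suc k) p = {u \<in> Lp p. \<forall>b\<in>Basis. \<exists>w\<in>sobolev k p. weak_partial b u w}"

text \<open>The square of the $H^1$ norm, infinite outside $H^1$.  Weak derivatives are unique up to
  null sets, so the choice is immaterial.\<close>

definition H1_norm_sq :: "('a::euclidean_space \<Rightarrow> real) \<Rightarrow> ennreal" where
  "H1_norm_sq u = (if u \<in> sobolev 1 2 then
       (\<integral>\<^sup>+x. ennreal ((u x)\<^sup>2) \<partial>lebesgue) +
       (\<Sum>b\<in>Basis. \<integral>\<^sup>+x. ennreal (((SOME w. weak_partial b u w) x)\<^sup>2) \<partial>lebesgue)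
     else \<infinity>)"


section \<open>Wiener space, Wiener shift and the Ornstein-Uhlenbeck process\<close>

definition shift :: "real \<Rightarrow> (real \<Rightarrow> real) \<Rightarrow> real \<Rightarrow> real" where
  "shift t \<omega> = (\<lambda>s. \<omega> (s + t) - \<omega> t)"

text \<open>The coordinate process on a space of continuous paths vanishing at 0 is a two-sided Wiener
  process.  The shift is required to be measurable and measure preserving for each fixed time;
  joint measurability in time and path is not asked for, since it clashes with completeness of the
  sigma-algebra.\<close>

definition wiener_system :: "(real \<Rightarrow> real) measure \<Rightarrow> bool" where
  "wiener_system P \<longleftrightarrow>
     prob_space P \<and> complete_measure P \<and>
     space P \<subseteq> {\<omega>. continuous_on UNIV \<omega> \<and> \<omega> 0 = 0} \<and>
     (\<forall>t. (\<lambda>\<omega>. \<omega> t) \<in> borel_measurable P) \<and>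
     (\<forall>s t. s < t \<longrightarrow>
        distributed P lborel (\<lambda>\<omega>. \<omega> t - \<omega> s) (\<lambda>x. ennreal (normal_density 0 (sqrt (t - s)) x))) \<and>
     (\<forall>(\<tau> :: nat \<Rightarrow> real) m. strict_mono \<tau> \<longrightarrow>
        prob_space.indep_vars P (\<lambda>_. borel) (\<lambda>i \<omega>. \<omega> (\<tau> (Suc i)) - \<omega> (\<tau> i)) {..<m}) \<and>
     (\<forall>t. shift t \<in> measurable P P \<and> distr P P (shift t) = P)"

definition ou :: "real \<Rightarrow> (real \<Rightarrow> real) \<Rightarrow> real" where
  "ou lam \<omega> = - lam * (LINT \<tau>:{..0}|lborel. exp (lam * \<tau>) * \<omega> \<tau>)"


section \<open>Solutions of the random and of the deterministic equation\<close>

text \<open>Solutions of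
  \[ \partial_t v + \lambda v - \Delta v = f(x, v + c(t) h) + g + c(t) \Delta h, \quad v(0) = v_0, \]
  in $C([0,\infty), L^2) \cap L^2((0,T), H^1)$ for all $T$, where the equation holds in the sense of
  distributions: it is tested against test functions of the space variable and integrated in time.
  The term $f(x, v + c(t) h)$ has to be locally integrable on $[0,\infty) \times R^n$ for this to
  make sense.  The two terms $\Delta v$ and $c(t) \Delta h$ are combined and moved to the test
  function.\<close>

definition solution ::
  "real \<Rightarrow> ('a::euclidean_space \<Rightarrow> real \<Rightarrow> real) \<Rightarrow> ('a \<Rightarrow> real) \<Rightarrow> ('a \<Rightarrow> real) \<Rightarrow>
   (real \<Rightarrow> real) \<Rightarrow> 'a L2 \<Rightarrow> (real \<Rightarrow> 'a L2) \<Rightarrow> bool" where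
  "solution lam f g h c v0 v \<longleftrightarrow>
     continuous_on {0..} v \<and> v 0 = v0 \<and>
     (\<forall>T>0. (\<integral>\<^sup>+t\<in>{0..T}. H1_norm_sq (L2_fun (v t)) \<partial>lborel) < \<infinity>) \<and>
     (\<forall>T>0. \<forall>R.
        (\<integral>\<^sup>+t\<in>{0..T}. (\<integral>\<^sup>+x\<in>cball 0 R. ennreal \<bar>f x (L2_fun (v t) x + c t * h x)\<bar> \<partial>lebesgue)
           \<partial>lborel) < \<infinity>) \<and>
     (\<forall>\<phi>. test_function \<phi> \<longrightarrow> (\<forall>t\<ge>0.
        (\<integral>x. L2_fun (v t) x * \<phi> x \<partial>lebesgue) =
        (\<integral>x. L2_fun v0 x * \<phi> x \<partial>lebesgue) +
        (LINT s:{0..t}|lborel.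
           - lam * (\<integral>x. L2_fun (v s) x * \<phi> x \<partial>lebesgue)
           + (\<integral>x. (L2_fun (v s) x + c s * h x) * laplacian \<phi> x \<partial>lebesgue)
           + (\<integral>x. f x (L2_fun (v s) x + c s * h x) * \<phi> x \<partial>lebesgue)
           + (\<integral>x. g x * \<phi> x \<partial>lebesgue))))"

definition the_solution ::
  "real \<Rightarrow> ('a::euclidean_space \<Rightarrow> real \<Rightarrow> real) \<Rightarrow> ('a \<Rightarrow> real) \<Rightarrow> ('a \<Rightarrow> real) \<Rightarrow>
   (real \<Rightarrow> real) \<Rightarrow> 'a L2 \<Rightarrow> (real \<Rightarrow> 'a L2) \<Rightarrow> bool" where
  "the_solution lam f g h c v0 v \<longleftrightarrow>
     solution lam f g h c v0 v \<and> (\<forall>w. solution lam f g h c v0 w \<longrightarrow> (\<forall>t\<ge>0. w t = v t))"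

text \<open>In the following definitions \<open>N\<close> is the exceptional null set behind "for P-almost every
  \<omega>".  It is kept as a parameter because a statement about uncountably many \<open>\<epsilon>\<close> at
  once is only meaningful if one null set serves all \<open>\<epsilon>\<close>.

  \<open>\<Phi>\<close> is generated by the stochastic equation if, off \<open>N\<close>,
  $\Phi(t,\omega,u_0) = v(t,\omega,u_0 - \epsilon z(\omega)) + \epsilon z(\theta_t\omega)$
  with $z(\omega) = y(\omega) h$.\<close>

definition generated_by_stochastic_equation ::
  "(real \<Rightarrow> real) measure \<Rightarrow> (real \<Rightarrow> real) set \<Rightarrow> real \<Rightarrow>
   ('a::euclidean_space \<Rightarrow> real \<Rightarrow> real) \<Rightarrow> ('a \<Rightarrow> real) \<Rightarrow> ('a \<Rightarrow> real) \<Rightarrow> real \<Rightarrow>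
   (real \<Rightarrow> (real \<Rightarrow> real) \<Rightarrow> 'a L2 \<Rightarrow> 'a L2) \<Rightarrow> bool" where
  "generated_by_stochastic_equation P N lam f g h \<epsilon> \<Phi> \<longleftrightarrow>
     (\<forall>\<omega>\<in>space P - N. \<forall>u0.
        the_solution lam f g h (\<lambda>t. \<epsilon> * ou lam (shift t \<omega>))
          (u0 - (\<epsilon> * ou lam \<omega>) *\<^sub>R L2_of h)
          (\<lambda>t. \<Phi> t \<omega> u0 - (\<epsilon> * ou lam (shift t \<omega>)) *\<^sub>R L2_of h))"

definition generated_by_deterministic_equation ::
  "real \<Rightarrow> ('a::euclidean_space \<Rightarrow> real \<Rightarrow> real) \<Rightarrow> ('a \<Rightarrow> real) \<Rightarrow>
   (real \<Rightarrow> 'a L2 \<Rightarrow> 'a L2) \<Rightarrow> bool" where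
  "generated_by_deterministic_equation lam f g S \<longleftrightarrow>
     (\<forall>u0. the_solution lam f g (\<lambda>x. 0) (\<lambda>t. 0) u0 (\<lambda>t. S t u0))"


section \<open>Attractors\<close>

text \<open>Suprema and infima are taken in \<open>ennreal\<close>, so that unbounded sets and the empty set get
  the expected values.\<close>

definition semidist :: "'b::metric_space set \<Rightarrow> 'b set \<Rightarrow> ennreal" where
  "semidist A B = (SUP a\<in>A. INF b\<in>B. ennreal (dist a b))"

definition set_norm :: "'b::real_normed_vector set \<Rightarrow> ennreal" where
  "set_norm B = (SUP u\<in>B. ennreal (norm u))"

definition global_attractor ::
  "(real \<Rightarrow> 'b::metric_space \<Rightarrow> 'b) \<Rightarrow> 'b set \<Rightarrow> bool" where
  "global_attractor S A \<longleftrightarrow>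
     compact A \<and> (\<forall>t\<ge>0. S t ` A = A) \<and>
     (\<forall>B. bounded B \<longrightarrow> ((\<lambda>t. semidist (S t ` B) A) \<longlongrightarrow> 0) at_top)"

definition random_set :: "'w measure \<Rightarrow> ('w \<Rightarrow> 'b::metric_space set) \<Rightarrow> bool" where
  "random_set P B \<longleftrightarrow> (\<forall>x. (\<lambda>\<omega>. INF b\<in>B \<omega>. ennreal (dist x b)) \<in> borel_measurable P)"

definition tempered ::
  "(real \<Rightarrow> real) measure \<Rightarrow> (real \<Rightarrow> real) set \<Rightarrow> real \<Rightarrow>
   ((real \<Rightarrow> real) \<Rightarrow> 'b::real_normed_vector set) \<Rightarrow> bool" where
  "tempered P N lam B \<longleftrightarrow> random_set P B \<and>
     (\<forall>\<omega>\<in>space P - N.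
        ((\<lambda>t. ennreal (exp (- (1/2) * lam * t)) * set_norm (B (shift (- t) \<omega>))) \<longlongrightarrow> 0) at_top)"

text \<open>The collection $\mathcal{D}$.\<close>

definition tempered_sets ::
  "(real \<Rightarrow> real) measure \<Rightarrow> real \<Rightarrow> ((real \<Rightarrow> real) \<Rightarrow> 'b::real_normed_vector set) set" where
  "tempered_sets P lam = {B. \<exists>N\<in>null_sets P. tempered P N lam B}"

text \<open>In the attraction clause the exceptional null set has to depend on \<open>B\<close>: members of
  $\mathcal{D}$ are arbitrary on null sets of orbits, so no single null set can serve all of
  them.\<close>

definition random_attractor ::
  "(real \<Rightarrow> real) measure \<Rightarrow> (real \<Rightarrow> real) set \<Rightarrow> real \<Rightarrow>
   (real \<Rightarrow> (real \<Rightarrow> real) \<Rightarrow> 'b::real_normed_vector \<Rightarrow> 'b) \<Rightarrow>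
   ((real \<Rightarrow> real) \<Rightarrow> 'b set) \<Rightarrow> bool" where
  "random_attractor P N lam \<Phi> A \<longleftrightarrow>
     random_set P A \<and>
     (\<forall>\<omega>\<in>space P - N. compact (A \<omega>) \<and> (\<forall>t\<ge>0. \<Phi> t \<omega> ` A \<omega> = A (shift t \<omega>))) \<and>
     (\<forall>B\<in>tempered_sets P lam. AE \<omega> in P.
        ((\<lambda>t. semidist (\<Phi> t (shift (- t) \<omega>) ` B (shift (- t) \<omega>)) (A \<omega>)) \<longlongrightarrow> 0) at_top)"

end

theory Submission
  imports Defs "HOL-Real_Asymp.Real_Asymp"
begin

text \<open>
  Write \<open>Y t\<close> for the stationary Ornstein-Uhlenbeck process at the path shifted by \<open>t\<close>, and
  recall that \<open>v = u - \<epsilon> Y h\<close> solves an equation with random coefficients but without noise.  Two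
  estimates carry the theorem.

  The first (\<open>attractor_bound\<close>) bounds the random attractors by a quantity that becomes
  deterministic as \<open>\<epsilon>\<close> tends to 0.  By invariance, a point \<open>a\<close> of the attractor over the path
  shifted by \<open>-m\<close> is reached after time \<open>j\<close> from a point \<open>b\<close> of the attractor over the path shifted
  by \<open>-m-j\<close>.  The energy inequality damps the contribution of \<open>b\<close> by \<open>exp (- lam * j)\<close>; attractor
  and process are tempered, so this contribution vanishes as \<open>j\<close> tends to infinity.  What remains is
  \<open>2 * D0 / lam\<close>, which comes from the deterministic equation alone, and \<open>\<epsilon>\<close> times a constant that
  depends on the path and on \<open>m\<close>.

  The second (\<open>solution_difference\<close>) says that for a fixed time \<open>m\<close> the random flow converges to the
  deterministic one, uniformly on bounded sets.  It is the energy inequality for the difference of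
  two solutions, together with the one-sided Lipschitz bound on \<open>f\<close> and the inequality of Gronwall.

  To combine them (\<open>attractors_converge\<close>), choose \<open>m\<close> such that the deterministic flow at time \<open>m\<close>
  maps the ball of radius \<open>sqrt (2 * D0 / lam) + 1\<close> into the \<open>\<eta>\<close>-neighbourhood of the global
  attractor.  For small \<open>\<epsilon>\<close> the attractor over the path shifted by \<open>-m\<close> lies in this ball, its image
  at time \<open>m\<close> is the attractor over the unshifted path, and random and deterministic flow differ by
  less than \<open>\<eta>\<close> at its points.

  The equation holds in the sense of distributions, and \<open>f (x, u)\<close> is only locally integrable in
  space and time, so the energy inequality (\<open>weak_evolution.energy_inequality\<close>) has to be derived.
  After mollification in space the solution is absolutely continuous in time at every point.  A
  convex function with bounded derivative, the Huber function, is applied to it and the result is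
  integrated against a cutoff.  The Laplacian is approximated by second difference quotients:
  convexity gives them a sign, and translation invariance of the Lebesgue measure moves them to the
  cutoff.  Since the derivative of the Huber function is bounded, the mollification can be removed by
  convergence in the mean; then the truncation and the cutoff are removed, the \<open>p\<close>-th power of the
  solution being controlled by the lemma of Fatou.

  The growth of \<open>Y\<close> (\<open>AE_ou_growth\<close>) follows from Gaussian moments: the integral over the past of
  a high power of the path, weighted with \<open>exp (lam * t)\<close>, has finite expectation, and its finiteness
  controls the path integral that defines the process.
\<close>

section \<open>Smooth bump functions and difference quotients\<close>

text \<open>The powers of \<open>t\<close> in the denominator close the family under
  differentiation: the derivative is a combination of two members
  (\<open>DERIV_flat_exp\<close>).\<close>

definition flat_exp :: "nat \<Rightarrow> real \<Rightarrow> real" where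
  "flat_exp m t = (if t > 0 then exp (- (1 / t)) / t ^ m else 0)"

lemma flat_exp_nonneg: "0 \<le> flat_exp m t"
  by (simp add: flat_exp_def)

lemma power_le_fact_exp: "0 \<le> x \<Longrightarrow> x ^ n \<le> fact n * exp (x :: real)"
proof -
  assume x: "0 \<le> x"
  have "(\<Sum>k<Suc n. x ^ k /\<^sub>R fact k) \<le> exp x"
    unfolding exp_def using x by (intro sum_le_suminf summable_exp_generic) auto
  moreover have "x ^ n /\<^sub>R fact n \<le> (\<Sum>k<Suc n. x ^ k /\<^sub>R fact k)"
    using x by (intro member_le_sum) auto
  ultimately have "x ^ n / fact n \<le> exp x" by (simp add: divide_inverse mult.commute)
  then show ?thesis by (simp add: pos_divide_le_eq mult.commute)
qed

text \<open>A bound of second order at 0 gives the derivative 0 there.\<close>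

lemma flat_exp_le_square: "\<bar>flat_exp m t\<bar> \<le> fact (m + 2) * t\<^sup>2"
proof (cases "t > 0")
  case True
  have "(1 / t) ^ (m + 2) \<le> fact (m + 2) * exp (1 / t)"
    using True by (intro power_le_fact_exp) simp
  then have "(1 / t) ^ (m + 2) * t ^ (m + 2) \<le> fact (m + 2) * exp (1 / t) * t ^ (m + 2)"
    using True by (intro mult_right_mono) auto
  moreover have "(1 / t) ^ (m + 2) * t ^ (m + 2) = 1"
    using True by (simp add: power_mult_distrib[symmetric] del: power_Suc)
  ultimately have "1 * exp (- (1 / t)) \<le> fact (m + 2) * exp (1 / t) * t ^ (m + 2) * exp (- (1 / t))"
    by (intro mult_right_mono) (auto simp del: fact_Suc power_Suc)
  also have "\<dots> = fact (m + 2) * t ^ (m + 2) * exp (1 / t + - (1 / t))"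
    unfolding exp_add by (simp only: mult_ac)
  finally have "exp (- (1 / t)) \<le> fact (m + 2) * t ^ (m + 2)"
    by (simp del: fact_Suc power_Suc)
  also have "t ^ (m + 2) = t\<^sup>2 * t ^ m" by (simp add: power_add mult.commute power2_eq_square)
  finally have "exp (- (1 / t)) / t ^ m \<le> fact (m + 2) * t\<^sup>2"
    using True by (subst pos_divide_le_eq) (simp_all only: mult.assoc zero_less_power)
  then show ?thesis
    using True unfolding flat_exp_def by (simp del: fact_Suc)
qed (simp add: flat_exp_def)

lemma DERIV_flat_exp:
  "(flat_exp m has_real_derivative flat_exp (m + 2) t - m * flat_exp (m + 1) t) (at t)"
proof -
  consider "t > 0" | "t < 0" | "t = 0" by linarith
  then show ?thesis
  proof cases
    case 1
    have inv: "((\<lambda>t. inverse t) has_real_derivative - (inverse t ^ 2)) (at t)"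
      using DERIV_inverse[of t UNIV] 1 by (simp add: numeral_2_eq_2)
    have pow: "((\<lambda>t. inverse t ^ m) has_real_derivative - (m * inverse t ^ (m + 1))) (at t)"
    proof (cases m)
      case (Suc j)
      show ?thesis unfolding Suc
        by (rule DERIV_power_Suc[OF inv, THEN DERIV_cong])
           (simp add: power2_eq_square algebra_simps)
    qed simp
    have "((\<lambda>t. exp (- inverse t) * inverse t ^ m) has_real_derivative
        exp (- inverse t) * inverse t ^ (m + 2) - m * (exp (- inverse t) * inverse t ^ (m + 1))) (at t)"
      by (rule DERIV_mult[OF DERIV_fun_exp[OF DERIV_minus[OF inv]] pow, THEN DERIV_cong])
         (simp add: power2_eq_square power_add algebra_simps)
    then have "((\<lambda>t. exp (- (1 / t)) / t ^ m) has_real_derivative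
        flat_exp (m + 2) t - m * flat_exp (m + 1) t) (at t)"
      using 1 by (simp add: flat_exp_def divide_inverse power_inverse)
    moreover have "\<forall>\<^sub>F s in nhds t. exp (- (1 / s)) / s ^ m = flat_exp m s"
      using eventually_nhds_in_open[of "{0<..}" t] 1
      by (auto simp: flat_exp_def elim!: eventually_mono)
    ultimately show ?thesis
      by (subst DERIV_cong_ev[OF refl _ refl, symmetric])
  next
    case 2
    have "((\<lambda>t::real. 0) has_real_derivative flat_exp (m + 2) t - m * flat_exp (m + 1) t) (at t)"
      using 2 by (simp add: flat_exp_def)
    moreover have "\<forall>\<^sub>F s in nhds t. 0 = flat_exp m s"
      using eventually_nhds_in_open[of "{..<0}" t] 2
      by (auto simp: flat_exp_def elim!: eventually_mono)
    ultimately show ?thesis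
      by (subst DERIV_cong_ev[OF refl _ refl, symmetric])
  next
    case 3
    have "((\<lambda>h. flat_exp m h / h) \<longlongrightarrow> 0) (at 0)"
    proof (rule Lim_null_comparison)
      show "\<forall>\<^sub>F h in at 0. norm (flat_exp m h / h) \<le> fact (m + 2) * \<bar>h\<bar>"
      proof (rule always_eventually, rule allI)
        fix h :: real
        show "norm (flat_exp m h / h) \<le> fact (m + 2) * \<bar>h\<bar>"
        proof (cases "h = 0")
          case False
          have "\<bar>flat_exp m h\<bar> / \<bar>h\<bar> \<le> fact (m + 2) * h\<^sup>2 / \<bar>h\<bar>"
            by (intro divide_right_mono flat_exp_le_square) simp
          also have "\<dots> = fact (m + 2) * \<bar>h\<bar>"
            using False by (simp add: power2_eq_square abs_if)
          finally show ?thesis by simp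
        qed simp
      qed
      show "((\<lambda>h. fact (m + 2) * \<bar>h\<bar>) \<longlongrightarrow> (0::real)) (at 0)"
        by (auto intro!: tendsto_eq_intros)
    qed
    then show ?thesis using 3 by (simp add: DERIV_def flat_exp_def)
  qed
qed

text \<open>Smoothness comes without a formula for higher derivatives: this space contains a
  radial bump supported in the ball of radius \<open>sqrt r\<close> around \<open>a\<close>
  and is closed under partial derivatives, hence all its members are \<open>Ck k\<close> by
  induction on \<open>k\<close>. Linear factors are included because they arise when the
  squared distance to \<open>a\<close> is differentiated.\<close>

inductive_set bump_span :: "'a::euclidean_space \<Rightarrow> real \<Rightarrow> ('a \<Rightarrow> real) set" for a r where
  base: "(\<lambda>x. flat_exp m (r - (x - a) \<bullet> (x - a))) \<in> bump_span a r"
| coord: "f \<in> bump_span a r \<Longrightarrow> (\<lambda>x. (x \<bullet> v) * f x) \<in> bump_span a r"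
| scale: "f \<in> bump_span a r \<Longrightarrow> (\<lambda>x. c * f x) \<in> bump_span a r"
| add: "f \<in> bump_span a r \<Longrightarrow> f' \<in> bump_span a r \<Longrightarrow> (\<lambda>x. f x + f' x) \<in> bump_span a r"

lemma bump_span_derivative:
  assumes "f \<in> bump_span a r"
  shows "\<exists>D. (\<forall>x. (f has_derivative D x) (at x)) \<and> (\<forall>v. (\<lambda>x. D x v) \<in> bump_span a r)"
  using assms
proof induction
  case (base m)
  define e where "e k x = flat_exp k (r - (x - a) \<bullet> (x - a))" for k x
  let ?D = "\<lambda>x v. (e (m + 2) x - m * e (m + 1) x) * (- 2 * ((x - a) \<bullet> v))"
  have "((\<lambda>x. flat_exp m (r - (x - a) \<bullet> (x - a))) has_derivative ?D x) (at x)" for x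
    unfolding e_def
    by (rule DERIV_compose_FDERIV[OF DERIV_flat_exp, THEN has_derivative_eq_rhs])
       (auto intro!: derivative_eq_intros simp: inner_commute algebra_simps)
  moreover have "(\<lambda>x. ?D x v) \<in> bump_span a r" for v
  proof -
    have e: "e k \<in> bump_span a r" for k
      unfolding e_def by (rule bump_span.base)
    have g: "(\<lambda>x. e (m + 2) x + (- real m) * e (m + 1) x) \<in> bump_span a r" (is "?g \<in> _")
      by (intro bump_span.add bump_span.scale e)
    have "(\<lambda>x. (-2) * ((x \<bullet> v) * ?g x) + (2 * (a \<bullet> v)) * ?g x) \<in> bump_span a r"
      by (intro bump_span.add bump_span.scale bump_span.coord e)
    also have "(\<lambda>x. (-2) * ((x \<bullet> v) * ?g x) + (2 * (a \<bullet> v)) * ?g x) = (\<lambda>x. ?D x v)"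
      by (auto simp: algebra_simps inner_diff_left)
    finally show ?thesis .
  qed
  ultimately show ?case by (intro exI[of _ ?D] conjI allI)
next
  case (coord f w)
  then obtain D where D: "\<And>x. (f has_derivative D x) (at x)" "\<And>v. (\<lambda>x. D x v) \<in> bump_span a r"
    by blast
  have "((\<lambda>x. (x \<bullet> w) * f x) has_derivative (\<lambda>v. (x \<bullet> w) * D x v + (w \<bullet> v) * f x)) (at x)" for x
    by (auto intro!: derivative_eq_intros D simp: inner_commute)
  moreover have "(\<lambda>x. (x \<bullet> w) * D x v + (w \<bullet> v) * f x) \<in> bump_span a r" for v
    by (intro bump_span.add bump_span.scale bump_span.coord D coord)
  ultimately show ?case
    by (intro exI[of _ "\<lambda>x v. (x \<bullet> w) * D x v + (w \<bullet> v) * f x"]) auto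
next
  case (scale f c)
  then obtain D where D: "\<And>x. (f has_derivative D x) (at x)" "\<And>v. (\<lambda>x. D x v) \<in> bump_span a r"
    by blast
  have "((\<lambda>x. c * f x) has_derivative (\<lambda>v. c * D x v)) (at x)" for x
    by (auto intro!: derivative_eq_intros D)
  then show ?case
    using bump_span.scale[OF D(2)] by (intro exI[of _ "\<lambda>x v. c * D x v"]) auto
next
  case (add f f')
  then obtain D D' where D: "\<And>x. (f has_derivative D x) (at x)" "\<And>v. (\<lambda>x. D x v) \<in> bump_span a r"
    "\<And>x. (f' has_derivative D' x) (at x)" "\<And>v. (\<lambda>x. D' x v) \<in> bump_span a r"
    by blast
  have "((\<lambda>x. f x + f' x) has_derivative (\<lambda>v. D x v + D' x v)) (at x)" for x
    by (auto intro!: derivative_eq_intros D)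
  then show ?case
    using bump_span.add[OF D(2,4)] by (intro exI[of _ "\<lambda>x v. D x v + D' x v"]) auto
qed

lemma bump_span_differentiable: "f \<in> bump_span a r \<Longrightarrow> f differentiable (at x)"
  using bump_span_derivative[of f a r] by (auto simp: differentiable_def)

lemma bump_span_partial_deriv:
  assumes "f \<in> bump_span a r" shows "partial_deriv v f \<in> bump_span a r"
proof -
  obtain D where D: "\<And>x. (f has_derivative D x) (at x)" "\<And>v. (\<lambda>x. D x v) \<in> bump_span a r"
    using bump_span_derivative[OF assms] by blast
  have "partial_deriv v f = (\<lambda>x. D x v)"
    unfolding partial_deriv_def using frechet_derivative_at[OF D(1)] by metis
  then show ?thesis using D(2) by simp
qed

lemma bump_span_continuous: "f \<in> bump_span a r \<Longrightarrow> continuous_on UNIV f"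
  using bump_span_differentiable differentiable_imp_continuous_within
  by (metis continuous_at_imp_continuous_on)

lemma bump_span_smooth: "f \<in> bump_span a r \<Longrightarrow> smooth f"
proof -
  have "\<forall>f\<in>bump_span a r. Ck k f" for k
    by (induction k) (auto simp: bump_span_continuous bump_span_differentiable bump_span_partial_deriv)
  then show "f \<in> bump_span a r \<Longrightarrow> smooth f" by (auto simp: smooth_def)
qed

lemma bump_span_support: "f \<in> bump_span a r \<Longrightarrow> r \<le> (x - a) \<bullet> (x - a) \<Longrightarrow> f x = 0"
  by (induction rule: bump_span.induct) (auto simp: flat_exp_def)

lemma bump_span_support_ball:
  assumes "f \<in> bump_span a r" "f x \<noteq> 0" shows "x \<in> cball a (sqrt r)"
proof -
  have "(norm (x - a))\<^sup>2 < r"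
    using bump_span_support[OF assms(1), of x] assms(2) by (force simp: power2_norm_eq_inner)
  then have "norm (x - a) \<le> sqrt r"
    by (intro real_le_rsqrt) simp
  then show ?thesis by (simp add: dist_norm norm_minus_commute)
qed

lemma bump_span_test_function:
  assumes "f \<in> bump_span a r" shows "test_function f"
proof -
  have "norm x \<le> sqrt r + norm a" if "f x \<noteq> 0" for x
    using bump_span_support_ball[OF assms that] norm_triangle_sub[of x a]
    by (simp add: dist_norm norm_minus_commute)
  then show ?thesis
    using bump_span_smooth[OF assms] by (auto simp: test_function_def)
qed

lemma bounded_if_continuous_supported:
  fixes f :: "'a::euclidean_space \<Rightarrow> real"
  assumes "continuous_on UNIV f" "\<And>x. f x \<noteq> 0 \<Longrightarrow> x \<in> cball a R"
  shows "\<exists>C\<ge>0. \<forall>x. \<bar>f x\<bar> \<le> C"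
proof -
  have "compact (f ` cball a R)"
    by (intro compact_continuous_image continuous_on_subset[OF assms(1)]) auto
  then obtain C where C: "\<And>x. x \<in> cball a R \<Longrightarrow> \<bar>f x\<bar> \<le> C"
    by (force dest!: compact_imp_bounded simp: bounded_iff)
  have "\<bar>f x\<bar> \<le> max C 0" for x
    using C[of x] assms(2)[of x] by (cases "f x = 0") auto
  then show ?thesis by (intro exI[of _ "max C 0"]) auto
qed

lemma bump_span_bounded: "f \<in> bump_span a r \<Longrightarrow> \<exists>C\<ge>0. \<forall>x. \<bar>f x\<bar> \<le> C"
  by (rule bounded_if_continuous_supported[of f a "sqrt r"])
     (auto simp del: mem_cball intro: bump_span_continuous bump_span_support_ball)

text \<open>The discrete Laplacian. Unlike the Laplacian it is defined for all functions, so
  it can be applied after composition with a convex function that is only once differentiable,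
  and it is symmetric by translation invariance of the Lebesgue measure.\<close>

definition second_difference :: "real \<Rightarrow> ('a::euclidean_space \<Rightarrow> real) \<Rightarrow> 'a \<Rightarrow> real" where
  "second_difference \<tau> f x =
     (\<Sum>b\<in>Basis. (f (x + \<tau> *\<^sub>R b) + f (x - \<tau> *\<^sub>R b) - 2 * f x) / \<tau>\<^sup>2)"

text \<open>Taylor expansion to second order in both directions; the terms of first order
  cancel.\<close>

lemma second_difference_1d:
  fixes g g' g'' :: "real \<Rightarrow> real"
  assumes "\<And>s. (g has_real_derivative g' s) (at s)" "\<And>s. (g' has_real_derivative g'' s) (at s)"
    and "\<tau> > 0"
  shows "\<exists>s1 s2. \<bar>s1\<bar> \<le> \<tau> \<and> \<bar>s2\<bar> \<le> \<tau> \<and> (g \<tau> + g (- \<tau>) - 2 * g 0) / \<tau>\<^sup>2 = (g'' s1 + g'' s2) / 2"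
proof -
  have *: "\<exists>s. 0 < s \<and> s < \<tau> \<and> f \<tau> = f 0 + f' 0 * \<tau> + f'' s / 2 * \<tau>\<^sup>2"
    if d: "\<And>s. (f has_real_derivative f' s) (at s)" "\<And>s. (f' has_real_derivative f'' s) (at s)"
    for f f' f'' :: "real \<Rightarrow> real"
  proof -
    define diff where "diff m = (if m = 0 then f else if m = 1 then f' else f'')" for m :: nat
    have "\<exists>t>0. t < \<tau> \<and> f \<tau> = (\<Sum>m<2. diff m 0 / fact m * \<tau> ^ m) + diff 2 t / fact 2 * \<tau> ^ 2"
      by (rule Maclaurin[OF assms(3)]) (auto simp: diff_def d less_Suc_eq numeral_2_eq_2)
    then show ?thesis by (auto simp: diff_def numeral_2_eq_2)
  qed
  obtain s1 where s1: "0 < s1" "s1 < \<tau>" "g \<tau> = g 0 + g' 0 * \<tau> + g'' s1 / 2 * \<tau>\<^sup>2"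
    using *[OF assms(1,2)] by auto
  have m1: "((\<lambda>s. g (- s)) has_real_derivative (\<lambda>s. - g' (- s)) s) (at s)" for s
    by (rule DERIV_chain2[OF assms(1), THEN DERIV_cong]) (auto intro!: derivative_eq_intros)
  have m2: "((\<lambda>s. - g' (- s)) has_real_derivative (\<lambda>s. g'' (- s)) s) (at s)" for s
    by (rule DERIV_minus[OF DERIV_chain2[OF assms(2)], THEN DERIV_cong]) (auto intro!: derivative_eq_intros)
  obtain s2 where s2: "0 < s2" "s2 < \<tau>" "g (- \<tau>) = g 0 - g' 0 * \<tau> + g'' (- s2) / 2 * \<tau>\<^sup>2"
    using *[OF m1 m2] by auto
  have "(g \<tau> + g (- \<tau>) - 2 * g 0) / \<tau>\<^sup>2 = (g'' s1 + g'' (- s2)) / 2"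
    using assms(3) s1(3) s2(3) by (simp add: field_simps)
  then show ?thesis using s1 s2 by (intro exI[of _ s1] exI[of _ "- s2"]) auto
qed

lemma bump_span_directional:
  assumes "f \<in> bump_span a r"
  shows "((\<lambda>s. f (x + s *\<^sub>R b)) has_real_derivative partial_deriv b f (x + s *\<^sub>R b)) (at s)"
proof -
  have d: "(f has_derivative frechet_derivative f (at (x + s *\<^sub>R b))) (at (x + s *\<^sub>R b))"
    using bump_span_differentiable[OF assms] frechet_derivative_works by blast
  have "((\<lambda>s. f (x + s *\<^sub>R b)) has_derivative
      (\<lambda>t. frechet_derivative f (at (x + s *\<^sub>R b)) (t *\<^sub>R b))) (at s)"
    by (rule has_derivative_compose[where f = "\<lambda>s. x + s *\<^sub>R b" and g = f, OF _ d])
       (auto intro!: derivative_eq_intros)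
  moreover have "frechet_derivative f (at (x + s *\<^sub>R b)) (t *\<^sub>R b)
      = partial_deriv b f (x + s *\<^sub>R b) * t" for t
    using linear_scale[OF has_derivative_linear[OF d]] by (simp add: partial_deriv_def)
  ultimately show ?thesis by (simp add: has_field_derivative_def)
qed

lemma second_difference_bump_span:
  assumes f: "f \<in> bump_span a r" and "\<tau> > 0" "b \<in> Basis"
  shows "\<exists>y z. dist y x \<le> \<tau> \<and> dist z x \<le> \<tau> \<and> (f (x + \<tau> *\<^sub>R b) + f (x - \<tau> *\<^sub>R b) - 2 * f x) / \<tau>\<^sup>2
     = (partial_deriv b (partial_deriv b f) y + partial_deriv b (partial_deriv b f) z) / 2"
proof -
  from second_difference_1d[OF bump_span_directional[OF f, of x b]
     bump_span_directional[OF bump_span_partial_deriv[OF f], of b x b] assms(2)]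
  obtain s1 s2 where "\<bar>s1\<bar> \<le> \<tau>" "\<bar>s2\<bar> \<le> \<tau>"
    "(f (x + \<tau> *\<^sub>R b) + f (x + (-\<tau>) *\<^sub>R b) - 2 * f (x + 0 *\<^sub>R b)) / \<tau>\<^sup>2
     = (partial_deriv b (partial_deriv b f) (x + s1 *\<^sub>R b) + partial_deriv b (partial_deriv b f) (x + s2 *\<^sub>R b)) / 2"
    by blast
  then show ?thesis
    using assms(3) by (intro exI[of _ "x + s1 *\<^sub>R b"] exI[of _ "x + s2 *\<^sub>R b"]) (auto simp: dist_norm)
qed

text \<open>The bound is uniform in the step, as needed for dominated convergence when the
  step tends to 0.\<close>

lemma second_difference_bounded:
  fixes f :: "'a::euclidean_space \<Rightarrow> real"
  assumes f: "f \<in> bump_span a r"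
  shows "\<exists>C\<ge>0. \<forall>\<tau>>0. \<forall>x. \<bar>second_difference \<tau> f x\<bar> \<le> C"
proof -
  have "\<exists>C\<ge>0. \<forall>x. \<bar>partial_deriv b (partial_deriv b f) x\<bar> \<le> C" for b
    by (intro bump_span_bounded[of _ a r] bump_span_partial_deriv f)
  then obtain C where C: "\<And>b. 0 \<le> C b" "\<And>b x. \<bar>partial_deriv b (partial_deriv b f) x\<bar> \<le> C b"
    by metis
  have "\<bar>second_difference \<tau> f x\<bar> \<le> (\<Sum>b\<in>Basis. C b)" if "\<tau> > 0" for \<tau> x
    unfolding second_difference_def
  proof (rule sum_abs[THEN order_trans], rule sum_mono)
    fix b :: 'a assume "b \<in> Basis"
    from second_difference_bump_span[OF f that this, of x]
    obtain y z where "(f (x + \<tau> *\<^sub>R b) + f (x - \<tau> *\<^sub>R b) - 2 * f x) / \<tau>\<^sup>2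
     = (partial_deriv b (partial_deriv b f) y + partial_deriv b (partial_deriv b f) z) / 2" (is "?q = _")
      by blast
    moreover have "\<bar>(u + w) / 2\<bar> \<le> C b" if "\<bar>u\<bar> \<le> C b" "\<bar>w\<bar> \<le> C b" for u w :: real
      using that unfolding abs_le_iff by (auto simp: field_simps)
    ultimately show "\<bar>(f (x + \<tau> *\<^sub>R b) + f (x - \<tau> *\<^sub>R b) - 2 * f x) / \<tau>\<^sup>2\<bar> \<le> C b"
      using C(2) by metis
  qed
  then show ?thesis using C(1) by (intro exI[of _ "\<Sum>b\<in>Basis. C b"]) (auto intro: sum_nonneg)
qed

lemma second_difference_tendsto_laplacian:
  fixes f :: "'a::euclidean_space \<Rightarrow> real"
  assumes f: "f \<in> bump_span a r"
  shows "((\<lambda>\<tau>. second_difference \<tau> f x) \<longlongrightarrow> laplacian f x) (at_right 0)"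
  unfolding second_difference_def laplacian_def
proof (rule tendsto_sum)
  fix b :: 'a assume b: "b \<in> Basis"
  let ?D = "partial_deriv b (partial_deriv b f)"
  have cont: "isCont ?D x"
    using bump_span_continuous[OF bump_span_partial_deriv[OF bump_span_partial_deriv[OF f]]]
    by (simp add: continuous_on_eq_continuous_at)
  show "((\<lambda>\<tau>. (f (x + \<tau> *\<^sub>R b) + f (x - \<tau> *\<^sub>R b) - 2 * f x) / \<tau>\<^sup>2) \<longlongrightarrow> ?D x) (at_right 0)"
  proof (rule tendstoI)
    fix e :: real assume "e > 0"
    then obtain d where d: "d > 0" "\<And>y. dist y x < d \<Longrightarrow> dist (?D y) (?D x) < e"
      using cont[unfolded continuous_at_eps_delta] by blast
    show "\<forall>\<^sub>F \<tau> in at_right 0. dist ((f (x + \<tau> *\<^sub>R b) + f (x - \<tau> *\<^sub>R b) - 2 * f x) / \<tau>\<^sup>2) (?D x) < e"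
      using eventually_at_right_less[of 0] eventually_at_right_real[OF d(1)]
    proof eventually_elim
      case (elim \<tau>)
      from second_difference_bump_span[OF f elim(1) b, of x]
      obtain y z where yz: "dist y x \<le> \<tau>" "dist z x \<le> \<tau>"
       "(f (x + \<tau> *\<^sub>R b) + f (x - \<tau> *\<^sub>R b) - 2 * f x) / \<tau>\<^sup>2 = (?D y + ?D z) / 2" by blast
      have "dist (?D y) (?D x) < e" "dist (?D z) (?D x) < e"
        using d(2) yz(1,2) elim(2) by force+
      then show ?case unfolding yz(3) by (auto simp: dist_real_def abs_less_iff field_simps)
    qed
  qed
qed

lemma second_difference_translate: "second_difference \<tau> (\<lambda>y. f (y - x)) y = second_difference \<tau> f (y - x)"
  by (simp add: second_difference_def algebra_simps)

section \<open>Mollifiers and translations in the mean\<close>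

lemma nn_integral_lborel_affine:
  fixes f :: "'a::euclidean_space \<Rightarrow> ennreal"
  assumes [measurable]: "f \<in> borel_measurable borel" and c: "\<bar>c\<bar> = 1"
  shows "(\<integral>\<^sup>+y. f (x + c *\<^sub>R y) \<partial>lborel) = (\<integral>\<^sup>+y. f y \<partial>lborel)"
proof -
  have "(\<integral>\<^sup>+y. f y \<partial>lborel) = (\<integral>\<^sup>+y. f y \<partial>density (distr lborel borel (\<lambda>y. x + c *\<^sub>R y)) (\<lambda>_. \<bar>c\<bar> ^ DIM('a)))"
    using lborel_affine[of c x] c by auto
  then show ?thesis
    using c by (simp add: nn_integral_density nn_integral_distr)
qed

lemma nn_integral_lborel_shift:
  fixes f :: "'a::euclidean_space \<Rightarrow> ennreal"
  assumes "f \<in> borel_measurable borel"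
  shows "(\<integral>\<^sup>+y. f (y - x) \<partial>lborel) = (\<integral>\<^sup>+y. f y \<partial>lborel)"
    and "(\<integral>\<^sup>+y. f (x - y) \<partial>lborel) = (\<integral>\<^sup>+y. f y \<partial>lborel)"
    and "(\<integral>\<^sup>+y. f (y + x) \<partial>lborel) = (\<integral>\<^sup>+y. f y \<partial>lborel)"
  using nn_integral_lborel_affine[OF assms, of 1 "- x"] nn_integral_lborel_affine[OF assms, of "-1" x]
     nn_integral_lborel_affine[OF assms, of 1 x]
  by (simp_all add: add.commute)

lemma integrable_continuous_supported:
  fixes f :: "'a::euclidean_space \<Rightarrow> real"
  assumes "continuous_on UNIV f" "\<And>x. f x \<noteq> 0 \<Longrightarrow> x \<in> cball a R"
  shows "integrable lborel f"
proof -
  have "integrable lborel (\<lambda>x. indicator (cball a R) x *\<^sub>R f x)"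
    by (intro borel_integrable_compact continuous_on_subset[OF assms(1)]) auto
  also have "(\<lambda>x. indicator (cball a R) x *\<^sub>R f x) = f"
    using assms(2) by (fastforce simp: indicator_def)
  finally show ?thesis .
qed

lemma bump_span_integrable: "f \<in> bump_span a r \<Longrightarrow> integrable lborel f"
  by (rule integrable_continuous_supported[of f a "sqrt r"])
     (auto simp del: mem_cball intro: bump_span_continuous bump_span_support_ball)

text \<open>The standard mollifier with support in the ball of radius \<open>1 / Suc
  n\<close>.\<close>

definition kernel :: "nat \<Rightarrow> 'a::euclidean_space \<Rightarrow> real" where
  "kernel n z = inverse (\<integral>z. flat_exp 0 ((1 / Suc n)\<^sup>2 - (z::'a) \<bullet> z) \<partial>lborel) * flat_exp 0 ((1 / Suc n)\<^sup>2 - z \<bullet> z)"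

lemma kernel_bump_span: "(\<lambda>y. kernel n (y - x)) \<in> bump_span x ((1 / Suc n)\<^sup>2)"
  unfolding kernel_def by (intro bump_span.scale bump_span.base)

lemma kernel_bump_span0: "kernel n \<in> bump_span 0 ((1 / Suc n)\<^sup>2)"
  using kernel_bump_span[of n 0] by simp

lemma kernel_support: "1 / Suc n \<le> norm z \<Longrightarrow> kernel n z = 0"
  using bump_span_support[OF kernel_bump_span0, of n z]
  by (simp add: power2_norm_eq_inner[symmetric] power_mono)

lemma kernel_support': "1 \<le> norm z \<Longrightarrow> kernel n z = 0"
proof -
  assume "1 \<le> norm z"
  moreover have "1 / Suc n \<le> (1::real)" by simp
  ultimately show ?thesis by (intro kernel_support) linarith
qed

lemma kernel_continuous: "continuous_on UNIV (kernel n)"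
  by (rule bump_span_continuous[OF kernel_bump_span0])

lemma kernel_measurable[measurable]: "kernel n \<in> borel_measurable borel"
  using kernel_continuous borel_measurable_continuous_onI by blast

lemma kernel_sym: "kernel n (- z) = kernel n z"
  by (simp add: kernel_def)

lemma kernel_swap: "kernel n (x - y) = kernel n (y - x)"
  using kernel_sym[of n "y - x"] by simp

lemma kernel_mass_pos: "0 < (\<integral>z. flat_exp 0 ((1 / Suc n)\<^sup>2 - (z::'a::euclidean_space) \<bullet> z) \<partial>lborel)"
proof -
  let ?f = "\<lambda>z::'a. flat_exp 0 ((1 / Suc n)\<^sup>2 - z \<bullet> z)"
  have "(\<lambda>z. flat_exp 0 ((1 / Suc n)\<^sup>2 - (z - 0) \<bullet> (z - 0))) \<in> bump_span 0 ((1 / Suc n)\<^sup>2)"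
    by (rule bump_span.base)
  then have f: "integrable lborel ?f"
    using bump_span_integrable by fastforce
  have "\<not> (AE z in lborel. ?f z = 0)"
  proof
    assume "AE z in lborel. ?f z = 0"
    then have "AE z in lborel. z \<notin> ball (0::'a) (1 / Suc n)"
    proof eventually_elim
      case (elim z)
      then have "(1 / Suc n)\<^sup>2 \<le> z \<bullet> z" by (auto simp: flat_exp_def split: if_splits)
      then have "1 / Suc n \<le> norm z"
        by (simp add: power2_norm_eq_inner[symmetric] power2_le_iff_abs_le)
      then show ?case by simp
    qed
    then have "emeasure lborel (ball (0::'a) (1 / Suc n)) = 0"
      using AE_iff_null_sets[of "ball (0::'a) (1 / Suc n)" lborel] null_setsD1 by simp
    moreover have "emeasure lborel (ball (0::'a) (1 / Suc n)) > 0"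
      by (simp add: emeasure_ball ennreal_mult'[symmetric])
    ultimately show False by simp
  qed
  moreover have "(\<integral>z. ?f z \<partial>lborel) = 0 \<longleftrightarrow> (AE z in lborel. ?f z = 0)"
    by (intro integral_nonneg_eq_0_iff_AE f) (auto simp: flat_exp_nonneg)
  ultimately have "(\<integral>z. ?f z \<partial>lborel) \<noteq> 0" by blast
  moreover have "(\<integral>z. ?f z \<partial>lborel) \<ge> 0" by (intro integral_nonneg_AE) (auto simp: flat_exp_nonneg)
  ultimately show ?thesis by simp
qed

lemma kernel_nonneg: "0 \<le> kernel n z"
  unfolding kernel_def using kernel_mass_pos[of n, THEN less_imp_le]
  by (intro mult_nonneg_nonneg flat_exp_nonneg) simp

lemma kernel_integrable: "integrable lborel (kernel n)"
  by (rule bump_span_integrable[OF kernel_bump_span0])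

lemma nn_integral_kernel: "(\<integral>\<^sup>+z. kernel n (z::'a::euclidean_space) \<partial>lborel) = 1"
proof -
  have "(\<integral>z. kernel n (z::'a) \<partial>lborel) = 1"
    unfolding kernel_def using kernel_mass_pos[of n, where 'a = 'a] by simp
  then show ?thesis
    by (simp add: nn_integral_eq_integral kernel_integrable kernel_nonneg)
qed

lemma nn_integral_kernel_shift:
  "(\<integral>\<^sup>+y. kernel n (y - x) \<partial>lborel) = 1" "(\<integral>\<^sup>+y. kernel n (x - y) \<partial>lborel) = 1"
  using nn_integral_lborel_shift(1,2)[of "\<lambda>z. ennreal (kernel n z)" x] by (simp_all add: nn_integral_kernel)

text \<open>The mean \<open>L\<^sup>1\<close> modulus of continuity at scale \<open>1 / Suc
  n\<close>. It dominates the \<open>L\<^sup>1\<close> distance between a function and its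
  mollification and is subadditive, so its limit can be computed by approximation.\<close>

definition osc :: "nat \<Rightarrow> ('a::euclidean_space \<Rightarrow> real) \<Rightarrow> ennreal" where
  "osc n w = (\<integral>\<^sup>+x. \<integral>\<^sup>+y. ennreal \<bar>w y - w x\<bar> * kernel n (y - x) \<partial>lborel \<partial>lborel)"

lemma ennreal_mult_split:
  "a \<le> b + c \<Longrightarrow> 0 \<le> b \<Longrightarrow> 0 \<le> c \<Longrightarrow> ennreal a * k \<le> ennreal b * k + ennreal c * k"
  using mult_right_mono[OF ennreal_leI, of a "b + c" k] by (simp add: distrib_right)

lemma osc_le:
  assumes [measurable]: "w \<in> borel_measurable borel"
  shows "osc n w \<le> 2 * (\<integral>\<^sup>+x. ennreal \<bar>w x\<bar> \<partial>lborel)"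
proof -
  have "osc n w \<le> (\<integral>\<^sup>+x. \<integral>\<^sup>+y. (ennreal \<bar>w y\<bar> * kernel n (y - x) + ennreal \<bar>w x\<bar> * kernel n (y - x)) \<partial>lborel \<partial>lborel)"
    unfolding osc_def
    by (intro nn_integral_mono ennreal_mult_split) auto
  also have "\<dots> = (\<integral>\<^sup>+x. \<integral>\<^sup>+y. ennreal \<bar>w y\<bar> * kernel n (y - x) \<partial>lborel \<partial>lborel)
     + (\<integral>\<^sup>+x. \<integral>\<^sup>+y. ennreal \<bar>w x\<bar> * kernel n (y - x) \<partial>lborel \<partial>lborel)"
    by (simp add: nn_integral_add)
  also have "(\<integral>\<^sup>+x. \<integral>\<^sup>+y. ennreal \<bar>w y\<bar> * kernel n (y - x) \<partial>lborel \<partial>lborel)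
     = (\<integral>\<^sup>+y. \<integral>\<^sup>+x. ennreal \<bar>w y\<bar> * kernel n (y - x) \<partial>lborel \<partial>lborel)"
    by (rule lborel_pair.Fubini'[symmetric]) measurable
  also have "\<dots> = (\<integral>\<^sup>+x. ennreal \<bar>w x\<bar> \<partial>lborel)"
    by (simp add: nn_integral_cmult nn_integral_kernel_shift)
  also have "(\<integral>\<^sup>+x. \<integral>\<^sup>+y. ennreal \<bar>w x\<bar> * kernel n (y - x) \<partial>lborel \<partial>lborel) = (\<integral>\<^sup>+x. ennreal \<bar>w x\<bar> \<partial>lborel)"
    by (simp add: nn_integral_cmult nn_integral_kernel_shift)
  finally show ?thesis by (simp add: mult_2)
qed

lemma osc_triangle:
  assumes [measurable]: "v \<in> borel_measurable borel" "w \<in> borel_measurable borel"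
  shows "osc n (\<lambda>x. v x + w x) \<le> osc n v + osc n w"
proof -
  have "osc n (\<lambda>x. v x + w x) \<le> (\<integral>\<^sup>+x. \<integral>\<^sup>+y. (ennreal \<bar>v y - v x\<bar> * kernel n (y - x)
      + ennreal \<bar>w y - w x\<bar> * kernel n (y - x)) \<partial>lborel \<partial>lborel)"
    unfolding osc_def
    by (intro nn_integral_mono ennreal_mult_split) auto
  also have "\<dots> = osc n v + osc n w"
    unfolding osc_def by (simp add: nn_integral_add)
  finally show ?thesis .
qed

lemma osc_cmult:
  assumes [measurable]: "w \<in> borel_measurable borel"
  shows "osc n (\<lambda>x. w x * c) = ennreal \<bar>c\<bar> * osc n w"
proof -
  have "ennreal \<bar>w y * c - w x * c\<bar> * kernel n (y - x) = ennreal \<bar>c\<bar> * (ennreal \<bar>w y - w x\<bar> * kernel n (y - x))"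
    for x y
    unfolding left_diff_distrib[symmetric] abs_mult by (simp add: ennreal_mult' mult_ac)
  then show ?thesis unfolding osc_def by (simp add: nn_integral_cmult)
qed

text \<open>For \<open>x\<close> in \<open>U\<close> the kernel centred at \<open>x\<close>
  eventually has no mass outside \<open>U\<close>, and \<open>U\<close> has finite measure, so
  dominated convergence applies. The pairs with \<open>y\<close> inside and \<open>x\<close>
  outside contribute the same amount because the kernel is even.\<close>

lemma osc_open:
  fixes U :: "'a::euclidean_space set"
  assumes U: "open U" "emeasure lborel U < \<infinity>"
  shows "(\<lambda>n. osc n (indicator U)) \<longlonglongrightarrow> 0"
proof -
  have [measurable]: "U \<in> sets borel" using U by simp
  define J where "J n x = (\<integral>\<^sup>+y. indicator (- U) y * ennreal (kernel n (y - x)) \<partial>lborel)" for n and x :: 'a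
  have J1: "J n x \<le> 1" for n x
  proof -
    have "J n x \<le> (\<integral>\<^sup>+y. ennreal (kernel n (y - x)) \<partial>lborel)"
      unfolding J_def by (intro nn_integral_mono) (auto simp: indicator_def)
    then show ?thesis by (simp add: nn_integral_kernel_shift)
  qed
  have [measurable]: "J n \<in> borel_measurable borel" for n unfolding J_def by measurable
  have J0: "(\<lambda>n. indicator U x * J n x) \<longlonglongrightarrow> 0" for x
  proof (cases "x \<in> U")
    case True
    then obtain e where e: "e > 0" "ball x e \<subseteq> U" using U open_contains_ball by metis
    obtain N where N: "1 / Suc N < e" using nat_approx_posE[OF e(1)] by blast
    have "indicator U x * J n x = 0" if "n \<ge> N" for n
    proof -
      have "indicator (- U) y * ennreal (kernel n (y - x)) = 0" for y
      proof (cases "y \<in> U")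
        case False
        then have "e \<le> norm (y - x)" using e(2) by (force simp: dist_norm norm_minus_commute)
        moreover have "1 / Suc n \<le> 1 / Suc N" using that by (simp add: field_simps)
        ultimately have "kernel n (y - x) = 0" using N by (intro kernel_support) linarith
        then show ?thesis by simp
      qed simp
      then have "J n x = (\<integral>\<^sup>+y. 0 \<partial>(lborel :: 'a measure))"
        unfolding J_def by (intro nn_integral_cong)
      then show ?thesis by simp
    qed
    then show ?thesis by (intro tendsto_eventually) (auto simp: eventually_sequentially)
  qed simp
  have "(\<lambda>n. \<integral>\<^sup>+x. indicator U x * J n x \<partial>lborel) \<longlonglongrightarrow> (\<integral>\<^sup>+x. 0 \<partial>(lborel::'a measure))"
  proof (rule nn_integral_dominated_convergence[where w = "indicator U"])
    show "AE x in lborel. indicator U x * J n x \<le> indicator U x" for n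
      using J1 by (auto simp: indicator_def)
    show "(\<integral>\<^sup>+x. indicator U x \<partial>lborel) < \<infinity>" using U by simp
    show "AE x in lborel. (\<lambda>n. indicator U x * J n x) \<longlonglongrightarrow> 0" using J0 by (intro always_eventually allI)
  qed simp_all
  then have lim: "(\<lambda>n. 2 * (\<integral>\<^sup>+x. indicator U x * J n x \<partial>lborel)) \<longlonglongrightarrow> 0"
    by (intro tendsto_eq_intros) auto
  have "osc n (indicator U) = 2 * (\<integral>\<^sup>+x. indicator U x * J n x \<partial>lborel)" for n
  proof -
    have "osc n (indicator U) = (\<integral>\<^sup>+x. \<integral>\<^sup>+y. (indicator U x * (indicator (- U) y * ennreal (kernel n (y - x)))
       + indicator U y * (indicator (- U) x * ennreal (kernel n (y - x)))) \<partial>lborel \<partial>lborel)"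
      unfolding osc_def by (intro nn_integral_cong) (auto simp: indicator_def)
    also have "\<dots> = (\<integral>\<^sup>+x. \<integral>\<^sup>+y. indicator U x * (indicator (- U) y * ennreal (kernel n (y - x))) \<partial>lborel \<partial>lborel)
       + (\<integral>\<^sup>+x. \<integral>\<^sup>+y. indicator U y * (indicator (- U) x * ennreal (kernel n (y - x))) \<partial>lborel \<partial>lborel)"
      by (simp add: nn_integral_add)
    also have "(\<integral>\<^sup>+x. \<integral>\<^sup>+y. indicator U y * (indicator (- U) x * ennreal (kernel n (y - x))) \<partial>lborel \<partial>lborel)
      = (\<integral>\<^sup>+y. \<integral>\<^sup>+x. indicator U y * (indicator (- U) x * ennreal (kernel n (y - x))) \<partial>lborel \<partial>lborel)"
      by (rule lborel_pair.Fubini'[symmetric]) measurable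
    also have "\<dots> = (\<integral>\<^sup>+x. \<integral>\<^sup>+y. indicator U x * (indicator (- U) y * ennreal (kernel n (y - x))) \<partial>lborel \<partial>lborel)"
      by (intro nn_integral_cong arg_cong2[where f = "(*)"] arg_cong[where f = ennreal] refl kernel_swap)
    also have "\<dots> = (\<integral>\<^sup>+x. indicator U x * J n x \<partial>lborel)"
      unfolding J_def by (simp add: nn_integral_cmult)
    finally show ?thesis by (simp add: mult_2)
  qed
  then show ?thesis using lim by simp
qed

text \<open>Outer regularity passes from open sets to measurable sets of finite measure,
  subadditivity to simple functions, and \<open>osc_le\<close> to integrable functions.\<close>

lemma osc_tendsto_0:
  fixes w :: "'a::euclidean_space \<Rightarrow> real"
  assumes "integrable lborel w"
  shows "(\<lambda>n. osc n w) \<longlonglongrightarrow> 0"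
  using assms
proof (induction rule: integrable_induct)
  case (base A c)
  then have [measurable]: "A \<in> sets borel" by simp
  have ind: "(\<lambda>n. osc n (indicator A)) \<longlonglongrightarrow> 0"
  proof (rule order_tendstoI)
    fix e :: ennreal assume "0 < e"
    \<comment> \<open>one \<open>d\<close> for \<open>osc n (indicator U)\<close>, two for the
      set \<open>U - A\<close>\<close>
    then obtain d :: real where d: "0 < d" "3 * ennreal d < e"
    proof -
      assume *: "\<And>d. 0 < d \<Longrightarrow> 3 * ennreal d < e \<Longrightarrow> thesis"
      obtain d' where "0 < d'" "d' < e" "d' < \<infinity>" using \<open>0 < e\<close> dense[of 0 "min e 1"]
        by (metis ennreal_one_less_top less_trans min_less_iff_conj top_neq_ennreal infinity_ennreal_def zero_less_one)
      then obtain r where r: "0 < r" "ennreal r < e"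
        by (cases d') auto
      have "3 * ennreal (r / 3) = ennreal r" using r
        by (simp add: ennreal_mult'[symmetric] flip: ennreal_numeral)
      then show thesis using r *[of "r / 3"] by simp
    qed
    obtain U where U: "open U" "A \<subseteq> U" "emeasure lborel (U - A) < d"
      using outer_regular_lborel[of A d] d base by auto
    have [measurable]: "U \<in> sets borel" using U by simp
    have "emeasure lborel U \<le> emeasure lborel A + emeasure lborel (U - A)"
      using U(2) by (subst emeasure_Un'[symmetric]) (auto simp: Un_absorb1)
    also have "\<dots> < \<infinity>" using base U(3) by (auto simp: less_top[symmetric] top_unique)
    finally have "(\<lambda>n. osc n (indicator U)) \<longlonglongrightarrow> 0" by (intro osc_open U)
    then have "\<forall>\<^sub>F n in sequentially. osc n (indicator U) < ennreal d"
      using d by (intro order_tendstoD(2)) auto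
    then show "\<forall>\<^sub>F n in sequentially. osc n (indicator A) < e"
    proof eventually_elim
      case (elim n)
      have "osc n (indicator A) = osc n (\<lambda>x. indicator U x + indicator (U - A) x * (- 1))"
        using U(2) by (intro arg_cong[where f = "osc n"]) (auto simp: indicator_def fun_eq_iff)
      also have "\<dots> \<le> osc n (indicator U) + osc n (\<lambda>x. indicator (U - A) x * (- 1))"
        by (intro osc_triangle) auto
      also have "osc n (\<lambda>x. indicator (U - A) x * (- 1)) = osc n (indicator (U - A))"
        by (subst osc_cmult) auto
      also have "\<dots> \<le> 2 * (\<integral>\<^sup>+x. ennreal \<bar>indicator (U - A) x\<bar> \<partial>lborel)"
        by (intro osc_le) auto
      also have "(\<integral>\<^sup>+x. ennreal \<bar>indicator (U - A) x\<bar> \<partial>lborel) = emeasure lborel (U - A)"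
        by (simp add: ennreal_indicator)
      finally have "osc n (indicator A) \<le> osc n (indicator U) + 2 * emeasure lborel (U - A)"
        by (simp add: add_left_mono)
      also have "\<dots> \<le> ennreal d + 2 * ennreal d"
        using elim U(3) by (intro add_mono mult_left_mono) auto
      also have "\<dots> = 3 * ennreal d" using distrib_right[of 1 2 "ennreal d"] by simp
      finally show ?case using d by simp
    qed
  qed simp
  have "(\<lambda>n. ennreal \<bar>c\<bar> * osc n (indicator A)) \<longlonglongrightarrow> ennreal \<bar>c\<bar> * 0"
    using ind by (intro ennreal_tendsto_cmult) auto
  then show ?case by (simp add: osc_cmult)
next
  case (add f g)
  have [measurable]: "f \<in> borel_measurable borel" "g \<in> borel_measurable borel"
    using add by (auto dest: borel_measurable_integrable)
  have "(\<lambda>n. osc n f + osc n g) \<longlonglongrightarrow> 0 + 0" using add by (intro tendsto_add) auto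
  then have "(\<lambda>n. osc n f + osc n g) \<longlonglongrightarrow> 0" by simp
  then show ?case
    by (rule tendsto_sandwich[OF _ _ tendsto_const, rotated 2]) (simp_all add: osc_triangle)
next
  case (lim f s)
  have [measurable]: "f \<in> borel_measurable borel" "\<And>i. s i \<in> borel_measurable borel"
    using lim by (auto dest: borel_measurable_integrable)
  have "(\<lambda>i. \<integral>\<^sup>+x. norm (f x - s i x) \<partial>lborel) \<longlonglongrightarrow> (\<integral>\<^sup>+x. 0 \<partial>(lborel :: 'a measure))"
  proof (rule nn_integral_dominated_convergence[where w = "\<lambda>x. 3 * ennreal (norm (f x))"])
    have "norm (f x - s i x) \<le> 3 * norm (f x)" for i x
      using lim(3)[of x i] norm_triangle_ineq4[of "f x" "s i x"] by simp
    then have "ennreal (norm (f x - s i x)) \<le> 3 * ennreal (norm (f x))" for i x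
      by (metis ennreal_leI ennreal_mult'' ennreal_numeral norm_ge_zero)
    then show "AE x in lborel. ennreal (norm (f x - s i x)) \<le> 3 * ennreal (norm (f x))" for i
      by auto
    show "(\<integral>\<^sup>+x. 3 * ennreal (norm (f x)) \<partial>lborel) < \<infinity>"
      using lim(4) by (simp add: nn_integral_cmult integrable_iff_bounded ennreal_mult_less_top)
    show "AE x in lborel. (\<lambda>i. ennreal (norm (f x - s i x))) \<longlonglongrightarrow> 0"
    proof (intro always_eventually allI)
      fix x
      have "(\<lambda>i. norm (f x - s i x)) \<longlonglongrightarrow> norm (f x - f x)"
        using lim(2)[of x] by (intro tendsto_intros) auto
      then show "(\<lambda>i. ennreal (norm (f x - s i x))) \<longlonglongrightarrow> 0"
        using tendsto_ennrealI by fastforce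
    qed
  qed auto
  then have L: "(\<lambda>i. 2 * (\<integral>\<^sup>+x. \<bar>f x - s i x\<bar> \<partial>lborel)) \<longlonglongrightarrow> 0"
    by (intro tendsto_eq_intros) auto
  show ?case
  proof (rule order_tendstoI)
    fix e :: ennreal assume "0 < e"
    then obtain i where i: "2 * (\<integral>\<^sup>+x. \<bar>f x - s i x\<bar> \<partial>lborel) < e"
      using order_tendstoD(2)[OF L] by (auto simp: eventually_sequentially)
    have "(\<lambda>n. osc n (s i) + 2 * (\<integral>\<^sup>+x. \<bar>f x - s i x\<bar> \<partial>lborel)) \<longlonglongrightarrow> 0 + 2 * (\<integral>\<^sup>+x. \<bar>f x - s i x\<bar> \<partial>lborel)"
      using lim(5) by (intro tendsto_add) auto
    then have "\<forall>\<^sub>F n in sequentially. osc n (s i) + 2 * (\<integral>\<^sup>+x. \<bar>f x - s i x\<bar> \<partial>lborel) < e"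
      using i by (intro order_tendstoD(2)) auto
    then show "\<forall>\<^sub>F n in sequentially. osc n f < e"
    proof eventually_elim
      case (elim n)
      have "osc n f = osc n (\<lambda>x. s i x + (f x - s i x))" by simp
      also have "\<dots> \<le> osc n (s i) + osc n (\<lambda>x. f x - s i x)" by (intro osc_triangle) auto
      also have "\<dots> \<le> osc n (s i) + 2 * (\<integral>\<^sup>+x. \<bar>f x - s i x\<bar> \<partial>lborel)"
        by (intro add_left_mono osc_le) auto
      finally show ?case using elim by simp
    qed
  qed simp
qed

section \<open>Truncated squares and a chain rule inequality\<close>

definition clamp_real :: "real \<Rightarrow> real \<Rightarrow> real" where
  "clamp_real k s = max (- k) (min k s)"

text \<open>The Huber function: \<open>s\<^sup>2 / 2\<close> where \<open>\<bar>s\<bar> \<le>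
  k\<close>, continued with slope \<open>k\<close> or \<open>- k\<close>; its derivative is
  \<open>clamp_real k\<close>. In the form below it is the maximum of \<open>c * s - c\<^sup>2
  / 2\<close> over \<open>\<bar>c\<bar> \<le> k\<close>, which shows convexity
  (\<open>huber_ge\<close>).\<close>

definition huber :: "real \<Rightarrow> real \<Rightarrow> real" where
  "huber k s = clamp_real k s * s - (clamp_real k s)\<^sup>2 / 2"

lemma clamp_real_cases:
  assumes "0 \<le> k"
  obtains "k < s" "clamp_real k s = k" | "s < - k" "clamp_real k s = - k"
    | "- k \<le> s" "s \<le> k" "clamp_real k s = s"
  using assms by (cases "k < s"; cases "s < - k") (simp_all add: clamp_real_def)

lemma huber_ge:
  assumes "\<bar>c\<bar> \<le> k" shows "c * s - c\<^sup>2 / 2 \<le> huber k s"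
proof -
  have "huber k s - (c * s - c\<^sup>2 / 2) = (clamp_real k s - c) * (s - clamp_real k s) + (clamp_real k s - c)\<^sup>2 / 2"
    unfolding huber_def by (simp add: power2_eq_square field_simps)
  moreover have "0 \<le> (clamp_real k s - c) * (s - clamp_real k s)"
  proof -
    have "0 \<le> k" "c \<le> k" "- k \<le> c" using assms by auto
    then show ?thesis
      by (cases rule: clamp_real_cases[of k s]) (auto intro: mult_nonneg_nonneg mult_nonpos_nonpos)
  qed
  ultimately show ?thesis using zero_le_power2[of "clamp_real k s - c"] by linarith
qed

lemma clamp_real_abs_le: "0 \<le> k \<Longrightarrow> \<bar>clamp_real k s\<bar> \<le> k"
  by (cases rule: clamp_real_cases[of k s]) auto

lemma clamp_real_diff_le:
  assumes "0 \<le> k" shows "\<bar>clamp_real k s - clamp_real k t\<bar> \<le> \<bar>s - t\<bar>"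
  by (rule clamp_real_cases[OF assms, of s]; rule clamp_real_cases[OF assms, of t]; use assms in linarith)

lemma clamp_real_continuous: "continuous_on S (clamp_real k)"
  unfolding clamp_real_def by (intro continuous_intros)

lemma clamp_real_measurable[measurable]: "clamp_real k \<in> borel_measurable borel"
  by (rule borel_measurable_continuous_onI[OF clamp_real_continuous])

lemma huber_measurable[measurable]: "huber k \<in> borel_measurable borel"
  unfolding huber_def by measurable

lemma huber_convex: "0 \<le> k \<Longrightarrow> huber k q - huber k p \<le> clamp_real k q * (q - p)"
  using huber_ge[OF clamp_real_abs_le, of k q p] by (simp add: huber_def algebra_simps)

lemma huber_nonneg: "0 \<le> k \<Longrightarrow> 0 \<le> huber k s"
  using huber_ge[of 0 k s] by simp

lemma huber_le: "huber k s \<le> s\<^sup>2 / 2"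
  using zero_le_power2[of "s - clamp_real k s"] by (simp add: huber_def power2_diff mult_ac)

lemma huber_lipschitz: "0 \<le> k \<Longrightarrow> \<bar>huber k p - huber k q\<bar> \<le> k * \<bar>p - q\<bar>"
proof -
  have *: "huber k q - huber k p \<le> k * \<bar>p - q\<bar>" if "0 \<le> k" for p q
  proof -
    have "huber k q - huber k p \<le> \<bar>clamp_real k q * (q - p)\<bar>"
      using huber_convex[OF that, of q p] by linarith
    also have "\<dots> \<le> k * \<bar>p - q\<bar>"
      unfolding abs_mult abs_minus_commute[of p q]
      by (intro mult_right_mono clamp_real_abs_le that) auto
    finally show ?thesis .
  qed
  show "0 \<le> k \<Longrightarrow> ?thesis" using *[of p q] *[of q p] unfolding abs_minus_commute[of q p] abs_le_iff by simp
qed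

lemma huber_eq: "\<bar>s\<bar> \<le> k \<Longrightarrow> huber k s = s\<^sup>2 / 2"
proof -
  assume "\<bar>s\<bar> \<le> k"
  then have "clamp_real k s = s" by (simp add: clamp_real_def)
  then show ?thesis by (simp add: huber_def power2_eq_square)
qed

text \<open>The factorisation \<open>clamp_real k s = ratio k s * s\<close> turns an upper
  bound for \<open>G * V\<close> into one for \<open>G\<close> times the truncation of
  \<open>V\<close>. The value 1 at 0 makes the ratio tend to 1 everywhere as \<open>k\<close>
  grows.\<close>

definition ratio :: "real \<Rightarrow> real \<Rightarrow> real" where
  "ratio k s = (if s = 0 then 1 else clamp_real k s / s)"

lemma ratio_bounds: "0 \<le> k \<Longrightarrow> 0 \<le> ratio k s" "0 \<le> k \<Longrightarrow> ratio k s \<le> 1"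
  by (cases rule: clamp_real_cases[of k s]; auto simp: ratio_def field_simps zero_le_divide_iff divide_le_eq)+

lemma clamp_eq_ratio: "0 \<le> k \<Longrightarrow> clamp_real k s = ratio k s * s"
  by (auto simp: ratio_def clamp_real_def)

lemma ratio_eq_1: "\<bar>s\<bar> \<le> k \<Longrightarrow> ratio k s = 1"
  by (auto simp: ratio_def clamp_real_def)

lemma ratio_measurable[measurable]: "ratio k \<in> borel_measurable borel"
  unfolding ratio_def[abs_def] by measurable

lemma set_integral_combine:
  fixes f :: "real \<Rightarrow> real"
  assumes "set_integrable lborel {s..t} f" "s \<le> m" "m \<le> t"
  shows "(LINT x:{s..t}|lborel. f x) = (LINT x:{s..m}|lborel. f x) + (LINT x:{m..t}|lborel. f x)"
proof -
  have "set_integrable lborel {s..m} f" "set_integrable lborel {m..t} f"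
    using assms(2,3) by (auto intro!: set_integrable_subset[OF assms(1)])
  then show ?thesis
    using assms by (simp add: set_borel_integral_eq_integral Henstock_Kurzweil_Integration.integral_combine)
qed

lemma primitive_continuous:
  fixes f :: "real \<Rightarrow> real"
  assumes "set_integrable lborel {a..b} f"
  shows "continuous_on {a..b} (\<lambda>t. LINT x:{a..t}|lborel. f x)"
proof -
  have "set_integrable lborel {a..t} f" if "t \<in> {a..b}" for t
    using that by (auto intro: set_integrable_subset[OF assms])
  then have "continuous_on {a..b} (\<lambda>t. LINT x:{a..t}|lborel. f x) \<longleftrightarrow> continuous_on {a..b} (\<lambda>t. integral {a..t} f)"
    by (intro continuous_on_cong) (auto simp: set_borel_integral_eq_integral)
  then show ?thesis
    using indefinite_integral_continuous_1[of f a b] set_borel_integral_eq_integral(1)[OF assms] by simp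
qed

lemma set_integrable_bounded_mult:
  fixes f g :: "'b \<Rightarrow> real"
  assumes f: "set_integrable M A f" and A: "A \<in> sets M"
    and g: "set_borel_measurable M A g" and k: "\<And>x. x \<in> A \<Longrightarrow> \<bar>g x\<bar> \<le> k"
  shows "set_integrable M A (\<lambda>x. g x * f x)"
  unfolding set_integrable_def
proof (rule Bochner_Integration.integrable_bound)
  show "integrable M (\<lambda>x. k * (indicator A x *\<^sub>R f x))"
    using f unfolding set_integrable_def by (rule integrable_mult_right)
  have "(\<lambda>x. (indicator A x *\<^sub>R g x) * (indicator A x *\<^sub>R f x)) \<in> borel_measurable M"
    using f g unfolding set_integrable_def set_borel_measurable_def by measurable
  also have "(\<lambda>x. (indicator A x *\<^sub>R g x) * (indicator A x *\<^sub>R f x)) = (\<lambda>x. indicator A x *\<^sub>R (g x * f x))"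
    by (auto simp: indicator_def)
  finally show "(\<lambda>x. indicator A x *\<^sub>R (g x * f x)) \<in> borel_measurable M" .
  show "AE x in M. norm (indicator A x *\<^sub>R (g x * f x)) \<le> norm (k * (indicator A x *\<^sub>R f x))"
  proof (rule AE_I2)
    fix x
    show "norm (indicator A x *\<^sub>R (g x * f x)) \<le> norm (k * (indicator A x *\<^sub>R f x))"
    proof (cases "x \<in> A")
      case True
      then have "\<bar>g x\<bar> * \<bar>f x\<bar> \<le> \<bar>k\<bar> * \<bar>f x\<bar>"
        using k[OF True] by (intro mult_right_mono) auto
      then show ?thesis using True by (simp add: abs_mult)
    qed simp
  qed
qed

text \<open>For an integral \<open>u\<close> with merely integrable density \<open>D\<close>.
  On a short interval convexity bounds the increment of \<open>H \<circ> u\<close> by the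
  value of \<open>H' \<circ> u\<close> at the right end times the increment of
  \<open>u\<close>, and replacing this value by \<open>H' (u x)\<close> under the integral
  costs at most \<open>d * \<bar>D x\<bar>\<close>. Bisection adds up the short intervals.\<close>

lemma convex_chain_rule_le:
  fixes D u H H' :: "real \<Rightarrow> real"
  assumes ab: "a \<le> b" and D: "set_integrable lborel {a..b} D"
    and u: "\<And>t. t \<in> {a..b} \<Longrightarrow> u t = u a + (LINT s:{a..t}|lborel. D s)"
    and conv: "\<And>p q. H q - H p \<le> H' q * (q - p)"
    and cont: "continuous_on UNIV H'" and k: "\<And>q. \<bar>H' q\<bar> \<le> k"
  shows "H (u b) - H (u a) \<le> (LINT s:{a..b}|lborel. H' (u s) * D s)"
proof (rule field_le_epsilon)
  fix e :: real assume e: "e > 0"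
  define A where "A = (LINT s:{a..b}|lborel. \<bar>D s\<bar>) + 1"
  have A: "A > 0" unfolding A_def
    by (auto simp: set_lebesgue_integral_def intro!: add_nonneg_pos integral_nonneg)
  define d where "d = e / A"
  have d: "d > 0" using e A by (simp add: d_def)
  have ucont: "continuous_on {a..b} u"
  proof -
    have "continuous_on {a..b} (\<lambda>t. u a + (LINT s:{a..t}|lborel. D s))"
      by (intro continuous_intros primitive_continuous D)
    then show ?thesis by (subst continuous_on_cong[OF refl u]) auto
  qed
  have Hucont: "continuous_on {a..b} (\<lambda>s. H' (u s))"
    using continuous_on_compose2[OF cont ucont] by simp
  have HD: "set_integrable lborel {a..b} (\<lambda>s. H' (u s) * D s)"
    by (rule set_integrable_bounded_mult[OF D _ _ k])
       (use borel_measurable_continuous_on_indicator[OF _ Hucont] in \<open>simp_all add: set_borel_measurable_def\<close>)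
  have absD: "set_integrable lborel {a..b} (\<lambda>s. \<bar>D s\<bar>)" using D by (rule set_integrable_abs)
  define P where "P s t \<longleftrightarrow> (a \<le> s \<and> t \<le> b \<longrightarrow> H (u t) - H (u s) \<le>
     (LINT x:{s..t}|lborel. H' (u x) * D x) + d * (LINT x:{s..t}|lborel. \<bar>D x\<bar>))" for s t
  have "P a b"
  proof (rule Bolzano[OF ab])
    fix s m t assume *: "P s m" "P m t" "s \<le> m" "m \<le> t"
    show "P s t" unfolding P_def
    proof (intro impI, elim conjE)
      assume st: "a \<le> s" "t \<le> b"
      have "set_integrable lborel {s..t} (\<lambda>s. H' (u s) * D s)" "set_integrable lborel {s..t} (\<lambda>s. \<bar>D s\<bar>)"
        using st by (auto intro: set_integrable_subset[OF HD] set_integrable_subset[OF absD])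
      from this[THEN set_integral_combine[OF _ *(3,4)]] * st
      show "H (u t) - H (u s) \<le>
         (LINT x:{s..t}|lborel. H' (u x) * D x) + d * (LINT x:{s..t}|lborel. \<bar>D x\<bar>)"
        unfolding P_def by (simp add: distrib_left)
    qed
  next
    fix x assume x: "a \<le> x" "x \<le> b"
    then obtain r where r: "r > 0" "\<And>y. y \<in> {a..b} \<Longrightarrow> dist y x < r \<Longrightarrow> dist (H' (u y)) (H' (u x)) < d / 2"
      using Hucont d unfolding continuous_on_iff by (metis atLeastAtMost_iff half_gt_zero)
    have "P s t" if st: "s \<le> x" "x \<le> t" "t - s < r" for s t
      unfolding P_def
    proof (intro impI, elim conjE)
      assume ab': "a \<le> s" "t \<le> b"
      have sub: "{s..t} \<subseteq> {a..b}" using ab' by auto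
      have int: "set_integrable lborel {s..t} D" "set_integrable lborel {s..t} (\<lambda>s. H' (u s) * D s)" "set_integrable lborel {s..t} (\<lambda>s. \<bar>D s\<bar>)"
        using sub by (auto intro: set_integrable_subset[OF HD] set_integrable_subset[OF D] set_integrable_subset[OF absD])
      have close: "\<bar>H' (u t) - H' (u y)\<bar> \<le> d" if "y \<in> {s..t}" for y
      proof -
        have "dist (H' (u y)) (H' (u x)) < d / 2" "dist (H' (u t)) (H' (u x)) < d / 2"
          by (intro r(2); use that st ab' in \<open>auto simp: dist_real_def\<close>)+
        then show ?thesis unfolding dist_real_def by arith
      qed
      have "u t - u s = (LINT x:{s..t}|lborel. D x)"
        using u[of s] u[of t] set_integral_combine[of a t D s] set_integrable_subset[OF D, of "{a..t}"] ab' st x by auto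
      then have "H (u t) - H (u s) \<le> H' (u t) * (LINT x:{s..t}|lborel. D x)"
        using conv[of "u t" "u s"] by simp
      also have "\<dots> = (LINT x:{s..t}|lborel. H' (u t) * D x)" by simp
      also have "\<dots> \<le> (LINT x:{s..t}|lborel. H' (u x) * D x + d * \<bar>D x\<bar>)"
      proof (rule set_integral_mono)
        show "H' (u t) * D y \<le> H' (u y) * D y + d * \<bar>D y\<bar>" if "y \<in> {s..t}" for y
        proof -
          have "(H' (u t) - H' (u y)) * D y \<le> \<bar>H' (u t) - H' (u y)\<bar> * \<bar>D y\<bar>"
            unfolding abs_mult[symmetric] by simp
          also have "\<dots> \<le> d * \<bar>D y\<bar>" by (intro mult_right_mono close that) auto
          finally show ?thesis by (simp add: algebra_simps)
        qed
      qed (use int in auto)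
      also have "\<dots> = (LINT x:{s..t}|lborel. H' (u x) * D x) + d * (LINT x:{s..t}|lborel. \<bar>D x\<bar>)"
        using int by (subst set_integral_add) auto
      finally show "H (u t) - H (u s) \<le> (LINT x:{s..t}|lborel. H' (u x) * D x) + d * (LINT x:{s..t}|lborel. \<bar>D x\<bar>)" .
    qed
    then show "\<exists>r>0. \<forall>s t. s \<le> x \<and> x \<le> t \<and> t - s < r \<longrightarrow> P s t" using r(1) by blast
  qed
  then have "H (u b) - H (u a) \<le> (LINT x:{a..b}|lborel. H' (u x) * D x) + d * (LINT x:{a..b}|lborel. \<bar>D x\<bar>)"
    unfolding P_def by simp
  also have "d * (LINT x:{a..b}|lborel. \<bar>D x\<bar>) \<le> d * A" unfolding A_def using d by simp
  also have "d * A = e" using A by (simp add: d_def)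
  finally show "H (u b) - H (u a) \<le> (LINT s:{a..b}|lborel. H' (u s) * D s) + e" by simp
qed

lemma abs_mult_le_squares: "\<bar>(a::real) * b\<bar> \<le> a\<^sup>2 + b\<^sup>2"
proof -
  have "2 * (\<bar>a\<bar> * \<bar>b\<bar>) \<le> a\<^sup>2 + b\<^sup>2"
    using sum_squares_bound[of "\<bar>a\<bar>" "\<bar>b\<bar>"] by (simp add: mult.assoc)
  moreover have "0 \<le> \<bar>a\<bar> * \<bar>b\<bar>" by simp
  ultimately show ?thesis unfolding abs_mult by linarith
qed

lemma integrable_mult_squares:
  fixes v w :: "'b \<Rightarrow> real"
  assumes [measurable]: "v \<in> borel_measurable M" "w \<in> borel_measurable M"
    and "integrable M (\<lambda>x. (v x)\<^sup>2)" "integrable M (\<lambda>x. (w x)\<^sup>2)"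
  shows "integrable M (\<lambda>x. v x * w x)"
    and "(\<integral>x. \<bar>v x * w x\<bar> \<partial>M) \<le> (\<integral>x. (v x)\<^sup>2 \<partial>M) + (\<integral>x. (w x)\<^sup>2 \<partial>M)"
proof -
  show 1: "integrable M (\<lambda>x. v x * w x)"
    by (rule Bochner_Integration.integrable_bound[of M "\<lambda>x. (v x)\<^sup>2 + (w x)\<^sup>2"])
       (use assms in \<open>auto intro!: AE_I2 abs_mult_le_squares\<close>)
  have "(\<integral>x. \<bar>v x * w x\<bar> \<partial>M) \<le> (\<integral>x. (v x)\<^sup>2 + (w x)\<^sup>2 \<partial>M)"
    using assms 1 by (intro integral_mono abs_mult_le_squares) auto
  then show "(\<integral>x. \<bar>v x * w x\<bar> \<partial>M) \<le> (\<integral>x. (v x)\<^sup>2 \<partial>M) + (\<integral>x. (w x)\<^sup>2 \<partial>M)"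
    using assms by simp
qed

lemma square_integrable_bounded_supported:
  fixes \<phi> :: "'a::euclidean_space \<Rightarrow> real"
  assumes [measurable]: "\<phi> \<in> borel_measurable borel" and "\<And>y. \<bar>\<phi> y\<bar> \<le> C" "\<And>y. \<phi> y \<noteq> 0 \<Longrightarrow> y \<in> cball c R"
  shows "integrable lborel (\<lambda>y. (\<phi> y)\<^sup>2)" "(\<integral>y. (\<phi> y)\<^sup>2 \<partial>lborel) \<le> C\<^sup>2 * measure lborel (cball (0::'a) R)"
proof -
  have int: "integrable lborel (\<lambda>y. C\<^sup>2 * indicator (cball c R) y)"
    by (intro integrable_mult_right integrable_real_indicator)
       (auto simp: emeasure_lborel_cball_finite[unfolded infinity_ennreal_def])
  have le: "(\<phi> y)\<^sup>2 \<le> C\<^sup>2 * indicator (cball c R) y" for y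
  proof (cases "y \<in> cball c R")
    case True
    have "\<bar>\<phi> y\<bar>\<^sup>2 \<le> C\<^sup>2" using assms(2)[of y] by (intro power_mono) auto
    then show ?thesis using True by simp
  next
    case False then show ?thesis using assms(3)[of y] by auto
  qed
  show 1: "integrable lborel (\<lambda>y. (\<phi> y)\<^sup>2)"
    by (rule Bochner_Integration.integrable_bound[OF int]) (use le in \<open>auto intro!: AE_I2\<close>)
  have "(\<integral>y. (\<phi> y)\<^sup>2 \<partial>lborel) \<le> (\<integral>y. C\<^sup>2 * indicator (cball c R) y \<partial>lborel)"
    by (intro integral_mono 1 int le)
  also have "\<dots> = C\<^sup>2 * measure lborel (cball c R)" by simp
  also have "measure lborel (cball c R) = measure lborel (cball (0::'a) R)"
    by (cases "R \<ge> 0") (simp_all add: content_cball)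
  finally show "(\<integral>y. (\<phi> y)\<^sup>2 \<partial>lborel) \<le> C\<^sup>2 * measure lborel (cball (0::'a) R)" .
qed

section \<open>Mollification and the discrete Laplacian\<close>

lemma integrable_mult_supported:
  fixes w \<phi> :: "'a::euclidean_space \<Rightarrow> real"
  assumes "w \<in> borel_measurable borel" "integrable lborel (\<lambda>x. (w x)\<^sup>2)"
    and "\<phi> \<in> borel_measurable borel" "\<And>y. \<bar>\<phi> y\<bar> \<le> C" "\<And>y. \<phi> y \<noteq> 0 \<Longrightarrow> y \<in> cball c R"
  shows "integrable lborel (\<lambda>x. w x * \<phi> x)"
    and "(\<integral>x. \<bar>w x * \<phi> x\<bar> \<partial>lborel) \<le> (\<integral>x. (w x)\<^sup>2 \<partial>lborel) + C\<^sup>2 * measure lborel (cball (0::'a) R)"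
proof -
  note sq = square_integrable_bounded_supported[OF assms(3-5)]
  show "integrable lborel (\<lambda>x. w x * \<phi> x)"
    using assms(1-3) sq by (intro integrable_mult_squares) auto
  have "(\<integral>x. \<bar>w x * \<phi> x\<bar> \<partial>lborel) \<le> (\<integral>x. (w x)\<^sup>2 \<partial>lborel) + (\<integral>x. (\<phi> x)\<^sup>2 \<partial>lborel)"
    using assms(1-3) sq by (intro integrable_mult_squares) auto
  then show "(\<integral>x. \<bar>w x * \<phi> x\<bar> \<partial>lborel) \<le> (\<integral>x. (w x)\<^sup>2 \<partial>lborel) + C\<^sup>2 * measure lborel (cball (0::'a) R)"
    using sq(2) by linarith
qed

text \<open>Since the kernel is even this is the usual convolution; with the argument \<open>y
  - x\<close> it is literally the pairing with the test function \<open>kernel n\<close>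
  centred at \<open>x\<close>.\<close>

definition mollify :: "nat \<Rightarrow> ('a::euclidean_space \<Rightarrow> real) \<Rightarrow> 'a \<Rightarrow> real" where
  "mollify n w x = (\<integral>y. w y * kernel n (y - x) \<partial>lborel)"

definition mollify_laplacian :: "nat \<Rightarrow> ('a::euclidean_space \<Rightarrow> real) \<Rightarrow> 'a \<Rightarrow> real" where
  "mollify_laplacian n w x = (\<integral>y. w y * laplacian (kernel n) (y - x) \<partial>lborel)"

lemma laplacian_bump_span:
  assumes f: "f \<in> bump_span a r"
  shows "continuous_on UNIV (laplacian f)" "\<And>x. laplacian f x \<noteq> 0 \<Longrightarrow> x \<in> cball a (sqrt r)"
proof -
  have "continuous_on UNIV (\<lambda>x. \<Sum>b\<in>Basis. partial_deriv b (partial_deriv b f) x)"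
    by (intro continuous_on_sum bump_span_continuous[of _ a r] bump_span_partial_deriv f)
  then show "continuous_on UNIV (laplacian f)" unfolding laplacian_def[abs_def] .
  fix x assume "laplacian f x \<noteq> 0"
  then obtain b where "partial_deriv b (partial_deriv b f) x \<noteq> 0"
    unfolding laplacian_def by (meson sum.neutral)
  then show "x \<in> cball a (sqrt r)"
    by (intro bump_span_support_ball[of "partial_deriv b (partial_deriv b f)"] bump_span_partial_deriv f)
qed

lemma laplacian_kernel_measurable[measurable]: "laplacian (kernel n) \<in> borel_measurable borel"
  by (intro borel_measurable_continuous_onI laplacian_bump_span[OF kernel_bump_span0])

lemma sqrt_square_Suc: "sqrt ((1 / real (Suc n))\<^sup>2) \<le> 1"
  by simp

lemma kernel_shift_support: "kernel n (y - x) \<noteq> 0 \<Longrightarrow> y \<in> cball x 1"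
  using kernel_support'[of "y - x" n] by (force simp: dist_norm norm_minus_commute)

lemma kernel_bounded: "\<exists>C\<ge>0. \<forall>z. \<bar>kernel n z\<bar> \<le> C"
  by (rule bump_span_bounded[OF kernel_bump_span0])

lemma laplacian_kernel_support: "laplacian (kernel n) (y - x) \<noteq> 0 \<Longrightarrow> y \<in> cball x 1"
proof -
  assume "laplacian (kernel n) (y - x) \<noteq> 0"
  then have "norm (y - x) \<le> sqrt ((1 / real (Suc n))\<^sup>2)"
    using laplacian_bump_span(2)[OF kernel_bump_span0, of n "y - x"] by (simp add: dist_norm norm_minus_commute)
  then have "norm (y - x) \<le> 1" using sqrt_square_Suc[of n] by linarith
  then show ?thesis by (simp add: dist_norm norm_minus_commute)
qed

lemma laplacian_kernel_bounded: "\<exists>C\<ge>0. \<forall>z. \<bar>laplacian (kernel n) z\<bar> \<le> C"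
  by (rule bounded_if_continuous_supported[OF laplacian_bump_span[OF kernel_bump_span0]])

lemma laplacian_translated_kernel: "laplacian (\<lambda>y. kernel n (y - x)) y = laplacian (kernel n) (y - x)"
proof (rule tendsto_unique)
  show "((\<lambda>\<tau>. second_difference \<tau> (kernel n) (y - x)) \<longlongrightarrow> laplacian (kernel n) (y - x)) (at_right 0)"
    by (rule second_difference_tendsto_laplacian[OF kernel_bump_span0])
  show "((\<lambda>\<tau>. second_difference \<tau> (kernel n) (y - x)) \<longlongrightarrow> laplacian (\<lambda>y. kernel n (y - x)) y) (at_right 0)"
    using second_difference_tendsto_laplacian[OF kernel_bump_span] by (simp add: second_difference_translate)
qed simp

text \<open>Jensen's inequality for the probability density \<open>kernel n (y - x)\<close>,
  obtained from the nonnegativity of the variance, and then an exchange of integrals.\<close>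

lemma mollify_square_le:
  fixes w :: "'a::euclidean_space \<Rightarrow> real"
  assumes [measurable]: "w \<in> borel_measurable borel" and w: "integrable lborel (\<lambda>x. (w x)\<^sup>2)"
  shows "integrable lborel (\<lambda>x. (mollify n w x)\<^sup>2)"
    and "(\<integral>x. (mollify n w x)\<^sup>2 \<partial>lborel) \<le> (\<integral>x. (w x)\<^sup>2 \<partial>lborel)"
proof -
  have [measurable]: "mollify n w \<in> borel_measurable borel"
    unfolding mollify_def[abs_def] by measurable
  obtain C where C: "\<And>z. \<bar>kernel n (z::'a)\<bar> \<le> C" using kernel_bounded by blast
  have point: "ennreal ((mollify n w x)\<^sup>2) \<le> (\<integral>\<^sup>+y. ennreal ((w y)\<^sup>2) * kernel n (y - x) \<partial>lborel)" for x
  proof -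
    define c where "c = mollify n w x"
    have i1: "integrable lborel (\<lambda>y. (w y)\<^sup>2 * kernel n (y - x))"
    proof (rule Bochner_Integration.integrable_bound)
      show "integrable lborel (\<lambda>y. C * (w y)\<^sup>2)" using w by simp
      have "\<bar>(w y)\<^sup>2 * kernel n (y - x)\<bar> \<le> \<bar>C * (w y)\<^sup>2\<bar>" for y
        using mult_right_mono[OF order_trans[OF C[of "y - x"] abs_ge_self], of "(w y)\<^sup>2"]
        by (simp add: abs_mult mult.commute)
      then show "AE y in lborel. norm ((w y)\<^sup>2 * kernel n (y - x)) \<le> norm (C * (w y)\<^sup>2)" by simp
    qed simp
    have i2: "integrable lborel (\<lambda>y. w y * kernel n (y - x))"
      by (rule integrable_mult_supported(1)[OF _ w _ C kernel_shift_support]) simp_all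
    have i3: "integrable lborel (\<lambda>y. kernel n (y - x))"
      by (rule bump_span_integrable[OF kernel_bump_span])
    have k1: "(\<integral>y. kernel n (y - x) \<partial>lborel) = 1"
      using nn_integral_kernel_shift(1)[of n x] nn_integral_eq_integral[OF i3 AE_I2[OF kernel_nonneg]]
      by simp
    \<comment> \<open>\<open>c\<close> is the mean of \<open>w\<close> with respect to the
      kernel\<close>
    have "0 \<le> (\<integral>y. (w y - c)\<^sup>2 * kernel n (y - x) \<partial>lborel)"
      by (intro Bochner_Integration.integral_nonneg mult_nonneg_nonneg kernel_nonneg) simp
    also have "\<dots> = (\<integral>y. (w y)\<^sup>2 * kernel n (y - x) - 2 * c * (w y * kernel n (y - x)) + c\<^sup>2 * kernel n (y - x) \<partial>lborel)"
      by (intro Bochner_Integration.integral_cong) (auto simp: power2_eq_square algebra_simps)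
    also have "\<dots> = (\<integral>y. (w y)\<^sup>2 * kernel n (y - x) \<partial>lborel) - 2 * c * c + c\<^sup>2"
      using i1 i2 i3 k1 by (simp add: c_def mollify_def)
    finally have "c\<^sup>2 \<le> (\<integral>y. (w y)\<^sup>2 * kernel n (y - x) \<partial>lborel)" by (simp add: power2_eq_square)
    then have "ennreal (c\<^sup>2) \<le> ennreal (\<integral>y. (w y)\<^sup>2 * kernel n (y - x) \<partial>lborel)" by (rule ennreal_leI)
    also have "\<dots> = (\<integral>\<^sup>+y. ennreal ((w y)\<^sup>2 * kernel n (y - x)) \<partial>lborel)"
      by (intro nn_integral_eq_integral[symmetric] i1) (simp add: kernel_nonneg)
    finally show ?thesis by (simp add: c_def ennreal_mult')
  qed
  have "(\<integral>\<^sup>+x. ennreal ((mollify n w x)\<^sup>2) \<partial>lborel)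
      \<le> (\<integral>\<^sup>+x. \<integral>\<^sup>+y. ennreal ((w y)\<^sup>2) * kernel n (y - x) \<partial>lborel \<partial>lborel)"
    by (intro nn_integral_mono point)
  also have "\<dots> = (\<integral>\<^sup>+y. \<integral>\<^sup>+x. ennreal ((w y)\<^sup>2) * kernel n (y - x) \<partial>lborel \<partial>lborel)"
    by (rule lborel_pair.Fubini'[symmetric]) measurable
  also have "\<dots> = (\<integral>\<^sup>+y. ennreal ((w y)\<^sup>2) \<partial>lborel)"
    by (simp add: nn_integral_cmult nn_integral_kernel_shift)
  also have "\<dots> = ennreal (\<integral>y. (w y)\<^sup>2 \<partial>lborel)"
    by (intro nn_integral_eq_integral w) simp
  finally have le: "(\<integral>\<^sup>+x. ennreal ((mollify n w x)\<^sup>2) \<partial>lborel) \<le> ennreal (\<integral>y. (w y)\<^sup>2 \<partial>lborel)" .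
  show int: "integrable lborel (\<lambda>x. (mollify n w x)\<^sup>2)"
    using le by (intro integrableI_bounded) (auto simp: le_less_trans)
  show "(\<integral>x. (mollify n w x)\<^sup>2 \<partial>lborel) \<le> (\<integral>x. (w x)\<^sup>2 \<partial>lborel)"
    using le by (subst (asm) nn_integral_eq_integral[OF int]) auto
qed

lemma second_difference_mollify:
  fixes w :: "'a::euclidean_space \<Rightarrow> real"
  assumes [measurable]: "w \<in> borel_measurable borel" and w: "integrable lborel (\<lambda>x. (w x)\<^sup>2)"
  shows "second_difference \<tau> (mollify n w) x = (\<integral>y. w y * second_difference \<tau> (kernel n) (y - x) \<partial>lborel)"
proof -
  obtain C where C: "\<And>z. \<bar>kernel n (z::'a)\<bar> \<le> C" using kernel_bounded by blast
  have i: "integrable lborel (\<lambda>y. w y * kernel n (y - x))" for x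
    by (rule integrable_mult_supported(1)[OF _ w _ C kernel_shift_support]) simp_all
  have eq: "kernel n (y - x + \<tau> *\<^sub>R b) = kernel n (y - (x - \<tau> *\<^sub>R b))"
     "kernel n (y - x - \<tau> *\<^sub>R b) = kernel n (y - (x + \<tau> *\<^sub>R b))" for y b :: 'a
    by (simp_all add: algebra_simps)
  have "(\<integral>y. w y * second_difference \<tau> (kernel n) (y - x) \<partial>lborel)
    = (\<integral>y. (\<Sum>b\<in>Basis. (w y * kernel n (y - (x - \<tau> *\<^sub>R b)) + w y * kernel n (y - (x + \<tau> *\<^sub>R b)) - 2 * (w y * kernel n (y - x))) / \<tau>\<^sup>2) \<partial>lborel)"
    unfolding second_difference_def eq sum_distrib_left
    by (intro Bochner_Integration.integral_cong sum.cong) (auto simp: field_simps)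
  also have "\<dots> = (\<Sum>b\<in>Basis. (mollify n w (x - \<tau> *\<^sub>R b) + mollify n w (x + \<tau> *\<^sub>R b) - 2 * mollify n w x) / \<tau>\<^sup>2)"
    unfolding mollify_def using i by simp
  also have "\<dots> = second_difference \<tau> (mollify n w) x"
    unfolding second_difference_def by (simp add: add.commute)
  finally show ?thesis by simp
qed

text \<open>The discrete form of \<open>H'(u) \<Delta>u \<le> \<Delta>(H(u))\<close>.\<close>

lemma second_difference_convex:
  assumes conv: "\<And>p q::real. H q - H p \<le> H' q * (q - p)"
  shows "H' (u x) * second_difference \<tau> u x \<le> second_difference \<tau> (\<lambda>x. H (u x)) x"
  unfolding second_difference_def sum_distrib_left
proof (rule sum_mono)
  fix b :: 'a
  have "H' (u x) * (u (x + \<tau> *\<^sub>R b) + u (x - \<tau> *\<^sub>R b) - 2 * u x)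
     \<le> H (u (x + \<tau> *\<^sub>R b)) + H (u (x - \<tau> *\<^sub>R b)) - 2 * H (u x)"
    using conv[of "u x" "u (x + \<tau> *\<^sub>R b)"] conv[of "u x" "u (x - \<tau> *\<^sub>R b)"] by (simp add: algebra_simps)
  then show "H' (u x) * ((u (x + \<tau> *\<^sub>R b) + u (x - \<tau> *\<^sub>R b) - 2 * u x) / \<tau>\<^sup>2)
    \<le> (H (u (x + \<tau> *\<^sub>R b)) + H (u (x - \<tau> *\<^sub>R b)) - 2 * H (u x)) / \<tau>\<^sup>2"
    by (simp add: divide_right_mono)
qed

lemma integral_lborel_shift:
  fixes f :: "'a::euclidean_space \<Rightarrow> real"
  assumes [measurable]: "f \<in> borel_measurable borel"
  shows "(\<integral>x. f (x + c) \<partial>lborel) = (\<integral>x. f x \<partial>lborel)" "integrable lborel (\<lambda>x. f (x + c)) \<longleftrightarrow> integrable lborel f"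
proof -
  have "(\<integral>x. f x \<partial>distr lborel borel ((+) c)) = (\<integral>x. f (c + x) \<partial>lborel)"
    by (rule integral_distr) auto
  then show "(\<integral>x. f (x + c) \<partial>lborel) = (\<integral>x. f x \<partial>lborel)"
    by (simp add: lborel_distr_plus add.commute)
  have "integrable (distr lborel borel ((+) c)) f \<longleftrightarrow> integrable lborel (\<lambda>x. f (c + x))"
    by (rule integrable_distr_eq) auto
  then show "integrable lborel (\<lambda>x. f (x + c)) \<longleftrightarrow> integrable lborel f"
    by (simp add: lborel_distr_plus add.commute)
qed

text \<open>Summation by parts: a translation of \<open>v\<close> is a translation of
  \<open>\<eta>\<close> in the opposite direction.\<close>

lemma second_difference_transfer:
  fixes v \<eta> :: "'a::euclidean_space \<Rightarrow> real"
  assumes v: "integrable lborel v" and [measurable]: "\<eta> \<in> borel_measurable borel" and C: "\<And>x. \<bar>\<eta> x\<bar> \<le> C"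
  shows "(\<integral>x. \<eta> x * second_difference \<tau> v x \<partial>lborel) = (\<integral>x. second_difference \<tau> \<eta> x * v x \<partial>lborel)"
    and "integrable lborel (\<lambda>x. \<eta> x * second_difference \<tau> v x)"
    and "integrable lborel (\<lambda>x. second_difference \<tau> \<eta> x * v x)"
proof -
  have [measurable]: "v \<in> borel_measurable borel" using v by auto
  have i: "integrable lborel (\<lambda>x. \<eta> x * v (x + c))" for c
  proof (rule Bochner_Integration.integrable_bound)
    show "integrable lborel (\<lambda>x. C * v (x + c))" using v by (simp add: integral_lborel_shift)
    have "\<bar>\<eta> x * v (x + c)\<bar> \<le> \<bar>C * v (x + c)\<bar>" for x
      unfolding abs_mult using C[of x] by (intro mult_right_mono) auto
    then show "AE x in lborel. norm (\<eta> x * v (x + c)) \<le> norm (C * v (x + c))" by simp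
  qed simp
  have j: "integrable lborel (\<lambda>x. \<eta> (x + c) * v x)" for c
    using i[of "- c"] integral_lborel_shift(2)[of "\<lambda>x. \<eta> (x + c) * v x" "- c"] by simp
  have ij: "(\<integral>x. \<eta> x * v (x + c) \<partial>lborel) = (\<integral>x. \<eta> (x + (- c)) * v x \<partial>lborel)" for c
    using integral_lborel_shift(1)[of "\<lambda>x. \<eta> (x - c) * v x" c] by simp
  note i' = i[of 0, simplified] i i[of "- c" for c, simplified]
  note j' = j[of 0, simplified] j j[of "- c" for c, simplified]
  note ij' = ij[of 0, simplified] ij[of c for c, simplified] ij[of "- c" for c, simplified]
  have e1: "(\<lambda>x. \<eta> x * second_difference \<tau> v x) = (\<lambda>x. \<Sum>b\<in>Basis. (\<eta> x * v (x + \<tau> *\<^sub>R b) + \<eta> x * v (x - \<tau> *\<^sub>R b) - 2 * (\<eta> x * v x)) / \<tau>\<^sup>2)"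
    unfolding second_difference_def sum_distrib_left by (auto simp: field_simps intro!: sum.cong ext)
  have e2: "(\<lambda>x. second_difference \<tau> \<eta> x * v x) = (\<lambda>x. \<Sum>b\<in>Basis. (\<eta> (x - \<tau> *\<^sub>R b) * v x + \<eta> (x + \<tau> *\<^sub>R b) * v x - 2 * (\<eta> x * v x)) / \<tau>\<^sup>2)"
    unfolding second_difference_def sum_distrib_right by (auto simp: field_simps intro!: sum.cong ext)
  show "integrable lborel (\<lambda>x. \<eta> x * second_difference \<tau> v x)"
    unfolding e1 by (simp add: i')
  show "integrable lborel (\<lambda>x. second_difference \<tau> \<eta> x * v x)"
    unfolding e2 by (simp add: j')
  show "(\<integral>x. \<eta> x * second_difference \<tau> v x \<partial>lborel) = (\<integral>x. second_difference \<tau> \<eta> x * v x \<partial>lborel)"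
    unfolding e1 e2 by (simp add: i' j' ij')
qed

lemma cball_borel[measurable]: "cball c r \<in> sets borel"
  by simp

lemma mollify_measurable[measurable (raw)]:
  assumes [measurable]: "(\<lambda>(x, y). f x y) \<in> borel_measurable (N \<Otimes>\<^sub>M lborel)" "g \<in> borel_measurable N"
  shows "(\<lambda>x. mollify n (f x) (g x)) \<in> borel_measurable N"
  unfolding mollify_def by measurable

lemma mollify_laplacian_measurable[measurable (raw)]:
  assumes [measurable]: "(\<lambda>(x, y). f x y) \<in> borel_measurable (N \<Otimes>\<^sub>M lborel)" "g \<in> borel_measurable N"
  shows "(\<lambda>x. mollify_laplacian n (f x) (g x)) \<in> borel_measurable N"
  unfolding mollify_laplacian_def by measurable

lemma second_difference_measurable[measurable]:
  assumes [measurable]: "f \<in> borel_measurable borel"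
  shows "second_difference \<tau> f \<in> borel_measurable borel"
  unfolding second_difference_def[abs_def] by measurable

lemma inverse_Suc_at_right_0: "filterlim (\<lambda>j. 1 / real (Suc j)) (at_right 0) sequentially"
  unfolding filterlim_at using LIMSEQ_inverse_real_of_nat by (auto simp: inverse_eq_divide)

lemma integrable_bounded_supported:
  fixes f :: "'a::euclidean_space \<Rightarrow> real"
  assumes "f \<in> borel_measurable borel" "\<And>x. \<bar>f x\<bar> \<le> C * indicator (cball c R) x"
  shows "integrable lborel f"
proof (rule Bochner_Integration.integrable_bound)
  show "integrable lborel (\<lambda>x. C * indicator (cball c R) x :: real)"
    by (intro integrable_mult_right integrable_real_indicator)
       (auto simp: emeasure_lborel_cball_finite[unfolded infinity_ennreal_def])
  show "AE x in lborel. norm (f x) \<le> norm (C * indicator (cball c R) x :: real)"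
    using assms(2) by (auto intro!: AE_I2 order_trans[OF _ abs_ge_self])
qed (use assms in simp)

text \<open>Formally, with \<open>u = mollify n w\<close>, the left side is the integral of
  \<open>\<eta> H'(u) \<Delta>u\<close> for the convex function \<open>H = huber k\<close>,
  which is at most the integral of \<open>\<Delta>\<eta> H(u)\<close>, and \<open>H(u) \<le>
  u\<^sup>2 / 2\<close>. The estimate is made for second differences and survives when the
  step tends to 0, since the kernel is smooth.\<close>

lemma mollify_laplacian_dissipative:
  fixes w \<eta> :: "'a::euclidean_space \<Rightarrow> real"
  assumes w_meas[measurable]: "w \<in> borel_measurable borel" and w: "integrable lborel (\<lambda>x. (w x)\<^sup>2)"
    and M: "(\<integral>x. (w x)\<^sup>2 \<partial>lborel) \<le> M"
    and \<eta>_meas[measurable]: "\<eta> \<in> borel_measurable borel"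
    and \<eta>: "\<And>x. 0 \<le> \<eta> x" "\<And>x. \<eta> x \<le> C" "\<And>x. \<eta> x \<noteq> 0 \<Longrightarrow> x \<in> cball 0 R"
    and B: "\<And>\<tau> x. 0 < \<tau> \<Longrightarrow> \<bar>second_difference \<tau> \<eta> x\<bar> \<le> B" and k: "0 \<le> k"
  shows "(\<integral>x. \<eta> x * (clamp_real k (mollify n w x) * mollify_laplacian n w x) \<partial>lborel) \<le> B * M / 2"
proof -
  define u where "u = mollify n w"
  have u_meas[measurable]: "u \<in> borel_measurable borel" unfolding u_def by measurable
  have C0: "0 \<le> C" using \<eta>(1,2)[of 0] by linarith
  have B0: "0 \<le> B" using B[of 1 0] by linarith
  obtain Cs where Cs: "0 \<le> Cs" "\<And>\<tau> z. 0 < \<tau> \<Longrightarrow> \<bar>second_difference \<tau> (kernel n) (z::'a)\<bar> \<le> Cs"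
    using second_difference_bounded[OF kernel_bump_span0[of n]] by blast
  have supp: "y \<in> cball x 2" if "second_difference \<tau> (kernel n) (y - x) \<noteq> 0" "0 < \<tau>" "\<tau> \<le> 1" for \<tau> x and y :: 'a
  proof -
    have "\<exists>b\<in>Basis. kernel n (y - x + \<tau> *\<^sub>R b) \<noteq> 0 \<or> kernel n (y - x - \<tau> *\<^sub>R b) \<noteq> 0 \<or> kernel n (y - x) \<noteq> 0"
    proof (rule ccontr)
      assume "\<not> ?thesis"
      then have "second_difference \<tau> (kernel n) (y - x) = 0"
        unfolding second_difference_def by (intro sum.neutral ballI) auto
      then show False using that(1) by simp
    qed
    then obtain b where b: "b \<in> Basis"
      "kernel n (y - x + \<tau> *\<^sub>R b) \<noteq> 0 \<or> kernel n (y - x - \<tau> *\<^sub>R b) \<noteq> 0 \<or> kernel n (y - x) \<noteq> 0" by blast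
    have "norm (\<tau> *\<^sub>R b) \<le> 1" using b(1) that by simp
    moreover have "norm (y - x + \<tau> *\<^sub>R b) < 1 \<or> norm (y - x - \<tau> *\<^sub>R b) < 1 \<or> norm (y - x) < 1"
      using b(2) kernel_support'[of _ n] by (meson not_le)
    ultimately have "norm (y - x) \<le> 2"
      using norm_triangle_ineq4[of "y - x + \<tau> *\<^sub>R b" "\<tau> *\<^sub>R b"] norm_triangle_ineq[of "y - x - \<tau> *\<^sub>R b" "\<tau> *\<^sub>R b"]
      by auto
    then show ?thesis by (simp add: dist_norm norm_minus_commute)
  qed
  define \<tau> where "\<tau> j = 1 / real (Suc j)" for j
  have \<tau>: "0 < \<tau> j" "\<tau> j \<le> 1" for j by (simp_all add: \<tau>_def)
  define Q where "Q = M + Cs\<^sup>2 * measure lborel (cball (0::'a) 2)"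
  have Q: "\<bar>second_difference (\<tau> j) u x\<bar> \<le> Q" for j x
  proof -
    have meas: "(\<lambda>y. second_difference (\<tau> j) (kernel n) (y - x)) \<in> borel_measurable borel" by measurable
    have "\<bar>second_difference (\<tau> j) u x\<bar> \<le> (\<integral>y. \<bar>w y * second_difference (\<tau> j) (kernel n) (y - x)\<bar> \<partial>lborel)"
      unfolding u_def second_difference_mollify[OF w_meas w] by (rule integral_abs_bound)
    also have "\<dots> \<le> (\<integral>x. (w x)\<^sup>2 \<partial>lborel) + Cs\<^sup>2 * measure lborel (cball (0::'a) 2)"
      by (rule integrable_mult_supported(2)[OF w_meas w meas Cs(2)[OF \<tau>(1)] supp[OF _ \<tau>]])
    finally show ?thesis using M by (simp add: Q_def)
  qed
  have Q0: "0 \<le> Q" using Q[of 0 0] by linarith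
  have lim: "(\<lambda>j. second_difference (\<tau> j) u x) \<longlonglongrightarrow> mollify_laplacian n w x" for x
    unfolding u_def second_difference_mollify[OF w_meas w] mollify_laplacian_def
  proof (rule integral_dominated_convergence[where w = "\<lambda>y. \<bar>w y * (Cs * indicator (cball x 2) y)\<bar>"])
    have "integrable lborel (\<lambda>y. w y * (Cs * indicator (cball x 2) y))"
      by (rule integrable_mult_supported(1)[OF w_meas w, where C = Cs and c = x and R = 2])
         (use Cs(1) in \<open>auto simp: indicator_def split: if_splits\<close>)
    then show "integrable lborel (\<lambda>y. \<bar>w y * (Cs * indicator (cball x 2) y)\<bar>)" by (rule integrable_abs)
    show "AE y in lborel. (\<lambda>j. w y * second_difference (\<tau> j) (kernel n) (y - x)) \<longlonglongrightarrow> w y * laplacian (kernel n) (y - x)"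
    proof (intro AE_I2 tendsto_mult tendsto_const)
      fix y
      show "(\<lambda>j. second_difference (\<tau> j) (kernel n) (y - x)) \<longlonglongrightarrow> laplacian (kernel n) (y - x)"
        unfolding \<tau>_def
        by (rule filterlim_compose[OF second_difference_tendsto_laplacian[OF kernel_bump_span0] inverse_Suc_at_right_0])
    qed
    show "AE y in lborel. norm (w y * second_difference (\<tau> j) (kernel n) (y - x)) \<le> \<bar>w y * (Cs * indicator (cball x 2) y)\<bar>" for j
    proof (rule AE_I2)
      fix y
      have "\<bar>second_difference (\<tau> j) (kernel n) (y - x)\<bar> \<le> \<bar>Cs * indicator (cball x 2) y\<bar>"
      proof (cases "y \<in> cball x 2")
        case True then show ?thesis using Cs(2)[OF \<tau>(1), of j "y - x"] Cs(1) by simp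
      next
        case False then have "second_difference (\<tau> j) (kernel n) (y - x) = 0" using supp[OF _ \<tau>] by blast
        then show ?thesis by simp
      qed
      then show "norm (w y * second_difference (\<tau> j) (kernel n) (y - x)) \<le> \<bar>w y * (Cs * indicator (cball x 2) y)\<bar>"
        unfolding real_norm_def abs_mult by (intro mult_left_mono) (auto simp: abs_mult)
    qed
  qed measurable
  have dom: "\<bar>\<eta> x * (clamp_real k (u x) * second_difference (\<tau> j) u x)\<bar> \<le> C * (k * Q) * indicator (cball 0 R) x" for j x
  proof (cases "x \<in> cball 0 R")
    case True
    then show ?thesis unfolding abs_mult using \<eta>(1,2)[of x]
      by (auto intro!: mult_mono Q clamp_real_abs_le k mult_nonneg_nonneg Q0 C0)
  next
    case False then have "\<eta> x = 0" using \<eta>(3) by blast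
    then show ?thesis using C0 Q0 k by simp
  qed
  have i1: "integrable lborel (\<lambda>x. \<eta> x * (clamp_real k (u x) * second_difference (\<tau> j) u x))" for j
    by (rule integrable_bounded_supported[OF _ dom]) measurable
  have "(\<lambda>j. \<integral>x. \<eta> x * (clamp_real k (u x) * second_difference (\<tau> j) u x) \<partial>lborel)
      \<longlonglongrightarrow> (\<integral>x. \<eta> x * (clamp_real k (u x) * mollify_laplacian n w x) \<partial>lborel)"
  proof (rule integral_dominated_convergence[where w = "\<lambda>x. C * (k * Q) * indicator (cball 0 R) x"])
    show "integrable lborel (\<lambda>x. C * (k * Q) * indicator (cball (0::'a) R) x :: real)"
      by (rule integrable_bounded_supported[where C = "C * (k * Q)" and c = 0 and R = R])
         (use C0 Q0 k in \<open>auto simp: abs_mult\<close>)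
    show "AE x in lborel. norm (\<eta> x * (clamp_real k (u x) * second_difference (\<tau> j) u x)) \<le> C * (k * Q) * indicator (cball 0 R) x" for j
      using dom by (intro AE_I2) simp
  qed (use lim in \<open>auto intro!: AE_I2 tendsto_intros\<close>)
  moreover have "(\<integral>x. \<eta> x * (clamp_real k (u x) * second_difference (\<tau> j) u x) \<partial>lborel) \<le> B * M / 2" for j
  proof -
    have u2: "integrable lborel (\<lambda>x. (u x)\<^sup>2)" "(\<integral>x. (u x)\<^sup>2 \<partial>lborel) \<le> M"
      using mollify_square_le[OF w_meas w, of n] M by (auto simp: u_def)
    have Hu: "integrable lborel (\<lambda>x. huber k (u x))"
    proof (rule Bochner_Integration.integrable_bound[OF u2(1)])
      have "\<bar>huber k (u x)\<bar> \<le> (u x)\<^sup>2" for x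
        using huber_le[of k "u x"] huber_nonneg[OF k, of "u x"] zero_le_power2[of "u x"] by linarith
      then show "AE x in lborel. norm (huber k (u x)) \<le> norm ((u x)\<^sup>2)" by simp
    qed simp
    have \<eta>C: "\<bar>\<eta> x\<bar> \<le> C" for x using \<eta>(1,2)[of x] by simp
    note tr = second_difference_transfer[OF Hu \<eta>_meas \<eta>C]
    have "(\<integral>x. \<eta> x * (clamp_real k (u x) * second_difference (\<tau> j) u x) \<partial>lborel)
       \<le> (\<integral>x. \<eta> x * second_difference (\<tau> j) (\<lambda>x. huber k (u x)) x \<partial>lborel)"
      by (intro integral_mono i1 tr mult_left_mono second_difference_convex \<eta>(1) huber_convex k)
    also have "\<dots> = (\<integral>x. second_difference (\<tau> j) \<eta> x * huber k (u x) \<partial>lborel)" by (rule tr)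
    also have "\<dots> \<le> (\<integral>x. B * ((u x)\<^sup>2 / 2) \<partial>lborel)"
    proof (intro integral_mono tr)
      show "integrable lborel (\<lambda>x. B * ((u x)\<^sup>2 / 2))" using u2 by simp
      fix x
      have "second_difference (\<tau> j) \<eta> x * huber k (u x) \<le> B * huber k (u x)"
        using B[OF \<tau>(1), of j x] by (intro mult_right_mono huber_nonneg k) linarith
      also have "\<dots> \<le> B * ((u x)\<^sup>2 / 2)" by (intro mult_left_mono huber_le B0)
      finally show "second_difference (\<tau> j) \<eta> x * huber k (u x) \<le> B * ((u x)\<^sup>2 / 2)" .
    qed
    also have "\<dots> = B * (\<integral>x. (u x)\<^sup>2 \<partial>lborel) / 2" by simp
    also have "\<dots> \<le> B * M / 2" using u2(2) B0 by (simp add: mult_left_mono)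
    finally show ?thesis .
  qed
  ultimately show ?thesis
    unfolding u_def by (blast intro: LIMSEQ_le_const2)
qed

lemma nn_integral_cball_le:
  fixes w :: "'a::euclidean_space \<Rightarrow> real"
  assumes [measurable]: "w \<in> borel_measurable borel" and w: "integrable lborel (\<lambda>x. (w x)\<^sup>2)" "(\<integral>x. (w x)\<^sup>2 \<partial>lborel) \<le> M"
  shows "(\<integral>\<^sup>+x\<in>cball (0::'a) R. ennreal \<bar>w x\<bar> \<partial>lborel) \<le> ennreal M + emeasure lborel (cball (0::'a) R)"
proof -
  have "(\<integral>\<^sup>+x\<in>cball (0::'a) R. ennreal \<bar>w x\<bar> \<partial>lborel) \<le> (\<integral>\<^sup>+x. ennreal ((w x)\<^sup>2) + indicator (cball (0::'a) R) x \<partial>lborel)"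
  proof (rule nn_integral_mono)
    fix x
    have "ennreal \<bar>w x\<bar> \<le> ennreal ((w x)\<^sup>2) + 1"
      using abs_mult_le_squares[of "w x" 1] by (simp add: ennreal_leI flip: ennreal_1 ennreal_plus)
    then show "ennreal \<bar>w x\<bar> * indicator (cball (0::'a) R) x \<le> ennreal ((w x)\<^sup>2) + indicator (cball (0::'a) R) x"
      by (auto simp: indicator_def)
  qed
  also have "\<dots> = (\<integral>\<^sup>+x. ennreal ((w x)\<^sup>2) \<partial>lborel) + emeasure lborel (cball (0::'a) R)"
    by (subst nn_integral_add) auto
  also have "(\<integral>\<^sup>+x. ennreal ((w x)\<^sup>2) \<partial>lborel) = ennreal (\<integral>x. (w x)\<^sup>2 \<partial>lborel)"
    by (intro nn_integral_eq_integral w) simp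
  finally show ?thesis using w(2) by (meson add_right_mono ennreal_leI order_trans)
qed

definition slab_integrable :: "real \<Rightarrow> real \<Rightarrow> (real \<Rightarrow> 'a::euclidean_space \<Rightarrow> real) \<Rightarrow> bool" where
  "slab_integrable a b F \<longleftrightarrow> (\<lambda>(s, x). F s x) \<in> borel_measurable (lborel \<Otimes>\<^sub>M lborel) \<and>
     (\<forall>R. (\<integral>\<^sup>+s\<in>{a..b}. (\<integral>\<^sup>+x\<in>cball 0 R. ennreal \<bar>F s x\<bar> \<partial>lborel) \<partial>lborel) < \<infinity>)"

lemma slab_integrable_square:
  fixes F :: "real \<Rightarrow> 'a::euclidean_space \<Rightarrow> real"
  assumes F[measurable]: "(\<lambda>(s, x). F s x) \<in> borel_measurable (lborel \<Otimes>\<^sub>M lborel)"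
    and sq: "\<And>s. s \<in> {a..b} \<Longrightarrow> integrable lborel (\<lambda>x. (F s x)\<^sup>2)" "\<And>s. s \<in> {a..b} \<Longrightarrow> (\<integral>x. (F s x)\<^sup>2 \<partial>lborel) \<le> M"
  shows "slab_integrable a b F"
  unfolding slab_integrable_def
proof (intro conjI allI F)
  fix R
  have Fs: "F s \<in> borel_measurable borel" for s
    using measurable_compose[OF measurable_Pair1'[of s lborel lborel] F] by simp
  have "(\<integral>\<^sup>+s\<in>{a..b}. (\<integral>\<^sup>+x\<in>cball (0::'a) R. ennreal \<bar>F s x\<bar> \<partial>lborel) \<partial>lborel)
    \<le> (\<integral>\<^sup>+s. (ennreal M + emeasure lborel (cball (0::'a) R)) * indicator {a..b} s \<partial>lborel)"
    using nn_integral_cball_le[OF Fs sq] by (intro nn_integral_mono) (simp add: indicator_def)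
  also have "\<dots> = (ennreal M + emeasure lborel (cball (0::'a) R)) * emeasure lborel {a..b}"
    by (simp add: nn_integral_cmult)
  also have "\<dots> < \<infinity>"
    using emeasure_lborel_cball_finite[of "0::'a" R] by (simp add: ennreal_mult_less_top emeasure_lborel_Icc_eq)
  finally show "(\<integral>\<^sup>+s\<in>{a..b}. (\<integral>\<^sup>+x\<in>cball (0::'a) R. ennreal \<bar>F s x\<bar> \<partial>lborel) \<partial>lborel) < \<infinity>" .
qed

section \<open>The energy inequality for evolutions in the sense of distributions\<close>

text \<open>The heat equation \<open>\<partial>\<^sub>t V = \<Delta>V + G\<close> on
  \<open>{a..b}\<close> in the sense of distributions, integrated in time so that it makes a
  statement about \<open>V t\<close> for every \<open>t\<close>. \<open>M\<close> bounds the
  squared \<open>L\<^sup>2\<close> norm, and \<open>G\<close> is locally integrable. The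
  nonlinear term and all data will be part of \<open>G\<close>.\<close>

locale weak_evolution =
  fixes a b M :: real and V G :: "real \<Rightarrow> 'a::euclidean_space \<Rightarrow> real"
  assumes ab: "a \<le> b"
    and V_meas[measurable]: "(\<lambda>(s, x). V s x) \<in> borel_measurable (lborel \<Otimes>\<^sub>M lborel)"
    and G_meas[measurable]: "(\<lambda>(s, x). G s x) \<in> borel_measurable (lborel \<Otimes>\<^sub>M lborel)"
    and V_sq: "\<And>s. s \<in> {a..b} \<Longrightarrow> integrable lborel (\<lambda>x. (V s x)\<^sup>2)"
    and V_le: "\<And>s. s \<in> {a..b} \<Longrightarrow> (\<integral>x. (V s x)\<^sup>2 \<partial>lborel) \<le> M"
    and G_loc: "\<And>R. (\<integral>\<^sup>+s\<in>{a..b}. (\<integral>\<^sup>+x\<in>cball 0 R. ennreal \<bar>G s x\<bar> \<partial>lborel) \<partial>lborel) < \<infinity>"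
    and weak: "\<And>t \<phi>. t \<in> {a..b} \<Longrightarrow> test_function \<phi> \<Longrightarrow>
      (\<integral>x. V t x * \<phi> x \<partial>lborel) = (\<integral>x. V a x * \<phi> x \<partial>lborel) +
      (LINT s:{a..t}|lborel. (\<integral>x. V s x * laplacian \<phi> x \<partial>lborel) + (\<integral>x. G s x * \<phi> x \<partial>lborel))"
begin

lemma V_meas1[measurable]: "V s \<in> borel_measurable borel"
  using measurable_compose[OF measurable_Pair1'[of s lborel lborel] V_meas] by simp

lemma M_nonneg: "0 \<le> M"
proof -
  have "0 \<le> (\<integral>x. (V a x)\<^sup>2 \<partial>lborel)" by (rule Bochner_Integration.integral_nonneg) simp
  also have "\<dots> \<le> M" using ab by (intro V_le) auto
  finally show ?thesis .
qed

text \<open>The right side does not depend on \<open>x\<close>; it may be infinite for some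
  \<open>s\<close>, where the Bochner integral in \<open>mollify\<close> may take its default
  value 0, and the bound still holds.\<close>

lemma mollify_G_bound:
  assumes C: "\<And>z::'a. \<bar>kernel n z\<bar> \<le> C" and x: "x \<in> cball 0 R"
  shows "ennreal \<bar>mollify n (G s) x\<bar> \<le> ennreal C * (\<integral>\<^sup>+y\<in>cball 0 (R + 1). ennreal \<bar>G s y\<bar> \<partial>lborel)"
proof -
  have le: "ennreal \<bar>G s y * kernel n (y - x)\<bar> \<le> ennreal C * (ennreal \<bar>G s y\<bar> * indicator (cball 0 (R + 1)) y)" for y
  proof (cases "kernel n (y - x) = 0")
    case False
    from kernel_shift_support[OF this] have "y \<in> cball 0 (R + 1)"
      using x dist_triangle[of 0 y x] by auto
    moreover have "\<bar>G s y * kernel n (y - x)\<bar> \<le> C * \<bar>G s y\<bar>"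
      using mult_right_mono[OF C[of "y - x"], of "\<bar>G s y\<bar>"] by (simp add: abs_mult mult.commute)
    moreover have "0 \<le> C" using C[of 0] by linarith
    ultimately show ?thesis by (simp add: ennreal_mult'[symmetric] ennreal_leI)
  qed simp
  have "ennreal \<bar>mollify n (G s) x\<bar> \<le> (\<integral>\<^sup>+y. ennreal \<bar>G s y * kernel n (y - x)\<bar> \<partial>lborel)"
  proof (cases "integrable lborel (\<lambda>y. G s y * kernel n (y - x))")
    case True
    from integral_norm_bound_ennreal[OF this] show ?thesis by (simp add: mollify_def)
  next
    case False then show ?thesis by (simp add: mollify_def not_integrable_integral_eq)
  qed
  also have "\<dots> \<le> (\<integral>\<^sup>+y. ennreal C * (ennreal \<bar>G s y\<bar> * indicator (cball 0 (R + 1)) y) \<partial>lborel)"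
    by (intro nn_integral_mono le)
  also have "\<dots> = ennreal C * (\<integral>\<^sup>+y\<in>cball 0 (R + 1). ennreal \<bar>G s y\<bar> \<partial>lborel)"
    by (rule nn_integral_cmult) measurable
  finally show ?thesis .
qed

lemma mollify_laplacian_V_bound: "\<exists>K\<ge>0. \<forall>s\<in>{a..b}. \<forall>x. \<bar>mollify_laplacian n (V s) x\<bar> \<le> K"
proof -
  obtain C where C: "0 \<le> C" "\<And>z. \<bar>laplacian (kernel n) (z::'a)\<bar> \<le> C" using laplacian_kernel_bounded by blast
  have "\<bar>mollify_laplacian n (V s) x\<bar> \<le> M + C\<^sup>2 * measure lborel (cball (0::'a) 1)" if s: "s \<in> {a..b}" for s x
  proof -
    have meas: "(\<lambda>y. laplacian (kernel n) (y - x)) \<in> borel_measurable borel" by measurable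
    have "\<bar>mollify_laplacian n (V s) x\<bar> \<le> (\<integral>y. \<bar>V s y * laplacian (kernel n) (y - x)\<bar> \<partial>lborel)"
      unfolding mollify_laplacian_def by (rule integral_abs_bound)
    also have "\<dots> \<le> (\<integral>x. (V s x)\<^sup>2 \<partial>lborel) + C\<^sup>2 * measure lborel (cball (0::'a) 1)"
      by (rule integrable_mult_supported(2)[OF V_meas1 V_sq[OF s] meas C(2) laplacian_kernel_support])
    finally show ?thesis using V_le[OF s] by linarith
  qed
  then show ?thesis using M_nonneg by (intro exI[of _ "M + C\<^sup>2 * measure lborel (cball (0::'a) 1)"]) auto
qed

lemma mollify_G_integrable: "set_integrable lborel {a..b} (\<lambda>s. mollify n (G s) x)"
  unfolding set_integrable_def
proof (rule integrableI_bounded)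
  obtain C where C: "\<And>z::'a. \<bar>kernel n z\<bar> \<le> C" using kernel_bounded by blast
  have "(\<integral>\<^sup>+s. ennreal (norm (indicator {a..b} s *\<^sub>R mollify n (G s) x)) \<partial>lborel)
     \<le> (\<integral>\<^sup>+s. ennreal C * ((\<integral>\<^sup>+y\<in>cball 0 (norm x + 1). ennreal \<bar>G s y\<bar> \<partial>lborel) * indicator {a..b} s) \<partial>lborel)"
    using mollify_G_bound[OF C, of x "norm x"] by (intro nn_integral_mono) (auto simp: indicator_def)
  also have "\<dots> = ennreal C * (\<integral>\<^sup>+s\<in>{a..b}. (\<integral>\<^sup>+y\<in>cball 0 (norm x + 1). ennreal \<bar>G s y\<bar> \<partial>lborel) \<partial>lborel)"
    by (rule nn_integral_cmult) measurable
  also have "\<dots> < \<infinity>" using G_loc by (simp add: ennreal_mult_less_top)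
  finally show "(\<integral>\<^sup>+s. ennreal (norm (indicator {a..b} s *\<^sub>R mollify n (G s) x)) \<partial>lborel) < \<infinity>" .
qed measurable

lemma mollify_laplacian_V_integrable: "set_integrable lborel {a..b} (\<lambda>s. mollify_laplacian n (V s) x)"
proof -
  obtain K where K: "\<And>s x. s \<in> {a..b} \<Longrightarrow> \<bar>mollify_laplacian n (V s) x\<bar> \<le> K"
    using mollify_laplacian_V_bound by blast
  have "set_integrable lborel {a..b} (\<lambda>s. mollify_laplacian n (V s) x * 1)"
  proof (rule set_integrable_bounded_mult[OF _ _ _ K])
    show "set_integrable lborel {a..b} (\<lambda>s. 1 :: real)"
      by (rule borel_integrable_atLeastAtMost') simp
    show "set_borel_measurable lborel {a..b} (\<lambda>s. mollify_laplacian n (V s) x)"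
      unfolding set_borel_measurable_def by measurable
  qed auto
  then show ?thesis by simp
qed

text \<open>The equation tested with the kernel centred at \<open>x\<close>.\<close>

lemma mollify_evolution:
  assumes "t \<in> {a..b}"
  shows "mollify n (V t) x = mollify n (V a) x +
    (LINT s:{a..t}|lborel. mollify_laplacian n (V s) x + mollify n (G s) x)"
  unfolding mollify_def mollify_laplacian_def
  using weak[OF assms bump_span_test_function[OF kernel_bump_span[of n x]]]
  by (simp add: laplacian_translated_kernel)

lemma huber_mollify_evolution:
  assumes "0 \<le> k"
  shows "huber k (mollify n (V b) x) - huber k (mollify n (V a) x) \<le>
    (LINT s:{a..b}|lborel. clamp_real k (mollify n (V s) x) * (mollify_laplacian n (V s) x + mollify n (G s) x))"
  by (rule convex_chain_rule_le[OF ab _ mollify_evolution huber_convex[OF assms] clamp_real_continuous clamp_real_abs_le[OF assms]])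
     (intro set_integral_add(1) mollify_laplacian_V_integrable mollify_G_integrable)

text \<open>Localisation in space and time as one function on the product space, to which
  Fubini's theorem and convergence in \<open>L\<^sup>1\<close> apply.\<close>

definition window :: "('a \<Rightarrow> real) \<Rightarrow> (real \<Rightarrow> 'a \<Rightarrow> real) \<Rightarrow> real \<Rightarrow> 'a \<Rightarrow> real" where
  "window \<eta> F s x = indicator {a..b} s * (\<eta> x * F s x)"

lemma window_measurable[measurable]:
  assumes [measurable]: "(\<lambda>(s, x). F s x) \<in> borel_measurable (lborel \<Otimes>\<^sub>M lborel)" "\<eta> \<in> borel_measurable borel"
  shows "(\<lambda>(s, x). window \<eta> F s x) \<in> borel_measurable (lborel \<Otimes>\<^sub>M lborel)"
  unfolding window_def by measurable

lemma integrable_window: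
  assumes F: "(\<lambda>(s, x). F s x) \<in> borel_measurable (lborel \<Otimes>\<^sub>M lborel)" "\<eta> \<in> borel_measurable borel"
    and \<eta>: "\<And>x. 0 \<le> \<eta> x" "\<And>x. \<eta> x \<le> C" "\<And>x. \<eta> x \<noteq> 0 \<Longrightarrow> x \<in> cball 0 R"
    and fin: "(\<integral>\<^sup>+s\<in>{a..b}. (\<integral>\<^sup>+x\<in>cball 0 R. ennreal \<bar>F s x\<bar> \<partial>lborel) \<partial>lborel) < \<infinity>"
  shows "integrable (lborel \<Otimes>\<^sub>M lborel) (\<lambda>(s, x). window \<eta> F s x)"
    and "(\<integral>\<^sup>+p. ennreal (norm (case p of (s, x) \<Rightarrow> window \<eta> F s x)) \<partial>(lborel \<Otimes>\<^sub>M lborel))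
      \<le> ennreal C * (\<integral>\<^sup>+s\<in>{a..b}. (\<integral>\<^sup>+x\<in>cball 0 R. ennreal \<bar>F s x\<bar> \<partial>lborel) \<partial>lborel)"
proof -
  note [measurable] = F
  have C: "0 \<le> C" using \<eta>(1,2)[of 0] by linarith
  have le: "ennreal \<bar>window \<eta> F s x\<bar> \<le> ennreal C * ((ennreal \<bar>F s x\<bar> * indicator (cball 0 R) x) * indicator {a..b} s)" for s x
  proof (cases "s \<in> {a..b} \<and> x \<in> cball 0 R")
    case True
    have "\<bar>\<eta> x * F s x\<bar> \<le> C * \<bar>F s x\<bar>" unfolding abs_mult using \<eta>(1,2)[of x] by (intro mult_right_mono) auto
    then show ?thesis using True by (simp add: window_def ennreal_mult'[symmetric] ennreal_leI C)
  next
    case False then have "window \<eta> F s x = 0" using \<eta>(3)[of x] by (auto simp: window_def)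
    then show ?thesis by simp
  qed
  have "(\<integral>\<^sup>+p. ennreal (norm (case p of (s, x) \<Rightarrow> window \<eta> F s x)) \<partial>(lborel \<Otimes>\<^sub>M lborel))
     = (\<integral>\<^sup>+s. \<integral>\<^sup>+x. ennreal \<bar>window \<eta> F s x\<bar> \<partial>lborel \<partial>lborel)"
    by (subst lborel.nn_integral_fst[symmetric]) (auto simp: real_norm_def)
  also have "\<dots> \<le> (\<integral>\<^sup>+s. \<integral>\<^sup>+x. ennreal C * ((ennreal \<bar>F s x\<bar> * indicator (cball 0 R) x) * indicator {a..b} s) \<partial>lborel \<partial>lborel)"
    by (intro nn_integral_mono le)
  also have "\<dots> = ennreal C * (\<integral>\<^sup>+s\<in>{a..b}. (\<integral>\<^sup>+x\<in>cball 0 R. ennreal \<bar>F s x\<bar> \<partial>lborel) \<partial>lborel)"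
    by (simp add: nn_integral_cmult nn_integral_multc)
  finally show le: "(\<integral>\<^sup>+p. ennreal (norm (case p of (s, x) \<Rightarrow> window \<eta> F s x)) \<partial>(lborel \<Otimes>\<^sub>M lborel))
      \<le> ennreal C * (\<integral>\<^sup>+s\<in>{a..b}. (\<integral>\<^sup>+x\<in>cball 0 R. ennreal \<bar>F s x\<bar> \<partial>lborel) \<partial>lborel)" .
  show "integrable (lborel \<Otimes>\<^sub>M lborel) (\<lambda>(s, x). window \<eta> F s x)"
  proof (rule integrableI_bounded)
    have "ennreal C * (\<integral>\<^sup>+s\<in>{a..b}. (\<integral>\<^sup>+x\<in>cball 0 R. ennreal \<bar>F s x\<bar> \<partial>lborel) \<partial>lborel) < \<infinity>"
      using fin by (simp add: ennreal_mult_less_top)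
    then show "(\<integral>\<^sup>+p. ennreal (norm (case p of (s, x) \<Rightarrow> window \<eta> F s x)) \<partial>(lborel \<Otimes>\<^sub>M lborel)) < \<infinity>"
      using le by (rule le_less_trans[rotated])
  qed measurable
qed

lemma bounded_window_finite:
  assumes "\<And>s x. s \<in> {a..b} \<Longrightarrow> \<bar>F s x\<bar> \<le> K"
  shows "(\<integral>\<^sup>+s\<in>{a..b}. (\<integral>\<^sup>+x\<in>cball (0::'a) R. ennreal \<bar>F s x\<bar> \<partial>lborel) \<partial>lborel) < \<infinity>"
proof -
  have "(\<integral>\<^sup>+x\<in>cball (0::'a) R. ennreal \<bar>F s x\<bar> \<partial>lborel) \<le> ennreal K * emeasure lborel (cball (0::'a) R)"
    if "s \<in> {a..b}" for s
  proof -
    have "(\<integral>\<^sup>+x\<in>cball (0::'a) R. ennreal \<bar>F s x\<bar> \<partial>lborel) \<le> (\<integral>\<^sup>+x. ennreal K * indicator (cball (0::'a) R) x \<partial>lborel)"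
      by (intro nn_integral_mono mult_right_mono ennreal_leI assms that) simp
    then show ?thesis by (simp add: nn_integral_cmult)
  qed
  then have "(\<integral>\<^sup>+s\<in>{a..b}. (\<integral>\<^sup>+x\<in>cball (0::'a) R. ennreal \<bar>F s x\<bar> \<partial>lborel) \<partial>lborel)
    \<le> (\<integral>\<^sup>+s. (ennreal K * emeasure lborel (cball (0::'a) R)) * indicator {a..b} s \<partial>lborel)"
    by (intro nn_integral_mono) (simp add: indicator_def)
  also have "\<dots> = ennreal K * emeasure lborel (cball (0::'a) R) * emeasure lborel {a..b}"
    by (simp add: nn_integral_cmult)
  also have "\<dots> < \<infinity>"
    using emeasure_lborel_cball_finite[of "0::'a" R] ab by (simp add: ennreal_mult_less_top)
  finally show ?thesis .
qed

lemma nn_integral_window_mono: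
  assumes "\<And>s x. s \<in> {a..b} \<Longrightarrow> x \<in> cball 0 R \<Longrightarrow> ennreal \<bar>F s x\<bar> \<le> H s x"
  shows "(\<integral>\<^sup>+s\<in>{a..b}. (\<integral>\<^sup>+x\<in>cball (0::'a) R. ennreal \<bar>F s x\<bar> \<partial>lborel) \<partial>lborel)
    \<le> (\<integral>\<^sup>+s\<in>{a..b}. (\<integral>\<^sup>+x\<in>cball (0::'a) R. H s x \<partial>lborel) \<partial>lborel)"
proof (rule nn_integral_mono)
  fix s
  show "(\<integral>\<^sup>+x\<in>cball (0::'a) R. ennreal \<bar>F s x\<bar> \<partial>lborel) * indicator {a..b} s
    \<le> (\<integral>\<^sup>+x\<in>cball (0::'a) R. H s x \<partial>lborel) * indicator {a..b} s"
  proof (cases "s \<in> {a..b}")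
    case True
    then show ?thesis
      using assms[OF True] by (intro mult_right_mono[OF nn_integral_mono]) (auto simp: indicator_def)
  qed simp
qed

lemma mollify_G_window_finite:
  assumes "0 \<le> k"
  shows "(\<integral>\<^sup>+s\<in>{a..b}. (\<integral>\<^sup>+x\<in>cball (0::'a) R. ennreal \<bar>clamp_real k (W s x) * mollify n (G s) x\<bar> \<partial>lborel) \<partial>lborel) < \<infinity>"
proof -
  obtain C where C: "\<And>z::'a. \<bar>kernel n z\<bar> \<le> C" using kernel_bounded by blast
  define g where "g s = (\<integral>\<^sup>+y\<in>cball (0::'a) (R + 1). ennreal \<bar>G s y\<bar> \<partial>lborel)" for s
  have g_meas[measurable]: "g \<in> borel_measurable lborel" unfolding g_def by measurable
  have "(\<integral>\<^sup>+s\<in>{a..b}. (\<integral>\<^sup>+x\<in>cball (0::'a) R. ennreal \<bar>clamp_real k (W s x) * mollify n (G s) x\<bar> \<partial>lborel) \<partial>lborel)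
    \<le> (\<integral>\<^sup>+s\<in>{a..b}. (\<integral>\<^sup>+x\<in>cball (0::'a) R. ennreal k * (ennreal C * g s) \<partial>lborel) \<partial>lborel)"
  proof (rule nn_integral_window_mono)
    fix s and x :: 'a assume "x \<in> cball 0 R"
    then have "ennreal \<bar>mollify n (G s) x\<bar> \<le> ennreal C * g s"
      unfolding g_def by (rule mollify_G_bound[OF C])
    moreover have "ennreal \<bar>clamp_real k (W s x)\<bar> \<le> ennreal k"
      by (intro ennreal_leI clamp_real_abs_le assms)
    ultimately have "ennreal \<bar>clamp_real k (W s x)\<bar> * ennreal \<bar>mollify n (G s) x\<bar> \<le> ennreal k * (ennreal C * g s)"
      by (intro mult_mono) auto
    then show "ennreal \<bar>clamp_real k (W s x) * mollify n (G s) x\<bar> \<le> ennreal k * (ennreal C * g s)"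
      unfolding abs_mult by (simp add: ennreal_mult')
  qed
  also have "\<dots> = (\<integral>\<^sup>+s. (ennreal k * ennreal C * emeasure lborel (cball (0::'a) R)) * (g s * indicator {a..b} s) \<partial>lborel)"
    by (simp add: nn_integral_cmult mult_ac)
  also have "\<dots> = (ennreal k * ennreal C * emeasure lborel (cball (0::'a) R)) * (\<integral>\<^sup>+s\<in>{a..b}. g s \<partial>lborel)"
    by (rule nn_integral_cmult) measurable
  also have "\<dots> < \<infinity>"
    using emeasure_lborel_cball_finite[of "0::'a" R] G_loc[of "R + 1"] by (simp add: ennreal_mult_less_top g_def)
  finally show ?thesis .
qed

lemma huber_integrable:
  assumes "u \<in> borel_measurable borel" "integrable lborel (\<lambda>x. (u x)\<^sup>2)" "0 \<le> k"
    and "\<eta> \<in> borel_measurable borel" "\<And>x. 0 \<le> \<eta> x" "\<And>x. \<eta> x \<le> C"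
  shows "integrable lborel (\<lambda>x::'a. \<eta> x * huber k (u x))"
proof (rule Bochner_Integration.integrable_bound)
  note [measurable] = assms(1,4)
  show "integrable lborel (\<lambda>x. C * (u x)\<^sup>2)" using assms(2) by simp
  have "\<bar>\<eta> x * huber k (u x)\<bar> \<le> \<bar>C * (u x)\<^sup>2\<bar>" for x
  proof -
    have "\<bar>huber k (u x)\<bar> \<le> (u x)\<^sup>2"
      using huber_le[of k "u x"] huber_nonneg[OF assms(3), of "u x"] zero_le_power2[of "u x"] by linarith
    then have "\<bar>\<eta> x\<bar> * \<bar>huber k (u x)\<bar> \<le> \<bar>C\<bar> * (u x)\<^sup>2"
      using assms(5,6)[of x] by (intro mult_mono) auto
    then show ?thesis by (simp add: abs_mult)
  qed
  then show "AE x in lborel. norm (\<eta> x * huber k (u x)) \<le> norm (C * (u x)\<^sup>2)" by simp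
  show "(\<lambda>x. \<eta> x * huber k (u x)) \<in> borel_measurable lborel" by measurable
qed

text \<open>Integrate \<open>huber_mollify_evolution\<close> against \<open>\<eta>\<close>; at
  each time the term with the Laplacian is bounded by
  \<open>mollify_laplacian_dissipative\<close>.\<close>

lemma regularised_energy:
  assumes \<eta>_meas[measurable]: "\<eta> \<in> borel_measurable borel"
    and \<eta>: "\<And>x. 0 \<le> \<eta> x" "\<And>x. \<eta> x \<le> C" "\<And>x. \<eta> x \<noteq> 0 \<Longrightarrow> x \<in> cball 0 R"
    and B: "\<And>\<tau> x. 0 < \<tau> \<Longrightarrow> \<bar>second_difference \<tau> \<eta> x\<bar> \<le> B" and k: "0 \<le> k"
  shows "(\<integral>x. \<eta> x * huber k (mollify n (V b) x) \<partial>lborel) \<le>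
    (\<integral>x. \<eta> x * huber k (mollify n (V a) x) \<partial>lborel) + (b - a) * (B * M / 2) +
    (\<integral>p. (case p of (s, x) \<Rightarrow> window \<eta> (\<lambda>s x. clamp_real k (mollify n (V s) x) * mollify n (G s) x) s x) \<partial>(lborel \<Otimes>\<^sub>M lborel))"
proof -
  define L where "L s x = clamp_real k (mollify n (V s) x) * mollify_laplacian n (V s) x" for s and x :: 'a
  define g where "g s x = clamp_real k (mollify n (V s) x) * mollify n (G s) x" for s and x :: 'a
  have [measurable]: "(\<lambda>(s, x). L s x) \<in> borel_measurable (lborel \<Otimes>\<^sub>M lborel)" unfolding L_def by measurable
  have [measurable]: "(\<lambda>(s, x). g s x) \<in> borel_measurable (lborel \<Otimes>\<^sub>M lborel)" unfolding g_def by measurable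
  obtain K where K: "0 \<le> K" "\<And>s x. s \<in> {a..b} \<Longrightarrow> \<bar>mollify_laplacian n (V s) x\<bar> \<le> K"
    using mollify_laplacian_V_bound by blast
  have "\<bar>L s x\<bar> \<le> k * K" if "s \<in> {a..b}" for s x
    unfolding L_def abs_mult by (intro mult_mono clamp_real_abs_le k K(2) that) simp_all
  then have finL: "(\<integral>\<^sup>+s\<in>{a..b}. (\<integral>\<^sup>+x\<in>cball 0 R. ennreal \<bar>L s x\<bar> \<partial>lborel) \<partial>lborel) < \<infinity>"
    by (rule bounded_window_finite)
  have fing: "(\<integral>\<^sup>+s\<in>{a..b}. (\<integral>\<^sup>+x\<in>cball 0 R. ennreal \<bar>g s x\<bar> \<partial>lborel) \<partial>lborel) < \<infinity>"
    unfolding g_def by (rule mollify_G_window_finite[OF k])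
  have iL: "integrable (lborel \<Otimes>\<^sub>M lborel) (\<lambda>(s, x). window \<eta> L s x)"
    by (rule integrable_window(1)[OF _ _ \<eta> finL]) measurable
  have ig: "integrable (lborel \<Otimes>\<^sub>M lborel) (\<lambda>(s, x). window \<eta> g s x)"
    by (rule integrable_window(1)[OF _ _ \<eta> fing]) measurable
  have isum: "integrable (lborel \<Otimes>\<^sub>M lborel) (\<lambda>(s, x). window \<eta> L s x + window \<eta> g s x)"
    using Bochner_Integration.integrable_add[OF iL ig] by (simp add: case_prod_unfold)
  have eq: "\<eta> x * (LINT s:{a..b}|lborel. clamp_real k (mollify n (V s) x) * (mollify_laplacian n (V s) x + mollify n (G s) x))
     = (\<integral>s. window \<eta> L s x + window \<eta> g s x \<partial>lborel)" for x
  proof -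
    have "(\<integral>s. window \<eta> L s x + window \<eta> g s x \<partial>lborel) =
      (\<integral>s. \<eta> x * (indicator {a..b} s * (clamp_real k (mollify n (V s) x) * (mollify_laplacian n (V s) x + mollify n (G s) x))) \<partial>lborel)"
      by (intro Bochner_Integration.integral_cong) (auto simp: window_def L_def g_def algebra_simps)
    then show ?thesis by (simp add: set_lebesgue_integral_def)
  qed
  have sq: "integrable lborel (\<lambda>x. (mollify n (V t) x)\<^sup>2)" if "t \<in> {a..b}" for t
    by (rule mollify_square_le(1)[OF V_meas1 V_sq[OF that]])
  have iH: "integrable lborel (\<lambda>x. \<eta> x * huber k (mollify n (V t) x))" if "t \<in> {a..b}" for t
    by (rule huber_integrable[OF _ sq[OF that] k \<eta>_meas \<eta>(1,2)]) measurable
  have "(\<integral>x. \<eta> x * huber k (mollify n (V b) x) \<partial>lborel) - (\<integral>x. \<eta> x * huber k (mollify n (V a) x) \<partial>lborel)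
    = (\<integral>x. \<eta> x * (huber k (mollify n (V b) x) - huber k (mollify n (V a) x)) \<partial>lborel)"
    using iH[of a] iH[of b] ab by (simp add: right_diff_distrib)
  also have "\<dots> \<le> (\<integral>x. (\<integral>s. window \<eta> L s x + window \<eta> g s x \<partial>lborel) \<partial>lborel)"
  proof (rule integral_mono)
    show "integrable lborel (\<lambda>x. \<eta> x * (huber k (mollify n (V b) x) - huber k (mollify n (V a) x)))"
      using iH[of a] iH[of b] ab by (simp add: right_diff_distrib)
    show "integrable lborel (\<lambda>x. \<integral>s. window \<eta> L s x + window \<eta> g s x \<partial>lborel)"
      by (rule lborel_pair.integrable_snd[OF isum])
    show "\<eta> x * (huber k (mollify n (V b) x) - huber k (mollify n (V a) x)) \<le> (\<integral>s. window \<eta> L s x + window \<eta> g s x \<partial>lborel)" for x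
      unfolding eq[symmetric] by (intro mult_left_mono huber_mollify_evolution k \<eta>(1))
  qed
  also have "\<dots> = (\<integral>p. (case p of (s, x) \<Rightarrow> window \<eta> L s x + window \<eta> g s x) \<partial>(lborel \<Otimes>\<^sub>M lborel))"
    by (rule lborel_pair.integral_snd[OF isum])
  also have "\<dots> = (\<integral>p. (case p of (s, x) \<Rightarrow> window \<eta> L s x) \<partial>(lborel \<Otimes>\<^sub>M lborel))
      + (\<integral>p. (case p of (s, x) \<Rightarrow> window \<eta> g s x) \<partial>(lborel \<Otimes>\<^sub>M lborel))"
    using Bochner_Integration.integral_add[OF iL ig] by (simp add: case_prod_unfold)
  also have "(\<integral>p. (case p of (s, x) \<Rightarrow> window \<eta> L s x) \<partial>(lborel \<Otimes>\<^sub>M lborel)) = (\<integral>s. (\<integral>x. window \<eta> L s x \<partial>lborel) \<partial>lborel)"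
    by (rule lborel_pair.integral_fst[OF iL, symmetric])
  also have "\<dots> \<le> (\<integral>s. indicator {a..b} s * (B * M / 2) \<partial>lborel)"
  proof (rule integral_mono)
    show "integrable lborel (\<lambda>s. \<integral>x. window \<eta> L s x \<partial>lborel)"
      by (rule lborel_pair.integrable_fst[OF iL])
    show "integrable lborel (\<lambda>s. indicator {a..b} s * (B * M / 2))"
      using ab by (intro integrable_mult_left integrable_real_indicator) (auto simp: emeasure_lborel_Icc_eq)
    fix s
    show "(\<integral>x. window \<eta> L s x \<partial>lborel) \<le> indicator {a..b} s * (B * M / 2)"
    proof (cases "s \<in> {a..b}")
      case True
      then show ?thesis
        using mollify_laplacian_dissipative[OF V_meas1 V_sq[OF True] V_le[OF True] \<eta>_meas \<eta> B k, of n]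
        by (simp add: window_def L_def)
    qed (simp add: window_def)
  qed
  also have "\<dots> = (b - a) * (B * M / 2)" using ab by simp
  finally show ?thesis unfolding g_def by simp
qed

end

text \<open>The kernel is supported in the unit ball, so on \<open>cball 0 R\<close> the
  mollification only sees \<open>cball 0 (R + 1)\<close>.\<close>

lemma mollify_local_error:
  fixes w :: "'a::euclidean_space \<Rightarrow> real"
  assumes w[measurable]: "w \<in> borel_measurable borel"
    and fin: "(\<integral>\<^sup>+x\<in>cball 0 (R + 1). ennreal \<bar>w x\<bar> \<partial>lborel) < \<infinity>"
  shows "(\<integral>\<^sup>+x\<in>cball 0 R. ennreal \<bar>mollify n w x - w x\<bar> \<partial>lborel) \<le> osc n (\<lambda>x. indicator (cball 0 (R + 1)) x * w x)"
    and "integrable lborel (\<lambda>x. indicator (cball 0 (R + 1)) x * w x)"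
proof -
  define W where "W x = indicator (cball 0 (R + 1)) x * w x" for x
  have [measurable]: "W \<in> borel_measurable borel" unfolding W_def by measurable
  have nnW: "(\<integral>\<^sup>+x. ennreal \<bar>W x\<bar> \<partial>lborel) = (\<integral>\<^sup>+x\<in>cball 0 (R + 1). ennreal \<bar>w x\<bar> \<partial>lborel)"
    by (intro nn_integral_cong) (auto simp: W_def indicator_def)
  have iW: "integrable lborel W"
    using fin by (intro integrableI_bounded) (simp_all add: nnW)
  then show "integrable lborel (\<lambda>x. indicator (cball 0 (R + 1)) x * w x)" by (simp add: W_def[abs_def])
  obtain C where C: "0 \<le> C" "\<And>z::'a. \<bar>kernel n z\<bar> \<le> C" using kernel_bounded by blast
  have point: "ennreal \<bar>mollify n w x - w x\<bar> \<le> (\<integral>\<^sup>+y. ennreal \<bar>W y - W x\<bar> * kernel n (y - x) \<partial>lborel)"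
    if x: "x \<in> cball 0 R" for x
  proof -
    have i1: "integrable lborel (\<lambda>y. W y * kernel n (y - x))"
    proof (rule Bochner_Integration.integrable_bound)
      show "integrable lborel (\<lambda>y. C * W y)" using iW by simp
      have "\<bar>W y * kernel n (y - x)\<bar> \<le> \<bar>C * W y\<bar>" for y
        unfolding abs_mult using mult_right_mono[OF C(2)[of "y - x"], of "\<bar>W y\<bar>"] C(1) by (simp add: mult.commute)
      then show "AE y in lborel. norm (W y * kernel n (y - x)) \<le> norm (C * W y)" by simp
    qed simp
    have i2: "integrable lborel (\<lambda>y. kernel n (y - x))"
      by (rule bump_span_integrable[OF kernel_bump_span])
    have k1: "(\<integral>y. kernel n (y - x) \<partial>lborel) = 1"
      using nn_integral_kernel_shift(1)[of n x] nn_integral_eq_integral[OF i2 AE_I2[OF kernel_nonneg]]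
      by simp
    have Wx: "W x = w x" using x by (auto simp: W_def)
    have "mollify n w x = (\<integral>y. W y * kernel n (y - x) \<partial>lborel)"
      unfolding mollify_def
    proof (rule Bochner_Integration.integral_cong[OF refl])
      fix y
      show "w y * kernel n (y - x) = W y * kernel n (y - x)"
      proof (cases "kernel n (y - x) = 0")
        case False
        from kernel_shift_support[OF this] have "y \<in> cball 0 (R + 1)"
          using x dist_triangle[of 0 y x] by auto
        then show ?thesis by (simp add: W_def)
      qed simp
    qed
    then have "mollify n w x - w x = (\<integral>y. W y * kernel n (y - x) - W x * kernel n (y - x) \<partial>lborel)"
      using i1 i2 by (simp add: k1 Wx)
    also have "\<dots> = (\<integral>y. (W y - W x) * kernel n (y - x) \<partial>lborel)" by (simp add: left_diff_distrib)
    finally have "ennreal \<bar>mollify n w x - w x\<bar> \<le> (\<integral>\<^sup>+y. ennreal (norm ((W y - W x) * kernel n (y - x))) \<partial>lborel)"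
      using integral_norm_bound_ennreal[of lborel "\<lambda>y. (W y - W x) * kernel n (y - x)"] i1 i2
      by (simp add: left_diff_distrib)
    also have "\<dots> = (\<integral>\<^sup>+y. ennreal \<bar>W y - W x\<bar> * kernel n (y - x) \<partial>lborel)"
      by (simp add: abs_mult kernel_nonneg ennreal_mult')
    finally show ?thesis .
  qed
  have "(\<integral>\<^sup>+x\<in>cball 0 R. ennreal \<bar>mollify n w x - w x\<bar> \<partial>lborel) \<le> osc n W"
    unfolding osc_def
  proof (rule nn_integral_mono)
    fix x
    show "ennreal \<bar>mollify n w x - w x\<bar> * indicator (cball 0 R) x \<le> (\<integral>\<^sup>+y. ennreal \<bar>W y - W x\<bar> * kernel n (y - x) \<partial>lborel)"
      using point[of x] by (cases "x \<in> cball 0 R") simp_all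
  qed
  then show "(\<integral>\<^sup>+x\<in>cball 0 R. ennreal \<bar>mollify n w x - w x\<bar> \<partial>lborel) \<le> osc n (\<lambda>x. indicator (cball 0 (R + 1)) x * w x)"
    by (simp add: W_def[abs_def])
qed

lemma mollify_tendsto_local:
  fixes w :: "'a::euclidean_space \<Rightarrow> real"
  assumes w[measurable]: "w \<in> borel_measurable borel"
    and fin: "(\<integral>\<^sup>+x\<in>cball 0 (R + 1). ennreal \<bar>w x\<bar> \<partial>lborel) < \<infinity>"
  shows "(\<lambda>n. \<integral>\<^sup>+x\<in>cball 0 R. ennreal \<bar>mollify n w x - w x\<bar> \<partial>lborel) \<longlonglongrightarrow> 0"
  by (rule tendsto_sandwich[OF _ _ tendsto_const osc_tendsto_0[OF mollify_local_error(2)[OF w fin]]])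
     (simp_all add: mollify_local_error(1)[OF w fin])

text \<open>Convergence holds at almost every time by \<open>mollify_tendsto_local\<close>,
  and twice the \<open>L\<^sup>1\<close> norm over the larger ball is a majorant.\<close>

lemma mollify_tendsto_space_time:
  fixes F :: "real \<Rightarrow> 'a::euclidean_space \<Rightarrow> real"
  assumes F[measurable]: "(\<lambda>(s, x). F s x) \<in> borel_measurable (lborel \<Otimes>\<^sub>M lborel)"
    and fin: "(\<integral>\<^sup>+s\<in>{a..b}. (\<integral>\<^sup>+x\<in>cball 0 (R + 1). ennreal \<bar>F s x\<bar> \<partial>lborel) \<partial>lborel) < \<infinity>"
  shows "(\<lambda>n. \<integral>\<^sup>+s\<in>{a..b}. (\<integral>\<^sup>+x\<in>cball 0 R. ennreal \<bar>mollify n (F s) x - F s x\<bar> \<partial>lborel) \<partial>lborel) \<longlonglongrightarrow> 0"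
proof -
  have Fs[measurable]: "F s \<in> borel_measurable borel" for s
    using measurable_compose[OF measurable_Pair1'[of s lborel lborel] F] by simp
  define E where "E n s = (\<integral>\<^sup>+x\<in>cball 0 R. ennreal \<bar>mollify n (F s) x - F s x\<bar> \<partial>lborel) * indicator {a..b} s" for n s
  define \<phi> where "\<phi> s = (\<integral>\<^sup>+x\<in>cball 0 (R + 1). ennreal \<bar>F s x\<bar> \<partial>lborel)" for s
  have [measurable]: "\<phi> \<in> borel_measurable lborel" unfolding \<phi>_def by measurable
  have [measurable]: "E n \<in> borel_measurable lborel" for n unfolding E_def by measurable
  have E_le: "E n s \<le> 2 * (\<phi> s * indicator {a..b} s)" for n s
  proof (cases "s \<in> {a..b} \<and> \<phi> s < \<infinity>")
    case True
    have "E n s \<le> osc n (\<lambda>x. indicator (cball 0 (R + 1)) x * F s x)"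
      using mollify_local_error(1)[OF Fs[of s], where R = R and n = n] True by (simp add: E_def \<phi>_def)
    also have "\<dots> \<le> 2 * (\<integral>\<^sup>+x. ennreal \<bar>indicator (cball 0 (R + 1)) x * F s x\<bar> \<partial>lborel)"
      by (intro osc_le) measurable
    also have "(\<integral>\<^sup>+x. ennreal \<bar>indicator (cball 0 (R + 1)) x * F s x\<bar> \<partial>lborel) = \<phi> s"
      unfolding \<phi>_def by (intro nn_integral_cong) (auto simp: indicator_def)
    finally show ?thesis using True by simp
  next
    case False then show ?thesis
      by (cases "s \<in> {a..b}") (auto simp: E_def less_top[symmetric] ennreal_mult_top)
  qed
  have fin\<phi>: "(\<integral>\<^sup>+s. \<phi> s * indicator {a..b} s \<partial>lborel) < \<infinity>" using fin by (simp add: \<phi>_def)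
  have "AE s in lborel. \<phi> s * indicator {a..b} s \<noteq> \<infinity>"
    by (rule nn_integral_PInf_AE) (use fin\<phi> in auto)
  then have lim: "AE s in lborel. (\<lambda>n. E n s) \<longlonglongrightarrow> 0"
  proof eventually_elim
    case (elim s)
    show ?case
    proof (cases "s \<in> {a..b}")
      case True
      then have "\<phi> s < \<infinity>" using elim by (simp add: less_top)
      from mollify_tendsto_local[OF Fs this[unfolded \<phi>_def]] show ?thesis
        using True by (simp add: E_def)
    qed (simp add: E_def)
  qed
  have "(\<lambda>n. \<integral>\<^sup>+s. E n s \<partial>lborel) \<longlonglongrightarrow> (\<integral>\<^sup>+s. 0 \<partial>(lborel::real measure))"
  proof (rule nn_integral_dominated_convergence[where w = "\<lambda>s. 2 * (\<phi> s * indicator {a..b} s)"])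
    show "(\<integral>\<^sup>+s. 2 * (\<phi> s * indicator {a..b} s) \<partial>lborel) < \<infinity>"
      using fin\<phi> by (subst nn_integral_cmult) (auto simp: ennreal_mult_less_top)
  qed (use E_le lim in auto)
  then show ?thesis by (simp add: E_def)
qed

context weak_evolution
begin

lemma slab_V: "slab_integrable a b V"
  by (rule slab_integrable_square[OF V_meas V_sq V_le])

lemma slab_G: "slab_integrable a b G"
  unfolding slab_integrable_def using G_meas G_loc by blast

lemma V_window_finite:
  "(\<integral>\<^sup>+s\<in>{a..b}. (\<integral>\<^sup>+x\<in>cball (0::'a) R. ennreal \<bar>V s x\<bar> \<partial>lborel) \<partial>lborel) < \<infinity>"
  using slab_V unfolding slab_integrable_def by blast

lemma V_local_finite:
  assumes "t \<in> {a..b}" shows "(\<integral>\<^sup>+x\<in>cball (0::'a) R. ennreal \<bar>V t x\<bar> \<partial>lborel) < \<infinity>"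
proof (rule le_less_trans[OF nn_integral_cball_le[OF V_meas1 V_sq[OF assms] V_le[OF assms]]])
  show "ennreal M + emeasure lborel (cball (0::'a) R) < \<infinity>"
    using emeasure_lborel_cball_finite[of "0::'a" R] by simp
qed

text \<open>The Huber function is Lipschitz, so convergence in \<open>L\<^sup>1\<close> on
  balls is enough.\<close>

lemma huber_mollify_tendsto:
  assumes t: "t \<in> {a..b}" and k: "0 \<le> k"
    and \<eta>_meas[measurable]: "\<eta> \<in> borel_measurable borel"
    and \<eta>: "\<And>x. 0 \<le> \<eta> x" "\<And>x. \<eta> x \<le> C" "\<And>x. \<eta> x \<noteq> 0 \<Longrightarrow> x \<in> cball 0 R"
  shows "(\<lambda>n. \<integral>x. \<eta> x * huber k (mollify n (V t) x) \<partial>lborel) \<longlonglongrightarrow> (\<integral>x. \<eta> x * huber k (V t x) \<partial>lborel)"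
proof (rule tendsto_L1_int)
  have C: "0 \<le> C" using \<eta>(1,2)[of 0] by linarith
  show "integrable lborel (\<lambda>x. \<eta> x * huber k (mollify n (V t) x))" for n
    by (rule huber_integrable[OF _ mollify_square_le(1)[OF V_meas1 V_sq[OF t]] k \<eta>_meas \<eta>(1,2)]) measurable
  show "integrable lborel (\<lambda>x. \<eta> x * huber k (V t x))"
    by (rule huber_integrable[OF V_meas1 V_sq[OF t] k \<eta>_meas \<eta>(1,2)])
  have lim: "(\<lambda>n. \<integral>\<^sup>+x\<in>cball 0 R. ennreal \<bar>mollify n (V t) x - V t x\<bar> \<partial>lborel) \<longlonglongrightarrow> 0"
    by (rule mollify_tendsto_local[OF V_meas1 V_local_finite[OF t]])
  have "(\<lambda>n. ennreal (C * k) * (\<integral>\<^sup>+x\<in>cball 0 R. ennreal \<bar>mollify n (V t) x - V t x\<bar> \<partial>lborel)) \<longlonglongrightarrow> ennreal (C * k) * 0"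
    by (intro ennreal_tendsto_cmult lim) simp
  then have lim': "(\<lambda>n. ennreal (C * k) * (\<integral>\<^sup>+x\<in>cball 0 R. ennreal \<bar>mollify n (V t) x - V t x\<bar> \<partial>lborel)) \<longlonglongrightarrow> 0"
    by simp
  have le: "(\<integral>\<^sup>+x. norm (\<eta> x * huber k (mollify n (V t) x) - \<eta> x * huber k (V t x)) \<partial>lborel)
    \<le> ennreal (C * k) * (\<integral>\<^sup>+x\<in>cball 0 R. ennreal \<bar>mollify n (V t) x - V t x\<bar> \<partial>lborel)" for n
  proof -
    have "(\<integral>\<^sup>+x. norm (\<eta> x * huber k (mollify n (V t) x) - \<eta> x * huber k (V t x)) \<partial>lborel)
     \<le> (\<integral>\<^sup>+x. ennreal (C * k) * (ennreal \<bar>mollify n (V t) x - V t x\<bar> * indicator (cball 0 R) x) \<partial>lborel)"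
    proof (rule nn_integral_mono)
      fix x
      show "ennreal (norm (\<eta> x * huber k (mollify n (V t) x) - \<eta> x * huber k (V t x)))
        \<le> ennreal (C * k) * (ennreal \<bar>mollify n (V t) x - V t x\<bar> * indicator (cball 0 R) x)"
      proof (cases "x \<in> cball 0 R")
        case True
        have "\<bar>\<eta> x\<bar> * \<bar>huber k (mollify n (V t) x) - huber k (V t x)\<bar> \<le> C * (k * \<bar>mollify n (V t) x - V t x\<bar>)"
          using \<eta>(1,2)[of x] C by (intro mult_mono huber_lipschitz k) auto
        then show ?thesis using True C k
          by (simp add: right_diff_distrib[symmetric] abs_mult ennreal_mult[symmetric] ennreal_leI mult.assoc)
      next
        case False then have "\<eta> x = 0" using \<eta>(3) by blast
        then show ?thesis by simp
      qed
    qed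
    also have "\<dots> = ennreal (C * k) * (\<integral>\<^sup>+x\<in>cball 0 R. ennreal \<bar>mollify n (V t) x - V t x\<bar> \<partial>lborel)"
      by (rule nn_integral_cmult) measurable
    finally show ?thesis .
  qed
  show "(\<lambda>n. \<integral>\<^sup>+x. norm (\<eta> x * huber k (mollify n (V t) x) - \<eta> x * huber k (V t x)) \<partial>lborel) \<longlonglongrightarrow> 0"
    by (rule tendsto_sandwich[OF _ always_eventually[OF allI[OF le]] tendsto_const lim']) simp
qed

text \<open>A product of a bounded factor, which converges almost everywhere along a
  subsequence, and a factor that converges in \<open>L\<^sup>1\<close>. The error splits into
  \<open>e\<close>, where the second factor is off, and \<open>d\<close>, where the first is;
  \<open>d\<close> is treated by dominated convergence.\<close>

lemma forcing_tendsto_subseq: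
  assumes \<eta>_meas[measurable]: "\<eta> \<in> borel_measurable borel"
    and \<eta>: "\<And>x. 0 \<le> \<eta> x" "\<And>x. \<eta> x \<le> C" "\<And>x. \<eta> x \<noteq> 0 \<Longrightarrow> x \<in> cball 0 R" and k: "0 \<le> k"
  shows "\<exists>r. strict_mono r \<and>
    (\<lambda>n. \<integral>p. (case p of (s, x) \<Rightarrow> window \<eta> (\<lambda>s x. clamp_real k (mollify (r n) (V s) x) * mollify (r n) (G s) x) s x) \<partial>(lborel \<Otimes>\<^sub>M lborel))
      \<longlonglongrightarrow> (\<integral>p. (case p of (s, x) \<Rightarrow> window \<eta> (\<lambda>s x. clamp_real k (V s x) * G s x) s x) \<partial>(lborel \<Otimes>\<^sub>M lborel))"
    and "integrable (lborel \<Otimes>\<^sub>M lborel) (\<lambda>(s, x). window \<eta> (\<lambda>s x. clamp_real k (V s x) * G s x) s x)"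
proof -
  have C: "0 \<le> C" using \<eta>(1,2)[of 0] by linarith
  let ?\<mu> = "lborel \<Otimes>\<^sub>M lborel :: (real \<times> 'a) measure"
  let ?W = "\<lambda>F. \<integral>\<^sup>+s\<in>{a..b}. (\<integral>\<^sup>+x\<in>cball (0::'a) R. ennreal \<bar>F s x\<bar> \<partial>lborel) \<partial>lborel"
  define f where "f s x = clamp_real k (V s x) * G s x" for s and x :: 'a
  define h where "h n s x = clamp_real k (mollify n (V s) x) * mollify n (G s) x" for n s and x :: 'a
  define e where "e n s x = clamp_real k (mollify n (V s) x) * (mollify n (G s) x - G s x)" for n s and x :: 'a
  define d where "d n s x = (clamp_real k (mollify n (V s) x) - clamp_real k (V s x)) * G s x" for n s and x :: 'a
  define v where "v n s x = mollify n (V s) x - V s x" for n s and x :: 'a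
  have m[measurable]: "(\<lambda>(s, x). f s x) \<in> borel_measurable ?\<mu>" "\<And>n. (\<lambda>(s, x). h n s x) \<in> borel_measurable ?\<mu>"
    "\<And>n. (\<lambda>(s, x). e n s x) \<in> borel_measurable ?\<mu>" "\<And>n. (\<lambda>(s, x). d n s x) \<in> borel_measurable ?\<mu>"
    "\<And>n. (\<lambda>(s, x). v n s x) \<in> borel_measurable ?\<mu>"
    unfolding f_def h_def e_def d_def v_def by measurable
  have cl: "ennreal (\<bar>clamp_real k t\<bar> * c) \<le> ennreal k * ennreal c" if "0 \<le> c" for t c
  proof -
    have "\<bar>clamp_real k t\<bar> * c \<le> k * c" by (intro mult_right_mono clamp_real_abs_le k that)
    then have "ennreal (\<bar>clamp_real k t\<bar> * c) \<le> ennreal (k * c)" by (rule ennreal_leI)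
    then show ?thesis using k by (simp add: ennreal_mult')
  qed
  have cmult: "(\<integral>\<^sup>+s\<in>{a..b}. (\<integral>\<^sup>+x\<in>cball (0::'a) R. ennreal c * ennreal \<bar>F s x\<bar> \<partial>lborel) \<partial>lborel) = ennreal c * ?W F"
    if [measurable]: "(\<lambda>(s, x). F s x) \<in> borel_measurable ?\<mu>" for F c
    by (simp add: nn_integral_cmult mult.assoc)
  have finG: "?W G < \<infinity>" by (rule G_loc)
  have finf: "?W f < \<infinity>"
  proof -
    have "?W f \<le> (\<integral>\<^sup>+s\<in>{a..b}. (\<integral>\<^sup>+x\<in>cball (0::'a) R. ennreal k * ennreal \<bar>G s x\<bar> \<partial>lborel) \<partial>lborel)"
      by (rule nn_integral_window_mono) (simp add: f_def abs_mult cl)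
    also have "\<dots> = ennreal k * ?W G" by (rule cmult) measurable
    finally show ?thesis using finG by (auto simp: ennreal_mult_less_top le_less_trans)
  qed
  show intf: "integrable ?\<mu> (\<lambda>(s, x). window \<eta> (\<lambda>s x. clamp_real k (V s x) * G s x) s x)"
    using integrable_window(1)[OF m(1) \<eta>_meas \<eta> finf] by (simp add: f_def)
  have finh: "?W (h n) < \<infinity>" for n unfolding h_def by (rule mollify_G_window_finite[OF k])
  have limG: "(\<lambda>n. ?W (\<lambda>s x. mollify n (G s) x - G s x)) \<longlonglongrightarrow> 0"
    by (rule mollify_tendsto_space_time[OF G_meas G_loc])
  have limV: "(\<lambda>n. ?W (v n)) \<longlonglongrightarrow> 0"
    unfolding v_def by (rule mollify_tendsto_space_time[OF V_meas V_window_finite])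
  have lime: "(\<lambda>n. ?W (e n)) \<longlonglongrightarrow> 0"
  proof -
    have le: "?W (e n) \<le> ennreal k * ?W (\<lambda>s x. mollify n (G s) x - G s x)" for n
    proof -
      have "?W (e n) \<le> (\<integral>\<^sup>+s\<in>{a..b}. (\<integral>\<^sup>+x\<in>cball (0::'a) R. ennreal k * ennreal \<bar>mollify n (G s) x - G s x\<bar> \<partial>lborel) \<partial>lborel)"
        by (rule nn_integral_window_mono) (simp add: e_def abs_mult cl)
      also have "\<dots> = ennreal k * ?W (\<lambda>s x. mollify n (G s) x - G s x)" by (rule cmult) measurable
      finally show ?thesis .
    qed
    have "(\<lambda>n. ennreal k * ?W (\<lambda>s x. mollify n (G s) x - G s x)) \<longlonglongrightarrow> 0"
      using ennreal_tendsto_cmult[OF _ limG, of "ennreal k"] by simp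
    from tendsto_sandwich[OF _ always_eventually[OF allI[OF le]] tendsto_const this] show ?thesis by simp
  qed
  have finv: "?W (v n) < \<infinity>" if "n \<ge> N" and N: "\<And>n. n \<ge> N \<Longrightarrow> ?W (v n) < 1" for n N
    using N[OF that(1)] by (rule less_trans) simp
  \<comment> \<open>from index \<open>N\<close> on the distances are finite, so that the
    differences are integrable\<close>
  obtain N where N: "\<And>n. n \<ge> N \<Longrightarrow> ?W (v n) < 1"
    using order_tendstoD(2)[OF limV, of 1] by (auto simp: eventually_sequentially)
  define c :: "'a \<Rightarrow> real" where "c = indicator (cball 0 R)"
  have c: "c \<in> borel_measurable borel" "\<And>x. 0 \<le> c x" "\<And>x. c x \<le> 1" "\<And>x. c x \<noteq> 0 \<Longrightarrow> x \<in> cball 0 R"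
    unfolding c_def by (auto simp: indicator_def)
  have intv: "integrable ?\<mu> (\<lambda>(s, x). window c (v (n + N)) s x)" for n
    by (rule integrable_window(1)[OF m(5) c finv[OF _ N]]) simp_all
  have normv: "(\<lambda>n. \<integral>p. norm (case p of (s, x) \<Rightarrow> window c (v (n + N)) s x) \<partial>?\<mu>) \<longlonglongrightarrow> 0"
  proof -
    have "(\<lambda>n. \<integral>\<^sup>+p. norm (case p of (s, x) \<Rightarrow> window c (v (n + N)) s x) \<partial>?\<mu>) \<longlonglongrightarrow> 0"
    proof (rule tendsto_sandwich[OF _ always_eventually[OF allI] tendsto_const])
      show "(\<integral>\<^sup>+p. norm (case p of (s, x) \<Rightarrow> window c (v (n + N)) s x) \<partial>?\<mu>) \<le> ennreal 1 * ?W (v (n + N))" for n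
        by (rule integrable_window(2)[OF m(5) c finv[OF _ N]]) simp_all
      show "(\<lambda>n. ennreal 1 * ?W (v (n + N))) \<longlonglongrightarrow> 0"
        using limV[THEN LIMSEQ_ignore_initial_segment, of N] by simp
    qed simp
    then have "(\<lambda>n. enn2real (\<integral>\<^sup>+p. norm (case p of (s, x) \<Rightarrow> window c (v (n + N)) s x) \<partial>?\<mu>)) \<longlonglongrightarrow> enn2real 0"
      by (intro tendsto_enn2real) simp_all
    then show ?thesis
      by (subst integral_eq_nn_integral) (use intv in \<open>auto dest: borel_measurable_integrable\<close>)
  qed
  obtain r0 where r0: "strict_mono r0" "AE p in ?\<mu>. (\<lambda>n. case p of (s, x) \<Rightarrow> window c (v (r0 n + N)) s x) \<longlonglongrightarrow> 0"
    using tendsto_L1_AE_subseq[OF intv normv] by blast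
  define r where "r n = r0 n + N" for n
  have r: "strict_mono r" using r0(1) by (auto simp: r_def strict_mono_def)
  have nnd: "(\<lambda>n. \<integral>\<^sup>+p. norm (case p of (s, x) \<Rightarrow> window c (d (r n)) s x) \<partial>?\<mu>) \<longlonglongrightarrow> (\<integral>\<^sup>+p. 0 \<partial>?\<mu>)"
  proof (rule nn_integral_dominated_convergence[where w = "\<lambda>p. ennreal (2 * k) * norm (case p of (s, x) \<Rightarrow> window c G s x)"])
    have iG: "integrable ?\<mu> (\<lambda>(s, x). window c G s x)" by (rule integrable_window(1)[OF G_meas c finG])
    have [measurable]: "c \<in> borel_measurable borel" by (rule c)
    show "(\<lambda>p. ennreal (2 * k) * norm (case p of (s, x) \<Rightarrow> window c G s x)) \<in> borel_measurable ?\<mu>" by measurable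
    show "(\<lambda>p. ennreal (norm (case p of (s, x) \<Rightarrow> window c (d (r n)) s x))) \<in> borel_measurable ?\<mu>" for n by measurable
    show "(\<integral>\<^sup>+p. ennreal (2 * k) * norm (case p of (s, x) \<Rightarrow> window c G s x) \<partial>?\<mu>) < \<infinity>"
      using iG by (subst nn_integral_cmult) (auto simp: integrable_iff_bounded ennreal_mult_less_top)
    have "\<bar>window c (d n) s x\<bar> \<le> 2 * k * \<bar>window c G s x\<bar>" for n s x
    proof -
      have "\<bar>clamp_real k (mollify n (V s) x) - clamp_real k (V s x)\<bar> \<le> 2 * k"
        using clamp_real_abs_le[OF k, of "mollify n (V s) x"] clamp_real_abs_le[OF k, of "V s x"] by linarith
      from mult_right_mono[OF this, of "\<bar>window c G s x\<bar>"] show ?thesis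
        by (simp add: window_def d_def abs_mult mult_ac)
    qed
    then show "AE p in ?\<mu>. ennreal (norm (case p of (s, x) \<Rightarrow> window c (d (r n)) s x)) \<le> ennreal (2 * k) * norm (case p of (s, x) \<Rightarrow> window c G s x)" for n
      using k by (intro AE_I2) (auto simp: ennreal_mult[symmetric] intro!: ennreal_leI)
    show "AE p in ?\<mu>. (\<lambda>n. ennreal (norm (case p of (s, x) \<Rightarrow> window c (d (r n)) s x))) \<longlonglongrightarrow> 0"
      using r0(2)
    proof eventually_elim
      case (elim p)
      obtain s x where p: "p = (s, x)" by force
      have le: "norm (window c (d (r n)) s x) \<le> \<bar>window c (v (r n)) s x\<bar> * \<bar>G s x\<bar>" for n
      proof -
        have "\<bar>clamp_real k (mollify (r n) (V s) x) - clamp_real k (V s x)\<bar> \<le> \<bar>v (r n) s x\<bar>"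
          unfolding v_def by (rule clamp_real_diff_le[OF k])
        then have "(\<bar>indicator {a..b} s\<bar> * \<bar>c x\<bar> * \<bar>G s x\<bar>) * \<bar>clamp_real k (mollify (r n) (V s) x) - clamp_real k (V s x)\<bar>
          \<le> (\<bar>indicator {a..b} s\<bar> * \<bar>c x\<bar> * \<bar>G s x\<bar>) * \<bar>v (r n) s x\<bar>"
          by (intro mult_left_mono) auto
        then show ?thesis by (simp add: window_def d_def abs_mult mult_ac)
      qed
      have "(\<lambda>n. \<bar>window c (v (r n)) s x\<bar> * \<bar>G s x\<bar>) \<longlonglongrightarrow> 0"
        using elim by (auto simp: p r_def intro!: tendsto_eq_intros)
      from tendsto_sandwich[OF _ always_eventually[OF allI[OF le]] tendsto_const this]
      have "(\<lambda>n. norm (window c (d (r n)) s x)) \<longlonglongrightarrow> 0" by simp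
      then have "(\<lambda>n. ennreal (norm (window c (d (r n)) s x))) \<longlonglongrightarrow> ennreal 0" by (rule tendsto_ennrealI)
      then show ?case by (simp add: p)
    qed
  qed (rule borel_measurable_const)
  have "(\<lambda>n. \<integral>p. (case p of (s, x) \<Rightarrow> window \<eta> (h (r n)) s x) \<partial>?\<mu>) \<longlonglongrightarrow> (\<integral>p. (case p of (s, x) \<Rightarrow> window \<eta> f s x) \<partial>?\<mu>)"
  proof (rule tendsto_L1_int)
    show "integrable ?\<mu> (\<lambda>(s, x). window \<eta> (h (r n)) s x)" for n
      by (rule integrable_window(1)[OF m(2) \<eta>_meas \<eta> finh])
    show "integrable ?\<mu> (\<lambda>(s, x). window \<eta> f s x)" by (rule integrable_window(1)[OF m(1) \<eta>_meas \<eta> finf])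
    have [measurable]: "c \<in> borel_measurable borel" by (rule c)
    have bound: "(\<integral>\<^sup>+p. norm ((case p of (s, x) \<Rightarrow> window \<eta> (h (r n)) s x) - (case p of (s, x) \<Rightarrow> window \<eta> f s x)) \<partial>?\<mu>)
      \<le> ennreal C * ((\<integral>\<^sup>+p. norm (case p of (s, x) \<Rightarrow> window c (e (r n)) s x) \<partial>?\<mu>) + (\<integral>\<^sup>+p. norm (case p of (s, x) \<Rightarrow> window c (d (r n)) s x) \<partial>?\<mu>))" for n
    proof -
      have pt: "\<bar>window \<eta> (h n) s x - window \<eta> f s x\<bar> \<le> C * (\<bar>window c (e n) s x\<bar> + \<bar>window c (d n) s x\<bar>)" for n s x
      proof (cases "x \<in> cball 0 R")
        case True
        have "\<bar>h n s x - f s x\<bar> \<le> \<bar>e n s x\<bar> + \<bar>d n s x\<bar>"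
          unfolding h_def f_def e_def d_def by (rule order_trans[OF _ abs_triangle_ineq]) (simp add: algebra_simps)
        then have "\<bar>\<eta> x\<bar> * \<bar>h n s x - f s x\<bar> \<le> C * (\<bar>e n s x\<bar> + \<bar>d n s x\<bar>)"
          using \<eta>(1,2)[of x] by (intro mult_mono) auto
        then show ?thesis using True
          by (auto simp: window_def c_def indicator_def right_diff_distrib[symmetric] abs_mult)
      next
        case False then have "\<eta> x = 0" using \<eta>(3) by blast
        then show ?thesis using C by (simp add: window_def)
      qed
      have "(\<integral>\<^sup>+p. norm ((case p of (s, x) \<Rightarrow> window \<eta> (h (r n)) s x) - (case p of (s, x) \<Rightarrow> window \<eta> f s x)) \<partial>?\<mu>)
        \<le> (\<integral>\<^sup>+p. ennreal C * (ennreal (norm (case p of (s, x) \<Rightarrow> window c (e (r n)) s x)) + ennreal (norm (case p of (s, x) \<Rightarrow> window c (d (r n)) s x))) \<partial>?\<mu>)"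
      proof (rule nn_integral_mono)
        fix p :: "real \<times> 'a"
        obtain s x where p: "p = (s, x)" by force
        show "ennreal (norm ((case p of (s, x) \<Rightarrow> window \<eta> (h (r n)) s x) - (case p of (s, x) \<Rightarrow> window \<eta> f s x)))
          \<le> ennreal C * (ennreal (norm (case p of (s, x) \<Rightarrow> window c (e (r n)) s x)) + ennreal (norm (case p of (s, x) \<Rightarrow> window c (d (r n)) s x)))"
          using ennreal_leI[OF pt[of "r n" s x]] C by (simp add: p ennreal_mult ennreal_plus)
      qed
      also have "\<dots> = ennreal C * ((\<integral>\<^sup>+p. norm (case p of (s, x) \<Rightarrow> window c (e (r n)) s x) \<partial>?\<mu>) + (\<integral>\<^sup>+p. norm (case p of (s, x) \<Rightarrow> window c (d (r n)) s x) \<partial>?\<mu>))"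
      proof -
        have "(\<lambda>p. ennreal (norm (case p of (s, x) \<Rightarrow> window c (e (r n)) s x))) \<in> borel_measurable ?\<mu>"
          "(\<lambda>p. ennreal (norm (case p of (s, x) \<Rightarrow> window c (d (r n)) s x))) \<in> borel_measurable ?\<mu>"
          by measurable
        then show ?thesis
          by (subst nn_integral_cmult[OF borel_measurable_add]) (simp_all only: nn_integral_add)
      qed
      finally show ?thesis .
    qed
    have e0: "(\<lambda>n. \<integral>\<^sup>+p. norm (case p of (s, x) \<Rightarrow> window c (e (r n)) s x) \<partial>?\<mu>) \<longlonglongrightarrow> 0"
    proof (rule tendsto_sandwich[OF _ _ tendsto_const])
      have *: "\<forall>\<^sub>F n in sequentially. ?W (e (r n)) < 1"
        using order_tendstoD(2)[OF LIMSEQ_subseq_LIMSEQ[OF lime r], of 1] by (simp add: o_def)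
      show "\<forall>\<^sub>F n in sequentially. (\<integral>\<^sup>+p. norm (case p of (s, x) \<Rightarrow> window c (e (r n)) s x) \<partial>?\<mu>) \<le> ennreal 1 * ?W (e (r n))"
        using *
      proof eventually_elim
        case (elim n)
        then have "?W (e (r n)) < \<infinity>" by (rule less_trans) simp
        from integrable_window(2)[OF m(3) c this] show ?case .
      qed
      show "(\<lambda>n. ennreal 1 * ?W (e (r n))) \<longlonglongrightarrow> 0" using LIMSEQ_subseq_LIMSEQ[OF lime r] by (simp add: o_def)
    qed simp
    have "(\<lambda>n. ennreal C * ((\<integral>\<^sup>+p. norm (case p of (s, x) \<Rightarrow> window c (e (r n)) s x) \<partial>?\<mu>) + (\<integral>\<^sup>+p. norm (case p of (s, x) \<Rightarrow> window c (d (r n)) s x) \<partial>?\<mu>)))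
      \<longlonglongrightarrow> ennreal C * (0 + 0)"
      using nnd by (intro ennreal_tendsto_cmult tendsto_add e0) simp_all
    then have lim0: "(\<lambda>n. ennreal C * ((\<integral>\<^sup>+p. norm (case p of (s, x) \<Rightarrow> window c (e (r n)) s x) \<partial>?\<mu>) + (\<integral>\<^sup>+p. norm (case p of (s, x) \<Rightarrow> window c (d (r n)) s x) \<partial>?\<mu>)))
      \<longlonglongrightarrow> 0" by simp
    show "(\<lambda>n. \<integral>\<^sup>+p. norm ((case p of (s, x) \<Rightarrow> window \<eta> (h (r n)) s x) - (case p of (s, x) \<Rightarrow> window \<eta> f s x)) \<partial>?\<mu>) \<longlonglongrightarrow> 0"
      by (rule tendsto_sandwich[OF _ always_eventually[OF allI[OF bound]] tendsto_const lim0]) simp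
  qed
  then show "\<exists>r. strict_mono r \<and>
    (\<lambda>n. \<integral>p. (case p of (s, x) \<Rightarrow> window \<eta> (\<lambda>s x. clamp_real k (mollify (r n) (V s) x) * mollify (r n) (G s) x) s x) \<partial>(lborel \<Otimes>\<^sub>M lborel))
      \<longlonglongrightarrow> (\<integral>p. (case p of (s, x) \<Rightarrow> window \<eta> (\<lambda>s x. clamp_real k (V s x) * G s x) s x) \<partial>(lborel \<Otimes>\<^sub>M lborel))"
    using r unfolding h_def f_def by blast
qed

text \<open>The limit of \<open>regularised_energy\<close> as the mollification is removed.\<close>

lemma truncated_energy:
  assumes \<eta>_meas[measurable]: "\<eta> \<in> borel_measurable borel"
    and \<eta>: "\<And>x. 0 \<le> \<eta> x" "\<And>x. \<eta> x \<le> C" "\<And>x. \<eta> x \<noteq> 0 \<Longrightarrow> x \<in> cball 0 R"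
    and B: "\<And>\<tau> x. 0 < \<tau> \<Longrightarrow> \<bar>second_difference \<tau> \<eta> x\<bar> \<le> B" and k: "0 \<le> k"
  shows "(\<integral>x. \<eta> x * huber k (V b x) \<partial>lborel) \<le>
    (\<integral>x. \<eta> x * huber k (V a x) \<partial>lborel) + (b - a) * (B * M / 2) +
    (\<integral>p. (case p of (s, x) \<Rightarrow> window \<eta> (\<lambda>s x. clamp_real k (V s x) * G s x) s x) \<partial>(lborel \<Otimes>\<^sub>M lborel))"
proof -
  obtain r where r: "strict_mono r"
    "(\<lambda>n. \<integral>p. (case p of (s, x) \<Rightarrow> window \<eta> (\<lambda>s x. clamp_real k (mollify (r n) (V s) x) * mollify (r n) (G s) x) s x) \<partial>(lborel \<Otimes>\<^sub>M lborel))
      \<longlonglongrightarrow> (\<integral>p. (case p of (s, x) \<Rightarrow> window \<eta> (\<lambda>s x. clamp_real k (V s x) * G s x) s x) \<partial>(lborel \<Otimes>\<^sub>M lborel))"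
    using forcing_tendsto_subseq(1)[OF \<eta>_meas \<eta> k] by blast
  have H: "(\<lambda>n. \<integral>x. \<eta> x * huber k (mollify (r n) (V t) x) \<partial>lborel) \<longlonglongrightarrow> (\<integral>x. \<eta> x * huber k (V t x) \<partial>lborel)"
    if "t \<in> {a..b}" for t
    using LIMSEQ_subseq_LIMSEQ[OF huber_mollify_tendsto[OF that k \<eta>_meas \<eta>] r(1)] by (simp add: o_def)
  show ?thesis
    by (rule LIMSEQ_le[OF H[of b] tendsto_add[OF tendsto_add[OF H[of a] tendsto_const] r(2)]])
       (use ab regularised_energy[OF \<eta>_meas \<eta> B k] in auto)
qed

end

text \<open>The factor \<open>exp 1\<close> normalises the value at the origin to 1.\<close>

definition cutoff :: "nat \<Rightarrow> 'a::euclidean_space \<Rightarrow> real" where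
  "cutoff N x = exp 1 * flat_exp 0 (1 - (x /\<^sub>R real N) \<bullet> (x /\<^sub>R real N))"

lemma unit_bump: "(\<lambda>x. exp 1 * flat_exp 0 (1 - x \<bullet> x)) \<in> bump_span 0 1"
  using bump_span.scale[OF bump_span.base[of 0 1 0], of "exp 1"] by simp

lemma cutoff_measurable[measurable]: "cutoff N \<in> borel_measurable borel"
proof -
  have "(\<lambda>x::'a. exp 1 * flat_exp 0 (1 - x \<bullet> x)) \<in> borel_measurable borel"
    by (rule borel_measurable_continuous_onI[OF bump_span_continuous[OF unit_bump]])
  then have "(\<lambda>x. (\<lambda>x::'a. exp 1 * flat_exp 0 (1 - x \<bullet> x)) (x /\<^sub>R real N)) \<in> borel_measurable borel"
    by measurable
  then show ?thesis unfolding cutoff_def[abs_def] .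
qed

lemma cutoff_nonneg: "0 \<le> cutoff N x"
  by (simp add: cutoff_def flat_exp_nonneg)

lemma cutoff_le_1: "cutoff N x \<le> 1"
proof -
  have "flat_exp 0 t \<le> exp (- 1)" if "t \<le> 1" for t
    using that by (auto simp: flat_exp_def field_simps)
  then have "exp 1 * flat_exp 0 (1 - (x /\<^sub>R real N) \<bullet> (x /\<^sub>R real N)) \<le> exp 1 * exp (- 1)"
    by (intro mult_left_mono) auto
  then show ?thesis by (simp add: cutoff_def exp_minus)
qed

lemma cutoff_support: "N > 0 \<Longrightarrow> cutoff N x \<noteq> 0 \<Longrightarrow> x \<in> cball 0 (real N)"
  using bump_span_support_ball[OF unit_bump, of "x /\<^sub>R real N"] by (simp add: cutoff_def field_simps)

lemma cutoff_tendsto_1: "(\<lambda>j. cutoff (Suc j) x) \<longlonglongrightarrow> 1"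
proof -
  have "isCont (\<lambda>x::'a. exp 1 * flat_exp 0 (1 - x \<bullet> x)) 0"
    using bump_span_continuous[OF unit_bump] continuous_on_eq_continuous_at[OF open_UNIV] by blast
  moreover have "(\<lambda>j. x /\<^sub>R real (Suc j)) \<longlonglongrightarrow> 0 *\<^sub>R x"
    by (intro tendsto_scaleR LIMSEQ_inverse_real_of_nat tendsto_const)
  ultimately have "(\<lambda>j. cutoff (Suc j) x) \<longlonglongrightarrow> exp 1 * flat_exp 0 (1 - (0::'a) \<bullet> 0)"
    unfolding cutoff_def by (intro isCont_tendsto_compose[of 0 "\<lambda>x::'a. exp 1 * flat_exp 0 (1 - x \<bullet> x)"]) simp_all
  then show ?thesis by (simp add: flat_exp_def exp_minus)
qed

text \<open>By scaling, the second difference of the cutoff with step \<open>\<tau>\<close> is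
  the one of the unit bump with step \<open>\<tau> / N\<close>, divided by
  \<open>N\<^sup>2\<close>. Hence the error that the cutoff causes in the Laplacian vanishes
  in the limit.\<close>

lemma cutoff_second_difference:
  "\<exists>C\<ge>0. \<forall>N>0. \<forall>\<tau>>0. \<forall>x::'a::euclidean_space. \<bar>second_difference \<tau> (cutoff N) x\<bar> \<le> C / (real N)\<^sup>2"
proof -
  let ?f = "\<lambda>x::'a. exp 1 * flat_exp 0 (1 - x \<bullet> x)"
  obtain C where C: "0 \<le> C" "\<And>\<tau> x. 0 < \<tau> \<Longrightarrow> \<bar>second_difference \<tau> ?f x\<bar> \<le> C"
    using second_difference_bounded[OF unit_bump] by blast
  have "\<bar>second_difference \<tau> (cutoff N) x\<bar> \<le> C / (real N)\<^sup>2" if "0 < N" "0 < \<tau>" for N \<tau> and x :: 'a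
  proof -
    have "second_difference \<tau> (cutoff N) x = second_difference (\<tau> / real N) ?f (x /\<^sub>R real N) / (real N)\<^sup>2"
      unfolding second_difference_def cutoff_def sum_divide_distrib
      using that by (intro sum.cong) (auto simp: scaleR_add_right scaleR_diff_right field_simps)
    then show ?thesis using C(2)[of "\<tau> / real N" "x /\<^sub>R real N"] that
      by (simp add: abs_divide divide_right_mono)
  qed
  then show ?thesis using C(1) by blast
qed

context weak_evolution
begin

lemma truncated_norm_tendsto:
  assumes t: "t \<in> {a..b}"
  shows "(\<lambda>j. \<integral>x. cutoff (Suc j) x * huber (real (Suc j)) (V t x) \<partial>lborel) \<longlonglongrightarrow> (\<integral>x. (V t x)\<^sup>2 \<partial>lborel) / 2"
proof -
  have "(\<lambda>j. \<integral>x. cutoff (Suc j) x * huber (real (Suc j)) (V t x) \<partial>lborel) \<longlonglongrightarrow> (\<integral>x. 1 * ((V t x)\<^sup>2 / 2) \<partial>lborel)"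
  proof (rule integral_dominated_convergence[where w = "\<lambda>x. (V t x)\<^sup>2"])
    show "integrable lborel (\<lambda>x. (V t x)\<^sup>2)" by (rule V_sq[OF t])
    show "AE x in lborel. (\<lambda>j. cutoff (Suc j) x * huber (real (Suc j)) (V t x)) \<longlonglongrightarrow> 1 * ((V t x)\<^sup>2 / 2)"
    proof (intro AE_I2 tendsto_mult cutoff_tendsto_1)
      fix x
      obtain N :: nat where "\<bar>V t x\<bar> \<le> real N" using real_arch_simple by blast
      then have "huber (real (Suc j)) (V t x) = (V t x)\<^sup>2 / 2" if "j \<ge> N" for j
        using that by (intro huber_eq) simp
      then show "(\<lambda>j. huber (real (Suc j)) (V t x)) \<longlonglongrightarrow> (V t x)\<^sup>2 / 2"
        by (intro tendsto_eventually) (auto simp: eventually_sequentially)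
    qed
    show "AE x in lborel. norm (cutoff (Suc j) x * huber (real (Suc j)) (V t x)) \<le> (V t x)\<^sup>2" for j
    proof (rule AE_I2)
      fix x
      have "0 \<le> real (Suc j)" by simp
      have "cutoff (Suc j) x * huber (real (Suc j)) (V t x) \<le> 1 * ((V t x)\<^sup>2 / 2)"
        by (intro mult_mono cutoff_le_1 huber_le huber_nonneg) simp_all
      moreover have "0 \<le> cutoff (Suc j) x * huber (real (Suc j)) (V t x)"
        by (intro mult_nonneg_nonneg cutoff_nonneg huber_nonneg) simp
      ultimately show "norm (cutoff (Suc j) x * huber (real (Suc j)) (V t x)) \<le> (V t x)\<^sup>2"
        using zero_le_power2[of "V t x"] by simp
    qed
  qed measurable
  then show ?thesis by simp
qed

text \<open>Truncation level and cutoff radius are both \<open>Suc j\<close>. The product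
  \<open>G * V\<close> need not be integrable, so it enters through a pointwise bound with an
  integrable part \<open>Kp\<close> and a dissipative part \<open>Kn\<close>, and the integral
  of \<open>Kn\<close> is part of the conclusion: truncation and cutoff multiply
  \<open>Kn\<close> by factors that tend to 1, and Fatou's lemma applies.\<close>

proposition energy_inequality:
  assumes Kp_meas[measurable]: "(\<lambda>(s, x). Kp s x) \<in> borel_measurable (lborel \<Otimes>\<^sub>M lborel)"
    and Kn_meas[measurable]: "(\<lambda>(s, x). Kn s x) \<in> borel_measurable (lborel \<Otimes>\<^sub>M lborel)"
    and nonneg: "\<And>s x. 0 \<le> Kp s x" "\<And>s x. 0 \<le> Kn s x"
    and le: "\<And>s. s \<in> {a..b} \<Longrightarrow> AE x in lborel. G s x * V s x \<le> Kp s x - Kn s x"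
    and Q: "(\<integral>\<^sup>+s\<in>{a..b}. (\<integral>\<^sup>+x. ennreal (Kp s x) \<partial>lborel) \<partial>lborel) \<le> ennreal Q" "0 \<le> Q"
  shows "(\<integral>x. (V b x)\<^sup>2 \<partial>lborel) \<le> (\<integral>x. (V a x)\<^sup>2 \<partial>lborel) + 2 * Q"
    and "(\<integral>\<^sup>+s\<in>{a..b}. (\<integral>\<^sup>+x. ennreal (Kn s x) \<partial>lborel) \<partial>lborel)
      \<le> ennreal (((\<integral>x. (V a x)\<^sup>2 \<partial>lborel) - (\<integral>x. (V b x)\<^sup>2 \<partial>lborel)) / 2 + Q)"
proof -
  let ?\<mu> = "lborel \<Otimes>\<^sub>M lborel :: (real \<times> 'a) measure"
  obtain C where C: "0 \<le> C" "\<And>N \<tau> x. 0 < N \<Longrightarrow> 0 < \<tau> \<Longrightarrow> \<bar>second_difference \<tau> (cutoff N) (x::'a)\<bar> \<le> C / (real N)\<^sup>2"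
    using cutoff_second_difference[where 'a = 'a] by blast
  define A where "A j t = (\<integral>x. cutoff (Suc j) x * huber (real (Suc j)) (V t x) \<partial>lborel)" for j t
  define X where "X j = Q + A j a - A j b + (b - a) * (C / (real (Suc j))\<^sup>2 * M / 2)" for j
  define \<rho> where "\<rho> j s x = ratio (real (Suc j)) (V s x)" for j s and x :: 'a
  have [measurable]: "(\<lambda>(s, x). \<rho> j s x) \<in> borel_measurable ?\<mu>" for j unfolding \<rho>_def by measurable
  have \<rho>: "0 \<le> \<rho> j s x" "\<rho> j s x \<le> 1" for j s x unfolding \<rho>_def by (simp_all add: ratio_bounds)
  let ?wn = "\<lambda>j. \<lambda>(s, x). window (cutoff (Suc j)) (\<lambda>s x. \<rho> j s x * Kn s x) s x"
  let ?wp = "\<lambda>j. \<lambda>(s, x). window (cutoff (Suc j)) (\<lambda>s x. \<rho> j s x * Kp s x) s x"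
  have wn_nonneg: "0 \<le> ?wn j p" and wp_nonneg: "0 \<le> ?wp j p" for j p
    using nonneg \<rho> by (auto simp: window_def cutoff_nonneg split: prod.split intro!: mult_nonneg_nonneg)
  have main: "0 \<le> X j" "(\<integral>\<^sup>+p. ennreal (?wn j p) \<partial>?\<mu>) \<le> ennreal (X j)" for j
  proof -
    let ?k = "real (Suc j)"
    define f where "f p = (case p of (s, x) \<Rightarrow> window (cutoff (Suc j)) (\<lambda>s x. clamp_real ?k (V s x) * G s x) s x)" for p :: "real \<times> 'a"
    have cut: "\<And>x::'a. 0 \<le> cutoff (Suc j) x" "\<And>x::'a. cutoff (Suc j) x \<le> 1" "\<And>x::'a. cutoff (Suc j) x \<noteq> 0 \<Longrightarrow> x \<in> cball 0 ?k"
      "\<And>\<tau> x::'a. 0 < \<tau> \<Longrightarrow> \<bar>second_difference \<tau> (cutoff (Suc j)) x\<bar> \<le> C / ?k\<^sup>2"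
      using cutoff_support[of "Suc j"] C(2)[of "Suc j"] by (auto simp: cutoff_nonneg cutoff_le_1)
    have k: "0 \<le> ?k" by simp
    have f: "integrable ?\<mu> f"
      using forcing_tendsto_subseq(2)[OF cutoff_measurable cut(1-3) k] unfolding f_def[abs_def] .
    have f_ge: "A j b \<le> A j a + (b - a) * (C / ?k\<^sup>2 * M / 2) + (\<integral>p. f p \<partial>?\<mu>)"
      using truncated_energy[OF cutoff_measurable cut k] unfolding A_def f_def[abs_def] .
    have wp_le: "(\<integral>\<^sup>+p. ennreal (?wp j p) \<partial>?\<mu>) \<le> ennreal Q"
    proof -
      have "(\<integral>\<^sup>+p. ennreal (?wp j p) \<partial>?\<mu>) = (\<integral>\<^sup>+s. \<integral>\<^sup>+x. ennreal (?wp j (s, x)) \<partial>lborel \<partial>lborel)"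
        by (rule lborel.nn_integral_fst[symmetric]) measurable
      also have "\<dots> \<le> (\<integral>\<^sup>+s. \<integral>\<^sup>+x. ennreal (Kp s x) * indicator {a..b} s \<partial>lborel \<partial>lborel)"
      proof (intro nn_integral_mono)
        fix s :: real and x :: 'a
        have "cutoff (Suc j) x * (\<rho> j s x * Kp s x) \<le> 1 * (1 * Kp s x)"
          using \<rho> nonneg by (intro mult_mono cutoff_le_1 mult_nonneg_nonneg) auto
        then show "ennreal (?wp j (s, x)) \<le> ennreal (Kp s x) * indicator {a..b} s"
          by (cases "s \<in> {a..b}") (auto simp: window_def intro: ennreal_leI)
      qed
      also have "\<dots> = (\<integral>\<^sup>+s\<in>{a..b}. (\<integral>\<^sup>+x. ennreal (Kp s x) \<partial>lborel) \<partial>lborel)"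
        by (intro nn_integral_cong nn_integral_multc) measurable
      finally show ?thesis using Q(1) by simp
    qed
    have wp_meas: "?wp j \<in> borel_measurable ?\<mu>" and wn_meas: "?wn j \<in> borel_measurable ?\<mu>" by measurable
    have iwp: "integrable ?\<mu> (?wp j)"
      by (rule integrableI_nonneg[OF wp_meas AE_I2[OF wp_nonneg] le_less_trans[OF wp_le]]) simp
    have wpQ: "(\<integral>p. ?wp j p \<partial>?\<mu>) \<le> Q"
      using wp_le nn_integral_eq_integral[OF iwp AE_I2[OF wp_nonneg]] Q(2) by simp
    have f_meas: "f \<in> borel_measurable ?\<mu>" using f by (rule borel_measurable_integrable)
    have ae: "AE p in ?\<mu>. ?wn j p \<le> ?wp j p - f p"
    proof (rule lborel_pair.AE_pair_measure)
      show "{p \<in> space ?\<mu>. ?wn j p \<le> ?wp j p - f p} \<in> sets ?\<mu>"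
        using wp_meas wn_meas f_meas by measurable
      show "AE s in lborel. AE x in lborel. ?wn j (s, x) \<le> ?wp j (s, x) - f (s, x)"
      proof (rule AE_I2)
        fix s :: real
        show "AE x in lborel. ?wn j (s, x) \<le> ?wp j (s, x) - f (s, x)"
        proof (cases "s \<in> {a..b}")
          case True
          from le[OF this] show ?thesis
          proof eventually_elim
            case (elim x)
            then have "\<rho> j s x * (G s x * V s x) \<le> \<rho> j s x * (Kp s x - Kn s x)"
              using \<rho> by (intro mult_left_mono)
            moreover have "clamp_real ?k (V s x) * G s x = \<rho> j s x * (G s x * V s x)"
              unfolding \<rho>_def clamp_eq_ratio[OF k] by (simp add: mult_ac)
            ultimately have "cutoff (Suc j) x * (clamp_real ?k (V s x) * G s x) \<le> cutoff (Suc j) x * (\<rho> j s x * (Kp s x - Kn s x))"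
              by (intro mult_left_mono cutoff_nonneg) (simp only:)
            then show ?case using True by (simp add: f_def window_def algebra_simps)
          qed
        qed (simp add: f_def window_def)
      qed
    qed
    have iwn: "integrable ?\<mu> (?wn j)"
    proof (rule Bochner_Integration.integrable_bound[OF Bochner_Integration.integrable_diff[OF iwp f] wn_meas])
      show "AE p in ?\<mu>. norm (?wn j p) \<le> norm (?wp j p - f p)"
        using ae
      proof eventually_elim
        case (elim p)
        then show ?case using wn_nonneg[of j p] unfolding real_norm_def by linarith
      qed
    qed
    have "(\<integral>p. ?wn j p \<partial>?\<mu>) \<le> (\<integral>p. ?wp j p - f p \<partial>?\<mu>)"
      by (rule integral_mono_AE[OF iwn Bochner_Integration.integrable_diff[OF iwp f] ae])
    also have "\<dots> = (\<integral>p. ?wp j p \<partial>?\<mu>) - (\<integral>p. f p \<partial>?\<mu>)"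
      by (rule Bochner_Integration.integral_diff[OF iwp f])
    also have "\<dots> \<le> X j" using wpQ f_ge by (simp add: X_def)
    finally have wnX: "(\<integral>p. ?wn j p \<partial>?\<mu>) \<le> X j" .
    moreover have "0 \<le> (\<integral>p. ?wn j p \<partial>?\<mu>)"
      by (rule Bochner_Integration.integral_nonneg[OF wn_nonneg])
    ultimately show "0 \<le> X j" by linarith
    show "(\<integral>\<^sup>+p. ennreal (?wn j p) \<partial>?\<mu>) \<le> ennreal (X j)"
      using nn_integral_eq_integral[OF iwn AE_I2[OF wn_nonneg]] wnX by (simp add: ennreal_leI)
  qed
  define X0 where "X0 = Q + (\<integral>x. (V a x)\<^sup>2 \<partial>lborel) / 2 - (\<integral>x. (V b x)\<^sup>2 \<partial>lborel) / 2"
  have "(\<lambda>j. 1 / (real (Suc j))) \<longlonglongrightarrow> 0"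
    using LIMSEQ_inverse_real_of_nat by (simp add: inverse_eq_divide)
  then have "(\<lambda>j. (b - a) * (C * (1 / real (Suc j))\<^sup>2 * M / 2)) \<longlonglongrightarrow> (b - a) * (C * 0\<^sup>2 * M / 2)"
    by (intro tendsto_intros) simp_all
  then have c0: "(\<lambda>j. (b - a) * (C / (real (Suc j))\<^sup>2 * M / 2)) \<longlonglongrightarrow> 0"
    by (simp add: power_divide)
  have "(\<lambda>j. Q + A j a - A j b + (b - a) * (C / (real (Suc j))\<^sup>2 * M / 2)) \<longlonglongrightarrow> X0 + 0"
    unfolding X0_def A_def using ab by (intro tendsto_add tendsto_diff tendsto_const c0 truncated_norm_tendsto) auto
  then have X: "X \<longlonglongrightarrow> X0" by (simp add: X_def[abs_def])
  have "0 \<le> X0" using main(1) by (intro LIMSEQ_le_const[OF X]) auto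
  then show "(\<integral>x. (V b x)\<^sup>2 \<partial>lborel) \<le> (\<integral>x. (V a x)\<^sup>2 \<partial>lborel) + 2 * Q"
    by (simp add: X0_def)
  have lim: "(\<lambda>j. ennreal (?wn j (s, x))) \<longlonglongrightarrow> ennreal (Kn s x) * indicator {a..b} s" for s x
  proof -
    obtain N :: nat where N: "\<bar>V s x\<bar> \<le> real N" using real_arch_simple by blast
    then have "\<rho> j s x = 1" if "j \<ge> N" for j
      using that unfolding \<rho>_def by (intro ratio_eq_1) simp
    then have "(\<lambda>j. \<rho> j s x) \<longlonglongrightarrow> 1"
      by (intro tendsto_eventually) (auto simp: eventually_sequentially)
    then have "(\<lambda>j. indicator {a..b} s * (cutoff (Suc j) x * (\<rho> j s x * Kn s x))) \<longlonglongrightarrow> indicator {a..b} s * (1 * (1 * Kn s x))"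
      by (intro tendsto_intros cutoff_tendsto_1)
    then have "(\<lambda>j. ennreal (?wn j (s, x))) \<longlonglongrightarrow> ennreal (indicator {a..b} s * (1 * (1 * Kn s x)))"
      unfolding window_def split_conv by (rule tendsto_ennrealI)
    then show ?thesis by (cases "s \<in> {a..b}") simp_all
  qed
  have "(\<integral>\<^sup>+s\<in>{a..b}. (\<integral>\<^sup>+x. ennreal (Kn s x) \<partial>lborel) \<partial>lborel) = (\<integral>\<^sup>+s. \<integral>\<^sup>+x. ennreal (Kn s x) * indicator {a..b} s \<partial>lborel \<partial>lborel)"
    by (intro nn_integral_cong nn_integral_multc[symmetric]) measurable
  also have "\<dots> = (\<integral>\<^sup>+s. \<integral>\<^sup>+x. (\<lambda>p. liminf (\<lambda>j. ennreal (?wn j p))) (s, x) \<partial>lborel \<partial>lborel)"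
    by (intro nn_integral_cong lim_imp_Liminf[symmetric] lim) simp
  also have "\<dots> = (\<integral>\<^sup>+p. liminf (\<lambda>j. ennreal (?wn j p)) \<partial>?\<mu>)"
    by (rule lborel.nn_integral_fst) measurable
  also have "\<dots> \<le> liminf (\<lambda>j. \<integral>\<^sup>+p. ennreal (?wn j p) \<partial>?\<mu>)"
    by (rule nn_integral_liminf) measurable
  also have "\<dots> \<le> liminf (\<lambda>j. ennreal (X j))"
    by (intro Liminf_mono always_eventually allI main)
  also have "\<dots> = ennreal X0"
    by (intro lim_imp_Liminf tendsto_ennrealI X) simp
  also have "X0 = ((\<integral>x. (V a x)\<^sup>2 \<partial>lborel) - (\<integral>x. (V b x)\<^sup>2 \<partial>lborel)) / 2 + Q"
    by (simp add: X0_def diff_divide_distrib)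
  finally show "(\<integral>\<^sup>+s\<in>{a..b}. (\<integral>\<^sup>+x. ennreal (Kn s x) \<partial>lborel) \<partial>lborel)
      \<le> ennreal (((\<integral>x. (V a x)\<^sup>2 \<partial>lborel) - (\<integral>x. (V b x)\<^sup>2 \<partial>lborel)) / 2 + Q)" .
qed

end

section \<open>Square integrable classes and Borel representatives\<close>

lemma L2_fun_in_Lp: "L2_fun u \<in> Lp 2"
  using Quotient3_rep_reflp[OF Quotient3_L2, of u] by (simp add: L2_rel_def L2_fun_def)

lemma L2_rel_rep_abs: "f \<in> Lp 2 \<Longrightarrow> L2_rel (rep_L2 (abs_L2 f)) f"
  using rep_abs_rsp_left[OF Quotient3_L2, of f f] by (simp add: L2_rel_def)

lemma L2_fun_abs: "f \<in> Lp 2 \<Longrightarrow> AE x in lebesgue. L2_fun (abs_L2 f) x = f x"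
  using L2_rel_rep_abs[of f] by (simp add: L2_rel_def L2_fun_def)

lemma L2_fun_diff: "AE x in lebesgue. L2_fun (u - w) x = L2_fun u x - L2_fun w x"
  using L2_fun_abs[OF Lp_2_diff[OF L2_fun_in_Lp L2_fun_in_Lp]] by (simp add: minus_L2_def L2_fun_def)

lemma norm_L2_square: "(norm u)\<^sup>2 = (\<integral>x. (L2_fun u x)\<^sup>2 \<partial>lebesgue)"
  unfolding power2_norm_eq_inner inner_L2_def L2_fun_def by (simp add: power2_eq_square)

lemma borel_representative:
  fixes f :: "'a::euclidean_space \<Rightarrow> real"
  assumes "f \<in> borel_measurable lebesgue"
  shows "\<exists>f'\<in>borel_measurable borel. AE x in lborel. f x = f' x"
  using completion_ex_borel_measurable_real[OF assms] by simp

lemma borel_measurable_completion_AE: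
  fixes f f' :: "'b \<Rightarrow> 'c::topological_space"
  assumes f': "f' \<in> borel_measurable (completion M)" and ae: "AE x in completion M. f x = f' x"
  shows "f \<in> borel_measurable (completion M)"
proof (rule measurableI)
  fix A :: "'c set" assume A: "A \<in> sets borel"
  obtain N where N: "{x \<in> space (completion M). f x \<noteq> f' x} \<subseteq> N" "N \<in> null_sets (completion M)"
    using ae unfolding eventually_ae_filter by blast
  have eq: "f x = f' x" if "x \<in> space (completion M)" "x \<notin> N" for x
    using N(1) that by (auto simp: subset_eq)
  have "f -` A \<inter> space (completion M) = (f' -` A \<inter> space (completion M) - N) \<union> (f -` A \<inter> space (completion M) \<inter> N)"
  proof (rule set_eqI)
    fix x
    show "x \<in> f -` A \<inter> space (completion M) \<longleftrightarrow> x \<in> (f' -` A \<inter> space (completion M) - N) \<union> (f -` A \<inter> space (completion M) \<inter> N)"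
      using eq[of x] by (cases "x \<in> N"; cases "x \<in> space (completion M)") simp_all
  qed
  moreover have "f -` A \<inter> space (completion M) \<inter> N \<in> null_sets (completion M)"
    by (rule null_sets_completion_subset[OF _ N(2)]) (rule Int_lower2)
  moreover have "f' -` A \<inter> space (completion M) - N \<in> sets (completion M)"
    using measurable_sets[OF f' A] N(2) by auto
  ultimately show "f -` A \<inter> space (completion M) \<in> sets (completion M)"
    by (metis null_setsD2 sets.Un)
qed simp

lemma integral_lebesgue_eq:
  fixes f f' :: "'a::euclidean_space \<Rightarrow> real"
  assumes "f' \<in> borel_measurable borel" "AE x in lborel. f x = f' x"
  shows "(\<integral>x. f x \<partial>lebesgue) = (\<integral>x. f' x \<partial>lborel)"
    and "integrable lebesgue f \<Longrightarrow> integrable lborel f'"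
proof -
  have ae: "AE x in lebesgue. f x = f' x" using assms(2) by (rule AE_completion)
  have meas: "f' \<in> borel_measurable lebesgue" using assms(1) by (simp add: measurable_completion)
  have meas': "f \<in> borel_measurable lebesgue"
    by (rule borel_measurable_completion_AE[OF meas ae])
  show "(\<integral>x. f x \<partial>lebesgue) = (\<integral>x. f' x \<partial>lborel)"
    using integral_cong_AE[OF meas' meas ae] assms(1) by (simp add: integral_completion)
  show "integrable lebesgue f \<Longrightarrow> integrable lborel f'"
    using Bochner_Integration.integrable_cong_AE[OF meas' meas ae] assms(1) by (simp add: integrable_completion)
qed

lemma norm_L2_square_lborel:
  assumes "w \<in> borel_measurable borel" "AE x in lborel. L2_fun u x = w x"
  shows "(norm u)\<^sup>2 = (\<integral>x. (w x)\<^sup>2 \<partial>lborel)" "integrable lborel (\<lambda>x. (w x)\<^sup>2)"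
proof -
  have ae: "AE x in lborel. (L2_fun u x)\<^sup>2 = (w x)\<^sup>2" using assms(2) by eventually_elim simp
  have meas: "(\<lambda>x. (w x)\<^sup>2) \<in> borel_measurable borel" using assms(1) by measurable
  show "(norm u)\<^sup>2 = (\<integral>x. (w x)\<^sup>2 \<partial>lborel)"
    unfolding norm_L2_square by (rule integral_lebesgue_eq(1)[OF meas ae])
  show "integrable lborel (\<lambda>x. (w x)\<^sup>2)"
    using integral_lebesgue_eq(2)[OF meas ae] L2_fun_in_Lp[of u] by (simp add: Lp_2_iff)
qed

lemma L2_borel_representative:
  "\<exists>w. w \<in> borel_measurable borel \<and> (AE x in lborel. L2_fun u x = w x)"
  using borel_representative[OF Lp_2_measurable[OF L2_fun_in_Lp[of u]]] by blast

text \<open>The sum of the squares has finite integral, hence is finite almost everywhere.\<close>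

lemma AE_tendsto_0_if_summable:
  fixes d :: "nat \<Rightarrow> 'b \<Rightarrow> real"
  assumes [measurable]: "\<And>k. d k \<in> borel_measurable M" and le: "\<And>k. (\<integral>\<^sup>+x. ennreal ((d k x)\<^sup>2) \<partial>M) \<le> ennreal (C * q ^ k)"
    and q: "0 \<le> C" "0 \<le> q" "q < 1"
  shows "AE x in M. (\<lambda>k. d k x) \<longlonglongrightarrow> 0"
proof -
  have "(\<integral>\<^sup>+x. (\<Sum>k. ennreal ((d k x)\<^sup>2)) \<partial>M) = (\<Sum>k. \<integral>\<^sup>+x. ennreal ((d k x)\<^sup>2) \<partial>M)"
    by (rule nn_integral_suminf) measurable
  also have "\<dots> \<le> (\<Sum>k. ennreal (C * q ^ k))"
    by (intro suminf_le le) auto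
  also have "\<dots> = ennreal (\<Sum>k. C * q ^ k)"
    using q by (intro suminf_ennreal2 summable_mult summable_geometric) auto
  finally have "(\<integral>\<^sup>+x. (\<Sum>k. ennreal ((d k x)\<^sup>2)) \<partial>M) \<noteq> \<infinity>" by (auto simp: top_unique)
  then have "AE x in M. (\<Sum>k. ennreal ((d k x)\<^sup>2)) \<noteq> \<infinity>"
    by (intro nn_integral_PInf_AE) measurable
  then show ?thesis
  proof eventually_elim
    case (elim x)
    then have "summable (\<lambda>k. (d k x)\<^sup>2)"
      by (intro summable_suminf_not_top) auto
    then have "(\<lambda>k. (d k x)\<^sup>2) \<longlonglongrightarrow> 0" by (rule summable_LIMSEQ_zero)
    then have "(\<lambda>k. sqrt ((d k x)\<^sup>2)) \<longlonglongrightarrow> sqrt 0" by (rule tendsto_real_sqrt)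
    then show ?case by (simp add: tendsto_rabs_zero_iff)
  qed
qed

text \<open>The representatives \<open>L2_fun (v s)\<close> are chosen independently for each
  \<open>s\<close>, so a jointly measurable choice has to be constructed: sample
  \<open>v\<close> on grids fine enough for the squared errors to be at most \<open>(1/2) ^
  k\<close> and take the pointwise limit.\<close>

lemma measurable_version:
  fixes v :: "real \<Rightarrow> 'a::euclidean_space L2"
  assumes cont: "continuous_on {a..b} v" and ab: "a \<le> b"
  shows "\<exists>V. (\<lambda>(s, x). V s x) \<in> borel_measurable (lborel \<Otimes>\<^sub>M lborel) \<and>
     (\<forall>s\<in>{a..b}. AE x in lborel. L2_fun (v s) x = V s x)"
proof -
  have "\<forall>u::'a L2. \<exists>w. w \<in> borel_measurable borel \<and> (AE x in lborel. L2_fun u x = w x)"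
    using L2_borel_representative by blast
  then obtain rep where rep: "\<And>u::'a L2. rep u \<in> borel_measurable borel"
    "\<And>u::'a L2. AE x in lborel. L2_fun u x = rep u x" by metis
  have uc: "uniformly_continuous_on {a..b} v"
    by (rule compact_uniformly_continuous[OF cont]) simp
  have "\<exists>m::nat. 0 < m \<and> (\<forall>s\<in>{a..b}. \<forall>t\<in>{a..b}. \<bar>s - t\<bar> \<le> 1 / real m \<longrightarrow> (norm (v s - v t))\<^sup>2 \<le> (1/2) ^ k)" for k :: nat
  proof -
    have "0 < sqrt ((1/2) ^ k)" by simp
    then obtain d where d: "d > 0" "\<And>s t. s \<in> {a..b} \<Longrightarrow> t \<in> {a..b} \<Longrightarrow> dist t s < d \<Longrightarrow> dist (v t) (v s) < sqrt ((1/2) ^ k)"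
      using uc unfolding uniformly_continuous_on_def by metis
    obtain m where m: "1 / real (Suc m) < d" using nat_approx_posE[OF d(1)] by blast
    have "(norm (v s - v t))\<^sup>2 \<le> (1/2) ^ k" if "s \<in> {a..b}" "t \<in> {a..b}" "\<bar>s - t\<bar> \<le> 1 / real (Suc m)" for s t
    proof -
      have "norm (v s - v t) < sqrt ((1/2) ^ k)"
        using d(2)[of t s] that m by (simp add: dist_norm)
      then have "(norm (v s - v t))\<^sup>2 \<le> (sqrt ((1/2) ^ k))\<^sup>2" by (intro power_mono) auto
      then show ?thesis by simp
    qed
    then show ?thesis by (intro exI[of _ "Suc m"]) auto
  qed
  then obtain m :: "nat \<Rightarrow> nat" where m: "\<And>k. 0 < m k"
    "\<And>k s t. s \<in> {a..b} \<Longrightarrow> t \<in> {a..b} \<Longrightarrow> \<bar>s - t\<bar> \<le> 1 / real (m k) \<Longrightarrow> (norm (v s - v t))\<^sup>2 \<le> (1/2) ^ k"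
    by metis
  \<comment> \<open>the maximum keeps the sample points, which are rounded down, inside
    \<open>{a..b}\<close>\<close>
  define grid where "grid k (i::int) = max a (real_of_int i / real (m k))" for k i
  define W where "W k s x = rep (v (grid k \<lfloor>s * real (m k)\<rfloor>)) x" for k s x
  have grid: "grid k \<lfloor>s * real (m k)\<rfloor> \<in> {a..b}" "\<bar>grid k \<lfloor>s * real (m k)\<rfloor> - s\<bar> \<le> 1 / real (m k)" if s: "s \<in> {a..b}" for k s
  proof -
    let ?i = "real_of_int \<lfloor>s * real (m k)\<rfloor> / real (m k)"
    have "?i \<le> s * real (m k) / real (m k)" by (intro divide_right_mono) auto
    then have 1: "?i \<le> s" using m(1)[of k] by simp
    have "s * real (m k) / real (m k) \<le> (real_of_int \<lfloor>s * real (m k)\<rfloor> + 1) / real (m k)"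
      by (intro divide_right_mono) linarith+
    then have 2: "s \<le> ?i + 1 / real (m k)" using m(1)[of k] by (simp add: add_divide_distrib)
    show "grid k \<lfloor>s * real (m k)\<rfloor> \<in> {a..b}" "\<bar>grid k \<lfloor>s * real (m k)\<rfloor> - s\<bar> \<le> 1 / real (m k)"
      unfolding grid_def using 1 2 s ab by (auto simp: max_def)
  qed
  have W_meas[measurable]: "(\<lambda>(s, x). W k s x) \<in> borel_measurable (lborel \<Otimes>\<^sub>M lborel)" for k
  proof -
    have "(\<lambda>p. (\<lambda>i p. rep (v (grid k i)) (snd p)) \<lfloor>fst p * real (m k)\<rfloor> p) \<in> borel_measurable (lborel \<Otimes>\<^sub>M lborel)"
    proof (rule measurable_compose_countable)
      show "(\<lambda>p. rep (v (grid k i)) (snd p)) \<in> borel_measurable (lborel \<Otimes>\<^sub>M (lborel::'a measure))" for i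
        using rep(1)[of "v (grid k i)"] by measurable
      show "(\<lambda>p. \<lfloor>fst p * real (m k)\<rfloor>) \<in> lborel \<Otimes>\<^sub>M (lborel::'a measure) \<rightarrow>\<^sub>M count_space UNIV" by measurable
    qed
    then show ?thesis by (simp add: W_def case_prod_unfold)
  qed
  define V where "V s x = lim (\<lambda>k. W k s x)" for s x
  have "(\<lambda>p. lim (\<lambda>k. (case p of (s, x) \<Rightarrow> W k s x))) \<in> borel_measurable (lborel \<Otimes>\<^sub>M lborel)"
    by (rule borel_measurable_lim_metric[OF W_meas])
  then have "(\<lambda>(s, x). V s x) \<in> borel_measurable (lborel \<Otimes>\<^sub>M lborel)"
    by (simp add: V_def case_prod_unfold)
  moreover have "AE x in lborel. L2_fun (v s) x = V s x" if s: "s \<in> {a..b}" for s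
  proof -
    have Wk: "W k s \<in> borel_measurable borel" for k unfolding W_def[abs_def] by (simp add: rep(1))
    have d_meas: "(\<lambda>x. W k s x - rep (v s) x) \<in> borel_measurable lborel" for k
      using Wk[of k] rep(1)[of "v s"] by measurable
    have "AE x in lborel. (\<lambda>k. W k s x - rep (v s) x) \<longlonglongrightarrow> 0"
    proof (rule AE_tendsto_0_if_summable[OF d_meas, where C = 1 and q = "1/2"])
      fix k
      let ?t = "grid k \<lfloor>s * real (m k)\<rfloor>"
      have ae: "AE x in lborel. L2_fun (v ?t - v s) x = W k s x - rep (v s) x"
        using rep(2)[of "v ?t"] rep(2)[of "v s"] L2_fun_diff[of "v ?t" "v s", unfolded AE_completion_iff]
        by eventually_elim (simp add: W_def)
      have dm: "(\<lambda>x. W k s x - rep (v s) x) \<in> borel_measurable borel" using d_meas by simp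
      have "(\<integral>\<^sup>+x. ennreal ((W k s x - rep (v s) x)\<^sup>2) \<partial>lborel) = ennreal ((norm (v ?t - v s))\<^sup>2)"
        using norm_L2_square_lborel[OF dm ae] by (simp add: nn_integral_eq_integral)
      also have "\<dots> \<le> ennreal ((1/2) ^ k)"
        by (intro ennreal_leI m(2) grid s)
      finally show "(\<integral>\<^sup>+x. ennreal ((W k s x - rep (v s) x)\<^sup>2) \<partial>lborel) \<le> ennreal (1 * (1/2) ^ k)" by simp
    qed simp_all
    with rep(2)[of "v s"] show ?thesis
    proof eventually_elim
      case (elim x)
      then have "(\<lambda>k. W k s x - rep (v s) x + rep (v s) x) \<longlonglongrightarrow> 0 + rep (v s) x"
        by (intro tendsto_add tendsto_const)
      then have "V s x = rep (v s) x" unfolding V_def by (intro limI) simp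
      then show ?case using elim by simp
    qed
  qed
  ultimately show ?thesis by blast
qed

section \<open>Test functions, restriction and difference of evolutions\<close>

lemma partial_deriv_support:
  fixes \<phi> :: "'a::euclidean_space \<Rightarrow> real"
  assumes R: "\<And>x. \<phi> x \<noteq> 0 \<Longrightarrow> norm x \<le> R" and nz: "partial_deriv b \<phi> x \<noteq> 0"
  shows "norm x \<le> R"
proof (rule ccontr)
  assume *: "\<not> norm x \<le> R"
  have op: "open {x::'a. R < norm x}" by (intro open_Collect_less continuous_intros)
  have "(\<phi> has_derivative (\<lambda>_. 0)) (at x)"
    by (rule has_derivative_transform_within_open[OF has_derivative_const[of 0] op])
       (use * R in force)+
  from frechet_derivative_at[OF this] have "partial_deriv b \<phi> x = 0"
    unfolding partial_deriv_def by metis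
  then show False using nz by simp
qed

lemma smooth_partial_deriv: "smooth \<phi> \<Longrightarrow> b \<in> Basis \<Longrightarrow> smooth (partial_deriv b \<phi>)"
  unfolding smooth_def by (metis Ck.simps(2))

lemma smooth_continuous: "smooth \<phi> \<Longrightarrow> continuous_on UNIV \<phi>"
  unfolding smooth_def by (metis Ck.simps(1))

lemma test_function_partial_deriv:
  assumes "test_function \<phi>" "b \<in> Basis"
  shows "test_function (partial_deriv b \<phi>)"
proof -
  obtain R where R: "\<And>x. \<phi> x \<noteq> 0 \<Longrightarrow> norm x \<le> R" and sm: "smooth \<phi>"
    using assms(1) by (auto simp: test_function_def)
  show ?thesis
    unfolding test_function_def using partial_deriv_support[OF R] smooth_partial_deriv[OF sm assms(2)] by blast
qed

lemma test_function_bounds: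
  fixes \<phi> :: "'a::euclidean_space \<Rightarrow> real"
  assumes "test_function \<phi>"
  obtains C R where "0 \<le> C" "\<phi> \<in> borel_measurable borel" "\<And>x. \<bar>\<phi> x\<bar> \<le> C" "\<And>x. \<phi> x \<noteq> 0 \<Longrightarrow> x \<in> cball 0 R"
    "laplacian \<phi> \<in> borel_measurable borel" "\<And>x. \<bar>laplacian \<phi> x\<bar> \<le> C" "\<And>x. laplacian \<phi> x \<noteq> 0 \<Longrightarrow> x \<in> cball 0 R"
proof -
  obtain R where R: "\<And>x. \<phi> x \<noteq> 0 \<Longrightarrow> norm x \<le> R" and sm: "smooth \<phi>"
    using assms by (auto simp: test_function_def)
  have supp: "\<phi> x \<noteq> 0 \<Longrightarrow> x \<in> cball 0 R" for x using R by simp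
  have lsupp: "x \<in> cball 0 R" if nz: "laplacian \<phi> x \<noteq> 0" for x
  proof -
    obtain b where b: "b \<in> Basis" "partial_deriv b (partial_deriv b \<phi>) x \<noteq> 0"
      using nz unfolding laplacian_def by (meson sum.neutral)
    have "norm x \<le> R"
      by (rule partial_deriv_support[OF partial_deriv_support[OF R] b(2)])
    then show ?thesis by simp
  qed
  have "continuous_on UNIV (\<lambda>x. \<Sum>b\<in>Basis. partial_deriv b (partial_deriv b \<phi>) x)"
    by (intro continuous_on_sum smooth_continuous smooth_partial_deriv sm)
  then have lcont: "continuous_on UNIV (laplacian \<phi>)" unfolding laplacian_def[abs_def] .
  obtain C1 where C1: "0 \<le> C1" "\<And>x. \<bar>\<phi> x\<bar> \<le> C1"
    using bounded_if_continuous_supported[OF smooth_continuous[OF sm] supp] by blast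
  obtain C2 where C2: "0 \<le> C2" "\<And>x. \<bar>laplacian \<phi> x\<bar> \<le> C2"
    using bounded_if_continuous_supported[OF lcont lsupp] by blast
  show thesis
  proof (rule that[of "C1 + C2" R])
    show "\<phi> \<in> borel_measurable borel" "laplacian \<phi> \<in> borel_measurable borel"
      by (intro borel_measurable_continuous_onI smooth_continuous sm lcont)+
    show "\<bar>\<phi> x\<bar> \<le> C1 + C2" "\<bar>laplacian \<phi> x\<bar> \<le> C1 + C2" for x
      using C1(1) C1(2)[of x] C2(1) C2(2)[of x] by linarith+
  qed (use C1(1) C2(1) supp lsupp in auto)
qed

lemma slab_integrable_add:
  assumes "slab_integrable a b F" "slab_integrable a b H"
  shows "slab_integrable a b (\<lambda>s x. F s x + H s x)"
  unfolding slab_integrable_def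
proof (intro conjI allI)
  have [measurable]: "(\<lambda>(s, x). F s x) \<in> borel_measurable (lborel \<Otimes>\<^sub>M lborel)" "(\<lambda>(s, x). H s x) \<in> borel_measurable (lborel \<Otimes>\<^sub>M lborel)"
    using assms by (auto simp: slab_integrable_def)
  show "(\<lambda>(s, x). F s x + H s x) \<in> borel_measurable (lborel \<Otimes>\<^sub>M lborel)" by measurable
  fix R
  have "(\<integral>\<^sup>+s\<in>{a..b}. (\<integral>\<^sup>+x\<in>cball 0 R. ennreal \<bar>F s x + H s x\<bar> \<partial>lborel) \<partial>lborel)
    \<le> (\<integral>\<^sup>+s. (\<integral>\<^sup>+x. ennreal \<bar>F s x\<bar> * indicator (cball 0 R) x + ennreal \<bar>H s x\<bar> * indicator (cball 0 R) x \<partial>lborel) * indicator {a..b} s \<partial>lborel)"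
    by (intro nn_integral_mono mult_right_mono[OF nn_integral_mono] ennreal_mult_split) auto
  also have "\<dots> = (\<integral>\<^sup>+s. ((\<integral>\<^sup>+x\<in>cball 0 R. ennreal \<bar>F s x\<bar> \<partial>lborel) + (\<integral>\<^sup>+x\<in>cball 0 R. ennreal \<bar>H s x\<bar> \<partial>lborel)) * indicator {a..b} s \<partial>lborel)"
    by (intro nn_integral_cong arg_cong2[where f = "(*)"] refl nn_integral_add) measurable
  also have "\<dots> = (\<integral>\<^sup>+s. (\<integral>\<^sup>+x\<in>cball 0 R. ennreal \<bar>F s x\<bar> \<partial>lborel) * indicator {a..b} s + (\<integral>\<^sup>+x\<in>cball 0 R. ennreal \<bar>H s x\<bar> \<partial>lborel) * indicator {a..b} s \<partial>lborel)"
    by (simp add: distrib_right)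
  also have "\<dots> = (\<integral>\<^sup>+s\<in>{a..b}. (\<integral>\<^sup>+x\<in>cball 0 R. ennreal \<bar>F s x\<bar> \<partial>lborel) \<partial>lborel) + (\<integral>\<^sup>+s\<in>{a..b}. (\<integral>\<^sup>+x\<in>cball 0 R. ennreal \<bar>H s x\<bar> \<partial>lborel) \<partial>lborel)"
    by (rule nn_integral_add) measurable
  also have "\<dots> < \<infinity>" using assms by (simp add: slab_integrable_def)
  finally show "(\<integral>\<^sup>+s\<in>{a..b}. (\<integral>\<^sup>+x\<in>cball 0 R. ennreal \<bar>F s x + H s x\<bar> \<partial>lborel) \<partial>lborel) < \<infinity>" .
qed

lemma slab_integrable_test:
  fixes F :: "real \<Rightarrow> 'a::euclidean_space \<Rightarrow> real"
  assumes F: "slab_integrable a b F"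
    and \<phi>_meas[measurable]: "\<phi> \<in> borel_measurable borel" and \<phi>: "\<And>x. \<bar>\<phi> x\<bar> \<le> C" "\<And>x. \<phi> x \<noteq> 0 \<Longrightarrow> x \<in> cball 0 R"
  shows "AE s in lborel. s \<in> {a..b} \<longrightarrow> integrable lborel (\<lambda>x. F s x * \<phi> x)"
    and "(\<lambda>s. \<integral>x. F s x * \<phi> x \<partial>lborel) \<in> borel_measurable borel"
    and "set_integrable lborel {a..b} (\<lambda>s. \<integral>x. F s x * \<phi> x \<partial>lborel)"
proof -
  have F_meas[measurable]: "(\<lambda>(s, x). F s x) \<in> borel_measurable (lborel \<Otimes>\<^sub>M lborel)" using F by (simp add: slab_integrable_def)
  have Fs[measurable]: "F s \<in> borel_measurable borel" for s
    using measurable_compose[OF measurable_Pair1'[of s lborel lborel] F_meas] by simp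
  define g where "g s = (\<integral>\<^sup>+x\<in>cball (0::'a) R. ennreal \<bar>F s x\<bar> \<partial>lborel)" for s
  have g_meas[measurable]: "g \<in> borel_measurable lborel" unfolding g_def by measurable
  have fin: "(\<integral>\<^sup>+s. g s * indicator {a..b} s \<partial>lborel) < \<infinity>" using F by (simp add: slab_integrable_def g_def)
  have C0: "0 \<le> C" using \<phi>(1)[of 0] by linarith
  have le: "(\<integral>\<^sup>+x. ennreal \<bar>F s x * \<phi> x\<bar> \<partial>lborel) \<le> ennreal C * g s" for s
  proof -
    have "(\<integral>\<^sup>+x. ennreal \<bar>F s x * \<phi> x\<bar> \<partial>lborel) \<le> (\<integral>\<^sup>+x. ennreal C * (ennreal \<bar>F s x\<bar> * indicator (cball 0 R) x) \<partial>lborel)"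
    proof (rule nn_integral_mono)
      fix x
      show "ennreal \<bar>F s x * \<phi> x\<bar> \<le> ennreal C * (ennreal \<bar>F s x\<bar> * indicator (cball 0 R) x)"
      proof (cases "\<phi> x = 0")
        case False
        have "\<bar>F s x * \<phi> x\<bar> \<le> C * \<bar>F s x\<bar>" 
          using mult_right_mono[OF \<phi>(1)[of x], of "\<bar>F s x\<bar>"] by (simp add: abs_mult mult.commute)
        then have "ennreal \<bar>F s x * \<phi> x\<bar> \<le> ennreal C * ennreal \<bar>F s x\<bar>"
          using ennreal_leI C0 by (simp add: ennreal_mult'[symmetric])
        then show ?thesis using \<phi>(2)[OF False] by simp
      qed simp
    qed
    also have "\<dots> = ennreal C * g s" unfolding g_def by (rule nn_integral_cmult) measurable
    finally show ?thesis .
  qed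
  have "AE s in lborel. g s * indicator {a..b} s \<noteq> \<infinity>"
    by (rule nn_integral_PInf_AE) (use fin in auto)
  then show "AE s in lborel. s \<in> {a..b} \<longrightarrow> integrable lborel (\<lambda>x. F s x * \<phi> x)"
  proof eventually_elim
    case (elim s)
    show ?case
    proof
      assume "s \<in> {a..b}"
      then have "g s < \<infinity>" using elim by (simp add: less_top)
      then have "ennreal C * g s < \<infinity>" by (simp add: ennreal_mult_less_top)
      then show "integrable lborel (\<lambda>x. F s x * \<phi> x)"
        using le[of s] by (intro integrableI_bounded) (auto intro: le_less_trans)
    qed
  qed
  have "(\<lambda>s. \<integral>x. F s x * \<phi> x \<partial>lborel) \<in> borel_measurable lborel" by measurable
  then show meas[measurable]: "(\<lambda>s. \<integral>x. F s x * \<phi> x \<partial>lborel) \<in> borel_measurable borel" by simp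
  show "set_integrable lborel {a..b} (\<lambda>s. \<integral>x. F s x * \<phi> x \<partial>lborel)"
    unfolding set_integrable_def
  proof (rule integrableI_bounded)
    have pt: "ennreal (norm (indicator {a..b} s *\<^sub>R (\<integral>x. F s x * \<phi> x \<partial>lborel))) \<le> ennreal C * (g s * indicator {a..b} s)" for s
    proof -
      have "ennreal \<bar>\<integral>x. F s x * \<phi> x \<partial>lborel\<bar> \<le> (\<integral>\<^sup>+x. ennreal \<bar>F s x * \<phi> x\<bar> \<partial>lborel)"
      proof (cases "integrable lborel (\<lambda>x. F s x * \<phi> x)")
        case True from integral_norm_bound_ennreal[OF this] show ?thesis by simp
      qed (simp add: not_integrable_integral_eq)
      then show ?thesis using le[of s] by (auto simp: indicator_def)
    qed
    have "(\<integral>\<^sup>+s. ennreal (norm (indicator {a..b} s *\<^sub>R (\<integral>x. F s x * \<phi> x \<partial>lborel))) \<partial>lborel)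
      \<le> (\<integral>\<^sup>+s. ennreal C * (g s * indicator {a..b} s) \<partial>lborel)"
      by (intro nn_integral_mono pt)
    also have "\<dots> = ennreal C * (\<integral>\<^sup>+s. g s * indicator {a..b} s \<partial>lborel)" by (rule nn_integral_cmult) measurable
    also have "\<dots> < \<infinity>" using fin by (simp add: ennreal_mult_less_top)
    finally show "(\<integral>\<^sup>+s. ennreal (norm (indicator {a..b} s *\<^sub>R (\<integral>x. F s x * \<phi> x \<partial>lborel))) \<partial>lborel) < \<infinity>" .
  qed measurable
qed

lemma weak_evolutionI:
  assumes "a \<le> b" "slab_integrable a b G"
    "(\<lambda>(s, x). V s x) \<in> borel_measurable (lborel \<Otimes>\<^sub>M lborel)"
    "\<And>s. s \<in> {a..b} \<Longrightarrow> integrable lborel (\<lambda>x. (V s x)\<^sup>2)"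
    "\<And>s. s \<in> {a..b} \<Longrightarrow> (\<integral>x. (V s x)\<^sup>2 \<partial>lborel) \<le> M"
    "\<And>t \<phi>. t \<in> {a..b} \<Longrightarrow> test_function \<phi> \<Longrightarrow>
      (\<integral>x. V t x * \<phi> x \<partial>lborel) = (\<integral>x. V a x * \<phi> x \<partial>lborel) +
      (LINT s:{a..t}|lborel. (\<integral>x. V s x * laplacian \<phi> x \<partial>lborel) + (\<integral>x. G s x * \<phi> x \<partial>lborel))"
  shows "weak_evolution a b M V G"
proof
  show "(\<lambda>(s, x). G s x) \<in> borel_measurable (lborel \<Otimes>\<^sub>M lborel)"
    "(\<integral>\<^sup>+s\<in>{a..b}. (\<integral>\<^sup>+x\<in>cball 0 R. ennreal \<bar>G s x\<bar> \<partial>lborel) \<partial>lborel) < \<infinity>" for R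
    using assms(2) by (simp_all add: slab_integrable_def)
qed (fact assms)+

lemma (in weak_evolution) test_integrable:
  assumes "test_function \<phi>"
  shows "set_integrable lborel {a..b} (\<lambda>s. (\<integral>x. V s x * laplacian \<phi> x \<partial>lborel) + (\<integral>x. G s x * \<phi> x \<partial>lborel))"
proof -
  obtain C R where C: "0 \<le> C" "\<phi> \<in> borel_measurable borel" "\<And>x. \<bar>\<phi> x\<bar> \<le> C" "\<And>x. \<phi> x \<noteq> 0 \<Longrightarrow> x \<in> cball 0 R"
    "laplacian \<phi> \<in> borel_measurable borel" "\<And>x. \<bar>laplacian \<phi> x\<bar> \<le> C" "\<And>x. laplacian \<phi> x \<noteq> 0 \<Longrightarrow> x \<in> cball 0 R"
    using test_function_bounds[OF assms] by blast
  show ?thesis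
    by (intro set_integral_add slab_integrable_test(3)[OF slab_V C(5-7)] slab_integrable_test(3)[OF slab_G C(2-4)])
qed

lemma (in weak_evolution) subinterval:
  assumes "a \<le> a'" "a' \<le> b'" "b' \<le> b"
  shows "weak_evolution a' b' M V G"
proof
  have sub: "{a'..b'} \<subseteq> {a..b}" using assms by auto
  show "s \<in> {a'..b'} \<Longrightarrow> integrable lborel (\<lambda>x. (V s x)\<^sup>2)" "s \<in> {a'..b'} \<Longrightarrow> (\<integral>x. (V s x)\<^sup>2 \<partial>lborel) \<le> M" for s
    using sub V_sq V_le by auto
  show "(\<integral>\<^sup>+s\<in>{a'..b'}. (\<integral>\<^sup>+x\<in>cball 0 R. ennreal \<bar>G s x\<bar> \<partial>lborel) \<partial>lborel) < \<infinity>" for R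
  proof (rule le_less_trans[OF _ G_loc[of R]], rule nn_integral_mono)
    show "(\<integral>\<^sup>+x\<in>cball 0 R. ennreal \<bar>G s x\<bar> \<partial>lborel) * indicator {a'..b'} s \<le> (\<integral>\<^sup>+x\<in>cball 0 R. ennreal \<bar>G s x\<bar> \<partial>lborel) * indicator {a..b} s" for s
      using sub by (intro mult_left_mono) (auto simp: indicator_def)
  qed
  fix t and \<phi> :: "'a \<Rightarrow> real" assume t: "t \<in> {a'..b'}" and \<phi>: "test_function \<phi>"
  have ta: "t \<in> {a..b}" "a' \<in> {a..b}" using t assms by auto
  show "(\<integral>x. V t x * \<phi> x \<partial>lborel) = (\<integral>x. V a' x * \<phi> x \<partial>lborel) +
      (LINT s:{a'..t}|lborel. (\<integral>x. V s x * laplacian \<phi> x \<partial>lborel) + (\<integral>x. G s x * \<phi> x \<partial>lborel))"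
    using weak[OF ta(1) \<phi>] weak[OF ta(2) \<phi>] t assms
      set_integral_combine[of a t "\<lambda>s. (\<integral>x. V s x * laplacian \<phi> x \<partial>lborel) + (\<integral>x. G s x * \<phi> x \<partial>lborel)" a']
      set_integrable_subset[OF test_integrable[OF \<phi>], of "{a..t}"]
    by simp
qed (use assms in auto)

text \<open>The equation is linear in \<open>V\<close> and \<open>G\<close>, but the integrals
  over space may be split only at the times at which \<open>G\<close> and \<open>G'\<close>
  are integrable against the test function; these are almost all times.\<close>

lemma weak_evolution_diff:
  assumes e: "weak_evolution a b M V G" and e': "weak_evolution a b M' V' G'"
  shows "weak_evolution a b (2 * M + 2 * M') (\<lambda>s x. V s x - V' s x) (\<lambda>s x. G s x - G' s x)"
proof -
  interpret A: weak_evolution a b M V G by (rule e)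
  interpret B: weak_evolution a b M' V' G' by (rule e')
  note [measurable] = A.V_meas A.G_meas B.V_meas B.G_meas A.V_meas1 B.V_meas1
  have slabm: "slab_integrable a b (\<lambda>s x. - G' s x)"
    using B.slab_G unfolding slab_integrable_def by simp
  have le: "(p - q)\<^sup>2 \<le> 2 * p\<^sup>2 + 2 * q\<^sup>2" for p q :: real
    using zero_le_power2[of "p + q"] by (simp add: power2_eq_square algebra_simps)
  show ?thesis
  proof (rule weak_evolutionI)
    show "a \<le> b" by (rule A.ab)
    show "slab_integrable a b (\<lambda>s x. G s x - G' s x)"
      using slab_integrable_add[OF A.slab_G slabm] by simp
    show "(\<lambda>(s, x). V s x - V' s x) \<in> borel_measurable (lborel \<Otimes>\<^sub>M lborel)" by measurable
    fix s assume s: "s \<in> {a..b}"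
    have i: "integrable lborel (\<lambda>x. 2 * (V s x)\<^sup>2 + 2 * (V' s x)\<^sup>2)" using A.V_sq[OF s] B.V_sq[OF s] by simp
    show i2: "integrable lborel (\<lambda>x. (V s x - V' s x)\<^sup>2)"
      by (rule Bochner_Integration.integrable_bound[OF i]) (auto intro!: AE_I2 order_trans[OF le])
    have "(\<integral>x. (V s x - V' s x)\<^sup>2 \<partial>lborel) \<le> (\<integral>x. 2 * (V s x)\<^sup>2 + 2 * (V' s x)\<^sup>2 \<partial>lborel)"
      by (rule integral_mono[OF i2 i le])
    also have "\<dots> = 2 * (\<integral>x. (V s x)\<^sup>2 \<partial>lborel) + 2 * (\<integral>x. (V' s x)\<^sup>2 \<partial>lborel)" using A.V_sq[OF s] B.V_sq[OF s] by simp
    also have "\<dots> \<le> 2 * M + 2 * M'" using A.V_le[OF s] B.V_le[OF s] by simp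
    finally show "(\<integral>x. (V s x - V' s x)\<^sup>2 \<partial>lborel) \<le> 2 * M + 2 * M'" .
  next
    fix t and \<phi> :: "'a \<Rightarrow> real" assume t: "t \<in> {a..b}" and \<phi>: "test_function \<phi>"
    obtain C R where C: "0 \<le> C" "\<phi> \<in> borel_measurable borel" "\<And>x. \<bar>\<phi> x\<bar> \<le> C" "\<And>x. \<phi> x \<noteq> 0 \<Longrightarrow> x \<in> cball 0 R"
      "laplacian \<phi> \<in> borel_measurable borel" "\<And>x. \<bar>laplacian \<phi> x\<bar> \<le> C" "\<And>x. laplacian \<phi> x \<noteq> 0 \<Longrightarrow> x \<in> cball 0 R"
      using test_function_bounds[OF \<phi>] by blast
    note C(2,5)[measurable]
    let ?I = "\<lambda>s. (\<integral>x. V s x * laplacian \<phi> x \<partial>lborel) + (\<integral>x. G s x * \<phi> x \<partial>lborel)"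
    let ?I' = "\<lambda>s. (\<integral>x. V' s x * laplacian \<phi> x \<partial>lborel) + (\<integral>x. G' s x * \<phi> x \<partial>lborel)"
    let ?J = "\<lambda>s. (\<integral>x. (V s x - V' s x) * laplacian \<phi> x \<partial>lborel) + (\<integral>x. (G s x - G' s x) * \<phi> x \<partial>lborel)"
    have iV: "integrable lborel (\<lambda>x. V s x * \<phi> x)" "integrable lborel (\<lambda>x. V' s x * \<phi> x)"
      "integrable lborel (\<lambda>x. V s x * laplacian \<phi> x)" "integrable lborel (\<lambda>x. V' s x * laplacian \<phi> x)" if "s \<in> {a..b}" for s
      using integrable_mult_supported(1)[OF A.V_meas1 A.V_sq[OF that] C(2-4)] integrable_mult_supported(1)[OF B.V_meas1 B.V_sq[OF that] C(2-4)]
        integrable_mult_supported(1)[OF A.V_meas1 A.V_sq[OF that] C(5-7)] integrable_mult_supported(1)[OF B.V_meas1 B.V_sq[OF that] C(5-7)]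
      by auto
    have aeG: "AE s in lborel. s \<in> {a..b} \<longrightarrow> integrable lborel (\<lambda>x. G s x * \<phi> x)"
      by (rule slab_integrable_test(1)[OF A.slab_G C(2-4)])
    have aeG': "AE s in lborel. s \<in> {a..b} \<longrightarrow> integrable lborel (\<lambda>x. G' s x * \<phi> x)"
      by (rule slab_integrable_test(1)[OF B.slab_G C(2-4)])
    have "(LINT s:{a..t}|lborel. ?J s) = (LINT s:{a..t}|lborel. ?I s - ?I' s)"
    proof (rule set_lebesgue_integral_cong_AE)
      show "?J \<in> borel_measurable lborel" "(\<lambda>s. ?I s - ?I' s) \<in> borel_measurable lborel" by measurable
      show "AE s\<in>{a..t} in lborel. ?J s = ?I s - ?I' s"
        using aeG aeG'
      proof eventually_elim
        case (elim s)
        show ?case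
        proof
          assume "s \<in> {a..t}"
          then have s: "s \<in> {a..b}" using t by auto
          then show "?J s = ?I s - ?I' s" using elim iV[OF s] by (simp add: left_diff_distrib)
        qed
      qed
    qed simp
    also have "\<dots> = (LINT s:{a..t}|lborel. ?I s) - (LINT s:{a..t}|lborel. ?I' s)"
      using t by (intro set_integral_diff(2) set_integrable_subset[OF A.test_integrable[OF \<phi>]] set_integrable_subset[OF B.test_integrable[OF \<phi>]]) auto
    finally have J: "(LINT s:{a..t}|lborel. ?J s) = (LINT s:{a..t}|lborel. ?I s) - (LINT s:{a..t}|lborel. ?I' s)" .
    have "a \<in> {a..b}" using t by auto
    then show "(\<integral>x. (V t x - V' t x) * \<phi> x \<partial>lborel) = (\<integral>x. (V a x - V' a x) * \<phi> x \<partial>lborel) + (LINT s:{a..t}|lborel. ?J s)"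
      unfolding J using A.weak[OF t \<phi>] B.weak[OF t \<phi>] iV[OF t] iV[of a] by (simp add: left_diff_distrib)
  qed
qed

section \<open>From solutions to evolutions of Borel functions\<close>

lemma test_function_in_Lp2:
  assumes "test_function \<phi>" shows "\<phi> \<in> Lp 2"
proof -
  obtain C R where C: "\<phi> \<in> borel_measurable borel" "\<And>x. \<bar>\<phi> x\<bar> \<le> C" "\<And>x. \<phi> x \<noteq> 0 \<Longrightarrow> x \<in> cball 0 R"
    using test_function_bounds[OF assms] by metis
  note [measurable] = C(1)
  have "integrable lborel (\<lambda>x. (\<phi> x)\<^sup>2)" by (rule square_integrable_bounded_supported(1)[OF C])
  then show ?thesis unfolding Lp_2_iff using C(1) by (simp add: integrable_completion measurable_completion)
qed

lemma Lp_2_sum: "finite I \<Longrightarrow> (\<And>i. i \<in> I \<Longrightarrow> u i \<in> Lp 2) \<Longrightarrow> (\<lambda>x. \<Sum>i\<in>I. u i x) \<in> Lp 2"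
  by (induction I rule: finite_induct) (simp_all add: Lp_2_zero Lp_2_add)

lemma sobolev_weak_laplacian:
  fixes h :: "'a::euclidean_space \<Rightarrow> real"
  assumes "h \<in> sobolev 2 2"
  obtains Lh where "Lh \<in> Lp 2"
    "\<And>\<phi>. test_function \<phi> \<Longrightarrow> (\<integral>x. h x * laplacian \<phi> x \<partial>lebesgue) = (\<integral>x. Lh x * \<phi> x \<partial>lebesgue)"
proof -
  have h: "h \<in> Lp 2" "\<forall>b\<in>Basis. \<exists>w\<in>sobolev 1 2. weak_partial b h w"
    using assms by (auto simp: numeral_2_eq_2)
  have "\<exists>w'\<in>Lp 2. \<forall>\<phi>. test_function \<phi> \<longrightarrow> (\<integral>x. h x * partial_deriv b (partial_deriv b \<phi>) x \<partial>lebesgue) = (\<integral>x. w' x * \<phi> x \<partial>lebesgue)"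
    if b: "b \<in> Basis" for b
  proof -
    obtain w where w: "w \<in> sobolev 1 2" "weak_partial b h w" using h(2) b by blast
    obtain w' where w': "w' \<in> Lp 2" "weak_partial b w w'" using w(1) b by auto
    have "(\<integral>x. h x * partial_deriv b (partial_deriv b \<phi>) x \<partial>lebesgue) = (\<integral>x. w' x * \<phi> x \<partial>lebesgue)"
      if \<phi>: "test_function \<phi>" for \<phi>
      using w(2) w'(2) \<phi> test_function_partial_deriv[OF \<phi> b] by (simp add: weak_partial_def)
    then show ?thesis using w'(1) by blast
  qed
  then obtain w' where w': "\<And>b. b \<in> Basis \<Longrightarrow> w' b \<in> Lp 2"
    "\<And>b \<phi>. b \<in> Basis \<Longrightarrow> test_function \<phi> \<Longrightarrow> (\<integral>x. h x * partial_deriv b (partial_deriv b \<phi>) x \<partial>lebesgue) = (\<integral>x. w' b x * \<phi> x \<partial>lebesgue)"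
    by metis
  show thesis
  proof (rule that[of "\<lambda>x. \<Sum>b\<in>Basis. w' b x"])
    show "(\<lambda>x. \<Sum>b\<in>Basis. w' b x) \<in> Lp 2" by (intro Lp_2_sum w') auto
    fix \<phi> :: "'a \<Rightarrow> real" assume \<phi>: "test_function \<phi>"
    have i: "integrable lebesgue (\<lambda>x. h x * partial_deriv b (partial_deriv b \<phi>) x)" if "b \<in> Basis" for b
      by (intro Lp_2_mult_integrable h test_function_in_Lp2 test_function_partial_deriv \<phi> that)
    have j: "integrable lebesgue (\<lambda>x. w' b x * \<phi> x)" if "b \<in> Basis" for b
      by (intro Lp_2_mult_integrable w' test_function_in_Lp2 \<phi> that)
    have "(\<integral>x. h x * laplacian \<phi> x \<partial>lebesgue) = (\<Sum>b\<in>Basis. \<integral>x. h x * partial_deriv b (partial_deriv b \<phi>) x \<partial>lebesgue)"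
      unfolding laplacian_def sum_distrib_left by (rule Bochner_Integration.integral_sum) (rule i)
    also have "\<dots> = (\<Sum>b\<in>Basis. \<integral>x. w' b x * \<phi> x \<partial>lebesgue)"
      by (intro sum.cong refl w' \<phi>)
    also have "\<dots> = (\<integral>x. (\<Sum>b\<in>Basis. w' b x) * \<phi> x \<partial>lebesgue)"
      unfolding sum_distrib_right by (rule Bochner_Integration.integral_sum[symmetric]) (rule j)
    finally show "(\<integral>x. h x * laplacian \<phi> x \<partial>lebesgue) = (\<integral>x. (\<Sum>b\<in>Basis. w' b x) * \<phi> x \<partial>lebesgue)" .
  qed
qed

lemma nn_integral_lebesgue_eq:
  assumes "AE x in lborel. F x = F' x"
  shows "(\<integral>\<^sup>+x. F x \<partial>lebesgue) = (\<integral>\<^sup>+x. F' x \<partial>lborel)"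
  unfolding nn_integral_completion using assms by (rule nn_integral_cong_AE)

text \<open>The solution \<open>v\<close> is replaced by a jointly measurable version
  \<open>V\<close>, the data by Borel representatives, and the Laplacian of \<open>c h\<close>
  is evaluated through the weak Laplacian \<open>Lb\<close> of \<open>h\<close>. All terms
  except the Laplacian of \<open>V\<close> then form the inhomogeneity.\<close>

lemma solution_weak_evolution:
  fixes V :: "real \<Rightarrow> 'a::euclidean_space \<Rightarrow> real"
  assumes sol: "solution lam f g h c v0 v" and T: "0 < T"
    and f: "continuous_on UNIV (\<lambda>(x, s). f x s)"
    and V_meas[measurable]: "(\<lambda>(s, x). V s x) \<in> borel_measurable (lborel \<Otimes>\<^sub>M lborel)"
    and V: "\<And>s. s \<in> {0..T} \<Longrightarrow> AE x in lborel. L2_fun (v s) x = V s x"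
    and h[measurable]: "hb \<in> borel_measurable borel" and h': "AE x in lborel. h x = hb x" "integrable lborel (\<lambda>x. (hb x)\<^sup>2)"
    and g[measurable]: "gb \<in> borel_measurable borel" and g': "AE x in lborel. g x = gb x" "integrable lborel (\<lambda>x. (gb x)\<^sup>2)"
    and L[measurable]: "Lb \<in> borel_measurable borel" and L': "integrable lborel (\<lambda>x. (Lb x)\<^sup>2)"
      "\<And>\<phi>. test_function \<phi> \<Longrightarrow> (\<integral>x. hb x * laplacian \<phi> x \<partial>lborel) = (\<integral>x. Lb x * \<phi> x \<partial>lborel)"
    and c[measurable]: "c' \<in> borel_measurable borel" and c': "\<And>s. s \<in> {0..T} \<Longrightarrow> c s = c' s" "\<And>s. s \<in> {0..T} \<Longrightarrow> \<bar>c' s\<bar> \<le> Cc"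
    and B: "\<And>s. s \<in> {0..T} \<Longrightarrow> (norm (v s))\<^sup>2 \<le> B"
  shows "weak_evolution 0 T B V (\<lambda>s x. (- lam * V s x + f x (V s x + c' s * hb x)) + (gb x + c' s * Lb x))"
proof -
  have Vs[measurable]: "V s \<in> borel_measurable borel" for s
    using measurable_compose[OF measurable_Pair1'[of s lborel lborel] V_meas] by simp
  have f_meas: "(\<lambda>(x, s). f x s) \<in> borel_measurable (borel \<Otimes>\<^sub>M borel)"
    unfolding borel_prod by (rule borel_measurable_continuous_onI[OF f])
  define F where "F s x = f x (V s x + c' s * hb x)" for s x
  have F_meas[measurable]: "(\<lambda>(s, x). F s x) \<in> borel_measurable (lborel \<Otimes>\<^sub>M lborel)"
  proof -
    have "(\<lambda>p. (snd p, V (fst p) (snd p) + c' (fst p) * hb (snd p))) \<in> lborel \<Otimes>\<^sub>M lborel \<rightarrow>\<^sub>M borel \<Otimes>\<^sub>M borel"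
      by measurable
    from measurable_compose[OF this f_meas] show ?thesis by (simp add: F_def case_prod_unfold)
  qed
  have Fs[measurable]: "F s \<in> borel_measurable borel" for s
    using measurable_compose[OF measurable_Pair1'[of s lborel lborel] F_meas] by simp
  have U: "AE x in lborel. L2_fun (v s) x + c s * h x = V s x + c' s * hb x" if "s \<in> {0..T}" for s
    using V[OF that] h'(1) by eventually_elim (simp add: c'(1)[OF that])
  have normV: "(\<integral>x. (V s x)\<^sup>2 \<partial>lborel) = (norm (v s))\<^sup>2" "integrable lborel (\<lambda>x. (V s x)\<^sup>2)" if "s \<in> {0..T}" for s
    using norm_L2_square_lborel[OF Vs V[OF that]] by auto
  have slabF: "slab_integrable 0 T F"
    unfolding slab_integrable_def
  proof (intro conjI allI F_meas)
    fix R
    have "(\<integral>\<^sup>+s\<in>{0..T}. (\<integral>\<^sup>+x\<in>cball 0 R. ennreal \<bar>F s x\<bar> \<partial>lborel) \<partial>lborel)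
      = (\<integral>\<^sup>+s\<in>{0..T}. (\<integral>\<^sup>+x\<in>cball 0 R. ennreal \<bar>f x (L2_fun (v s) x + c s * h x)\<bar> \<partial>lebesgue) \<partial>lborel)"
    proof (rule nn_integral_cong)
      fix s
      show "(\<integral>\<^sup>+x\<in>cball 0 R. ennreal \<bar>F s x\<bar> \<partial>lborel) * indicator {0..T} s
        = (\<integral>\<^sup>+x\<in>cball 0 R. ennreal \<bar>f x (L2_fun (v s) x + c s * h x)\<bar> \<partial>lebesgue) * indicator {0..T} s"
      proof (cases "s \<in> {0..T}")
        case True
        have "(\<integral>\<^sup>+x\<in>cball 0 R. ennreal \<bar>f x (L2_fun (v s) x + c s * h x)\<bar> \<partial>lebesgue) = (\<integral>\<^sup>+x\<in>cball 0 R. ennreal \<bar>F s x\<bar> \<partial>lborel)"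
          by (rule nn_integral_lebesgue_eq) (use U[OF True] in \<open>eventually_elim, simp add: F_def\<close>)
        then show ?thesis by simp
      qed simp
    qed
    also have "\<dots> < \<infinity>" using sol T unfolding solution_def by blast
    finally show "(\<integral>\<^sup>+s\<in>{0..T}. (\<integral>\<^sup>+x\<in>cball 0 R. ennreal \<bar>F s x\<bar> \<partial>lborel) \<partial>lborel) < \<infinity>" .
  qed
  have slabV: "slab_integrable 0 T (\<lambda>s x. - lam * V s x)"
  proof (rule slab_integrable_square[where M = "lam\<^sup>2 * B"])
    fix s assume s: "s \<in> {0..T}"
    show "integrable lborel (\<lambda>x. (- lam * V s x)\<^sup>2)" using normV(2)[OF s] by (simp add: power_mult_distrib)
    have "(\<integral>x. (- lam * V s x)\<^sup>2 \<partial>lborel) = lam\<^sup>2 * (norm (v s))\<^sup>2"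
      using normV[OF s] by (simp add: power_mult_distrib)
    also have "\<dots> \<le> lam\<^sup>2 * B" by (intro mult_left_mono B s) simp
    finally show "(\<integral>x. (- lam * V s x)\<^sup>2 \<partial>lborel) \<le> lam\<^sup>2 * B" .
  qed measurable
  have Cc: "(c' s)\<^sup>2 \<le> Cc\<^sup>2" if "s \<in> {0..T}" for s
    using power_mono[OF c'(2)[OF that], of 2] by simp
  have slabg: "slab_integrable 0 T (\<lambda>s x. gb x + c' s * Lb x)"
  proof (rule slab_integrable_square[where M = "2 * (\<integral>x. (gb x)\<^sup>2 \<partial>lborel) + 2 * (Cc\<^sup>2 * (\<integral>x. (Lb x)\<^sup>2 \<partial>lborel))"])
    fix s assume s: "s \<in> {0..T}"
    have le: "(p + q)\<^sup>2 \<le> 2 * p\<^sup>2 + 2 * q\<^sup>2" for p q :: real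
      using zero_le_power2[of "p - q"] by (simp add: power2_eq_square algebra_simps)
    have i: "integrable lborel (\<lambda>x. 2 * (gb x)\<^sup>2 + 2 * (c' s * Lb x)\<^sup>2)"
      using g' L' by (simp add: power_mult_distrib)
    show i2: "integrable lborel (\<lambda>x. (gb x + c' s * Lb x)\<^sup>2)"
      by (rule Bochner_Integration.integrable_bound[OF i]) (auto intro!: AE_I2 order_trans[OF le])
    have "(\<integral>x. (gb x + c' s * Lb x)\<^sup>2 \<partial>lborel) \<le> (\<integral>x. 2 * (gb x)\<^sup>2 + 2 * (c' s * Lb x)\<^sup>2 \<partial>lborel)"
      by (rule integral_mono[OF i2 i le])
    also have "\<dots> = 2 * (\<integral>x. (gb x)\<^sup>2 \<partial>lborel) + 2 * ((c' s)\<^sup>2 * (\<integral>x. (Lb x)\<^sup>2 \<partial>lborel))"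
      using g' L' by (simp add: power_mult_distrib)
    also have "\<dots> \<le> 2 * (\<integral>x. (gb x)\<^sup>2 \<partial>lborel) + 2 * (Cc\<^sup>2 * (\<integral>x. (Lb x)\<^sup>2 \<partial>lborel))"
      by (intro add_left_mono mult_left_mono mult_right_mono Cc s Bochner_Integration.integral_nonneg) simp_all
    finally show "(\<integral>x. (gb x + c' s * Lb x)\<^sup>2 \<partial>lborel) \<le> 2 * (\<integral>x. (gb x)\<^sup>2 \<partial>lborel) + 2 * (Cc\<^sup>2 * (\<integral>x. (Lb x)\<^sup>2 \<partial>lborel))" .
  qed measurable
  define G where "G s x = (- lam * V s x + F s x) + (gb x + c' s * Lb x)" for s x
  have "weak_evolution 0 T B V G"
  proof (rule weak_evolutionI)
    show "slab_integrable 0 T G"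
      unfolding G_def by (intro slab_integrable_add slabV slabF slabg)
    fix t and \<phi> :: "'a \<Rightarrow> real" assume t: "t \<in> {0..T}" and \<phi>: "test_function \<phi>"
    obtain C R where C: "0 \<le> C" "\<phi> \<in> borel_measurable borel" "\<And>x. \<bar>\<phi> x\<bar> \<le> C" "\<And>x. \<phi> x \<noteq> 0 \<Longrightarrow> x \<in> cball 0 R"
      "laplacian \<phi> \<in> borel_measurable borel" "\<And>x. \<bar>laplacian \<phi> x\<bar> \<le> C" "\<And>x. laplacian \<phi> x \<noteq> 0 \<Longrightarrow> x \<in> cball 0 R"
      using test_function_bounds[OF \<phi>] by blast
    note C(2,5)[measurable]
    let ?J = "\<lambda>s. - lam * (\<integral>x. V s x * \<phi> x \<partial>lborel) + (\<integral>x. (V s x + c' s * hb x) * laplacian \<phi> x \<partial>lborel)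
       + (\<integral>x. F s x * \<phi> x \<partial>lborel) + (\<integral>x. gb x * \<phi> x \<partial>lborel)"
    let ?K = "\<lambda>s. (\<integral>x. V s x * laplacian \<phi> x \<partial>lborel) + (\<integral>x. G s x * \<phi> x \<partial>lborel)"
    have G_meas[measurable]: "(\<lambda>(s, x). G s x) \<in> borel_measurable (lborel \<Otimes>\<^sub>M lborel)"
      unfolding G_def by measurable
    have test_eq: "(\<integral>x. w x * \<psi> x \<partial>lebesgue) = (\<integral>x. w' x * \<psi> x \<partial>lborel)"
      if ae: "AE x in lborel. w x = w' x" and [measurable]: "w' \<in> borel_measurable borel" "\<psi> \<in> borel_measurable borel" for w w' \<psi> :: "'a \<Rightarrow> real"
    proof (rule integral_lebesgue_eq(1))
      show "(\<lambda>x. w' x * \<psi> x) \<in> borel_measurable borel" by measurable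
      show "AE x in lborel. w x * \<psi> x = w' x * \<psi> x" using ae by eventually_elim simp
    qed
    have I_eq: "- lam * (\<integral>x. L2_fun (v s) x * \<phi> x \<partial>lebesgue)
           + (\<integral>x. (L2_fun (v s) x + c s * h x) * laplacian \<phi> x \<partial>lebesgue)
           + (\<integral>x. f x (L2_fun (v s) x + c s * h x) * \<phi> x \<partial>lebesgue)
           + (\<integral>x. g x * \<phi> x \<partial>lebesgue) = ?J s" if s: "s \<in> {0..T}" for s
    proof -
      have "(\<integral>x. L2_fun (v s) x * \<phi> x \<partial>lebesgue) = (\<integral>x. V s x * \<phi> x \<partial>lborel)"
        by (rule test_eq[OF V[OF s]]) measurable
      moreover have "(\<integral>x. (L2_fun (v s) x + c s * h x) * laplacian \<phi> x \<partial>lebesgue) = (\<integral>x. (V s x + c' s * hb x) * laplacian \<phi> x \<partial>lborel)"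
        by (rule test_eq[OF U[OF s]]) measurable
      moreover have "(\<integral>x. f x (L2_fun (v s) x + c s * h x) * \<phi> x \<partial>lebesgue) = (\<integral>x. F s x * \<phi> x \<partial>lborel)"
        by (rule test_eq) (use U[OF s] in \<open>eventually_elim, simp add: F_def\<close>, measurable)
      moreover have "(\<integral>x. g x * \<phi> x \<partial>lebesgue) = (\<integral>x. gb x * \<phi> x \<partial>lborel)"
        by (rule test_eq[OF g'(1)]) measurable
      ultimately show ?thesis by simp
    qed
    have ig: "integrable lborel (\<lambda>x. gb x * \<phi> x)" by (rule integrable_mult_supported(1)[OF g g'(2) C(2-4)])
    have iL: "integrable lborel (\<lambda>x. Lb x * \<phi> x)" by (rule integrable_mult_supported(1)[OF L L'(1) C(2-4)])
    have ih: "integrable lborel (\<lambda>x. hb x * laplacian \<phi> x)" by (rule integrable_mult_supported(1)[OF h h'(2) C(5-7)])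
    have iV: "integrable lborel (\<lambda>x. V s x * \<phi> x)" if "s \<in> {0..T}" for s
      by (rule integrable_mult_supported(1)[OF Vs normV(2)[OF that] C(2-4)])
    have iVL: "integrable lborel (\<lambda>x. V s x * laplacian \<phi> x)" if "s \<in> {0..T}" for s
      by (rule integrable_mult_supported(1)[OF Vs normV(2)[OF that] C(5-7)])
    have aeF: "AE s in lborel. s \<in> {0..T} \<longrightarrow> integrable lborel (\<lambda>x. F s x * \<phi> x)"
      by (rule slab_integrable_test(1)[OF slabF C(2-4)])
    have JK: "(LINT s:{0..t}|lborel. ?J s) = (LINT s:{0..t}|lborel. ?K s)"
    proof (rule set_lebesgue_integral_cong_AE)
      show "?J \<in> borel_measurable lborel" "?K \<in> borel_measurable lborel" by measurable
      show "AE s\<in>{0..t} in lborel. ?J s = ?K s"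
        using aeF
      proof eventually_elim
        case (elim s)
        show ?case
        proof
          assume "s \<in> {0..t}"
          then have s: "s \<in> {0..T}" using t by auto
          then have iF: "integrable lborel (\<lambda>x. F s x * \<phi> x)" using elim by blast
          have "(\<integral>x. (V s x + c' s * hb x) * laplacian \<phi> x \<partial>lborel) = (\<integral>x. V s x * laplacian \<phi> x + c' s * (hb x * laplacian \<phi> x) \<partial>lborel)"
            by (intro Bochner_Integration.integral_cong) (auto simp: algebra_simps)
          also have "\<dots> = (\<integral>x. V s x * laplacian \<phi> x \<partial>lborel) + c' s * (\<integral>x. Lb x * \<phi> x \<partial>lborel)"
            using iVL[OF s] ih L'(2)[OF \<phi>] by simp
          finally have 1: "(\<integral>x. (V s x + c' s * hb x) * laplacian \<phi> x \<partial>lborel) = (\<integral>x. V s x * laplacian \<phi> x \<partial>lborel) + c' s * (\<integral>x. Lb x * \<phi> x \<partial>lborel)" .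
          have "(\<integral>x. G s x * \<phi> x \<partial>lborel) = (\<integral>x. (- lam * (V s x * \<phi> x) + F s x * \<phi> x) + (gb x * \<phi> x + c' s * (Lb x * \<phi> x)) \<partial>lborel)"
            by (intro Bochner_Integration.integral_cong) (auto simp: G_def algebra_simps)
          also have "\<dots> = (- lam * (\<integral>x. V s x * \<phi> x \<partial>lborel) + (\<integral>x. F s x * \<phi> x \<partial>lborel)) + ((\<integral>x. gb x * \<phi> x \<partial>lborel) + c' s * (\<integral>x. Lb x * \<phi> x \<partial>lborel))"
            using iV[OF s] iF ig iL by simp
          finally show "?J s = ?K s" using 1 by simp
        qed
      qed
    qed simp
    have tV: "(\<integral>x. L2_fun (v s) x * \<phi> x \<partial>lebesgue) = (\<integral>x. V s x * \<phi> x \<partial>lborel)" if s: "s \<in> {0..T}" for s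
      by (rule test_eq[OF V[OF s]]) measurable
    have v0: "v0 = v 0" using sol by (simp add: solution_def)
    have "(\<integral>x. L2_fun (v t) x * \<phi> x \<partial>lebesgue) = (\<integral>x. L2_fun v0 x * \<phi> x \<partial>lebesgue) +
        (LINT s:{0..t}|lborel.
           - lam * (\<integral>x. L2_fun (v s) x * \<phi> x \<partial>lebesgue)
           + (\<integral>x. (L2_fun (v s) x + c s * h x) * laplacian \<phi> x \<partial>lebesgue)
           + (\<integral>x. f x (L2_fun (v s) x + c s * h x) * \<phi> x \<partial>lebesgue)
           + (\<integral>x. g x * \<phi> x \<partial>lebesgue))"
      using sol \<phi> t unfolding solution_def by auto
    also have "\<dots> = (\<integral>x. V 0 x * \<phi> x \<partial>lborel) + (LINT s:{0..t}|lborel. ?J s)"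
    proof (intro arg_cong2[where f = "(+)"])
      show "(\<integral>x. L2_fun v0 x * \<phi> x \<partial>lebesgue) = (\<integral>x. V 0 x * \<phi> x \<partial>lborel)"
        unfolding v0 using T by (intro tV) auto
      show "(LINT s:{0..t}|lborel.
           - lam * (\<integral>x. L2_fun (v s) x * \<phi> x \<partial>lebesgue)
           + (\<integral>x. (L2_fun (v s) x + c s * h x) * laplacian \<phi> x \<partial>lebesgue)
           + (\<integral>x. f x (L2_fun (v s) x + c s * h x) * \<phi> x \<partial>lebesgue)
           + (\<integral>x. g x * \<phi> x \<partial>lebesgue)) = (LINT s:{0..t}|lborel. ?J s)"
        using t by (intro set_lebesgue_integral_cong allI impI I_eq) auto
    qed
    finally show "(\<integral>x. V t x * \<phi> x \<partial>lborel) = (\<integral>x. V 0 x * \<phi> x \<partial>lborel) + (LINT s:{0..t}|lborel. ?K s)"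
      unfolding JK tV[OF t] .
  qed (use T normV B in auto)
  then show ?thesis by (simp add: G_def[abs_def] F_def)
qed

section \<open>Energy estimates for the reaction-diffusion equation\<close>

text \<open>Compare \<open>N\<close> with the solution \<open>m\<close> of the linear equation
  with the same initial value. If the difference \<open>D\<close> were positive at
  \<open>T\<close>, it would be nonnegative from its last zero \<open>s\<close> on, and the
  integral inequality on \<open>{s..T}\<close> would give \<open>D T \<le> 0\<close>. The
  inequality is assumed between arbitrary times, not only from time 0, because its integrand
  decreases in \<open>N\<close>.\<close>

lemma decay_integral_inequality:
  fixes N k :: "real \<Rightarrow> real"
  assumes T: "0 \<le> T" and lam: "0 < lam" and N: "continuous_on {0..T} N" and k: "continuous_on {0..T} k"
    and le: "\<And>a b. 0 \<le> a \<Longrightarrow> a \<le> b \<Longrightarrow> b \<le> T \<Longrightarrow> N b - N a \<le> integral {a..b} (\<lambda>s. - lam * N s + k s)"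
  shows "N T \<le> exp (- lam * T) * N 0 + integral {0..T} (\<lambda>s. exp (lam * (s - T)) * k s)"
proof -
  define m where "m t = exp (- lam * t) * (N 0 + integral {0..t} (\<lambda>s. exp (lam * s) * k s))" for t
  have ek: "continuous_on {0..T} (\<lambda>s. exp (lam * s) * k s)" by (intro continuous_intros k)
  have dm: "(m has_vector_derivative - lam * m t + k t) (at t within {0..T})" if t: "t \<in> {0..T}" for t
  proof -
    have "((\<lambda>t. integral {0..t} (\<lambda>s. exp (lam * s) * k s)) has_real_derivative exp (lam * t) * k t) (at t within {0..T})"
      by (rule integral_has_real_derivative[OF ek t])
    then have "(m has_real_derivative - lam * m t + k t) (at t within {0..T})"
      unfolding m_def
      by (auto intro!: derivative_eq_intros simp: exp_minus field_simps)
    then show ?thesis by (simp add: has_real_derivative_iff_has_vector_derivative)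
  qed
  have m_cont: "continuous_on {0..T} m"
    by (rule continuous_on_vector_derivative[OF dm])
  have m_int: "m b - m a = integral {a..b} (\<lambda>s. - lam * m s + k s)" if "0 \<le> a" "a \<le> b" "b \<le> T" for a b
  proof -
    have "((\<lambda>s. - lam * m s + k s) has_integral m b - m a) {a..b}"
      using that by (intro fundamental_theorem_of_calculus has_vector_derivative_within_subset[OF dm]) auto
    then show ?thesis by (simp add: integral_unique)
  qed
  define D where "D t = N t - m t" for t
  have D_cont: "continuous_on {0..T} D" unfolding D_def by (intro continuous_intros N m_cont)
  have D_le: "D b - D a \<le> integral {a..b} (\<lambda>s. - lam * D s)" if ab: "0 \<le> a" "a \<le> b" "b \<le> T" for a b
  proof -
    have sub: "{a..b} \<subseteq> {0..T}" using ab by auto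
    have i1: "(\<lambda>s. - lam * N s + k s) integrable_on {a..b}" "(\<lambda>s. - lam * m s + k s) integrable_on {a..b}"
      by (intro integrable_continuous_interval continuous_intros continuous_on_subset[OF N sub] continuous_on_subset[OF k sub] continuous_on_subset[OF m_cont sub])+
    have "D b - D a = (N b - N a) - (m b - m a)" by (simp add: D_def)
    also have "\<dots> \<le> integral {a..b} (\<lambda>s. - lam * N s + k s) - integral {a..b} (\<lambda>s. - lam * m s + k s)"
      using le[OF ab] m_int[OF ab] by simp
    also have "\<dots> = integral {a..b} (\<lambda>s. (- lam * N s + k s) - (- lam * m s + k s))"
      by (rule Henstock_Kurzweil_Integration.integral_diff[OF i1, symmetric])
    also have "\<dots> = integral {a..b} (\<lambda>s. - lam * D s)"
      by (intro integral_cong) (simp add: D_def algebra_simps)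
    finally show ?thesis .
  qed
  have "D T \<le> 0"
  proof (rule ccontr)
    assume "\<not> D T \<le> 0"
    then have DT: "0 < D T" by simp
    have D0: "D 0 = 0" by (simp add: D_def m_def)
    define Z where "Z = {t \<in> {0..T}. D t = 0}"
    have "compact Z"
    proof -
      have "closed ({0..T} \<inter> D -` {0})"
        by (rule continuous_closed_preimage[OF D_cont]) auto
      then have "compact ({0..T} \<inter> ({0..T} \<inter> D -` {0}))" by (intro compact_Int_closed) auto
      also have "{0..T} \<inter> ({0..T} \<inter> D -` {0}) = Z" by (auto simp: Z_def)
      finally show ?thesis .
    qed
    moreover have "Z \<noteq> {}" using D0 T by (auto simp: Z_def)
    ultimately obtain s where s: "s \<in> Z" "\<And>t. t \<in> Z \<Longrightarrow> t \<le> s" using compact_attains_sup by metis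
    have sT: "0 \<le> s" "s \<le> T" "D s = 0" using s(1) by (auto simp: Z_def)
    have pos: "0 \<le> D x" if x: "x \<in> {s..T}" for x
    proof (rule ccontr)
      assume "\<not> 0 \<le> D x"
      then have "\<exists>y\<ge>x. y \<le> T \<and> D y = 0"
        using DT x sT by (intro IVT' continuous_on_subset[OF D_cont]) auto
      then obtain y where "x \<le> y" "y \<le> T" "D y = 0" by blast
      then have "y \<in> Z" using x sT by (auto simp: Z_def)
      then have "y \<le> s" by (rule s(2))
      then have "x = s" using x \<open>x \<le> y\<close> by auto
      then show False using \<open>\<not> 0 \<le> D x\<close> sT by simp
    qed
    have "integral {s..T} (\<lambda>s. - lam * D s) \<le> 0"
    proof -
      have "0 \<le> integral {s..T} (\<lambda>s. lam * D s)"
        using pos lam sT by (intro integral_nonneg integrable_continuous_interval continuous_intros continuous_on_subset[OF D_cont]) auto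
      then show ?thesis by simp
    qed
    then show False using D_le[of s T] sT DT by simp
  qed
  then have "N T \<le> m T" by (simp add: D_def)
  also have "m T = exp (- lam * T) * N 0 + integral {0..T} (\<lambda>s. exp (- lam * T) * (exp (lam * s) * k s))"
    by (simp add: m_def distrib_left)
  also have "integral {0..T} (\<lambda>s. exp (- lam * T) * (exp (lam * s) * k s)) = integral {0..T} (\<lambda>s. exp (lam * (s - T)) * k s)"
    by (intro integral_cong) (simp add: exp_add[symmetric] mult.assoc[symmetric] right_diff_distrib)
  finally show ?thesis .
qed

lemma gronwall:
  fixes N :: "real \<Rightarrow> real"
  assumes T: "0 \<le> T" and L: "0 \<le> L" and N: "continuous_on {0..T} N"
    and le: "\<And>b. 0 \<le> b \<Longrightarrow> b \<le> T \<Longrightarrow> N b \<le> A + L * integral {0..b} N"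
  shows "N T \<le> A * exp (L * T)"
proof -
  define Z where "Z t = A + L * integral {0..t} N" for t
  define W where "W t = exp (- L * t) * Z t" for t
  have dW: "(W has_vector_derivative exp (- L * t) * L * (N t - Z t)) (at t within {0..T})" if t: "t \<in> {0..T}" for t
  proof -
    have "((\<lambda>t. integral {0..t} N) has_real_derivative N t) (at t within {0..T})"
      by (rule integral_has_real_derivative[OF N t])
    then have "(W has_real_derivative exp (- L * t) * L * (N t - Z t)) (at t within {0..T})"
      unfolding W_def Z_def by (auto intro!: derivative_eq_intros simp: algebra_simps)
    then show ?thesis by (simp add: has_real_derivative_iff_has_vector_derivative)
  qed
  have "((\<lambda>t. exp (- L * t) * L * (N t - Z t)) has_integral W T - W 0) {0..T}"
    by (rule fundamental_theorem_of_calculus[OF T dW]) simp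
  moreover have "exp (- L * t) * L * (N t - Z t) \<le> 0" if "t \<in> {0..T}" for t
    using that le[of t] L by (intro mult_nonneg_nonpos) (auto simp: Z_def)
  ultimately have "W T - W 0 \<le> 0"
    using has_integral_le[OF _ has_integral_0, of _ "W T - W 0" "{0..T}"] by blast
  then have "exp (- L * T) * Z T \<le> A" by (simp add: W_def Z_def)
  then have "exp (L * T) * (exp (- L * T) * Z T) \<le> exp (L * T) * A" by (intro mult_left_mono) auto
  moreover have "exp (L * T) * (exp (- L * T) * Z T) = exp (L * T + - L * T) * Z T"
    unfolding exp_add by (simp only: mult.assoc)
  moreover have "\<dots> = Z T" by simp
  ultimately have "Z T \<le> exp (L * T) * A" by linarith
  then have "Z T \<le> A * exp (L * T)" by (simp only: mult.commute)
  then show ?thesis using le[of T] T by (simp add: Z_def)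
qed

lemma nn_integral_continuous_interval:
  fixes k :: "real \<Rightarrow> real"
  assumes "continuous_on {a..b} k" "\<And>s. s \<in> {a..b} \<Longrightarrow> 0 \<le> k s"
  shows "(\<integral>\<^sup>+s\<in>{a..b}. ennreal (k s) \<partial>lborel) = ennreal (integral {a..b} k)"
proof -
  have int: "set_integrable lborel {a..b} k" by (rule borel_integrable_atLeastAtMost'[OF assms(1)])
  have "(\<integral>\<^sup>+s\<in>{a..b}. ennreal (k s) \<partial>lborel) = (\<integral>\<^sup>+s. ennreal (indicator {a..b} s *\<^sub>R k s) \<partial>lborel)"
    by (intro nn_integral_cong) (auto simp: indicator_def)
  also have "\<dots> = ennreal (LINT s:{a..b}|lborel. k s)"
    unfolding set_lebesgue_integral_def
    using int assms(2) by (intro nn_integral_eq_integral) (auto simp: set_integrable_def indicator_def)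
  also have "(LINT s:{a..b}|lborel. k s) = integral {a..b} k" by (rule set_borel_integral_eq_integral(2)[OF int])
  finally show ?thesis .
qed

text \<open>Young's inequality with constant 1: compare \<open>a\<close> with
  \<open>b\<close>.\<close>

lemma young_powr:
  fixes a b :: real
  assumes "0 \<le> a" "0 \<le> b" "1 \<le> p"
  shows "a * b powr (p - 1) \<le> a powr p + b powr p"
proof -
  have eq: "x * x powr (p - 1) = x powr p" if "0 \<le> x" for x :: real
    using powr_mult_base[OF that, of "p - 1"] by simp
  show ?thesis
  proof (cases "a \<le> b")
    case True
    then have "a * b powr (p - 1) \<le> b * b powr (p - 1)" by (intro mult_right_mono) auto
    then show ?thesis using eq[OF assms(2)] by (simp add: add_increasing)
  next
    case False
    then have "a * b powr (p - 1) \<le> a * a powr (p - 1)" using assms by (intro mult_left_mono powr_mono2) auto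
    then show ?thesis using eq[OF assms(1)] by (simp add: add_increasing2)
  qed
qed

text \<open>The constant is chosen for half of the dissipation \<open>\<alpha>1 * b powr
  p\<close> to absorb the term with \<open>b\<close>.\<close>

lemma young_powr_absorb:
  fixes a b :: real
  assumes "0 \<le> a" "0 \<le> b" "1 \<le> p" "0 < \<alpha>1" "0 \<le> \<alpha>2"
  shows "\<alpha>2 * (a * b powr (p - 1)) \<le> \<alpha>1 / 2 * b powr p + \<alpha>2 * (2 * \<alpha>2 / \<alpha>1) powr (p - 1) * a powr p"
proof -
  have eq: "x * x powr (p - 1) = x powr p" if "0 \<le> x" for x :: real
    using powr_mult_base[OF that, of "p - 1"] by simp
  show ?thesis
  proof (cases "\<alpha>2 * a \<le> \<alpha>1 / 2 * b")
    case True
    then have "\<alpha>2 * a * b powr (p - 1) \<le> \<alpha>1 / 2 * b * b powr (p - 1)" by (intro mult_right_mono) auto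
    then show ?thesis using eq[OF assms(2)] assms by (simp add: mult.assoc add_increasing2)
  next
    case False
    then have "b \<le> (2 * \<alpha>2 / \<alpha>1) * a" using assms(4) by (simp add: field_simps)
    then have "b powr (p - 1) \<le> ((2 * \<alpha>2 / \<alpha>1) * a) powr (p - 1)" using assms by (intro powr_mono2) auto
    also have "\<dots> = (2 * \<alpha>2 / \<alpha>1) powr (p - 1) * a powr (p - 1)" using assms by (subst powr_mult) auto
    finally have "\<alpha>2 * (a * b powr (p - 1)) \<le> \<alpha>2 * (a * ((2 * \<alpha>2 / \<alpha>1) powr (p - 1) * a powr (p - 1)))"
      using assms by (intro mult_left_mono) auto
    also have "\<dots> = \<alpha>2 * (2 * \<alpha>2 / \<alpha>1) powr (p - 1) * (a * a powr (p - 1))" by (simp add: mult_ac)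
    finally show ?thesis using eq[OF assms(1)] assms by (simp add: add_increasing)
  qed
qed

text \<open>The data of the equation for \<open>v\<close>, with Borel measurable
  representatives; \<open>Lh\<close> stands for the Laplacian of \<open>h\<close>.\<close>

locale reaction_diffusion =
  fixes lam p \<alpha>1 \<alpha>2 \<beta> :: real and f :: "'a::euclidean_space \<Rightarrow> real \<Rightarrow> real" and g h Lh \<psi>1 \<psi>2 :: "'a \<Rightarrow> real"
  assumes lam: "0 < lam" and p: "2 \<le> p" and \<alpha>1: "0 < \<alpha>1" and \<alpha>2: "0 < \<alpha>2" and \<beta>: "0 < \<beta>"
    and f_cont: "continuous_on UNIV (\<lambda>(x, s). f x s)"
    and dissipative: "AE x in lborel. \<forall>s. f x s * s \<le> - \<alpha>1 * \<bar>s\<bar> powr p + \<psi>1 x"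
    and growth: "AE x in lborel. \<forall>s. \<bar>f x s\<bar> \<le> \<alpha>2 * \<bar>s\<bar> powr (p - 1) + \<psi>2 x"
    and one_sided: "\<And>x s t. (f x s - f x t) * (s - t) \<le> \<beta> * (s - t)\<^sup>2"
    and meas[measurable]: "g \<in> borel_measurable borel" "h \<in> borel_measurable borel" "Lh \<in> borel_measurable borel"
      "\<psi>1 \<in> borel_measurable borel" "\<psi>2 \<in> borel_measurable borel"
    and int: "integrable lborel (\<lambda>x. (g x)\<^sup>2)" "integrable lborel (\<lambda>x. (h x)\<^sup>2)" "integrable lborel (\<lambda>x. (Lh x)\<^sup>2)"
      "integrable lborel (\<lambda>x. \<bar>h x\<bar> powr p)" "integrable lborel (\<lambda>x. \<bar>\<psi>1 x\<bar>)" "integrable lborel (\<lambda>x. (\<psi>2 x)\<^sup>2)"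
begin

definition forcing :: "(real \<Rightarrow> real) \<Rightarrow> (real \<Rightarrow> 'a \<Rightarrow> real) \<Rightarrow> real \<Rightarrow> 'a \<Rightarrow> real" where
  "forcing c V s x = (- lam * V s x + f x (V s x + c s * h x)) + (g x + c s * Lh x)"

definition C\<alpha> :: real where "C\<alpha> = \<alpha>2 * (2 * \<alpha>2 / \<alpha>1) powr (p - 1)"

text \<open>The energy produced by the data of the deterministic equation, and the
  coefficients of the quadratic and of the \<open>p\<close>-th power part of what the noise
  adds.\<close>

definition D0 :: real where "D0 = (\<integral>x. \<bar>\<psi>1 x\<bar> + (\<psi>2 x)\<^sup>2 + (g x)\<^sup>2 / lam \<partial>lborel)"
definition D1 :: real where "D1 = (\<integral>x. (h x)\<^sup>2 + (Lh x)\<^sup>2 / lam \<partial>lborel)"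
definition D2 :: real where "D2 = (\<integral>x. C\<alpha> * \<bar>h x\<bar> powr p \<partial>lborel)"

definition load :: "real \<Rightarrow> real" where "load y = D0 + y\<^sup>2 * D1 + \<bar>y\<bar> powr p * D2"

lemma C\<alpha>_nonneg: "0 \<le> C\<alpha>" using \<alpha>2 by (simp add: C\<alpha>_def)

lemma D_nonneg: "0 \<le> D0" "0 \<le> D1" "0 \<le> D2"
  unfolding D0_def D1_def D2_def using lam C\<alpha>_nonneg by (auto intro!: Bochner_Integration.integral_nonneg)

lemma load_nonneg: "0 \<le> load y"
  unfolding load_def using D_nonneg by simp

lemma load_continuous: "continuous_on S c \<Longrightarrow> continuous_on S (\<lambda>s. load (c s))"
  unfolding load_def using p by (intro continuous_intros continuous_on_powr') auto

text \<open>With \<open>U = v + y h\<close> write \<open>f(U) v = f(U) U - f(U) y h\<close>.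
  Dissipativity bounds the first term, and half of the gain \<open>\<alpha>1
  \<bar>U\<bar>\<^sup>p\<close> absorbs the second. Half of \<open>lam * v\<^sup>2\<close>
  pays for the linear terms.\<close>

lemma forcing_pointwise:
  "AE x in lborel. \<forall>v y. (- lam * v + f x (v + y * h x) + (g x + y * Lh x)) * v
     \<le> (\<bar>\<psi>1 x\<bar> + (\<psi>2 x)\<^sup>2 + (g x)\<^sup>2 / lam + y\<^sup>2 * ((h x)\<^sup>2 + (Lh x)\<^sup>2 / lam) + \<bar>y\<bar> powr p * (C\<alpha> * \<bar>h x\<bar> powr p))
       - (lam / 2 * v\<^sup>2 + \<alpha>1 / 2 * \<bar>v + y * h x\<bar> powr p)"
  using dissipative growth
proof eventually_elim
  case (elim x)
  show ?case
  proof (intro allI)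
    fix v y
    define U where "U = v + y * h x"
    define e where "e = y * h x"
    have 1: "f x U * U \<le> - \<alpha>1 * \<bar>U\<bar> powr p + \<bar>\<psi>1 x\<bar>" using elim(1)[rule_format, of U] by linarith
    have "- (f x U * e) \<le> \<bar>f x U\<bar> * \<bar>e\<bar>" unfolding abs_mult[symmetric] by linarith
    also have "\<dots> \<le> (\<alpha>2 * \<bar>U\<bar> powr (p - 1) + \<psi>2 x) * \<bar>e\<bar>" using elim(2) by (intro mult_right_mono) auto
    also have "\<dots> = \<alpha>2 * (\<bar>e\<bar> * \<bar>U\<bar> powr (p - 1)) + \<psi>2 x * \<bar>e\<bar>" by (simp add: algebra_simps)
    also have "\<alpha>2 * (\<bar>e\<bar> * \<bar>U\<bar> powr (p - 1)) \<le> \<alpha>1 / 2 * \<bar>U\<bar> powr p + C\<alpha> * \<bar>e\<bar> powr p"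
      unfolding C\<alpha>_def using p \<alpha>1 \<alpha>2 by (intro young_powr_absorb) auto
    also have "\<psi>2 x * \<bar>e\<bar> \<le> (\<psi>2 x)\<^sup>2 + e\<^sup>2"
      using abs_mult_le_squares[of "\<psi>2 x" "\<bar>e\<bar>"] by simp
    finally have 2: "- (f x U * e) \<le> \<alpha>1 / 2 * \<bar>U\<bar> powr p + C\<alpha> * \<bar>e\<bar> powr p + ((\<psi>2 x)\<^sup>2 + e\<^sup>2)" by simp
    have quad: "w * v \<le> w\<^sup>2 / lam + lam / 4 * v\<^sup>2" for w
    proof -
      have "0 \<le> (w - lam / 2 * v)\<^sup>2 / lam" using lam by simp
      also have "\<dots> = w\<^sup>2 / lam - w * v + lam / 4 * v\<^sup>2"
        using lam by (simp add: power2_diff field_simps power2_eq_square)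
      finally show ?thesis by simp
    qed
    have 3: "g x * v \<le> (g x)\<^sup>2 / lam + lam / 4 * v\<^sup>2" by (rule quad)
    have 4: "(y * Lh x) * v \<le> y\<^sup>2 * ((Lh x)\<^sup>2 / lam) + lam / 4 * v\<^sup>2"
      using quad[of "y * Lh x"] by (simp add: power_mult_distrib)
    have 5: "e\<^sup>2 = y\<^sup>2 * (h x)\<^sup>2" "C\<alpha> * \<bar>e\<bar> powr p = \<bar>y\<bar> powr p * (C\<alpha> * \<bar>h x\<bar> powr p)"
      by (simp_all add: e_def power_mult_distrib abs_mult powr_mult)
    have "(- lam * v + f x U + (g x + y * Lh x)) * v = - lam * v\<^sup>2 + (f x U * U - f x U * e) + g x * v + (y * Lh x) * v"
      by (simp add: U_def e_def power2_eq_square algebra_simps)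
    also have "\<dots> \<le> - lam * v\<^sup>2 + ((- \<alpha>1 * \<bar>U\<bar> powr p + \<bar>\<psi>1 x\<bar>) + (\<alpha>1 / 2 * \<bar>U\<bar> powr p + C\<alpha> * \<bar>e\<bar> powr p + ((\<psi>2 x)\<^sup>2 + e\<^sup>2)))
        + ((g x)\<^sup>2 / lam + lam / 4 * v\<^sup>2) + (y\<^sup>2 * ((Lh x)\<^sup>2 / lam) + lam / 4 * v\<^sup>2)"
      using 1 2 3 4 by linarith
    also have "\<dots> = (\<bar>\<psi>1 x\<bar> + (\<psi>2 x)\<^sup>2 + (g x)\<^sup>2 / lam + y\<^sup>2 * ((h x)\<^sup>2 + (Lh x)\<^sup>2 / lam) + \<bar>y\<bar> powr p * (C\<alpha> * \<bar>h x\<bar> powr p))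
       - (lam / 2 * v\<^sup>2 + \<alpha>1 / 2 * \<bar>U\<bar> powr p)"
      unfolding 5 by (simp add: algebra_simps)
    finally show "(- lam * v + f x (v + y * h x) + (g x + y * Lh x)) * v
     \<le> (\<bar>\<psi>1 x\<bar> + (\<psi>2 x)\<^sup>2 + (g x)\<^sup>2 / lam + y\<^sup>2 * ((h x)\<^sup>2 + (Lh x)\<^sup>2 / lam) + \<bar>y\<bar> powr p * (C\<alpha> * \<bar>h x\<bar> powr p))
       - (lam / 2 * v\<^sup>2 + \<alpha>1 / 2 * \<bar>v + y * h x\<bar> powr p)" unfolding U_def .
  qed
qed

lemma load_integrable:
  "integrable lborel (\<lambda>x. \<bar>\<psi>1 x\<bar> + (\<psi>2 x)\<^sup>2 + (g x)\<^sup>2 / lam + y\<^sup>2 * ((h x)\<^sup>2 + (Lh x)\<^sup>2 / lam) + \<bar>y\<bar> powr p * (C\<alpha> * \<bar>h x\<bar> powr p))"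
  and load_integral: "(\<integral>x. \<bar>\<psi>1 x\<bar> + (\<psi>2 x)\<^sup>2 + (g x)\<^sup>2 / lam + y\<^sup>2 * ((h x)\<^sup>2 + (Lh x)\<^sup>2 / lam) + \<bar>y\<bar> powr p * (C\<alpha> * \<bar>h x\<bar> powr p) \<partial>lborel) = load y"
proof -
  have i: "integrable lborel (\<lambda>x. \<bar>\<psi>1 x\<bar> + (\<psi>2 x)\<^sup>2 + (g x)\<^sup>2 / lam)" "integrable lborel (\<lambda>x. y\<^sup>2 * ((h x)\<^sup>2 + (Lh x)\<^sup>2 / lam))"
    "integrable lborel (\<lambda>x. \<bar>y\<bar> powr p * (C\<alpha> * \<bar>h x\<bar> powr p))"
    using int by auto
  show "integrable lborel (\<lambda>x. \<bar>\<psi>1 x\<bar> + (\<psi>2 x)\<^sup>2 + (g x)\<^sup>2 / lam + y\<^sup>2 * ((h x)\<^sup>2 + (Lh x)\<^sup>2 / lam) + \<bar>y\<bar> powr p * (C\<alpha> * \<bar>h x\<bar> powr p))"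
    by (intro Bochner_Integration.integrable_add i)
  have "(\<integral>x. (\<bar>\<psi>1 x\<bar> + (\<psi>2 x)\<^sup>2 + (g x)\<^sup>2 / lam) + y\<^sup>2 * ((h x)\<^sup>2 + (Lh x)\<^sup>2 / lam) + \<bar>y\<bar> powr p * (C\<alpha> * \<bar>h x\<bar> powr p) \<partial>lborel)
    = (\<integral>x. \<bar>\<psi>1 x\<bar> + (\<psi>2 x)\<^sup>2 + (g x)\<^sup>2 / lam \<partial>lborel) + (\<integral>x. y\<^sup>2 * ((h x)\<^sup>2 + (Lh x)\<^sup>2 / lam) \<partial>lborel) + (\<integral>x. \<bar>y\<bar> powr p * (C\<alpha> * \<bar>h x\<bar> powr p) \<partial>lborel)"
    by (subst Bochner_Integration.integral_add[OF Bochner_Integration.integrable_add[OF i(1,2)] i(3)],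
        subst Bochner_Integration.integral_add[OF i(1,2)]) (rule refl)
  then show "(\<integral>x. \<bar>\<psi>1 x\<bar> + (\<psi>2 x)\<^sup>2 + (g x)\<^sup>2 / lam + y\<^sup>2 * ((h x)\<^sup>2 + (Lh x)\<^sup>2 / lam) + \<bar>y\<bar> powr p * (C\<alpha> * \<bar>h x\<bar> powr p) \<partial>lborel) = load y"
    unfolding load_def D0_def D1_def D2_def by (simp only: integral_mult_right_zero)
qed

lemma load_le: "\<bar>y\<bar> \<le> 1 \<Longrightarrow> load y \<le> D0 + D1 + D2"
proof -
  assume y: "\<bar>y\<bar> \<le> 1"
  have "y\<^sup>2 \<le> 1" using y by (simp add: abs_square_le_1)
  moreover have "\<bar>y\<bar> powr p \<le> 1" using y p by (intro powr_le1) auto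
  ultimately have "y\<^sup>2 * D1 \<le> 1 * D1" "\<bar>y\<bar> powr p * D2 \<le> 1 * D2" using D_nonneg by (intro mult_right_mono; simp)+
  then show ?thesis by (simp add: load_def)
qed

text \<open>Both parts come from \<open>energy_inequality\<close>; the first uses the part
  \<open>lam / 2 * v\<^sup>2\<close> of the dissipation, the second the part with the
  \<open>p\<close>-th power.\<close>

lemma energy_estimate:
  assumes e: "weak_evolution 0 T B V (forcing c V)" and c: "continuous_on UNIV c"
    and N: "continuous_on {0..T} (\<lambda>t. \<integral>x. (V t x)\<^sup>2 \<partial>lborel)" and ab: "0 \<le> a" "a \<le> b" "b \<le> T"
  shows "(\<integral>x. (V b x)\<^sup>2 \<partial>lborel) - (\<integral>x. (V a x)\<^sup>2 \<partial>lborel)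
      \<le> integral {a..b} (\<lambda>s. - lam * (\<integral>x. (V s x)\<^sup>2 \<partial>lborel) + 2 * load (c s))"
    and "(\<integral>\<^sup>+s\<in>{a..b}. (\<integral>\<^sup>+x. ennreal (\<bar>V s x + c s * h x\<bar> powr p) \<partial>lborel) \<partial>lborel)
      \<le> ennreal (((\<integral>x. (V a x)\<^sup>2 \<partial>lborel) + 2 * integral {a..b} (\<lambda>s. load (c s))) / \<alpha>1)"
proof -
  interpret E: weak_evolution a b B V "forcing c V" by (rule weak_evolution.subinterval[OF e ab])
  have [measurable]: "c \<in> borel_measurable borel" by (rule borel_measurable_continuous_onI[OF c])
  define N where "N t = (\<integral>x. (V t x)\<^sup>2 \<partial>lborel)" for t
  define Kp where "Kp s x = \<bar>\<psi>1 x\<bar> + (\<psi>2 x)\<^sup>2 + (g x)\<^sup>2 / lam + (c s)\<^sup>2 * ((h x)\<^sup>2 + (Lh x)\<^sup>2 / lam) + \<bar>c s\<bar> powr p * (C\<alpha> * \<bar>h x\<bar> powr p)" for s x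
  define Kn where "Kn s x = lam / 2 * (V s x)\<^sup>2 + \<alpha>1 / 2 * \<bar>V s x + c s * h x\<bar> powr p" for s x
  have Kp_meas: "(\<lambda>(s, x). Kp s x) \<in> borel_measurable (lborel \<Otimes>\<^sub>M lborel)" unfolding Kp_def by measurable
  have Kn_meas: "(\<lambda>(s, x). Kn s x) \<in> borel_measurable (lborel \<Otimes>\<^sub>M lborel)" unfolding Kn_def by measurable
  have Kp0: "0 \<le> Kp s x" for s x unfolding Kp_def using lam C\<alpha>_nonneg by (intro add_nonneg_nonneg mult_nonneg_nonneg) auto
  have Kn0: "0 \<le> Kn s x" for s x unfolding Kn_def using lam \<alpha>1 by (intro add_nonneg_nonneg mult_nonneg_nonneg) auto
  have le: "AE x in lborel. forcing c V s x * V s x \<le> Kp s x - Kn s x" for s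
    using forcing_pointwise by eventually_elim (simp add: forcing_def Kp_def Kn_def)
  have lc: "continuous_on S (\<lambda>s. load (c s))" for S by (rule load_continuous[OF continuous_on_subset[OF c]]) simp
  define Q where "Q = integral {a..b} (\<lambda>s. load (c s))"
  have Q0: "0 \<le> Q" unfolding Q_def by (intro Henstock_Kurzweil_Integration.integral_nonneg integrable_continuous_interval lc load_nonneg)
  have "(\<integral>\<^sup>+x. ennreal (Kp s x) \<partial>lborel) = ennreal (load (c s))" for s
    using nn_integral_eq_integral[OF load_integrable[of "c s"]] Kp0[of s] unfolding load_integral Kp_def by simp
  then have Q: "(\<integral>\<^sup>+s\<in>{a..b}. (\<integral>\<^sup>+x. ennreal (Kp s x) \<partial>lborel) \<partial>lborel) \<le> ennreal Q"
    unfolding Q_def by (simp add: nn_integral_continuous_interval[OF lc] load_nonneg)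
  note en = E.energy_inequality[OF Kp_meas Kn_meas Kp0 Kn0 le Q Q0, folded N_def]
  have Nnn: "0 \<le> N t" for t unfolding N_def by (rule Bochner_Integration.integral_nonneg) simp
  define X where "X = (N a - N b) / 2 + Q"
  have X0: "0 \<le> X" using en(1) by (simp add: X_def field_simps)
  have Kn_le: "(\<integral>\<^sup>+s\<in>{a..b}. (\<integral>\<^sup>+x. ennreal (Kn s x) \<partial>lborel) \<partial>lborel) \<le> ennreal X"
    using en(2) unfolding X_def .
  have Ncont: "continuous_on {a..b} N" unfolding N_def using ab by (intro continuous_on_subset[OF N]) auto
  have NcontL: "continuous_on {a..b} (\<lambda>s. lam / 2 * N s)" by (intro continuous_intros Ncont)
  have "(\<integral>\<^sup>+s\<in>{a..b}. ennreal (lam / 2 * N s) \<partial>lborel) \<le> (\<integral>\<^sup>+s\<in>{a..b}. (\<integral>\<^sup>+x. ennreal (Kn s x) \<partial>lborel) \<partial>lborel)"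
  proof (rule nn_integral_mono)
    fix s
    show "ennreal (lam / 2 * N s) * indicator {a..b} s \<le> (\<integral>\<^sup>+x. ennreal (Kn s x) \<partial>lborel) * indicator {a..b} s"
    proof (cases "s \<in> {a..b}")
      case True
      have "ennreal (lam / 2 * N s) = (\<integral>\<^sup>+x. ennreal (lam / 2 * (V s x)\<^sup>2) \<partial>lborel)"
        using E.V_sq[OF True] lam by (subst nn_integral_eq_integral) (auto simp: N_def)
      also have "\<dots> \<le> (\<integral>\<^sup>+x. ennreal (Kn s x) \<partial>lborel)"
        using \<alpha>1 by (intro nn_integral_mono ennreal_leI) (simp add: Kn_def)
      finally show ?thesis by (rule mult_right_mono) simp
    qed simp
  qed
  also note Kn_le
  finally have "ennreal (integral {a..b} (\<lambda>s. lam / 2 * N s)) \<le> ennreal X"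
    using lam Nnn by (subst (asm) nn_integral_continuous_interval[OF NcontL]) auto
  then have "integral {a..b} (\<lambda>s. lam / 2 * N s) \<le> X" using X0 by simp
  then have "lam / 2 * integral {a..b} N \<le> X" by simp
  then have 1: "N b - N a \<le> - lam * integral {a..b} N + 2 * Q" by (simp add: X_def field_simps)
  have "integral {a..b} (\<lambda>s. - lam * N s + 2 * load (c s)) = integral {a..b} (\<lambda>s. - lam * N s) + integral {a..b} (\<lambda>s. 2 * load (c s))"
    by (intro Henstock_Kurzweil_Integration.integral_add integrable_continuous_interval continuous_intros Ncont lc)
  also have "\<dots> = - lam * integral {a..b} N + 2 * Q" by (simp add: Q_def)
  finally show "(\<integral>x. (V b x)\<^sup>2 \<partial>lborel) - (\<integral>x. (V a x)\<^sup>2 \<partial>lborel)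
      \<le> integral {a..b} (\<lambda>s. - lam * (\<integral>x. (V s x)\<^sup>2 \<partial>lborel) + 2 * load (c s))"
    using 1 unfolding N_def by simp
  define Y where "Y = (\<integral>\<^sup>+s\<in>{a..b}. (\<integral>\<^sup>+x. ennreal (\<bar>V s x + c s * h x\<bar> powr p) \<partial>lborel) \<partial>lborel)"
  have "ennreal (\<alpha>1 / 2) * Y = (\<integral>\<^sup>+s\<in>{a..b}. (\<integral>\<^sup>+x. ennreal (\<alpha>1 / 2 * \<bar>V s x + c s * h x\<bar> powr p) \<partial>lborel) \<partial>lborel)"
  proof -
    have eq: "ennreal (\<alpha>1 / 2 * u) = ennreal (\<alpha>1 / 2) * ennreal u" for u using \<alpha>1 by (intro ennreal_mult') simp
    have "(\<integral>\<^sup>+x. ennreal (\<alpha>1 / 2 * \<bar>V s x + c s * h x\<bar> powr p) \<partial>lborel) = ennreal (\<alpha>1 / 2) * (\<integral>\<^sup>+x. ennreal (\<bar>V s x + c s * h x\<bar> powr p) \<partial>lborel)" for s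
      unfolding eq by (rule nn_integral_cmult) measurable
    then show ?thesis
      unfolding Y_def mult.assoc by (simp only: mult.assoc) (rule nn_integral_cmult[symmetric], measurable)
  qed
  also have "\<dots> \<le> (\<integral>\<^sup>+s\<in>{a..b}. (\<integral>\<^sup>+x. ennreal (Kn s x) \<partial>lborel) \<partial>lborel)"
  proof (rule nn_integral_mono, rule mult_right_mono, rule nn_integral_mono, rule ennreal_leI)
    show "\<alpha>1 / 2 * \<bar>V s x + c s * h x\<bar> powr p \<le> Kn s x" for s x unfolding Kn_def using lam by simp
  qed simp
  also note Kn_le
  finally have "ennreal (2 / \<alpha>1) * (ennreal (\<alpha>1 / 2) * Y) \<le> ennreal (2 / \<alpha>1) * ennreal X" by (rule mult_left_mono) simp
  also have "ennreal (2 / \<alpha>1) * (ennreal (\<alpha>1 / 2) * Y) = Y"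
    using \<alpha>1 by (simp add: mult.assoc[symmetric] ennreal_mult'[symmetric])
  also have "ennreal (2 / \<alpha>1) * ennreal X = ennreal (2 / \<alpha>1 * X)"
    using \<alpha>1 by (intro ennreal_mult'[symmetric]) simp
  also have "\<dots> \<le> ennreal ((N a + 2 * Q) / \<alpha>1)"
  proof (rule ennreal_leI)
    have "2 * X \<le> N a + 2 * Q" using Nnn[of b] by (simp add: X_def distrib_left)
    then have "2 * X / \<alpha>1 \<le> (N a + 2 * Q) / \<alpha>1" using \<alpha>1 by (intro divide_right_mono) auto
    then show "2 / \<alpha>1 * X \<le> (N a + 2 * Q) / \<alpha>1" by simp
  qed
  finally show "(\<integral>\<^sup>+s\<in>{a..b}. (\<integral>\<^sup>+x. ennreal (\<bar>V s x + c s * h x\<bar> powr p) \<partial>lborel) \<partial>lborel)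
      \<le> ennreal (((\<integral>x. (V a x)\<^sup>2 \<partial>lborel) + 2 * integral {a..b} (\<lambda>s. load (c s))) / \<alpha>1)"
    unfolding Y_def Q_def N_def .
qed

definition D3 :: real where
  "D3 = (\<integral>x. 2 * \<beta> * (h x)\<^sup>2 + (Lh x)\<^sup>2 + ((h x)\<^sup>2 + (\<psi>2 x)\<^sup>2) + 2 * \<alpha>2 * \<bar>h x\<bar> powr p \<partial>lborel)"

text \<open>The energy of the difference of a random and a deterministic solution that is
  produced up to time \<open>T\<close>, per size \<open>\<delta>\<close> of the noise and for
  initial values with squared norm at most \<open>r\<close>. The second summand bounds the
  space-time integrals of both \<open>p\<close>-th powers.\<close>

definition gap :: "real \<Rightarrow> real \<Rightarrow> real" where
  "gap T r = 2 * (T * D3 + \<alpha>2 * (2 * ((r + 2 * (T * (D0 + D1 + D2))) / \<alpha>1)))"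

lemma D3_nonneg: "0 \<le> D3"
  unfolding D3_def using \<alpha>2 \<beta> by (intro Bochner_Integration.integral_nonneg) simp

text \<open>The nonlinear terms are compared at \<open>U = v + y h\<close> and
  \<open>u\<close>, which differ by \<open>(v - u) + y h\<close>. Against \<open>U - u\<close>
  the one-sided Lipschitz bound applies; the correction by \<open>y h\<close> carries a factor
  \<open>\<delta>\<close>, and the growth condition bounds it by \<open>p\<close>-th powers.\<close>

lemma forcing_difference_pointwise:
  assumes \<delta>: "\<delta> \<le> 1"
  shows "AE x in lborel. \<forall>v u y. \<bar>y\<bar> \<le> \<delta> \<longrightarrow>
     ((- lam * v + f x (v + y * h x) + (g x + y * Lh x)) - (- lam * u + f x u + g x)) * (v - u)
     \<le> (2 * \<beta> + 1) * (v - u)\<^sup>2 + \<delta> * ((2 * \<beta> * (h x)\<^sup>2 + (Lh x)\<^sup>2 + ((h x)\<^sup>2 + (\<psi>2 x)\<^sup>2) + 2 * \<alpha>2 * \<bar>h x\<bar> powr p)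
         + \<alpha>2 * (\<bar>v + y * h x\<bar> powr p + \<bar>u\<bar> powr p))"
  using growth
proof eventually_elim
  case (elim x)
  show ?case
  proof (intro allI impI)
    fix v u y :: real assume y: "\<bar>y\<bar> \<le> \<delta>"
    define U where "U = v + y * h x"
    define w where "w = v - u"
    have Uu: "U - u = w + y * h x" by (simp add: U_def w_def)
    have y2: "y\<^sup>2 \<le> \<delta>"
    proof -
      have "\<bar>y\<bar> * \<bar>y\<bar> \<le> 1 * \<delta>" using y \<delta> by (intro mult_mono) auto
      then show ?thesis by (simp add: power2_eq_square)
    qed
    have growthx: "\<bar>f x s\<bar> \<le> \<alpha>2 * \<bar>s\<bar> powr (p - 1) + \<psi>2 x" for s using elim by blast
    have Y: "\<bar>h x\<bar> * \<bar>f x s\<bar> \<le> \<alpha>2 * (\<bar>h x\<bar> powr p + \<bar>s\<bar> powr p) + ((h x)\<^sup>2 + (\<psi>2 x)\<^sup>2) / 2" for s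
    proof -
      have "\<bar>h x\<bar> * \<bar>f x s\<bar> \<le> \<bar>h x\<bar> * (\<alpha>2 * \<bar>s\<bar> powr (p - 1) + \<psi>2 x)" by (intro mult_left_mono growthx) simp
      also have "\<dots> = \<alpha>2 * (\<bar>h x\<bar> * \<bar>s\<bar> powr (p - 1)) + \<bar>h x\<bar> * \<psi>2 x" by (simp add: algebra_simps)
      also have "\<alpha>2 * (\<bar>h x\<bar> * \<bar>s\<bar> powr (p - 1)) \<le> \<alpha>2 * (\<bar>h x\<bar> powr p + \<bar>s\<bar> powr p)"
        using \<alpha>2 p by (intro mult_left_mono young_powr) auto
      also have "\<bar>h x\<bar> * \<psi>2 x \<le> ((h x)\<^sup>2 + (\<psi>2 x)\<^sup>2) / 2"
        using sum_squares_bound[of "\<bar>h x\<bar>" "\<psi>2 x"] by simp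
      finally show ?thesis by simp
    qed
    have 1: "(f x U - f x u) * (U - u) \<le> 2 * \<beta> * w\<^sup>2 + \<delta> * (2 * \<beta> * (h x)\<^sup>2)"
    proof -
      have "(f x U - f x u) * (U - u) \<le> \<beta> * (w + y * h x)\<^sup>2" using one_sided[of x U u] unfolding Uu .
      also have "\<dots> \<le> \<beta> * (2 * w\<^sup>2 + 2 * (y * h x)\<^sup>2)"
      proof (rule mult_left_mono)
        show "(w + y * h x)\<^sup>2 \<le> 2 * w\<^sup>2 + 2 * (y * h x)\<^sup>2"
          using zero_le_power2[of "w - y * h x"] unfolding power2_sum power2_diff by linarith
      qed (use \<beta> in simp)
      also have "\<dots> = 2 * \<beta> * w\<^sup>2 + y\<^sup>2 * (2 * \<beta> * (h x)\<^sup>2)" by (simp add: power_mult_distrib algebra_simps)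
      also have "y\<^sup>2 * (2 * \<beta> * (h x)\<^sup>2) \<le> \<delta> * (2 * \<beta> * (h x)\<^sup>2)" using y2 \<beta> by (intro mult_right_mono) auto
      finally show ?thesis by simp
    qed
    have 2: "- ((f x U - f x u) * (y * h x)) \<le> \<delta> * (\<alpha>2 * (\<bar>h x\<bar> powr p + \<bar>U\<bar> powr p) + \<alpha>2 * (\<bar>h x\<bar> powr p + \<bar>u\<bar> powr p) + ((h x)\<^sup>2 + (\<psi>2 x)\<^sup>2))"
    proof -
      have "- ((f x U - f x u) * (y * h x)) \<le> \<bar>(f x U - f x u) * (y * h x)\<bar>" by linarith
      also have "\<dots> = \<bar>y\<bar> * (\<bar>h x\<bar> * \<bar>f x U - f x u\<bar>)" by (simp add: abs_mult mult_ac)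
      also have "\<dots> \<le> \<delta> * (\<bar>h x\<bar> * (\<bar>f x U\<bar> + \<bar>f x u\<bar>))"
        using y by (intro mult_mono mult_left_mono abs_triangle_ineq4) auto
      also have "\<dots> = \<delta> * (\<bar>h x\<bar> * \<bar>f x U\<bar> + \<bar>h x\<bar> * \<bar>f x u\<bar>)" by (simp add: distrib_left)
      also have "\<dots> \<le> \<delta> * ((\<alpha>2 * (\<bar>h x\<bar> powr p + \<bar>U\<bar> powr p) + ((h x)\<^sup>2 + (\<psi>2 x)\<^sup>2) / 2) + (\<alpha>2 * (\<bar>h x\<bar> powr p + \<bar>u\<bar> powr p) + ((h x)\<^sup>2 + (\<psi>2 x)\<^sup>2) / 2))"
        using y by (intro mult_left_mono add_mono Y) auto
      finally show ?thesis by (simp add: field_simps)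
    qed
    have 3: "(y * Lh x) * w \<le> w\<^sup>2 + \<delta> * (Lh x)\<^sup>2"
    proof -
      have "(y * Lh x) * w \<le> (y * Lh x)\<^sup>2 + w\<^sup>2" using abs_mult_le_squares[of "y * Lh x" w] by linarith
      also have "(y * Lh x)\<^sup>2 \<le> \<delta> * (Lh x)\<^sup>2" using y2 by (simp add: power_mult_distrib mult_right_mono)
      finally show ?thesis by simp
    qed
    have "((- lam * v + f x U + (g x + y * Lh x)) - (- lam * u + f x u + g x)) * w
      = - lam * w\<^sup>2 + ((f x U - f x u) * (U - u) - (f x U - f x u) * (y * h x)) + (y * Lh x) * w"
      unfolding Uu by (simp add: w_def power2_eq_square algebra_simps)
    also have "\<dots> \<le> 0 + ((2 * \<beta> * w\<^sup>2 + \<delta> * (2 * \<beta> * (h x)\<^sup>2)) + \<delta> * (\<alpha>2 * (\<bar>h x\<bar> powr p + \<bar>U\<bar> powr p) + \<alpha>2 * (\<bar>h x\<bar> powr p + \<bar>u\<bar> powr p) + ((h x)\<^sup>2 + (\<psi>2 x)\<^sup>2)))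
        + (w\<^sup>2 + \<delta> * (Lh x)\<^sup>2)"
    proof -
      have "- lam * w\<^sup>2 \<le> 0" using lam by (intro mult_nonpos_nonneg) auto
      then show ?thesis using 1 2 3 by linarith
    qed
    also have "\<dots> = (2 * \<beta> + 1) * w\<^sup>2 + \<delta> * ((2 * \<beta> * (h x)\<^sup>2 + (Lh x)\<^sup>2 + ((h x)\<^sup>2 + (\<psi>2 x)\<^sup>2) + 2 * \<alpha>2 * \<bar>h x\<bar> powr p)
         + \<alpha>2 * (\<bar>U\<bar> powr p + \<bar>u\<bar> powr p))"
      by (simp add: algebra_simps)
    finally show "((- lam * v + f x (v + y * h x) + (g x + y * Lh x)) - (- lam * u + f x u + g x)) * (v - u)
     \<le> (2 * \<beta> + 1) * (v - u)\<^sup>2 + \<delta> * ((2 * \<beta> * (h x)\<^sup>2 + (Lh x)\<^sup>2 + ((h x)\<^sup>2 + (\<psi>2 x)\<^sup>2) + 2 * \<alpha>2 * \<bar>h x\<bar> powr p)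
         + \<alpha>2 * (\<bar>v + y * h x\<bar> powr p + \<bar>u\<bar> powr p))"
      unfolding U_def w_def .
  qed
qed

lemma powr_space_time_bound:
  assumes e: "weak_evolution 0 T B V (forcing c V)" and c: "continuous_on UNIV c" and T: "0 \<le> T"
    and N: "continuous_on {0..T} (\<lambda>t. \<integral>x. (V t x)\<^sup>2 \<partial>lborel)"
    and c1: "\<And>s. s \<in> {0..T} \<Longrightarrow> \<bar>c s\<bar> \<le> 1" and r: "(\<integral>x. (V 0 x)\<^sup>2 \<partial>lborel) \<le> r"
  shows "(\<integral>\<^sup>+s\<in>{0..T}. (\<integral>\<^sup>+x. ennreal (\<bar>V s x + c s * h x\<bar> powr p) \<partial>lborel) \<partial>lborel)
      \<le> ennreal ((r + 2 * (T * (D0 + D1 + D2))) / \<alpha>1)"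
proof -
  have lc: "continuous_on {0..T} (\<lambda>s. load (c s))" by (rule load_continuous[OF continuous_on_subset[OF c]]) simp
  have "integral {0..T} (\<lambda>s. load (c s)) \<le> integral {0..T} (\<lambda>s. D0 + D1 + D2)"
    using c1 by (intro integral_le integrable_continuous_interval lc continuous_intros load_le) auto
  then have "integral {0..T} (\<lambda>s. load (c s)) \<le> T * (D0 + D1 + D2)" using T by simp
  then have "((\<integral>x. (V 0 x)\<^sup>2 \<partial>lborel) + 2 * integral {0..T} (\<lambda>s. load (c s))) / \<alpha>1 \<le> (r + 2 * (T * (D0 + D1 + D2))) / \<alpha>1"
    using r \<alpha>1 by (intro divide_right_mono) auto
  then show ?thesis
    using energy_estimate(2)[OF e c N order_refl T order_refl] by (meson ennreal_leI order_trans)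
qed

text \<open>The \<open>p\<close>-th powers in the bound of
  \<open>forcing_difference_pointwise\<close> are integrable in space and time by
  \<open>powr_space_time_bound\<close>, with a bound that depends only on \<open>T\<close> and
  \<open>r\<close>. The rest is Gronwall's inequality.\<close>

lemma difference_estimate:
  assumes e: "weak_evolution 0 T B V (forcing c V)" and e': "weak_evolution 0 T B' V' (forcing (\<lambda>_. 0) V')"
    and c: "continuous_on UNIV c" and T: "0 \<le> T"
    and N: "continuous_on {0..T} (\<lambda>t. \<integral>x. (V t x)\<^sup>2 \<partial>lborel)" and N': "continuous_on {0..T} (\<lambda>t. \<integral>x. (V' t x)\<^sup>2 \<partial>lborel)"
    and NW: "continuous_on {0..T} (\<lambda>t. \<integral>x. (V t x - V' t x)\<^sup>2 \<partial>lborel)"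
    and \<delta>: "\<And>s. s \<in> {0..T} \<Longrightarrow> \<bar>c s\<bar> \<le> \<delta>" "\<delta> \<le> 1"
    and r: "(\<integral>x. (V 0 x)\<^sup>2 \<partial>lborel) \<le> r" "(\<integral>x. (V' 0 x)\<^sup>2 \<partial>lborel) \<le> r"
  shows "(\<integral>x. (V T x - V' T x)\<^sup>2 \<partial>lborel) \<le> ((\<integral>x. (V 0 x - V' 0 x)\<^sup>2 \<partial>lborel) + \<delta> * gap T r) * exp (2 * (2 * \<beta> + 1) * T)"
proof -
  have c_meas[measurable]: "c \<in> borel_measurable borel" by (rule borel_measurable_continuous_onI[OF c])
  note V_meas[measurable] = weak_evolution.V_meas[OF e] weak_evolution.V_meas[OF e']
  define M where "M t = (\<integral>x. (V t x - V' t x)\<^sup>2 \<partial>lborel)" for t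
  have M0: "0 \<le> M t" for t unfolding M_def by (rule Bochner_Integration.integral_nonneg) simp
  have \<delta>0: "0 \<le> \<delta>" using \<delta>(1)[of 0] T by simp
  define P where "P = (r + 2 * (T * (D0 + D1 + D2))) / \<alpha>1"
  have r0: "0 \<le> r"
    by (rule order_trans[OF _ r(1)]) (rule Bochner_Integration.integral_nonneg, simp)
  have P0: "0 \<le> P" unfolding P_def using r0 T D_nonneg \<alpha>1 by (intro divide_nonneg_pos add_nonneg_nonneg mult_nonneg_nonneg) auto
  define pU where "pU s x = \<bar>V s x + c s * h x\<bar> powr p" for s x
  define pu where "pu s x = \<bar>V' s x\<bar> powr p" for s x
  define H where "H x = 2 * \<beta> * (h x)\<^sup>2 + (Lh x)\<^sup>2 + ((h x)\<^sup>2 + (\<psi>2 x)\<^sup>2) + 2 * \<alpha>2 * \<bar>h x\<bar> powr p" for x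
  have m[measurable]: "(\<lambda>(s, x). pU s x) \<in> borel_measurable (lborel \<Otimes>\<^sub>M lborel)" "(\<lambda>(s, x). pu s x) \<in> borel_measurable (lborel \<Otimes>\<^sub>M lborel)"
    "H \<in> borel_measurable borel"
    unfolding pU_def pu_def H_def by measurable
  have pnn: "0 \<le> pU s x" "0 \<le> pu s x" for s x by (simp_all add: pU_def pu_def)
  have H0: "0 \<le> H x" for x unfolding H_def using \<beta> \<alpha>2 by (intro add_nonneg_nonneg mult_nonneg_nonneg) auto
  have intH: "integrable lborel H" unfolding H_def[abs_def] using int by auto
  have HD3: "(\<integral>\<^sup>+x. ennreal (H x) \<partial>lborel) = ennreal D3"
    using nn_integral_eq_integral[OF intH] H0 by (simp add: D3_def H_def[abs_def])
  have PU: "(\<integral>\<^sup>+s\<in>{0..T}. (\<integral>\<^sup>+x. ennreal (pU s x) \<partial>lborel) \<partial>lborel) \<le> ennreal P"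
    unfolding pU_def P_def by (rule powr_space_time_bound[OF e c T N _ r(1)]) (use \<delta> in force)
  have Pu: "(\<integral>\<^sup>+s\<in>{0..T}. (\<integral>\<^sup>+x. ennreal (pu s x) \<partial>lborel) \<partial>lborel) \<le> ennreal P"
    using powr_space_time_bound[OF e' continuous_on_const T N' _ r(2)] unfolding pu_def P_def by simp
  have step: "M b \<le> (M 0 + \<delta> * gap T r) + 2 * (2 * \<beta> + 1) * integral {0..b} M" if b: "0 \<le> b" "b \<le> T" for b
  proof -
    interpret W: weak_evolution 0 b "2 * B + 2 * B'" "\<lambda>s x. V s x - V' s x" "\<lambda>s x. forcing c V s x - forcing (\<lambda>_. 0) V' s x"
      by (rule weak_evolution.subinterval[OF weak_evolution_diff[OF e e']]) (use b in auto)
    have Mc: "continuous_on {0..b} (\<lambda>s. (2 * \<beta> + 1) * M s)"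
      unfolding M_def using b by (intro continuous_intros continuous_on_subset[OF NW]) auto
    define Kp where "Kp s x = (2 * \<beta> + 1) * (V s x - V' s x)\<^sup>2 + \<delta> * (H x + \<alpha>2 * (pU s x + pu s x))" for s x
    have Kp_meas: "(\<lambda>(s, x). Kp s x) \<in> borel_measurable (lborel \<Otimes>\<^sub>M lborel)" unfolding Kp_def by measurable
    have Kp0: "0 \<le> Kp s x" for s x
      unfolding Kp_def using \<beta> \<alpha>2 \<delta>0 H0 pnn by (intro add_nonneg_nonneg mult_nonneg_nonneg) auto
    have zero: "(\<lambda>(s::real, x::'a). 0::real) \<in> borel_measurable (lborel \<Otimes>\<^sub>M lborel)" by simp
    have le: "AE x in lborel. (forcing c V s x - forcing (\<lambda>_. 0) V' s x) * (V s x - V' s x) \<le> Kp s x - 0" if s: "s \<in> {0..b}" for s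
      using forcing_difference_pointwise[OF \<delta>(2)]
    proof eventually_elim
      case (elim x)
      have "\<bar>c s\<bar> \<le> \<delta>" using s b by (intro \<delta>(1)) auto
      then show ?case using elim[rule_format, of "c s" "V s x" "V' s x"]
        by (simp add: forcing_def Kp_def H_def pU_def pu_def)
    qed
    define Q where "Q = integral {0..b} (\<lambda>s. (2 * \<beta> + 1) * M s) + \<delta> * (T * D3 + \<alpha>2 * (2 * P))"
    have int0: "0 \<le> integral {0..b} (\<lambda>s. (2 * \<beta> + 1) * M s)"
      using \<beta> M0 by (intro Henstock_Kurzweil_Integration.integral_nonneg integrable_continuous_interval Mc) auto
    have rest0: "0 \<le> T * D3 + \<alpha>2 * (2 * P)" using T D3_nonneg \<alpha>2 P0 by simp
    have Q0: "0 \<le> Q" unfolding Q_def by (rule add_nonneg_nonneg[OF int0 mult_nonneg_nonneg[OF \<delta>0 rest0]])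
    have split: "(\<integral>\<^sup>+x. ennreal (Kp s x) \<partial>lborel) = ennreal ((2 * \<beta> + 1) * M s)
        + ennreal \<delta> * (ennreal D3 + ennreal \<alpha>2 * ((\<integral>\<^sup>+x. ennreal (pU s x) \<partial>lborel) + (\<integral>\<^sup>+x. ennreal (pu s x) \<partial>lborel)))"
      if s: "s \<in> {0..b}" for s
    proof -
      have pt: "ennreal (Kp s x) = ennreal ((2 * \<beta> + 1) * (V s x - V' s x)\<^sup>2) + ennreal \<delta> * (ennreal (H x) + ennreal \<alpha>2 * (ennreal (pU s x) + ennreal (pu s x)))" for x
      proof -
        have "0 \<le> \<alpha>2 * (pU s x + pu s x)" using \<alpha>2 pnn by (intro mult_nonneg_nonneg add_nonneg_nonneg) auto
        then show ?thesis
          unfolding Kp_def using \<beta> \<alpha>2 \<delta>0 H0[of x] pnn[of s x]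
          by (subst ennreal_plus; simp add: ennreal_mult)
      qed
      have mV[measurable]: "(\<lambda>x. V s x - V' s x) \<in> borel_measurable borel" by (rule W.V_meas1)
      have mp[measurable]: "pU s \<in> borel_measurable borel" "pu s \<in> borel_measurable borel"
        using measurable_compose[OF measurable_Pair1'[of s lborel lborel] m(1)] measurable_compose[OF measurable_Pair1'[of s lborel lborel] m(2)] by simp_all
      have sq: "(\<integral>\<^sup>+x. ennreal ((2 * \<beta> + 1) * (V s x - V' s x)\<^sup>2) \<partial>lborel) = ennreal ((2 * \<beta> + 1) * M s)"
        unfolding M_def using W.V_sq[OF s] \<beta> by (subst nn_integral_eq_integral) auto
      show ?thesis
        unfolding pt HD3[symmetric] sq[symmetric]
        by (simp add: nn_integral_add nn_integral_cmult)
    qed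
    have mI[measurable]: "(\<lambda>s. \<integral>\<^sup>+x. ennreal (pU s x) \<partial>lborel) \<in> borel_measurable lborel" "(\<lambda>s. \<integral>\<^sup>+x. ennreal (pu s x) \<partial>lborel) \<in> borel_measurable lborel"
      by measurable
    have "(\<integral>\<^sup>+s\<in>{0..b}. (\<integral>\<^sup>+x. ennreal (Kp s x) \<partial>lborel) \<partial>lborel)
      \<le> (\<integral>\<^sup>+s. ennreal ((2 * \<beta> + 1) * M s) * indicator {0..b} s + ennreal \<delta> * (ennreal D3 * indicator {0..T} s
          + ennreal \<alpha>2 * ((\<integral>\<^sup>+x. ennreal (pU s x) \<partial>lborel) * indicator {0..T} s + (\<integral>\<^sup>+x. ennreal (pu s x) \<partial>lborel) * indicator {0..T} s)) \<partial>lborel)"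
    proof (rule nn_integral_mono)
      fix s
      show "(\<integral>\<^sup>+x. ennreal (Kp s x) \<partial>lborel) * indicator {0..b} s \<le> ennreal ((2 * \<beta> + 1) * M s) * indicator {0..b} s + ennreal \<delta> * (ennreal D3 * indicator {0..T} s
          + ennreal \<alpha>2 * ((\<integral>\<^sup>+x. ennreal (pU s x) \<partial>lborel) * indicator {0..T} s + (\<integral>\<^sup>+x. ennreal (pu s x) \<partial>lborel) * indicator {0..T} s))"
      proof (cases "s \<in> {0..b}")
        case True
        then have "s \<in> {0..T}" using b by auto
        then show ?thesis using True split[OF True] by simp
      qed simp
    qed
    also have "\<dots> = (\<integral>\<^sup>+s. ennreal ((2 * \<beta> + 1) * M s) * indicator {0..b} s \<partial>lborel) + ennreal \<delta> * (ennreal D3 * emeasure lborel {0..T}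
          + ennreal \<alpha>2 * ((\<integral>\<^sup>+s\<in>{0..T}. (\<integral>\<^sup>+x. ennreal (pU s x) \<partial>lborel) \<partial>lborel) + (\<integral>\<^sup>+s\<in>{0..T}. (\<integral>\<^sup>+x. ennreal (pu s x) \<partial>lborel) \<partial>lborel)))"
    proof -
      have "(\<lambda>s. ennreal ((2 * \<beta> + 1) * M s) * indicator {0..b} s) \<in> borel_measurable lborel"
      proof -
        have "(\<lambda>s. indicator {0..b} s *\<^sub>R ((2 * \<beta> + 1) * M s)) \<in> borel_measurable borel"
          by (rule borel_measurable_continuous_on_indicator[OF _ Mc]) simp
        then have "(\<lambda>s. ennreal (indicator {0..b} s *\<^sub>R ((2 * \<beta> + 1) * M s))) \<in> borel_measurable lborel" by simp
        also have "(\<lambda>s. ennreal (indicator {0..b} s *\<^sub>R ((2 * \<beta> + 1) * M s))) = (\<lambda>s. ennreal ((2 * \<beta> + 1) * M s) * indicator {0..b} s)"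
          by (auto simp: indicator_def)
        finally show ?thesis .
      qed
      then show ?thesis by (simp add: nn_integral_add nn_integral_cmult)
    qed
    also have "\<dots> \<le> ennreal (integral {0..b} (\<lambda>s. (2 * \<beta> + 1) * M s)) + ennreal \<delta> * (ennreal D3 * ennreal T + ennreal \<alpha>2 * (ennreal P + ennreal P))"
    proof (intro add_mono mult_left_mono PU Pu)
      show "(\<integral>\<^sup>+s. ennreal ((2 * \<beta> + 1) * M s) * indicator {0..b} s \<partial>lborel) \<le> ennreal (integral {0..b} (\<lambda>s. (2 * \<beta> + 1) * M s))"
        using nn_integral_continuous_interval[OF Mc] \<beta> M0 by simp
      show "emeasure lborel {0..T} \<le> ennreal T" using T by simp
    qed simp_all
    also have "\<dots> = ennreal Q"
    proof -
      have "ennreal D3 * ennreal T + ennreal \<alpha>2 * (ennreal P + ennreal P) = ennreal (T * D3 + \<alpha>2 * (2 * P))"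
        using D3_nonneg T \<alpha>2 P0 by (simp add: ennreal_mult[symmetric] ennreal_plus[symmetric] mult.commute del: ennreal_plus)
      then have "ennreal \<delta> * (ennreal D3 * ennreal T + ennreal \<alpha>2 * (ennreal P + ennreal P)) = ennreal (\<delta> * (T * D3 + \<alpha>2 * (2 * P)))"
        using \<delta>0 by (simp only: ennreal_mult')
      then show ?thesis unfolding Q_def using int0 rest0 \<delta>0 by (simp only: ennreal_plus mult_nonneg_nonneg)
    qed
    finally have Q: "(\<integral>\<^sup>+s\<in>{0..b}. (\<integral>\<^sup>+x. ennreal (Kp s x) \<partial>lborel) \<partial>lborel) \<le> ennreal Q" .
    have "M b \<le> M 0 + 2 * Q"
      unfolding M_def by (rule W.energy_inequality(1)[OF Kp_meas zero Kp0 order_refl le Q Q0])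
    also have "M 0 + 2 * Q = (M 0 + \<delta> * gap T r) + 2 * (2 * \<beta> + 1) * integral {0..b} M"
    proof -
      have "integral {0..b} (\<lambda>s. (2 * \<beta> + 1) * M s) = (2 * \<beta> + 1) * integral {0..b} M" by simp
      then show ?thesis unfolding Q_def gap_def P_def by (simp add: distrib_left mult_ac)
    qed
    finally show ?thesis .
  qed
  have L: "0 \<le> 2 * (2 * \<beta> + 1)" using \<beta> by simp
  show ?thesis
    using gronwall[OF T L, of M "M 0 + \<delta> * gap T r"] NW step by (simp add: M_def)
qed

end

section \<open>Growth of the stationary Ornstein-Uhlenbeck process\<close>

lemma nn_integral_exp_atMost:
  assumes "0 < lam"
  shows "(\<integral>\<^sup>+s\<in>{..t}. ennreal (exp (lam * s)) \<partial>lborel) = ennreal (exp (lam * t) / lam)"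
proof -
  have "(\<integral>\<^sup>+s\<in>{..t}. ennreal (exp (lam * s)) \<partial>lborel) = (\<integral>\<^sup>+u. (\<lambda>s. ennreal (exp (lam * s)) * indicator {..t} s) (t - u) \<partial>lborel)"
    by (rule nn_integral_lborel_shift(2)[symmetric]) measurable
  also have "\<dots> = (\<integral>\<^sup>+u. ennreal (exp (lam * (t - u))) * indicator {0..} u \<partial>lborel)"
    by (intro nn_integral_cong) (auto simp: indicator_def)
  also have "\<dots> = ennreal (0 - (- exp (lam * (t - 0)) / lam))"
  proof (rule nn_integral_FTC_atLeast)
    show "((\<lambda>u. - exp (lam * (t - u)) / lam) has_real_derivative exp (lam * (t - x))) (at x)" for x
      using assms by (auto intro!: derivative_eq_intros)
    have "filterlim (\<lambda>u. lam * (t - u)) at_bot at_top"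
      using assms by real_asymp
    then have "((\<lambda>u. exp (lam * (t - u))) \<longlongrightarrow> 0) at_top" by (rule filterlim_compose[OF exp_at_bot])
    then have "((\<lambda>u. - exp (lam * (t - u)) / lam) \<longlongrightarrow> - 0 / lam) at_top"
      using assms by (intro tendsto_intros) auto
    then show "((\<lambda>u. - exp (lam * (t - u)) / lam) \<longlongrightarrow> 0) at_top" by simp
  qed auto
  finally show ?thesis by simp
qed

lemma exp_atMost_integral:
  fixes lam t :: real
  assumes "0 < lam"
  shows "set_integrable lborel {..t} (\<lambda>s. exp (lam * s))" "(LINT s:{..t}|lborel. exp (lam * s)) = exp (lam * t) / lam"
proof -
  have nn: "(\<integral>\<^sup>+s. ennreal (indicator {..t} s *\<^sub>R exp (lam * s)) \<partial>lborel) = ennreal (exp (lam * t) / lam)"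
    unfolding nn_integral_exp_atMost[OF assms, symmetric] by (intro nn_integral_cong) (auto simp: indicator_def)
  show int: "set_integrable lborel {..t} (\<lambda>s. exp (lam * s))"
    unfolding set_integrable_def by (rule integrableI_nonneg) (use nn in auto)
  show "(LINT s:{..t}|lborel. exp (lam * s)) = exp (lam * t) / lam"
    unfolding set_lebesgue_integral_def
    using nn nn_integral_eq_integral[OF int[unfolded set_integrable_def]] assms
    by (simp add: set_lebesgue_integral_def)
qed

text \<open>A single path with a finite weighted moment. The order is even, which suits
  Gaussian moments, and large enough for the \<open>m\<close>-th power of the remainder below
  to use up only half of the weight (\<open>ou_weighted_bound\<close>); \<open>m\<close> is an
  integer above \<open>p\<close>.\<close>

context
  fixes lam p :: real and m :: nat and \<omega> :: "real \<Rightarrow> real"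
  assumes lam: "0 < lam" and p: "2 \<le> p" "p \<le> real m" and \<omega>: "continuous_on UNIV \<omega>" "\<omega> 0 = 0"
    and fin: "(\<integral>\<^sup>+s\<in>{..0}. ennreal (exp (lam * s) * \<bar>\<omega> s\<bar> ^ (2 * m)) \<partial>lborel) < \<infinity>"
begin

lemma \<omega>_meas: "\<omega> \<in> borel_measurable borel"
  by (rule borel_measurable_continuous_onI[OF \<omega>(1)])

definition moment :: real where "moment = (LINT s:{..0}|lborel. exp (lam * s) * \<bar>\<omega> s\<bar> ^ (2 * m))"

lemma m2: "2 \<le> m" using p by linarith

lemma moment_integrable: "set_integrable lborel {..0} (\<lambda>s. exp (lam * s) * \<bar>\<omega> s\<bar> ^ (2 * m))"
  unfolding set_integrable_def
proof (rule integrableI_nonneg)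
  note \<omega>_meas[measurable]
  show "(\<lambda>s. indicator {..0} s *\<^sub>R (exp (lam * s) * \<bar>\<omega> s\<bar> ^ (2 * m))) \<in> borel_measurable lborel" by measurable
  have "(\<integral>\<^sup>+s. ennreal (indicator {..0} s *\<^sub>R (exp (lam * s) * \<bar>\<omega> s\<bar> ^ (2 * m))) \<partial>lborel)
     = (\<integral>\<^sup>+s\<in>{..0}. ennreal (exp (lam * s) * \<bar>\<omega> s\<bar> ^ (2 * m)) \<partial>lborel)"
    by (intro nn_integral_cong) (auto simp: indicator_def)
  then show "(\<integral>\<^sup>+s. ennreal (indicator {..0} s *\<^sub>R (exp (lam * s) * \<bar>\<omega> s\<bar> ^ (2 * m))) \<partial>lborel) < \<infinity>" using fin by simp
qed auto

lemma moment_nonneg: "0 \<le> moment"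
  unfolding moment_def set_lebesgue_integral_def by (intro Bochner_Integration.integral_nonneg) simp

text \<open>The level \<open>A\<close> splits a path into a bounded part and a part controlled
  by the moment.\<close>

lemma split_power:
  fixes A x :: real assumes "0 < A"
  shows "\<bar>x\<bar> \<le> A + \<bar>x\<bar> ^ (2 * m) / A ^ (2 * m - 1)"
proof (cases "\<bar>x\<bar> \<le> A")
  case True then show ?thesis using assms by (simp add: add_increasing2)
next
  case False
  have "\<bar>x\<bar> ^ (2 * m) = \<bar>x\<bar> * \<bar>x\<bar> ^ (2 * m - 1)" using m2 by (simp flip: power_Suc)
  moreover have "A ^ (2 * m - 1) \<le> \<bar>x\<bar> ^ (2 * m - 1)" using False assms by (intro power_mono) auto
  ultimately have "\<bar>x\<bar> * A ^ (2 * m - 1) \<le> \<bar>x\<bar> ^ (2 * m)" by (simp add: mult_left_mono)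
  then have "\<bar>x\<bar> \<le> \<bar>x\<bar> ^ (2 * m) / A ^ (2 * m - 1)" using assms by (simp add: field_simps)
  then show ?thesis using assms by linarith
qed

lemma weighted_integrable: "t \<le> 0 \<Longrightarrow> set_integrable lborel {..t} (\<lambda>s. exp (lam * s) * \<omega> s)"
proof -
  assume t: "t \<le> 0"
  note \<omega>_meas[measurable]
  have i: "set_integrable lborel {..t} (\<lambda>s. exp (lam * s) * 1 + exp (lam * s) * \<bar>\<omega> s\<bar> ^ (2 * m))"
    using exp_atMost_integral(1)[OF lam] set_integrable_subset[OF moment_integrable, of "{..t}"] t
    by (intro set_integral_add) auto
  show ?thesis
    unfolding set_integrable_def
  proof (rule Bochner_Integration.integrable_bound[OF i[unfolded set_integrable_def]])
    have "\<bar>exp (lam * s) * \<omega> s\<bar> \<le> \<bar>exp (lam * s) * 1 + exp (lam * s) * \<bar>\<omega> s\<bar> ^ (2 * m)\<bar>" for s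
    proof -
      have "exp (lam * s) * \<bar>\<omega> s\<bar> \<le> exp (lam * s) * (1 + \<bar>\<omega> s\<bar> ^ (2 * m))"
        using split_power[of 1 "\<omega> s"] by (intro mult_left_mono) auto
      then show ?thesis by (simp add: abs_mult distrib_left)
    qed
    then show "AE s in lborel. norm (indicator {..t} s *\<^sub>R (exp (lam * s) * \<omega> s)) \<le> norm (indicator {..t} s *\<^sub>R (exp (lam * s) * 1 + exp (lam * s) * \<bar>\<omega> s\<bar> ^ (2 * m)))"
      by (auto simp: indicator_def)
  qed measurable
qed

definition primitive :: "real \<Rightarrow> real" where "primitive t = (LINT s:{..t}|lborel. exp (lam * s) * \<omega> s)"

lemma primitive_continuous_path: "continuous_on {..0} primitive"
  unfolding continuous_on_sequentially
proof (intro allI ballI impI)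
  note \<omega>_meas[measurable]
  fix u t assume t: "t \<in> {..0::real}" and u: "(\<forall>n. u n \<in> {..0::real}) \<and> u \<longlonglongrightarrow> t"
  show "(primitive \<circ> u) \<longlonglongrightarrow> primitive t"
    unfolding primitive_def set_lebesgue_integral_def o_def
  proof (rule integral_dominated_convergence[where w = "\<lambda>s. \<bar>indicator {..0} s *\<^sub>R (exp (lam * s) * \<omega> s)\<bar>"])
    show "integrable lborel (\<lambda>s. \<bar>indicator {..0} s *\<^sub>R (exp (lam * s) * \<omega> s)\<bar>)"
      using weighted_integrable[of 0] unfolding set_integrable_def by (intro integrable_abs) simp
    show "AE s in lborel. norm (indicator {..u n} s *\<^sub>R (exp (lam * s) * \<omega> s)) \<le> \<bar>indicator {..0} s *\<^sub>R (exp (lam * s) * \<omega> s)\<bar>" for n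
      using u by (intro AE_I2) (auto simp: indicator_def dest: spec[of _ n])
    show "AE s in lborel. (\<lambda>n. indicator {..u n} s *\<^sub>R (exp (lam * s) * \<omega> s)) \<longlonglongrightarrow> indicator {..t} s *\<^sub>R (exp (lam * s) * \<omega> s)"
      using AE_lborel_singleton[of t]
    proof eventually_elim
      case (elim s)
      have "\<forall>\<^sub>F n in sequentially. (indicator {..u n} s :: real) = indicator {..t} s"
      proof (cases "s < t")
        case True
        then have "\<forall>\<^sub>F n in sequentially. s < u n" using u order_tendstoD(1) by blast
        then show ?thesis using True by (auto elim!: eventually_mono)
      next
        case False
        then have "\<forall>\<^sub>F n in sequentially. u n < s" using u elim order_tendstoD(2)[of u t sequentially s] by auto
        then show ?thesis using False elim by (auto elim!: eventually_mono)
      qed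
      then have "(\<lambda>n. indicator {..u n} s :: real) \<longlonglongrightarrow> indicator {..t} s" by (rule tendsto_eventually)
      then show ?case by (intro tendsto_intros)
    qed
  qed measurable
qed

text \<open>Substitute \<open>\<tau> + t\<close> in the integral that defines the process; the
  constant \<open>\<omega> t\<close> subtracted by the shift integrates to \<open>\<omega> t /
  lam\<close>.\<close>

lemma ou_shift_eq:
  assumes t: "t \<le> 0"
  shows "ou lam (shift t \<omega>) = \<omega> t - lam * exp (- lam * t) * primitive t"
proof -
  note \<omega>_meas[measurable]
  define F where "F s = indicator {..t} s *\<^sub>R (exp (lam * s) * \<omega> s)" for s
  have F_meas: "F \<in> borel_measurable borel" unfolding F_def by measurable
  have Fi: "integrable lborel F" using weighted_integrable[OF t] unfolding set_integrable_def F_def .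
  have eq: "indicator {..0} \<tau> *\<^sub>R (exp (lam * \<tau>) * (\<omega> (\<tau> + t) - \<omega> t)) = exp (- lam * t) * F (\<tau> + t) - \<omega> t * (indicator {..0} \<tau> *\<^sub>R exp (lam * \<tau>))" for \<tau>
  proof -
    have "exp (- lam * t) * exp (lam * (\<tau> + t)) = exp (lam * \<tau>)" by (simp add: exp_add[symmetric] algebra_simps)
    then have e: "exp (- lam * t) * (exp (lam * (\<tau> + t)) * \<omega> (\<tau> + t)) = exp (lam * \<tau>) * \<omega> (\<tau> + t)" by (simp only: mult.assoc[symmetric])
    show ?thesis
    proof (cases "\<tau> \<le> 0")
      case True
      then have F: "F (\<tau> + t) = exp (lam * (\<tau> + t)) * \<omega> (\<tau> + t)" by (simp add: F_def)
      show ?thesis unfolding F e using True by (simp add: right_diff_distrib)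
    qed (simp add: F_def)
  qed
  have "(LINT \<tau>:{..0}|lborel. exp (lam * \<tau>) * (\<omega> (\<tau> + t) - \<omega> t))
    = (\<integral>\<tau>. exp (- lam * t) * F (\<tau> + t) - \<omega> t * (indicator {..0} \<tau> *\<^sub>R exp (lam * \<tau>)) \<partial>lborel)"
    unfolding set_lebesgue_integral_def eq ..
  also have "\<dots> = exp (- lam * t) * (\<integral>\<tau>. F (\<tau> + t) \<partial>lborel) - \<omega> t * (LINT \<tau>:{..0}|lborel. exp (lam * \<tau>))"
    using Fi exp_atMost_integral(1)[OF lam, of 0] integral_lborel_shift(2)[OF F_meas, of t]
    unfolding set_integrable_def set_lebesgue_integral_def by simp
  also have "(\<integral>\<tau>. F (\<tau> + t) \<partial>lborel) = primitive t"
    by (subst integral_lborel_shift(1)[OF F_meas]) (simp add: primitive_def set_lebesgue_integral_def F_def[abs_def])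
  also have "(LINT \<tau>:{..0}|lborel. exp (lam * \<tau>)) = 1 / lam" using exp_atMost_integral(2)[OF lam, of 0] by simp
  finally show ?thesis unfolding ou_def shift_def using lam by (simp add: right_diff_distrib)
qed

definition remainder :: "real \<Rightarrow> real" where "remainder t = lam * exp (- lam * t) * primitive t"

text \<open>In \<open>split_power\<close> the level with \<open>A ^ (2 * m) = exp (- lam *
  t)\<close> balances the two terms.\<close>

lemma remainder_bound:
  assumes t: "t \<le> 0"
  shows "\<bar>remainder t\<bar> \<le> (1 + lam * moment) * exp (- lam * t / (2 * real m))"
proof -
  define A where "A = exp (- lam * t / (2 * real m))"
  have A: "0 < A" by (simp add: A_def)
  have Apow: "A ^ (2 * m) = exp (- lam * t)"
    unfolding A_def exp_of_nat_mult[symmetric] using m2 by simp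
  have A1: "A ^ (2 * m) = A * A ^ (2 * m - 1)" using m2 by (simp flip: power_Suc)
  have i1: "set_integrable lborel {..t} (\<lambda>s. A * exp (lam * s))" using exp_atMost_integral(1)[OF lam] by simp
  have i2: "set_integrable lborel {..t} (\<lambda>s. exp (lam * s) * \<bar>\<omega> s\<bar> ^ (2 * m))"
    using set_integrable_subset[OF moment_integrable, of "{..t}"] t by auto
  have i3: "set_integrable lborel {..t} (\<lambda>s. exp (lam * s) * \<bar>\<omega> s\<bar> ^ (2 * m) / A ^ (2 * m - 1))" using i2 by simp
  have "\<bar>primitive t\<bar> \<le> (LINT s:{..t}|lborel. \<bar>exp (lam * s) * \<omega> s\<bar>)"
    unfolding primitive_def set_lebesgue_integral_def
    by (rule order_trans[OF integral_abs_bound]) (simp add: abs_mult)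
  also have "\<dots> \<le> (LINT s:{..t}|lborel. A * exp (lam * s) + exp (lam * s) * \<bar>\<omega> s\<bar> ^ (2 * m) / A ^ (2 * m - 1))"
  proof (rule set_integral_mono)
    show "set_integrable lborel {..t} (\<lambda>s. \<bar>exp (lam * s) * \<omega> s\<bar>)" by (rule set_integrable_abs[OF weighted_integrable[OF t]])
    show "set_integrable lborel {..t} (\<lambda>s. A * exp (lam * s) + exp (lam * s) * \<bar>\<omega> s\<bar> ^ (2 * m) / A ^ (2 * m - 1))"
      using i1 i3 by (intro set_integral_add)
    show "\<bar>exp (lam * s) * \<omega> s\<bar> \<le> A * exp (lam * s) + exp (lam * s) * \<bar>\<omega> s\<bar> ^ (2 * m) / A ^ (2 * m - 1)" for s
      using mult_left_mono[OF split_power[OF A, of "\<omega> s"], of "exp (lam * s)"] by (simp add: abs_mult distrib_left mult.commute)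
  qed
  also have "\<dots> = A * (LINT s:{..t}|lborel. exp (lam * s)) + (LINT s:{..t}|lborel. exp (lam * s) * \<bar>\<omega> s\<bar> ^ (2 * m)) / A ^ (2 * m - 1)"
    using set_integral_add(2)[OF i1 i3] by simp
  also have "(LINT s:{..t}|lborel. exp (lam * s)) = exp (lam * t) / lam" by (rule exp_atMost_integral(2)[OF lam])
  also have "(LINT s:{..t}|lborel. exp (lam * s) * \<bar>\<omega> s\<bar> ^ (2 * m)) \<le> moment"
    unfolding moment_def set_lebesgue_integral_def
  proof (rule integral_mono)
    show "indicator {..t} s *\<^sub>R (exp (lam * s) * \<bar>\<omega> s\<bar> ^ (2 * m)) \<le> indicator {..0} s *\<^sub>R (exp (lam * s) * \<bar>\<omega> s\<bar> ^ (2 * m))" for s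
      using t by (auto simp: indicator_def)
  qed (use i2 moment_integrable in \<open>auto simp: set_integrable_def\<close>)
  finally have "\<bar>primitive t\<bar> \<le> A * (exp (lam * t) / lam) + moment / A ^ (2 * m - 1)"
    using A by (simp add: divide_right_mono)
  then have "lam * exp (- lam * t) * \<bar>primitive t\<bar> \<le> lam * exp (- lam * t) * (A * (exp (lam * t) / lam) + moment / A ^ (2 * m - 1))"
    using lam by (intro mult_left_mono) auto
  also have "\<dots> = A * (exp (- lam * t) * exp (lam * t)) + lam * moment * (exp (- lam * t) / A ^ (2 * m - 1))"
    using lam by (simp add: distrib_left mult_ac)
  also have "exp (- lam * t) * exp (lam * t) = 1" by (simp add: exp_minus)
  also have "exp (- lam * t) / A ^ (2 * m - 1) = A" unfolding Apow[symmetric] A1 using A by simp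
  finally show ?thesis using lam unfolding remainder_def A_def[symmetric] by (simp add: abs_mult algebra_simps)
qed

lemma ou_shift_continuous: "continuous_on {..0} (\<lambda>t. ou lam (shift t \<omega>))"
proof -
  have "continuous_on {..0} (\<lambda>t. \<omega> t - lam * exp (- lam * t) * primitive t)"
    by (intro continuous_intros primitive_continuous_path continuous_on_subset[OF \<omega>(1)]) auto
  then show ?thesis by (subst continuous_on_cong[OF refl ou_shift_eq]) auto
qed

lemma power_sum_le: "(a + b) ^ n \<le> 2 ^ n * (a ^ n + b ^ n)" if "0 \<le> a" "0 \<le> b" for a b :: real
proof -
  have "(a + b) ^ n \<le> (2 * max a b) ^ n" using that by (intro power_mono) auto
  also have "\<dots> = 2 ^ n * (max a b) ^ n" by (simp add: power_mult_distrib)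
  also have "(max a b) ^ n \<le> a ^ n + b ^ n" using that by (cases "a \<le> b") (simp_all add: max_def)
  finally show ?thesis by simp
qed

lemma powr_le_power:
  fixes y :: real assumes "0 \<le> y" shows "y powr p \<le> 1 + y ^ m" "y\<^sup>2 \<le> 1 + y ^ m"
proof -
  show "y powr p \<le> 1 + y ^ m"
  proof (cases "y \<le> 1")
    case True
    then have "y powr p \<le> 1" using assms p by (intro powr_le1) auto
    then show ?thesis using assms by (simp add: add_increasing2)
  next
    case False
    then have "y powr p \<le> y powr real m" using p by (intro powr_mono) auto
    then show ?thesis using False by (simp add: powr_realpow)
  qed
  show "y\<^sup>2 \<le> 1 + y ^ m"
  proof (cases "y \<le> 1")
    case True
    then have "y\<^sup>2 \<le> 1" using assms by (simp add: power_le_one)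
    then show ?thesis using assms by (simp add: add_increasing2)
  next
    case False
    then have "y\<^sup>2 \<le> y ^ m" using m2 by (intro power_increasing) auto
    then show ?thesis by simp
  qed
qed

text \<open>The remainder grows like \<open>exp (- lam * t / (2 * m))\<close>, so its
  \<open>m\<close>-th power costs only half of the exponential weight.\<close>

lemma ou_weighted_bound:
  assumes t: "t \<le> 0"
  shows "exp (lam * t) * ((ou lam (shift t \<omega>))\<^sup>2 + \<bar>ou lam (shift t \<omega>)\<bar> powr p)
    \<le> 2 * (1 + 2 ^ m * (1 + (1 + lam * moment) ^ m)) * exp (lam / 2 * t) + 2 * 2 ^ m * (exp (lam * t) * \<bar>\<omega> t\<bar> ^ (2 * m))"
proof -
  define y where "y = \<bar>ou lam (shift t \<omega>)\<bar>"
  define K where "K = 1 + lam * moment"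
  have K: "1 \<le> K" using lam moment_nonneg by (simp add: K_def)
  have "y \<le> \<bar>\<omega> t\<bar> + \<bar>remainder t\<bar>"
    unfolding y_def ou_shift_eq[OF t] remainder_def by (rule abs_triangle_ineq4)
  then have "y ^ m \<le> (\<bar>\<omega> t\<bar> + \<bar>remainder t\<bar>) ^ m" by (intro power_mono) (auto simp: y_def)
  also have "\<dots> \<le> 2 ^ m * (\<bar>\<omega> t\<bar> ^ m + \<bar>remainder t\<bar> ^ m)" by (rule power_sum_le) auto
  also have "\<bar>remainder t\<bar> ^ m \<le> (K * exp (- lam * t / (2 * real m))) ^ m"
    using remainder_bound[OF t] unfolding K_def by (intro power_mono) auto
  also have "\<dots> = K ^ m * exp (- lam / 2 * t)"
    using m2 by (simp add: power_mult_distrib exp_of_nat_mult[symmetric])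
  also have "\<bar>\<omega> t\<bar> ^ m \<le> 1 + \<bar>\<omega> t\<bar> ^ (2 * m)"
  proof -
    have "x \<le> 1 + x\<^sup>2" for x :: real using abs_mult_le_squares[of x 1] by simp
    from this[of "\<bar>\<omega> t\<bar> ^ m"] show ?thesis by (simp add: power_mult[symmetric] mult.commute)
  qed
  finally have ym: "y ^ m \<le> 2 ^ m * (1 + \<bar>\<omega> t\<bar> ^ (2 * m) + K ^ m * exp (- lam / 2 * t))" by simp
  have y0: "0 \<le> y" by (simp add: y_def)
  have "y\<^sup>2 + y powr p \<le> 2 * (1 + y ^ m)" using add_mono[OF powr_le_power(2,1)[OF y0]] by simp
  also have "\<dots> \<le> 2 * (1 + 2 ^ m * (1 + \<bar>\<omega> t\<bar> ^ (2 * m) + K ^ m * exp (- lam / 2 * t)))" using ym by simp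
  finally have "exp (lam * t) * (y\<^sup>2 + y powr p) \<le> exp (lam * t) * (2 * (1 + 2 ^ m * (1 + \<bar>\<omega> t\<bar> ^ (2 * m) + K ^ m * exp (- lam / 2 * t))))"
    by (intro mult_left_mono) auto
  also have "\<dots> = 2 * (1 + 2 ^ m) * exp (lam * t) + 2 * 2 ^ m * (K ^ m * (exp (lam * t) * exp (- lam / 2 * t))) + 2 * 2 ^ m * (exp (lam * t) * \<bar>\<omega> t\<bar> ^ (2 * m))"
    by (simp add: distrib_left distrib_right mult_ac)
  also have "exp (lam * t) * exp (- lam / 2 * t) = exp (lam / 2 * t)"
    by (simp add: exp_add[symmetric] field_simps)
  also have "2 * (1 + 2 ^ m) * exp (lam * t) \<le> 2 * (1 + 2 ^ m) * exp (lam / 2 * t)"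
    using lam t by (intro mult_left_mono) (auto simp: mult_le_0_iff)
  finally have "exp (lam * t) * (y\<^sup>2 + y powr p) \<le> 2 * (1 + 2 ^ m * (1 + K ^ m)) * exp (lam / 2 * t) + 2 * 2 ^ m * (exp (lam * t) * \<bar>\<omega> t\<bar> ^ (2 * m))"
    by (simp add: distrib_left distrib_right mult_ac)
  then show ?thesis by (simp add: y_def K_def)
qed

lemma ou_weighted_integral:
  "\<exists>Q\<ge>0. \<forall>n::nat. integral {- real n..0} (\<lambda>t. exp (lam * t) * ((ou lam (shift t \<omega>))\<^sup>2 + \<bar>ou lam (shift t \<omega>)\<bar> powr p)) \<le> Q"
proof (intro exI conjI allI)
  define c1 where "c1 = 2 * (1 + 2 ^ m * (1 + (1 + lam * moment) ^ m))"
  define c2 where "c2 = (2::real) * 2 ^ m"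
  have "0 \<le> lam * moment" using lam moment_nonneg by simp
  then have c: "0 \<le> c1" "0 \<le> c2" by (simp_all add: c1_def c2_def)
  let ?f = "\<lambda>t. exp (lam * t) * ((ou lam (shift t \<omega>))\<^sup>2 + \<bar>ou lam (shift t \<omega>)\<bar> powr p)"
  let ?g = "\<lambda>t. c1 * exp (lam / 2 * t) + c2 * (exp (lam * t) * \<bar>\<omega> t\<bar> ^ (2 * m))"
  have lam2: "0 < lam / 2" using lam by simp
  have g1: "set_integrable lborel {..0} (\<lambda>t. c1 * exp (lam / 2 * t))" using exp_atMost_integral(1)[OF lam2] by simp
  have g2: "set_integrable lborel {..0} (\<lambda>t. c2 * (exp (lam * t) * \<bar>\<omega> t\<bar> ^ (2 * m)))" using moment_integrable by simp
  have g: "set_integrable lborel {..0} ?g" by (rule set_integral_add(1)[OF g1 g2])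
  have g_int: "(LINT t:{..0}|lborel. ?g t) = c1 * (1 / (lam / 2)) + c2 * moment"
    using set_integral_add(2)[OF g1 g2] exp_atMost_integral(2)[OF lam2, of 0] by (simp add: moment_def)
  show "0 \<le> c1 * (1 / (lam / 2)) + c2 * moment"
    using c lam moment_nonneg by simp
  fix n :: nat
  have "continuous_on {- real n..0} ?f"
    using p by (intro continuous_intros continuous_on_powr' continuous_on_subset[OF ou_shift_continuous]) auto
  then have fi: "set_integrable lborel {- real n..0} ?f" by (rule borel_integrable_atLeastAtMost')
  have "integral {- real n..0} ?f = (LINT t:{- real n..0}|lborel. ?f t)"
    by (rule set_borel_integral_eq_integral(2)[OF fi, symmetric])
  also have "\<dots> \<le> (LINT t:{..0}|lborel. ?g t)"
    unfolding set_lebesgue_integral_def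
  proof (rule integral_mono)
    show "integrable lborel (\<lambda>t. indicator {- real n..0} t *\<^sub>R ?f t)" using fi unfolding set_integrable_def .
    show "integrable lborel (\<lambda>t. indicator {..0} t *\<^sub>R ?g t)" using g unfolding set_integrable_def .
    fix t
    have g0: "0 \<le> ?g t" using c by simp
    show "indicator {- real n..0} t *\<^sub>R ?f t \<le> indicator {..0} t *\<^sub>R ?g t"
    proof (cases "t \<le> 0")
      case True
      from ou_weighted_bound[OF this] have "?f t \<le> ?g t" unfolding c1_def c2_def .
      then show ?thesis using True g0 by (auto simp: indicator_def)
    qed (simp add: indicator_def)
  qed
  finally show "integral {- real n..0} ?f \<le> c1 * (1 / (lam / 2)) + c2 * moment" unfolding g_int .
qed

text \<open>As \<open>m\<close> is at least 2, the remainder grows at most like \<open>exp (-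
  lam * t / 4)\<close>.\<close>

lemma ou_tempered_integers:
  assumes "(\<lambda>n. exp (- lam / 2 * real n) * \<omega> (- real n)) \<longlonglongrightarrow> 0"
  shows "(\<lambda>n. exp (- lam / 2 * real n) * ou lam (shift (- real n) \<omega>)) \<longlonglongrightarrow> 0"
proof -
  define K where "K = 1 + lam * moment"
  have K: "1 \<le> K" using lam moment_nonneg by (simp add: K_def)
  have rem: "(\<lambda>n. exp (- lam / 2 * real n) * remainder (- real n)) \<longlonglongrightarrow> 0"
  proof (rule Lim_null_comparison)
    show "\<forall>\<^sub>F n in sequentially. norm (exp (- lam / 2 * real n) * remainder (- real n)) \<le> K * exp (- lam / 4 * real n)"
    proof (rule always_eventually, rule allI)
      fix n :: nat
      have "\<bar>remainder (- real n)\<bar> \<le> K * exp (lam * real n / (2 * real m))"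
        using remainder_bound[of "- real n"] by (simp add: K_def)
      also have "\<dots> \<le> K * exp (lam * real n / 4)"
      proof -
        have "lam * real n / (2 * real m) \<le> lam * real n / 4"
          using m2 lam by (intro divide_left_mono) auto
        then show ?thesis using K by (intro mult_left_mono) auto
      qed
      finally have "exp (- lam / 2 * real n) * \<bar>remainder (- real n)\<bar> \<le> exp (- lam / 2 * real n) * (K * exp (lam * real n / 4))"
        by (intro mult_left_mono) auto
      also have "\<dots> = K * (exp (- lam / 2 * real n) * exp (lam * real n / 4))" by simp
      also have "exp (- lam / 2 * real n) * exp (lam * real n / 4) = exp (- lam / 4 * real n)"
        by (simp add: exp_add[symmetric] field_simps)
      finally show "norm (exp (- lam / 2 * real n) * remainder (- real n)) \<le> K * exp (- lam / 4 * real n)"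
        by (simp add: abs_mult)
    qed
    have "((\<lambda>x. K * exp (- lam / 4 * x)) \<longlongrightarrow> 0) at_top" using lam by real_asymp
    then show "(\<lambda>n. K * exp (- lam / 4 * real n)) \<longlonglongrightarrow> 0" by (rule filterlim_compose[OF _ filterlim_real_sequentially])
  qed
  have "(\<lambda>n. exp (- lam / 2 * real n) * \<omega> (- real n) - exp (- lam / 2 * real n) * remainder (- real n)) \<longlonglongrightarrow> 0 - 0"
    by (intro tendsto_diff assms rem)
  then show ?thesis by (simp add: ou_shift_eq remainder_def right_diff_distrib)
qed

end

context
  fixes P :: "(real \<Rightarrow> real) measure"
  assumes W: "wiener_system P"
begin

interpretation prob_space P using W by (simp add: wiener_system_def)

lemma path_continuous: "\<omega> \<in> space P \<Longrightarrow> continuous_on UNIV \<omega>" and path_0: "\<omega> \<in> space P \<Longrightarrow> \<omega> 0 = 0"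
  using W by (auto simp: wiener_system_def)

lemma coordinate_measurable[measurable]: "(\<lambda>\<omega>. \<omega> t) \<in> borel_measurable P"
  using W by (simp add: wiener_system_def)

text \<open>Paths are continuous, hence limits of their values at rationals with growing
  denominators.\<close>

lemma path_joint_measurable: "(\<lambda>p. fst p (snd p)) \<in> borel_measurable (P \<Otimes>\<^sub>M lborel)"
proof -
  define X where "X k p = fst p (real_of_int \<lfloor>snd p * real (Suc k)\<rfloor> / real (Suc k))" for k and p :: "(real \<Rightarrow> real) \<times> real"
  have X_meas: "X k \<in> borel_measurable (P \<Otimes>\<^sub>M lborel)" for k
  proof -
    have "(\<lambda>p. (\<lambda>i p. fst p (real_of_int i / real (Suc k))) \<lfloor>snd p * real (Suc k)\<rfloor> p) \<in> borel_measurable (P \<Otimes>\<^sub>M lborel)"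
    proof (rule measurable_compose_countable[where f = "\<lambda>i p. fst p (real_of_int i / real (Suc k))" and g = "\<lambda>p. \<lfloor>snd p * real (Suc k)\<rfloor>"])
      show "(\<lambda>p. fst p (real_of_int i / real (Suc k))) \<in> borel_measurable (P \<Otimes>\<^sub>M (lborel :: real measure))" for i
        by (rule measurable_compose[OF measurable_fst coordinate_measurable])
      show "(\<lambda>p. \<lfloor>snd p * real (Suc k)\<rfloor>) \<in> P \<Otimes>\<^sub>M (lborel :: real measure) \<rightarrow>\<^sub>M count_space UNIV" by measurable
    qed
    then show ?thesis by (simp add: X_def[abs_def])
  qed
  show ?thesis
  proof (rule borel_measurable_LIMSEQ_real[OF _ X_meas])
  fix p assume "p \<in> space (P \<Otimes>\<^sub>M (lborel :: real measure))"
  then have \<omega>: "fst p \<in> space P" by (auto simp: space_pair_measure)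
  define s where "s = snd p"
  have "(\<lambda>k. real_of_int \<lfloor>s * real (Suc k)\<rfloor> / real (Suc k)) \<longlonglongrightarrow> s"
  proof (rule tendsto_sandwich)
    show "\<forall>\<^sub>F k in sequentially. s - 1 / real (Suc k) \<le> real_of_int \<lfloor>s * real (Suc k)\<rfloor> / real (Suc k)"
    proof (rule always_eventually, rule allI)
      fix k
      have "(s * real (Suc k) - 1) / real (Suc k) \<le> real_of_int \<lfloor>s * real (Suc k)\<rfloor> / real (Suc k)"
        by (intro divide_right_mono) linarith+
      then show "s - 1 / real (Suc k) \<le> real_of_int \<lfloor>s * real (Suc k)\<rfloor> / real (Suc k)" by (simp add: diff_divide_distrib)
    qed
    show "\<forall>\<^sub>F k in sequentially. real_of_int \<lfloor>s * real (Suc k)\<rfloor> / real (Suc k) \<le> s"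
    proof (rule always_eventually, rule allI)
      fix k
      have "real_of_int \<lfloor>s * real (Suc k)\<rfloor> / real (Suc k) \<le> s * real (Suc k) / real (Suc k)"
        by (intro divide_right_mono) auto
      then show "real_of_int \<lfloor>s * real (Suc k)\<rfloor> / real (Suc k) \<le> s" by simp
    qed
    have "(\<lambda>k. 1 / real (Suc k)) \<longlonglongrightarrow> 0" using LIMSEQ_inverse_real_of_nat by (simp add: inverse_eq_divide)
    then have "(\<lambda>k. s - 1 / real (Suc k)) \<longlonglongrightarrow> s - 0" by (intro tendsto_diff tendsto_const)
    then show "(\<lambda>k. s - 1 / real (Suc k)) \<longlonglongrightarrow> s" by simp
  qed simp
  moreover have "isCont (fst p) s" using path_continuous[OF \<omega>] by (simp add: continuous_on_eq_continuous_at)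
  ultimately show "(\<lambda>k. X k p) \<longlonglongrightarrow> fst p (snd p)"
    unfolding X_def s_def[symmetric] by (intro isCont_tendsto_compose[of s "fst p"])
  qed
qed

lemma path_moment_le:
  assumes m: "0 < m" and t: "t \<le> 0"
  shows "(\<integral>\<^sup>+\<omega>. ennreal (\<bar>\<omega> t\<bar> ^ (2 * m)) \<partial>P) \<le> ennreal (fact (2 * m) / (2 ^ m * fact m) * (- t) ^ m)"
proof (cases "t = 0")
  case True
  then have "(\<integral>\<^sup>+\<omega>. ennreal (\<bar>\<omega> t\<bar> ^ (2 * m)) \<partial>P) = (\<integral>\<^sup>+\<omega>. 0 \<partial>P)"
    using m by (intro nn_integral_cong) (simp add: path_0)
  then show ?thesis by simp
next
  case False
  then have tneg: "t < 0" using t by simp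
  define \<sigma> where "\<sigma> = sqrt (0 - t)"
  have \<sigma>: "0 < \<sigma>" "\<sigma>\<^sup>2 = - t" using tneg by (simp_all add: \<sigma>_def)
  have D: "distributed P lborel (\<lambda>\<omega>. \<omega> 0 - \<omega> t) (\<lambda>x. ennreal (normal_density 0 \<sigma> x))"
    using W tneg unfolding wiener_system_def \<sigma>_def by blast
  have "(\<integral>\<^sup>+\<omega>. ennreal (\<bar>\<omega> t\<bar> ^ (2 * m)) \<partial>P) = (\<integral>\<^sup>+\<omega>. ennreal ((\<omega> 0 - \<omega> t) ^ (2 * m)) \<partial>P)"
    by (intro nn_integral_cong) (simp add: path_0 power_mult)
  also have "\<dots> = (\<integral>\<^sup>+x. ennreal (normal_density 0 \<sigma> x) * ennreal (x ^ (2 * m)) \<partial>lborel)"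
    using distributed_nn_integral[OF D, of "\<lambda>x. ennreal (x ^ (2 * m))"] by simp
  also have "\<dots> = (\<integral>\<^sup>+x. ennreal (normal_density 0 \<sigma> x * (x - 0) ^ (2 * m)) \<partial>lborel)"
    by (intro nn_integral_cong) (simp add: ennreal_mult' normal_density_nonneg)
  also have "\<dots> = ennreal (fact (2 * m) / ((2 / \<sigma>\<^sup>2) ^ m * fact m))"
    using normal_moment_even[OF \<sigma>(1), of 0 m]
    by (subst nn_integral_eq_integral) (auto simp: has_bochner_integral_iff power_mult intro!: AE_I2 mult_nonneg_nonneg normal_density_nonneg)
  also have "fact (2 * m) / ((2 / \<sigma>\<^sup>2) ^ m * fact m) = fact (2 * m) / (2 ^ m * fact m) * (- t) ^ m"
    unfolding \<sigma>(2) power_divide[of 2 "- t" m] by simp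
  finally show ?thesis by simp
qed

text \<open>A Gaussian moment grows polynomially in time, and half of the exponential weight
  dominates it.\<close>

lemma path_moment_exp_le:
  assumes "0 < m" "0 < lam"
  shows "\<exists>C\<ge>0. \<forall>t\<le>0. (\<integral>\<^sup>+\<omega>. ennreal (\<bar>\<omega> t\<bar> ^ (2 * m)) \<partial>P) \<le> ennreal (C * exp (- lam / 2 * t))"
proof (intro exI conjI allI impI)
  let ?c = "fact (2 * m) / (2 ^ m * fact m) :: real"
  define C where "C = ?c * (fact m / (lam / 2) ^ m)"
  show "0 \<le> C" using assms by (simp add: C_def)
  fix t :: real assume t: "t \<le> 0"
  have "(lam / 2 * (- t)) ^ m \<le> fact m * exp (lam / 2 * (- t))"
    using assms t by (intro power_le_fact_exp) (simp add: mult_nonneg_nonpos)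
  then have "(lam / 2) ^ m * (- t) ^ m \<le> fact m * exp (- lam / 2 * t)" unfolding power_mult_distrib by simp
  then have "(- t) ^ m \<le> fact m * exp (- lam / 2 * t) / (lam / 2) ^ m"
    using assms by (subst pos_le_divide_eq) (simp_all add: mult.commute)
  then have "?c * (- t) ^ m \<le> C * exp (- lam / 2 * t)"
    unfolding C_def mult.assoc by (intro mult_left_mono) simp_all
  then show "(\<integral>\<^sup>+\<omega>. ennreal (\<bar>\<omega> t\<bar> ^ (2 * m)) \<partial>P) \<le> ennreal (C * exp (- lam / 2 * t))"
    using path_moment_le[OF assms(1) t] by (meson ennreal_leI order_trans)
qed

text \<open>The expectation is computed by exchanging the integrals.\<close>

lemma AE_path_moment_finite:
  assumes m: "0 < m" and lam: "0 < lam"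
  shows "AE \<omega> in P. (\<integral>\<^sup>+s\<in>{..0}. ennreal (exp (lam * s) * \<bar>\<omega> s\<bar> ^ (2 * m)) \<partial>lborel) < \<infinity>"
proof -
  interpret pair_sigma_finite P lborel ..
  obtain C where C: "0 \<le> C" "\<And>t. t \<le> 0 \<Longrightarrow> (\<integral>\<^sup>+\<omega>. ennreal (\<bar>\<omega> t\<bar> ^ (2 * m)) \<partial>P) \<le> ennreal (C * exp (- lam / 2 * t))"
    using path_moment_exp_le[OF m lam] by blast
  note path_joint_measurable[measurable]
  have joint: "(\<lambda>p. ennreal (exp (lam * snd p) * \<bar>fst p (snd p)\<bar> ^ (2 * m)) * indicator {..0} (snd p)) \<in> borel_measurable (P \<Otimes>\<^sub>M lborel)"
    by measurable
  have "(\<integral>\<^sup>+\<omega>. (\<integral>\<^sup>+s\<in>{..0}. ennreal (exp (lam * s) * \<bar>\<omega> s\<bar> ^ (2 * m)) \<partial>lborel) \<partial>P)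
    = (\<integral>\<^sup>+s. (\<integral>\<^sup>+\<omega>. ennreal (exp (lam * s) * \<bar>\<omega> s\<bar> ^ (2 * m)) * indicator {..0} s \<partial>P) \<partial>lborel)"
    using Fubini'[of "\<lambda>\<omega> s. ennreal (exp (lam * s) * \<bar>\<omega> s\<bar> ^ (2 * m)) * indicator {..0} s"] joint by (simp add: case_prod_unfold)
  also have "\<dots> \<le> (\<integral>\<^sup>+s. ennreal C * (ennreal (exp (lam / 2 * s)) * indicator {..0} s) \<partial>lborel)"
  proof (rule nn_integral_mono)
    fix s
    show "(\<integral>\<^sup>+\<omega>. ennreal (exp (lam * s) * \<bar>\<omega> s\<bar> ^ (2 * m)) * indicator {..0} s \<partial>P) \<le> ennreal C * (ennreal (exp (lam / 2 * s)) * indicator {..0} s)"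
    proof (cases "s \<le> 0")
      case True
      have "(\<integral>\<^sup>+\<omega>. ennreal (exp (lam * s) * \<bar>\<omega> s\<bar> ^ (2 * m)) \<partial>P) = ennreal (exp (lam * s)) * (\<integral>\<^sup>+\<omega>. ennreal (\<bar>\<omega> s\<bar> ^ (2 * m)) \<partial>P)"
        by (subst nn_integral_cmult[symmetric]) (auto simp: ennreal_mult')
      also have "\<dots> \<le> ennreal (exp (lam * s)) * ennreal (C * exp (- lam / 2 * s))" by (intro mult_left_mono C True) auto
      also have "\<dots> = ennreal (C * (exp (lam * s) * exp (- lam / 2 * s)))" using C(1) by (simp add: ennreal_mult'[symmetric] mult_ac)
      also have "exp (lam * s) * exp (- lam / 2 * s) = exp (lam / 2 * s)" by (simp add: exp_add[symmetric] field_simps)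
      finally show ?thesis using True C(1) by (simp add: ennreal_mult')
    qed simp
  qed
  also have "\<dots> = ennreal C * ennreal (exp (lam / 2 * 0) / (lam / 2))"
    using lam nn_integral_exp_atMost[of "lam / 2" 0] by (subst nn_integral_cmult) auto
  also have "\<dots> < \<infinity>" by (simp add: ennreal_mult_less_top)
  finally have "(\<integral>\<^sup>+\<omega>. (\<integral>\<^sup>+s\<in>{..0}. ennreal (exp (lam * s) * \<bar>\<omega> s\<bar> ^ (2 * m)) \<partial>lborel) \<partial>P) \<noteq> \<infinity>" by simp
  moreover have "(\<lambda>\<omega>. \<integral>\<^sup>+s\<in>{..0}. ennreal (exp (lam * s) * \<bar>\<omega> s\<bar> ^ (2 * m)) \<partial>lborel) \<in> borel_measurable P"
    using lborel.borel_measurable_nn_integral_fst[OF joint] by simp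
  ultimately have "AE \<omega> in P. (\<integral>\<^sup>+s\<in>{..0}. ennreal (exp (lam * s) * \<bar>\<omega> s\<bar> ^ (2 * m)) \<partial>lborel) \<noteq> \<infinity>"
    by (intro nn_integral_PInf_AE)
  then show ?thesis by eventually_elim (simp add: less_top)
qed

text \<open>The second moments of the sequence decay geometrically.\<close>

lemma AE_path_integers:
  assumes lam: "0 < lam"
  shows "AE \<omega> in P. (\<lambda>n. exp (- lam / 2 * real n) * \<omega> (- real n)) \<longlonglongrightarrow> 0"
proof -
  obtain C where C: "0 \<le> C" "\<And>t. t \<le> 0 \<Longrightarrow> (\<integral>\<^sup>+\<omega>. ennreal (\<bar>\<omega> t\<bar> ^ (2 * 1)) \<partial>P) \<le> ennreal (C * exp (- lam / 2 * t))"
    using path_moment_exp_le[OF zero_less_one lam] by blast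
  show ?thesis
  proof (rule AE_tendsto_0_if_summable[where C = C and q = "exp (- lam / 2)"])
    fix n :: nat
    have "(\<integral>\<^sup>+\<omega>. ennreal ((exp (- lam / 2 * real n) * \<omega> (- real n))\<^sup>2) \<partial>P) = (\<integral>\<^sup>+\<omega>. ennreal (exp (- lam * real n)) * ennreal (\<bar>\<omega> (- real n)\<bar> ^ (2 * 1)) \<partial>P)"
      by (intro nn_integral_cong) (simp add: power_mult_distrib ennreal_mult'[symmetric] exp_double[symmetric])
    also have "\<dots> = ennreal (exp (- lam * real n)) * (\<integral>\<^sup>+\<omega>. ennreal (\<bar>\<omega> (- real n)\<bar> ^ (2 * 1)) \<partial>P)"
      by (rule nn_integral_cmult) measurable
    also have "\<dots> \<le> ennreal (exp (- lam * real n)) * ennreal (C * exp (- lam / 2 * - real n))"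
      by (intro mult_left_mono C(2)) auto
    also have "\<dots> = ennreal (C * (exp (- lam * real n) * exp (- lam / 2 * - real n)))" using C(1) by (simp add: ennreal_mult'[symmetric] mult_ac)
    also have "exp (- lam * real n) * exp (- lam / 2 * - real n) = exp (real n * (- lam / 2))" by (simp add: exp_add[symmetric] field_simps)
    also have "\<dots> = exp (- lam / 2) ^ n" by (rule exp_of_nat_mult)
    finally show "(\<integral>\<^sup>+\<omega>. ennreal ((exp (- lam / 2 * real n) * \<omega> (- real n))\<^sup>2) \<partial>P) \<le> ennreal (C * exp (- lam / 2) ^ n)" .
  qed (use C lam in auto)
qed

proposition AE_ou_growth:
  assumes lam: "0 < lam" and p: "2 \<le> p"
  shows "AE \<omega> in P. continuous_on {..0} (\<lambda>t. ou lam (shift t \<omega>)) \<and>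
    (\<exists>Q\<ge>0. \<forall>n::nat. integral {- real n..0} (\<lambda>t. exp (lam * t) * ((ou lam (shift t \<omega>))\<^sup>2 + \<bar>ou lam (shift t \<omega>)\<bar> powr p)) \<le> Q) \<and>
    (\<lambda>n. exp (- lam / 2 * real n) * ou lam (shift (- real n) \<omega>)) \<longlonglongrightarrow> 0"
proof -
  obtain m :: nat where m: "p \<le> real m" using real_arch_simple by blast
  then have "0 < m" using p by (intro Nat.gr0I) auto
  from AE_path_moment_finite[OF this lam] AE_path_integers[OF lam] AE_space show ?thesis
  proof eventually_elim
    case (elim \<omega>)
    note path = lam p m path_continuous[OF elim(3)] path_0[OF elim(3)] elim(1)
    show ?case
      using ou_shift_continuous[OF path] ou_weighted_integral[OF path] ou_tempered_integers[OF path elim(2)] by blast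
  qed
qed

end

section \<open>Estimates along orbits of the cocycle\<close>

text \<open>\<open>g0\<close> and \<open>h0\<close> are the given Lebesgue measurable data, of
  which \<open>g\<close> and \<open>h\<close> are Borel representatives.\<close>

locale reaction_diffusion_equation = reaction_diffusion lam p \<alpha>1 \<alpha>2 \<beta> f g h Lh \<psi>1 \<psi>2
  for lam p \<alpha>1 \<alpha>2 \<beta> :: real and f :: "'a::euclidean_space \<Rightarrow> real \<Rightarrow> real" and g h Lh \<psi>1 \<psi>2 :: "'a \<Rightarrow> real" +
  fixes g0 h0 :: "'a \<Rightarrow> real"
  assumes g0: "AE x in lborel. g0 x = g x" and h0: "AE x in lborel. h0 x = h x"
    and weak_laplacian: "\<And>\<phi>. test_function \<phi> \<Longrightarrow> (\<integral>x. h x * laplacian \<phi> x \<partial>lborel) = (\<integral>x. Lh x * \<phi> x \<partial>lborel)"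
begin

lemma norm_bounded_on_interval:
  fixes v :: "real \<Rightarrow> 'a L2"
  assumes "continuous_on {0..} v"
  shows "\<exists>B. \<forall>s\<in>{0..T}. (norm (v s))\<^sup>2 \<le> B"
proof -
  have "continuous_on {0..T} (\<lambda>s. (norm (v s))\<^sup>2)"
    by (intro continuous_intros continuous_on_subset[OF assms]) auto
  then have "compact ((\<lambda>s. (norm (v s))\<^sup>2) ` {0..T})" by (rule compact_continuous_image) simp
  then have "bdd_above ((\<lambda>s. (norm (v s))\<^sup>2) ` {0..T})" by (intro bounded_imp_bdd_above compact_imp_bounded)
  then show ?thesis by (auto simp: bdd_above_def)
qed

text \<open>The coefficient \<open>c\<close> is continued by constants outside
  \<open>{0..T}\<close>.\<close>

lemma stochastic_evolution:
  assumes sol: "solution lam f g0 h0 c v0 v" and T: "0 < T" and c: "continuous_on {0..T} c"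
  shows "\<exists>V B c'. continuous_on UNIV c' \<and> (\<forall>s\<in>{0..T}. c' s = c s) \<and>
    weak_evolution 0 T B V (forcing c' V) \<and> (\<forall>s\<in>{0..T}. AE x in lborel. L2_fun (v s) x = V s x)"
proof -
  define c' where "c' s = c (max 0 (min T s))" for s
  have c'_cont: "continuous_on UNIV c'"
    unfolding c'_def using T by (intro continuous_on_compose2[OF c] continuous_intros) auto
  have c'_eq: "c' s = c s" if "s \<in> {0..T}" for s using that by (simp add: c'_def)
  have v: "continuous_on {0..} v" using sol by (simp add: solution_def)
  obtain V where V: "(\<lambda>(s, x). V s x) \<in> borel_measurable (lborel \<Otimes>\<^sub>M lborel)" "\<And>s. s \<in> {0..T} \<Longrightarrow> AE x in lborel. L2_fun (v s) x = V s x"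
    using measurable_version[OF continuous_on_subset[OF v], of 0 T] T by auto
  obtain B where B: "\<And>s. s \<in> {0..T} \<Longrightarrow> (norm (v s))\<^sup>2 \<le> B"
    using norm_bounded_on_interval[OF v] by blast
  have "compact (c ` {0..T})" by (rule compact_continuous_image[OF c]) simp
  then obtain Cc where Cc: "\<And>s. s \<in> {0..T} \<Longrightarrow> \<bar>c s\<bar> \<le> Cc"
    by (force dest!: compact_imp_bounded simp: bounded_iff)
  have "weak_evolution 0 T B V (\<lambda>s x. (- lam * V s x + f x (V s x + c' s * h x)) + (g x + c' s * Lh x))"
    by (rule solution_weak_evolution[OF sol T f_cont V meas(2) h0 int(2) meas(1) g0 int(1) meas(3) int(3) weak_laplacian, where Cc = Cc])
       (use c'_cont c'_eq Cc B in \<open>auto intro: borel_measurable_continuous_onI\<close>)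
  then have "weak_evolution 0 T B V (forcing c' V)" by (simp add: forcing_def[abs_def])
  with c'_cont c'_eq V(2) show ?thesis
    by (intro exI[where x = V] exI[where x = B] exI[where x = c'] conjI ballI)
qed

lemma deterministic_evolution:
  assumes sol: "solution lam f g0 (\<lambda>x. 0) (\<lambda>t. 0) u0 u" and T: "0 < T"
  obtains V B where "weak_evolution 0 T B V (forcing (\<lambda>_. 0) V)" "\<And>s. s \<in> {0..T} \<Longrightarrow> AE x in lborel. L2_fun (u s) x = V s x"
proof -
  have u: "continuous_on {0..} u" using sol by (simp add: solution_def)
  obtain V where V: "(\<lambda>(s, x). V s x) \<in> borel_measurable (lborel \<Otimes>\<^sub>M lborel)" "\<And>s. s \<in> {0..T} \<Longrightarrow> AE x in lborel. L2_fun (u s) x = V s x"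
    using measurable_version[OF continuous_on_subset[OF u], of 0 T] T by auto
  obtain B where B: "\<And>s. s \<in> {0..T} \<Longrightarrow> (norm (u s))\<^sup>2 \<le> B"
    using norm_bounded_on_interval[OF u] by blast
  have "weak_evolution 0 T B V (\<lambda>s x. (- lam * V s x + f x (V s x + 0 * 0)) + (g x + 0 * 0))"
    by (rule solution_weak_evolution[OF sol T f_cont V _ _ _ meas(1) g0 int(1), where hb = "\<lambda>x. 0" and Lb = "\<lambda>x. 0" and c' = "\<lambda>s. 0" and Cc = 0])
       (use B in auto)
  then have "weak_evolution 0 T B V (forcing (\<lambda>_. 0) V)" by (simp add: forcing_def[abs_def])
  then show thesis using that V(2) by blast
qed

lemma norm_evolution:
  assumes e: "weak_evolution 0 T B V G" and v: "continuous_on {0..} v" and V: "\<forall>s\<in>{0..T}. AE x in lborel. L2_fun (v s) x = V s x"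
  shows "\<And>t. t \<in> {0..T} \<Longrightarrow> (\<integral>x. (V t x)\<^sup>2 \<partial>lborel) = (norm (v t))\<^sup>2" "continuous_on {0..T} (\<lambda>t. \<integral>x. (V t x)\<^sup>2 \<partial>lborel)"
proof -
  show eq: "(\<integral>x. (V t x)\<^sup>2 \<partial>lborel) = (norm (v t))\<^sup>2" if "t \<in> {0..T}" for t
    by (rule norm_L2_square_lborel(1)[OF weak_evolution.V_meas1[OF e] V[rule_format, OF that], symmetric])
  have "continuous_on {0..T} (\<lambda>t. (norm (v t))\<^sup>2)"
    by (intro continuous_intros continuous_on_subset[OF v]) auto
  then show "continuous_on {0..T} (\<lambda>t. \<integral>x. (V t x)\<^sup>2 \<partial>lborel)"
    by (subst continuous_on_cong[OF refl eq]) auto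
qed

text \<open>Over a long time only the energy produced by the load remains.\<close>

lemma solution_decay:
  assumes sol: "solution lam f g0 h0 c v0 v" and T: "0 < T" and c: "continuous_on {0..T} c"
  shows "(norm (v T))\<^sup>2 \<le> exp (- lam * T) * (norm v0)\<^sup>2 + integral {0..T} (\<lambda>s. exp (lam * (s - T)) * (2 * load (c s)))"
proof -
  obtain V B c' where E0: "continuous_on UNIV c'" "\<forall>s\<in>{0..T}. c' s = c s"
    "weak_evolution 0 T B V (forcing c' V)" "\<forall>s\<in>{0..T}. AE x in lborel. L2_fun (v s) x = V s x"
    using stochastic_evolution[OF sol T c] by (elim exE conjE) (rule that)
  note E = E0(1) E0(2)[rule_format] E0(3) E0(4)[rule_format]
  have v: "continuous_on {0..} v" "v 0 = v0" using sol by (simp_all add: solution_def)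
  note N = norm_evolution[OF E(3) v(1) E0(4)]
  have "(\<integral>x. (V T x)\<^sup>2 \<partial>lborel) \<le> exp (- lam * T) * (\<integral>x. (V 0 x)\<^sup>2 \<partial>lborel) + integral {0..T} (\<lambda>s. exp (lam * (s - T)) * (2 * load (c' s)))"
  proof (rule decay_integral_inequality[OF _ lam N(2)])
    show "continuous_on {0..T} (\<lambda>s. 2 * load (c' s))"
      by (intro continuous_intros load_continuous continuous_on_subset[OF E(1)]) auto
    show "(\<integral>x. (V b x)\<^sup>2 \<partial>lborel) - (\<integral>x. (V a x)\<^sup>2 \<partial>lborel) \<le> integral {a..b} (\<lambda>s. - lam * (\<integral>x. (V s x)\<^sup>2 \<partial>lborel) + 2 * load (c' s))"
      if "0 \<le> a" "a \<le> b" "b \<le> T" for a b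
      by (rule energy_estimate(1)[OF E(3,1) N(2) that])
  qed (use T in simp)
  also have "integral {0..T} (\<lambda>s. exp (lam * (s - T)) * (2 * load (c' s))) = integral {0..T} (\<lambda>s. exp (lam * (s - T)) * (2 * load (c s)))"
    by (intro Henstock_Kurzweil_Integration.integral_cong) (simp add: E(2))
  finally show ?thesis using N(1)[of T] N(1)[of 0] T v(2) by simp
qed

lemma solution_difference:
  assumes sol: "solution lam f g0 h0 c v0 v" and sol': "solution lam f g0 (\<lambda>x. 0) (\<lambda>t. 0) u0 u"
    and T: "0 < T" and c: "continuous_on {0..T} c"
    and \<delta>: "\<And>s. s \<in> {0..T} \<Longrightarrow> \<bar>c s\<bar> \<le> \<delta>" "\<delta> \<le> 1" and r: "(norm v0)\<^sup>2 \<le> r" "(norm u0)\<^sup>2 \<le> r"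
  shows "(norm (v T - u T))\<^sup>2 \<le> ((norm (v0 - u0))\<^sup>2 + \<delta> * gap T r) * exp (2 * (2 * \<beta> + 1) * T)"
proof -
  obtain V B c' where E0: "continuous_on UNIV c'" "\<forall>s\<in>{0..T}. c' s = c s"
    "weak_evolution 0 T B V (forcing c' V)" "\<forall>s\<in>{0..T}. AE x in lborel. L2_fun (v s) x = V s x"
    using stochastic_evolution[OF sol T c] by (elim exE conjE) (rule that)
  note E = E0(1) E0(2)[rule_format] E0(3) E0(4)[rule_format]
  obtain V' B' where E': "weak_evolution 0 T B' V' (forcing (\<lambda>_. 0) V')" "\<And>s. s \<in> {0..T} \<Longrightarrow> AE x in lborel. L2_fun (u s) x = V' s x"
    by (rule deterministic_evolution[OF sol' T]) (rule that)
  have v: "continuous_on {0..} v" "v 0 = v0" using sol by (simp_all add: solution_def)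
  have u: "continuous_on {0..} u" "u 0 = u0" using sol' by (simp_all add: solution_def)
  have W: "AE x in lborel. L2_fun (v s - u s) x = V s x - V' s x" if s: "s \<in> {0..T}" for s
    using E(4)[OF s] E'(2)[OF s] L2_fun_diff[of "v s" "u s", unfolded AE_completion_iff] by eventually_elim simp
  then have W2: "\<forall>s\<in>{0..T}. AE x in lborel. L2_fun (v s - u s) x = V s x - V' s x" by blast
  have E2: "\<forall>s\<in>{0..T}. AE x in lborel. L2_fun (u s) x = V' s x" using E'(2) by blast
  note N = norm_evolution[OF E(3) v(1) E0(4)] and N' = norm_evolution[OF E'(1) u(1) E2]
  have "continuous_on {0..} (\<lambda>t. v t - u t)" by (intro continuous_intros v u)
  note NW = norm_evolution[OF weak_evolution_diff[OF E(3) E'(1)] this W2]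
  have 0: "0 \<in> {0..T}" "T \<in> {0..T}" using T by auto
  have "(\<integral>x. (V T x - V' T x)\<^sup>2 \<partial>lborel) \<le> ((\<integral>x. (V 0 x - V' 0 x)\<^sup>2 \<partial>lborel) + \<delta> * gap T r) * exp (2 * (2 * \<beta> + 1) * T)"
  proof (rule difference_estimate[OF E(3) E'(1) E(1) _ N(2) N'(2) NW(2) _ \<delta>(2)])
    show "\<bar>c' s\<bar> \<le> \<delta>" if "s \<in> {0..T}" for s using \<delta>(1)[OF that] E(2)[OF that] by simp
  qed (use T N(1)[OF 0(1)] N'(1)[OF 0(1)] r v u in auto)
  then show ?thesis unfolding NW(1)[OF 0(1)] NW(1)[OF 0(2)] v(2) u(2) .
qed

text \<open>The load exceeds \<open>D0\<close> by terms of second or higher order in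
  \<open>\<epsilon>\<close>, and \<open>\<epsilon>\<close> itself bounds them.\<close>

lemma load_scaled_le:
  assumes "0 < \<epsilon>" "\<epsilon> \<le> 1"
  shows "load (\<epsilon> * y) \<le> D0 + \<epsilon> * ((D1 + D2) * (y\<^sup>2 + \<bar>y\<bar> powr p))"
proof -
  have "\<epsilon>\<^sup>2 \<le> \<epsilon>" using assms by (simp add: power2_eq_square mult_left_le)
  then have "\<epsilon>\<^sup>2 * (y\<^sup>2 * D1) \<le> \<epsilon> * (y\<^sup>2 * D1)" using D_nonneg by (intro mult_right_mono) auto
  moreover have "\<epsilon> powr p \<le> \<epsilon> powr 1" using assms p by (intro powr_mono') auto
  then have "\<epsilon> powr p * (\<bar>y\<bar> powr p * D2) \<le> \<epsilon> * (\<bar>y\<bar> powr p * D2)" using D_nonneg assms by (intro mult_right_mono) auto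
  moreover have "0 \<le> \<epsilon> * (y\<^sup>2 * D2)" "0 \<le> \<epsilon> * (\<bar>y\<bar> powr p * D1)" using D_nonneg assms by auto
  moreover have "load (\<epsilon> * y) = D0 + \<epsilon>\<^sup>2 * (y\<^sup>2 * D1) + \<epsilon> powr p * (\<bar>y\<bar> powr p * D2)"
    using assms by (simp add: load_def power_mult_distrib abs_mult powr_mult)
  moreover have "\<epsilon> * ((D1 + D2) * (y\<^sup>2 + \<bar>y\<bar> powr p)) = \<epsilon> * (y\<^sup>2 * D1) + \<epsilon> * (\<bar>y\<bar> powr p * D2) + \<epsilon> * (y\<^sup>2 * D2) + \<epsilon> * (\<bar>y\<bar> powr p * D1)"
    by (simp add: algebra_simps)
  ultimately show ?thesis by linarith
qed

text \<open>Read at absolute time \<open>t = s - (m + j)\<close>, the weight is \<open>exp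
  (lam * m)\<close> times \<open>exp (lam * t)\<close>, so the noise contributes at most an
  integral over the whole past. The bound does not depend on \<open>j\<close>.\<close>

lemma load_integral_le:
  fixes Y :: "real \<Rightarrow> real" and j m :: nat
  assumes Y: "continuous_on {..0} Y" and \<epsilon>: "0 < \<epsilon>" "\<epsilon> \<le> 1"
    and Q: "integral {- real (m + j)..0} (\<lambda>t. exp (lam * t) * ((Y t)\<^sup>2 + \<bar>Y t\<bar> powr p)) \<le> Q"
  shows "integral {0..real j} (\<lambda>s. exp (lam * (s - real j)) * (2 * load (\<epsilon> * Y (s - real (m + j)))))
    \<le> 2 * D0 / lam + \<epsilon> * (2 * (D1 + D2) * exp (lam * real m) * Q)"
proof -
  define F where "F t = exp (lam * t) * ((Y t)\<^sup>2 + \<bar>Y t\<bar> powr p)" for t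
  have F_cont: "continuous_on {..0} F" unfolding F_def using p by (intro continuous_intros Y continuous_on_powr') auto
  have F0: "0 \<le> F t" for t unfolding F_def by simp
  let ?c = "\<epsilon> * (2 * (D1 + D2) * exp (lam * real m))"
  have c0: "0 \<le> ?c" using \<epsilon> D_nonneg by (intro mult_nonneg_nonneg) auto
  have Ys: "continuous_on {0..real j} (\<lambda>s. Y (s - real (m + j)))"
    by (rule continuous_on_compose2[OF Y]) (auto intro!: continuous_intros)
  have Fs: "continuous_on {0..real j} (\<lambda>s. F (s - real (m + j)))"
    by (rule continuous_on_compose2[OF F_cont]) (auto intro!: continuous_intros)
  have e_cont: "continuous_on {0..real j} (\<lambda>s. exp (lam * (s - real j)))" by (intro continuous_intros)
  have "integral {0..real j} (\<lambda>s. exp (lam * (s - real j)) * (2 * load (\<epsilon> * Y (s - real (m + j)))))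
    \<le> integral {0..real j} (\<lambda>s. 2 * D0 * exp (lam * (s - real j)) + ?c * F (s - real (m + j)))"
  proof (rule integral_le)
    show "(\<lambda>s. exp (lam * (s - real j)) * (2 * load (\<epsilon> * Y (s - real (m + j))))) integrable_on {0..real j}"
      by (intro integrable_continuous_interval continuous_intros load_continuous Ys)
    show "(\<lambda>s. 2 * D0 * exp (lam * (s - real j)) + ?c * F (s - real (m + j))) integrable_on {0..real j}"
      by (intro integrable_continuous_interval continuous_intros Fs)
    fix s
    define y where "y = Y (s - real (m + j))"
    have "exp (lam * (s - real j)) * (2 * load (\<epsilon> * y)) \<le> exp (lam * (s - real j)) * (2 * (D0 + \<epsilon> * ((D1 + D2) * (y\<^sup>2 + \<bar>y\<bar> powr p))))"
      using load_scaled_le[OF \<epsilon>, of y] by (intro mult_left_mono) auto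
    also have "\<dots> = 2 * D0 * exp (lam * (s - real j)) + \<epsilon> * (2 * (D1 + D2)) * (exp (lam * (s - real j)) * (y\<^sup>2 + \<bar>y\<bar> powr p))"
      by (simp add: algebra_simps)
    also have "exp (lam * (s - real j)) = exp (lam * real m) * exp (lam * (s - real (m + j)))"
      by (simp add: exp_add[symmetric] algebra_simps)
    also have "\<epsilon> * (2 * (D1 + D2)) * (exp (lam * real m) * exp (lam * (s - real (m + j))) * (y\<^sup>2 + \<bar>y\<bar> powr p)) = ?c * F (s - real (m + j))"
      by (simp add: F_def y_def)
    also have "exp (lam * real m) * exp (lam * (s - real (m + j))) = exp (lam * (s - real j))"
      by (simp add: exp_add[symmetric] algebra_simps)
    finally show "exp (lam * (s - real j)) * (2 * load (\<epsilon> * Y (s - real (m + j)))) \<le> 2 * D0 * exp (lam * (s - real j)) + ?c * F (s - real (m + j))"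
      unfolding y_def .
  qed
  also have "\<dots> = 2 * D0 * integral {0..real j} (\<lambda>s. exp (lam * (s - real j))) + ?c * integral {0..real j} (\<lambda>s. F (s - real (m + j)))"
  proof -
    have "integral {0..real j} (\<lambda>s. 2 * D0 * exp (lam * (s - real j)) + ?c * F (s - real (m + j)))
      = integral {0..real j} (\<lambda>s. 2 * D0 * exp (lam * (s - real j))) + integral {0..real j} (\<lambda>s. ?c * F (s - real (m + j)))"
      by (intro Henstock_Kurzweil_Integration.integral_add integrable_continuous_interval continuous_intros Fs)
    then show ?thesis by simp
  qed
  finally have le: "integral {0..real j} (\<lambda>s. exp (lam * (s - real j)) * (2 * load (\<epsilon> * Y (s - real (m + j)))))
    \<le> 2 * D0 * integral {0..real j} (\<lambda>s. exp (lam * (s - real j))) + ?c * integral {0..real j} (\<lambda>s. F (s - real (m + j)))" .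
  have le1: "integral {0..real j} (\<lambda>s. exp (lam * (s - real j))) \<le> 1 / lam"
  proof -
    have "((\<lambda>s. exp (lam * (s - real j))) has_integral exp (lam * (real j - real j)) / lam - exp (lam * (0 - real j)) / lam) {0..real j}"
      using lam by (intro fundamental_theorem_of_calculus)
        (auto intro!: derivative_eq_intros simp: has_real_derivative_iff_has_vector_derivative[symmetric])
    then have "integral {0..real j} (\<lambda>s. exp (lam * (s - real j))) = 1 / lam - exp (lam * (0 - real j)) / lam"
      by (simp add: integral_unique)
    then show ?thesis using lam by simp
  qed
  have "integral {0..real j} (\<lambda>s. F (s - real (m + j))) = integral {- real (m + j)..- real m} F"
  proof -
    have "integral {0..real j} (\<lambda>s. F (s + - real (m + j))) = integral {0 + - real (m + j)..real j + - real (m + j)} F"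
      by (rule integral_shift[OF continuous_on_subset[OF F_cont], unfolded o_def]) auto
    moreover have "(\<lambda>s. F (s + - real (m + j))) = (\<lambda>s. F (s - real (m + j)))" "0 + - real (m + j) = - real (m + j)" "real j + - real (m + j) = - real m" by (auto simp: algebra_simps)
    ultimately show ?thesis by (simp only:)
  qed
  also have "integral {- real (m + j)..- real m} F \<le> integral {- real (m + j)..0} F"
    by (intro integral_subset_le integrable_continuous_interval continuous_on_subset[OF F_cont]) (auto simp: F0)
  also have "integral {- real (m + j)..0} F \<le> Q" using Q unfolding F_def .
  finally have le2: "integral {0..real j} (\<lambda>s. F (s - real (m + j))) \<le> Q" .
  have "2 * D0 * integral {0..real j} (\<lambda>s. exp (lam * (s - real j))) \<le> 2 * D0 * (1 / lam)"
    using D_nonneg by (intro mult_left_mono[OF le1]) simp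
  moreover have "?c * integral {0..real j} (\<lambda>s. F (s - real (m + j))) \<le> ?c * Q"
    by (rule mult_left_mono[OF le2 c0])
  ultimately show ?thesis using le by (simp only: mult.assoc times_divide_eq_right mult_1_right)
qed

end

lemma shift_shift: "shift t (shift r \<omega>) = shift (t + r) \<omega>"
  by (auto simp: shift_def algebra_simps)

lemma shift_0: "\<omega> 0 = 0 \<Longrightarrow> shift 0 \<omega> = \<omega>"
  by (auto simp: shift_def)

text \<open>The shift preserves the measure, and countably many times are considered.\<close>

lemma AE_orbit_avoids_null_set:
  assumes W: "wiener_system P" and N: "N \<in> null_sets P"
  shows "AE \<omega> in P. \<forall>n::nat. shift (- real n) \<omega> \<in> space P - N"
  unfolding AE_all_countable
proof
  fix n :: nat
  have sh: "shift (- real n) \<in> measurable P P" "distr P P (shift (- real n)) = P"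
    using W unfolding wiener_system_def by blast+
  have "AE \<omega> in P. \<omega> \<in> space P - N"
    using AE_not_in[OF N] AE_space by eventually_elim simp
  then have "AE \<omega> in distr P P (shift (- real n)). \<omega> \<in> space P - N" by (simp only: sh(2))
  then show "AE \<omega> in P. shift (- real n) \<omega> \<in> space P - N" by (rule AE_distrD[OF sh(1)])
qed

section \<open>Convergence of the attractors\<close>

context reaction_diffusion_equation
begin

text \<open>Invariance provides the starting point \<open>b\<close>. The process along the
  shifted path is \<open>Y\<close> shifted in time, which makes the coefficient of the
  equation for \<open>v\<close> explicit.\<close>

lemma pullback_step:
  fixes \<omega> :: "real \<Rightarrow> real" and m j :: nat
  defines "Y \<equiv> \<lambda>t. ou lam (shift t \<omega>)" and "H \<equiv> L2_of h0"
  assumes gen: "generated_by_stochastic_equation P N lam f g0 h0 \<epsilon> \<Phi>" and attr: "random_attractor P N lam \<Phi> A"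
    and orbit: "\<And>n::nat. shift (- real n) \<omega> \<in> space P - N"
    and a: "a \<in> A (shift (- real m) \<omega>)"
  obtains b where "b \<in> A (shift (- real (m + j)) \<omega>)" "a = \<Phi> (real j) (shift (- real (m + j)) \<omega>) b"
    "solution lam f g0 h0 (\<lambda>t. \<epsilon> * Y (t - real (m + j))) (b - (\<epsilon> * Y (- real (m + j))) *\<^sub>R H)
      (\<lambda>t. \<Phi> t (shift (- real (m + j)) \<omega>) b - (\<epsilon> * Y (t - real (m + j))) *\<^sub>R H)"
proof -
  define w where "w = shift (- real (m + j)) \<omega>"
  have w: "w \<in> space P - N" using orbit[of "m + j"] by (simp add: w_def)
  have sh: "shift t w = shift (t - real (m + j)) \<omega>" for t by (simp only: w_def shift_shift diff_conv_add_uminus)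
  have "\<Phi> (real j) w ` A w = A (shift (real j) w)" using attr w unfolding random_attractor_def by auto
  also have "shift (real j) w = shift (- real m) \<omega>" by (simp add: sh)
  finally obtain b where b: "b \<in> A w" "a = \<Phi> (real j) w b" using a by auto
  have "the_solution lam f g0 h0 (\<lambda>t. \<epsilon> * ou lam (shift t w)) (b - (\<epsilon> * ou lam w) *\<^sub>R H) (\<lambda>t. \<Phi> t w b - (\<epsilon> * ou lam (shift t w)) *\<^sub>R H)"
    using gen w unfolding generated_by_stochastic_equation_def H_def by blast
  moreover have "ou lam w = Y (- real (m + j))" by (simp add: Y_def w_def)
  ultimately have "solution lam f g0 h0 (\<lambda>t. \<epsilon> * Y (t - real (m + j))) (b - (\<epsilon> * Y (- real (m + j))) *\<^sub>R H)
      (\<lambda>t. \<Phi> t w b - (\<epsilon> * Y (t - real (m + j))) *\<^sub>R H)"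
    unfolding the_solution_def sh by (simp add: Y_def)
  then show thesis using that b unfolding w_def by blast
qed

text \<open>Start at time \<open>- (m + j)\<close> in a point of the attractor and let
  \<open>j\<close> tend to infinity. The bound holds for all points of the attractor because
  the starting points, of which only temperedness is known, are forgotten at the rate
  \<open>exp (- lam * j)\<close>.\<close>

lemma attractor_bound:
  fixes \<omega> :: "real \<Rightarrow> real" and m :: nat
  defines "Y \<equiv> \<lambda>t. ou lam (shift t \<omega>)" and "H \<equiv> L2_of h0"
  assumes gen: "generated_by_stochastic_equation P N lam f g0 h0 \<epsilon> \<Phi>" and attr: "random_attractor P N lam \<Phi> A"
    and temp: "tempered P N lam A" and \<epsilon>: "0 < \<epsilon>" "\<epsilon> \<le> 1"
    and orbit: "\<And>n::nat. shift (- real n) \<omega> \<in> space P - N"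
    and Y_cont: "continuous_on {..0} Y"
    and Q: "\<And>n::nat. integral {- real n..0} (\<lambda>t. exp (lam * t) * ((Y t)\<^sup>2 + \<bar>Y t\<bar> powr p)) \<le> Q"
    and Y_lim: "(\<lambda>n. exp (- lam / 2 * real n) * Y (- real n)) \<longlonglongrightarrow> 0"
    and a: "a \<in> A (shift (- real m) \<omega>)"
  shows "(norm (a - (\<epsilon> * Y (- real m)) *\<^sub>R H))\<^sup>2 \<le> 2 * D0 / lam + \<epsilon> * (2 * (D1 + D2) * exp (lam * real m) * Q)"
proof -
  let ?w = "\<lambda>j. shift (- real (m + j)) \<omega>"
  let ?K = "2 * D0 / lam + \<epsilon> * (2 * (D1 + D2) * exp (lam * real m) * Q)"
  let ?x = "norm (a - (\<epsilon> * Y (- real m)) *\<^sub>R H)"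
  have "\<exists>b\<in>A (?w (Suc k)). ?x\<^sup>2 \<le> exp (- lam * real (Suc k)) * (norm (b - (\<epsilon> * Y (- real (m + Suc k))) *\<^sub>R H))\<^sup>2 + ?K" for k
  proof -
    define j where "j = Suc k"
    obtain b where b: "b \<in> A (?w j)" "a = \<Phi> (real j) (?w j) b"
      "solution lam f g0 h0 (\<lambda>t. \<epsilon> * Y (t - real (m + j))) (b - (\<epsilon> * Y (- real (m + j))) *\<^sub>R H)
      (\<lambda>t. \<Phi> t (?w j) b - (\<epsilon> * Y (t - real (m + j))) *\<^sub>R H)"
      unfolding Y_def H_def by (rule pullback_step[OF gen attr orbit a])
    have "continuous_on {0..real j} (\<lambda>t. \<epsilon> * Y (t - real (m + j)))"
      by (intro continuous_intros continuous_on_compose2[OF Y_cont]) auto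
    from solution_decay[OF b(3) _ this]
    have "(norm (\<Phi> (real j) (?w j) b - (\<epsilon> * Y (real j - real (m + j))) *\<^sub>R H))\<^sup>2
      \<le> exp (- lam * real j) * (norm (b - (\<epsilon> * Y (- real (m + j))) *\<^sub>R H))\<^sup>2
        + integral {0..real j} (\<lambda>s. exp (lam * (s - real j)) * (2 * load (\<epsilon> * Y (s - real (m + j)))))"
      by (simp add: j_def)
    also have "\<dots> \<le> exp (- lam * real j) * (norm (b - (\<epsilon> * Y (- real (m + j))) *\<^sub>R H))\<^sup>2 + ?K"
      by (intro add_left_mono load_integral_le[OF Y_cont \<epsilon> Q])
    finally show ?thesis using b(1) unfolding b(2)[symmetric] by (auto simp: j_def intro!: bexI[of _ b])
  qed
  \<comment> \<open>\<open>j = Suc k\<close>, since the estimates ask for a positive time\<close>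
  then obtain b where b: "\<And>k. b k \<in> A (?w (Suc k))"
    "\<And>k. ?x\<^sup>2 \<le> exp (- lam * real (Suc k)) * (norm (b k - (\<epsilon> * Y (- real (m + Suc k))) *\<^sub>R H))\<^sup>2 + ?K"
    by metis
  let ?e = "\<lambda>k. exp (- lam / 2 * real (m + Suc k))"
  have past: "filterlim (\<lambda>k. m + Suc k) at_top sequentially"
    by (rule filterlim_subseq) (simp add: strict_mono_def)
  have s_lim: "(\<lambda>k. ?e k * norm (b k)) \<longlonglongrightarrow> 0"
  proof -
    have "((\<lambda>t. ennreal (exp (- (1/2) * lam * t)) * set_norm (A (shift (- t) (shift 0 \<omega>)))) \<longlongrightarrow> 0) at_top"
      using temp orbit[of 0] unfolding tempered_def by auto
    from filterlim_compose[OF this filterlim_compose[OF filterlim_real_sequentially past]]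
    have lim: "(\<lambda>k. ennreal (?e k) * set_norm (A (?w (Suc k)))) \<longlonglongrightarrow> 0" by (simp add: shift_shift)
    have le: "ennreal (?e k * norm (b k)) \<le> ennreal (?e k) * set_norm (A (?w (Suc k)))" for k
      using b(1)[of k] by (subst ennreal_mult) (auto simp: set_norm_def intro!: mult_left_mono SUP_upper)
    have "(\<lambda>k. ennreal (?e k * norm (b k))) \<longlonglongrightarrow> 0"
      by (rule tendsto_sandwich[OF _ always_eventually[OF allI[OF le]] tendsto_const lim]) simp
    then show ?thesis by (subst (asm) ennreal_tendsto_0_iff) auto
  qed
  have "(\<lambda>k. ?e k * Y (- real (m + Suc k))) \<longlonglongrightarrow> 0" by (rule filterlim_compose[OF Y_lim past])
  then have "(\<lambda>k. \<bar>?e k * Y (- real (m + Suc k))\<bar> * norm H) \<longlonglongrightarrow> 0"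
    by (intro tendsto_mult_left_zero tendsto_rabs_zero)
  from tendsto_mult[OF tendsto_const tendsto_power[OF tendsto_add[OF s_lim this]]]
  have "(\<lambda>k. exp (lam * real m) * (?e k * norm (b k) + \<bar>?e k * Y (- real (m + Suc k))\<bar> * norm H)\<^sup>2) \<longlonglongrightarrow> exp (lam * real m) * (0 + 0)\<^sup>2" .
  then have "(\<lambda>k. exp (lam * real m) * (?e k * norm (b k) + \<bar>?e k * Y (- real (m + Suc k))\<bar> * norm H)\<^sup>2 + ?K) \<longlonglongrightarrow> exp (lam * real m) * (0 + 0)\<^sup>2 + ?K"
    by (rule tendsto_add[OF _ tendsto_const])
  then have lim: "(\<lambda>k. exp (lam * real m) * (?e k * norm (b k) + \<bar>?e k * Y (- real (m + Suc k))\<bar> * norm H)\<^sup>2 + ?K) \<longlonglongrightarrow> ?K" by simp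
  have "?x\<^sup>2 \<le> exp (lam * real m) * (?e k * norm (b k) + \<bar>?e k * Y (- real (m + Suc k))\<bar> * norm H)\<^sup>2 + ?K" for k
  proof -
    let ?y = "Y (- real (m + Suc k))"
    have "norm (b k - (\<epsilon> * ?y) *\<^sub>R H) \<le> norm (b k) + norm ((\<epsilon> * ?y) *\<^sub>R H)" by (rule norm_triangle_ineq4)
    also have "norm ((\<epsilon> * ?y) *\<^sub>R H) = \<epsilon> * (\<bar>?y\<bar> * norm H)" using \<epsilon> by (simp add: abs_mult)
    also have "\<dots> \<le> 1 * (\<bar>?y\<bar> * norm H)" using \<epsilon> by (intro mult_right_mono) auto
    finally have "?e k * norm (b k - (\<epsilon> * ?y) *\<^sub>R H) \<le> ?e k * (norm (b k) + 1 * (\<bar>?y\<bar> * norm H))" by (intro mult_left_mono) auto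
    also have "\<dots> = ?e k * norm (b k) + \<bar>?e k * ?y\<bar> * norm H" by (simp add: abs_mult distrib_left)
    finally have "(?e k * norm (b k - (\<epsilon> * ?y) *\<^sub>R H))\<^sup>2 \<le> (?e k * norm (b k) + \<bar>?e k * ?y\<bar> * norm H)\<^sup>2"
      by (intro power_mono) auto
    then have "exp (lam * real m) * (?e k * norm (b k - (\<epsilon> * ?y) *\<^sub>R H))\<^sup>2 \<le> exp (lam * real m) * (?e k * norm (b k) + \<bar>?e k * ?y\<bar> * norm H)\<^sup>2"
      by (intro mult_left_mono) auto
    also have "exp (lam * real m) * (?e k * norm (b k - (\<epsilon> * ?y) *\<^sub>R H))\<^sup>2 = exp (- lam * real (Suc k)) * (norm (b k - (\<epsilon> * ?y) *\<^sub>R H))\<^sup>2"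
    proof -
      \<comment> \<open>half of the decay rate for each factor of the square, and \<open>exp
        (lam * m)\<close> for the time between \<open>-m\<close> and 0\<close>
      have "exp (lam * real m) * (?e k)\<^sup>2 = exp (lam * real m + 2 * (- lam / 2 * real (m + Suc k)))"
        by (simp only: exp_add exp_double)
      also have "lam * real m + 2 * (- lam / 2 * real (m + Suc k)) = - lam * real (Suc k)" by (simp add: algebra_simps)
      finally show ?thesis by (simp add: power_mult_distrib mult.assoc[symmetric])
    qed
    finally show ?thesis using b(2)[of k] by linarith
  qed
  then show ?thesis by (intro LIMSEQ_le_const[OF lim]) blast
qed

text \<open>The radius \<open>M\<close> exceeds the limit of the bound in
  \<open>attractor_bound\<close> as \<open>\<epsilon>\<close> tends to 0, for every
  \<open>m\<close>; this is what allows \<open>m\<close> to be chosen before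
  \<open>\<epsilon>\<close>.\<close>

lemma attractors_converge:
  fixes \<omega> :: "real \<Rightarrow> real"
  defines "Y \<equiv> \<lambda>t. ou lam (shift t \<omega>)" and "H \<equiv> L2_of h0"
  assumes gen: "\<And>\<epsilon>. \<epsilon> > 0 \<Longrightarrow> generated_by_stochastic_equation P N lam f g0 h0 \<epsilon> (\<Phi> \<epsilon>)"
    and attr: "\<And>\<epsilon>. \<epsilon> > 0 \<Longrightarrow> random_attractor P N lam (\<Phi> \<epsilon>) (A \<epsilon>)"
    and temp: "\<And>\<epsilon>. \<epsilon> > 0 \<Longrightarrow> tempered P N lam (A \<epsilon>)"
    and det: "generated_by_deterministic_equation lam f g0 S" and A0: "global_attractor S A0"
    and \<omega>0: "\<omega> 0 = 0" and orbit: "\<And>n::nat. shift (- real n) \<omega> \<in> space P - N"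
    and Y_cont: "continuous_on {..0} Y"
    and Q: "\<And>n::nat. integral {- real n..0} (\<lambda>t. exp (lam * t) * ((Y t)\<^sup>2 + \<bar>Y t\<bar> powr p)) \<le> Q"
    and Y_lim: "(\<lambda>n. exp (- lam / 2 * real n) * Y (- real n)) \<longlonglongrightarrow> 0"
  shows "((\<lambda>\<epsilon>. semidist (A \<epsilon> \<omega>) A0) \<longlongrightarrow> 0) (at_right 0)"
proof -
  define M where "M = sqrt (2 * D0 / lam) + 1"
  have close: "eventually (\<lambda>\<epsilon>. semidist (A \<epsilon> \<omega>) A0 \<le> ennreal (2 * \<eta>)) (at_right 0)" if \<eta>: "0 < \<eta>" for \<eta>
  proof -
    have "((\<lambda>t. semidist (S t ` cball 0 M) A0) \<longlongrightarrow> 0) at_top"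
      using A0 unfolding global_attractor_def by (simp add: bounded_cball)
    then have "eventually (\<lambda>n. semidist (S (real n) ` cball 0 M) A0 < ennreal \<eta>) sequentially"
      using \<eta> by (intro order_tendstoD(2)[OF filterlim_compose[OF _ filterlim_real_sequentially]]) auto
    from eventually_happens[OF eventually_conj[OF this eventually_ge_at_top[of 1]]]
    obtain m :: nat where m: "semidist (S (real m) ` cball 0 M) A0 < ennreal \<eta>" "1 \<le> m" by auto
    define K where "K = 2 * (D1 + D2) * exp (lam * real m) * Q"
    have "compact (Y ` {- real m..0})"
      by (rule compact_continuous_image[OF continuous_on_subset[OF Y_cont]]) auto
    then obtain C where C: "\<And>t. t \<in> {- real m..0} \<Longrightarrow> \<bar>Y t\<bar> \<le> C"
      by (force dest!: compact_imp_bounded simp: bounded_iff)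
    have C0: "0 \<le> C" using C[of 0] by auto
    \<comment> \<open>the norm of \<open>v\<close> at time \<open>-m\<close> is at most that
      of \<open>u\<close> plus \<open>\<epsilon> * C * norm H\<close>\<close>
    define r where "r = (M + C * norm H)\<^sup>2"
    define E where "E = exp (2 * (2 * \<beta> + 1) * real m)"
    \<comment> \<open>distance of the two flows at time \<open>m\<close>: the estimate for
      \<open>v\<close>, and the passage from \<open>v\<close> to \<open>u\<close>\<close>
    define err where "err \<epsilon> = sqrt (((\<epsilon> * C * norm H)\<^sup>2 + \<epsilon> * C * gap (real m) r) * E) + \<epsilon> * C * norm H" for \<epsilon>
    have id0: "((\<lambda>\<epsilon>::real. \<epsilon>) \<longlongrightarrow> 0) (at_right 0)" by (rule tendsto_ident_at)
    have "((\<lambda>\<epsilon>. sqrt (2 * D0 / lam + \<epsilon> * K) + \<epsilon> * C * norm H) \<longlongrightarrow> sqrt (2 * D0 / lam + 0 * K) + 0 * C * norm H) (at_right 0)"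
      by (intro tendsto_intros id0)
    then have ev1: "eventually (\<lambda>\<epsilon>. sqrt (2 * D0 / lam + \<epsilon> * K) + \<epsilon> * C * norm H < M) (at_right 0)"
      by (rule order_tendstoD) (simp add: M_def)
    have "(err \<longlongrightarrow> sqrt (((0 * C * norm H)\<^sup>2 + 0 * C * gap (real m) r) * E) + 0 * C * norm H) (at_right 0)"
      unfolding err_def[abs_def] by (intro tendsto_intros id0)
    then have ev2: "eventually (\<lambda>\<epsilon>. err \<epsilon> < \<eta>) (at_right 0)"
      by (rule order_tendstoD) (simp add: \<eta>)
    have "((\<lambda>\<epsilon>. \<epsilon> * (1 + C)) \<longlongrightarrow> 0 * (1 + C)) (at_right 0)" by (intro tendsto_intros id0)
    then have ev3: "eventually (\<lambda>\<epsilon>. \<epsilon> * (1 + C) < 1) (at_right 0)" by (rule order_tendstoD) simp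
    have ev4: "eventually (\<lambda>\<epsilon>::real. 0 < \<epsilon>) (at_right 0)" by (simp add: eventually_at_right_less)
    show ?thesis
      using ev1 ev2 ev3 ev4
    proof eventually_elim
      case (elim \<epsilon>)
      have "0 \<le> \<epsilon> * C" using elim(4) C0 by simp
      then have \<epsilon>: "0 < \<epsilon>" "\<epsilon> \<le> 1" "\<epsilon> * C \<le> 1" using elim(3,4) unfolding distrib_left by auto
      have "(INF c\<in>A0. ennreal (dist a c)) \<le> ennreal (2 * \<eta>)" if "a \<in> A \<epsilon> \<omega>" for a
      proof -
        have "a \<in> A \<epsilon> (shift (- real 0) \<omega>)" using that \<omega>0 by (simp add: shift_0)
        then obtain b where b: "b \<in> A \<epsilon> (shift (- real (0 + m)) \<omega>)" "a = \<Phi> \<epsilon> (real m) (shift (- real (0 + m)) \<omega>) b"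
          "solution lam f g0 h0 (\<lambda>t. \<epsilon> * Y (t - real (0 + m))) (b - (\<epsilon> * Y (- real (0 + m))) *\<^sub>R H)
            (\<lambda>t. \<Phi> \<epsilon> t (shift (- real (0 + m)) \<omega>) b - (\<epsilon> * Y (t - real (0 + m))) *\<^sub>R H)"
          unfolding Y_def H_def by (rule pullback_step[OF gen[OF \<epsilon>(1)] attr[OF \<epsilon>(1)] orbit])
        let ?v0 = "b - (\<epsilon> * Y (- real m)) *\<^sub>R H"
        have small: "norm ((\<epsilon> * Y t) *\<^sub>R H) \<le> \<epsilon> * C * norm H" if "t \<in> {- real m..0}" for t
          using C[OF that] \<epsilon>(1) by (auto simp: abs_mult intro!: mult_right_mono mult_left_mono)
        have "b \<in> A \<epsilon> (shift (- real m) \<omega>)" using b(1) by simp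
        from attractor_bound[OF gen[OF \<epsilon>(1)] attr[OF \<epsilon>(1)] temp[OF \<epsilon>(1)] \<epsilon>(1,2) orbit Y_cont[unfolded Y_def] Q[unfolded Y_def] Y_lim[unfolded Y_def] this]
        have "(norm ?v0)\<^sup>2 \<le> 2 * D0 / lam + \<epsilon> * K" by (simp add: Y_def H_def K_def)
        then have v0: "norm ?v0 \<le> sqrt (2 * D0 / lam + \<epsilon> * K)" by (rule real_le_rsqrt)
        have sm: "norm ((\<epsilon> * Y (- real m)) *\<^sub>R H) \<le> \<epsilon> * C * norm H" by (rule small) simp
        have "norm b \<le> norm ?v0 + norm ((\<epsilon> * Y (- real m)) *\<^sub>R H)" using norm_triangle_ineq[of ?v0 "(\<epsilon> * Y (- real m)) *\<^sub>R H"] by simp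
        then have bM: "norm b \<le> M" "norm ?v0 \<le> M" using v0 sm elim(1) norm_ge_zero[of "(\<epsilon> * Y (- real m)) *\<^sub>R H"] by linarith+
        have "M \<le> M + C * norm H" using C0 by simp
        then have rs: "(norm ?v0)\<^sup>2 \<le> r" "(norm b)\<^sup>2 \<le> r"
          unfolding r_def using bM by (auto intro!: power_mono)
        have sol': "solution lam f g0 (\<lambda>x. 0) (\<lambda>t. 0) b (\<lambda>t. S t b)"
          using det unfolding generated_by_deterministic_equation_def the_solution_def by blast
        have c: "continuous_on {0..real m} (\<lambda>t. \<epsilon> * Y (t - real m))"
          by (intro continuous_intros continuous_on_compose2[OF Y_cont]) auto
        have "\<bar>\<epsilon> * Y (s - real m)\<bar> \<le> \<epsilon> * C" if "s \<in> {0..real m}" for s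
          using C[of "s - real m"] that \<epsilon>(1) by (simp add: abs_mult)
        from solution_difference[OF b(3)[unfolded add_0] sol' _ c this \<epsilon>(3) rs]
        have d: "(norm ((a - (\<epsilon> * Y 0) *\<^sub>R H) - S (real m) b))\<^sup>2 \<le> ((norm (?v0 - b))\<^sup>2 + \<epsilon> * C * gap (real m) r) * E"
          using m(2) b(2) by (simp add: E_def)
        also have "\<dots> \<le> ((\<epsilon> * C * norm H)\<^sup>2 + \<epsilon> * C * gap (real m) r) * E"
          using sm by (intro mult_right_mono add_right_mono power_mono) (auto simp: E_def)
        finally have "norm ((a - (\<epsilon> * Y 0) *\<^sub>R H) - S (real m) b) \<le> sqrt (((\<epsilon> * C * norm H)\<^sup>2 + \<epsilon> * C * gap (real m) r) * E)"
          by (rule real_le_rsqrt)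
        moreover have "norm ((\<epsilon> * Y 0) *\<^sub>R H) \<le> \<epsilon> * C * norm H" by (rule small) simp
        moreover have "dist a (S (real m) b) \<le> norm ((a - (\<epsilon> * Y 0) *\<^sub>R H) - S (real m) b) + norm ((\<epsilon> * Y 0) *\<^sub>R H)"
          using norm_triangle_ineq[of "(a - (\<epsilon> * Y 0) *\<^sub>R H) - S (real m) b" "(\<epsilon> * Y 0) *\<^sub>R H"] by (simp add: dist_norm algebra_simps)
        ultimately have near: "dist a (S (real m) b) < \<eta>" using elim(2) unfolding err_def by linarith
        have "(INF c\<in>A0. ennreal (dist (S (real m) b) c)) \<le> semidist (S (real m) ` cball 0 M) A0"
          unfolding semidist_def using bM(1) by (intro SUP_upper) (auto simp: dist_norm)
        also note m(1)
        finally obtain c where c: "c \<in> A0" "ennreal (dist (S (real m) b) c) < ennreal \<eta>" by (auto simp: INF_less_iff)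
        then have "dist (S (real m) b) c < \<eta>" by (simp add: ennreal_less_iff)
        then have "dist a c \<le> 2 * \<eta>" using near dist_triangle[of a c "S (real m) b"] by linarith
        then have "ennreal (dist a c) \<le> ennreal (2 * \<eta>)" by (rule ennreal_leI)
        then show ?thesis by (rule order_trans[OF INF_lower[OF c(1)]])
      qed
      then show ?case unfolding semidist_def by (intro SUP_least)
    qed
  qed
  show ?thesis
  proof (rule order_tendstoI)
    fix e :: ennreal assume "0 < e"
    then obtain q :: rat where q: "0 < ennreal (real_of_rat q)" "ennreal (real_of_rat q) < e"
      using ennreal_rat_dense by blast
    define \<eta> where "\<eta> = real_of_rat q / 2"
    have \<eta>: "0 < \<eta>" using q(1) by (simp add: \<eta>_def)
    show "eventually (\<lambda>\<epsilon>. semidist (A \<epsilon> \<omega>) A0 < e) (at_right 0)"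
      using close[OF \<eta>] by eventually_elim (use q(2) in \<open>simp add: \<eta>_def\<close>)
  qed simp
qed

end

lemma Lp_borel_representative:
  fixes u :: "'a::euclidean_space \<Rightarrow> real"
  assumes "u \<in> Lp p"
  obtains u' where "u' \<in> borel_measurable borel" "AE x in lborel. u x = u' x" "integrable lborel (\<lambda>x. \<bar>u' x\<bar> powr p)"
proof -
  have u: "u \<in> borel_measurable lebesgue" "integrable lebesgue (\<lambda>x. \<bar>u x\<bar> powr p)" using assms by (auto simp: Lp_def)
  obtain u' where u': "u' \<in> borel_measurable borel" "AE x in lborel. u x = u' x" using borel_representative[OF u(1)] by blast
  have "integrable lborel (\<lambda>x. \<bar>u' x\<bar> powr p)"
  proof (rule integral_lebesgue_eq(2)[OF _ _ u(2)])
    show "AE x in lborel. \<bar>u x\<bar> powr p = \<bar>u' x\<bar> powr p" using u'(2) by eventually_elim simp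
    show "(\<lambda>x. \<bar>u' x\<bar> powr p) \<in> borel_measurable borel" using u'(1) by measurable
  qed
  with u' show thesis by (rule that)
qed

lemma one_sided_Lipschitz:
  fixes \<phi> :: "real \<Rightarrow> real"
  assumes diff: "\<And>s. \<phi> differentiable (at s)" and le: "\<And>s. deriv \<phi> s \<le> \<beta>"
  shows "(\<phi> s - \<phi> t) * (s - t) \<le> \<beta> * (s - t)\<^sup>2"
proof -
  have *: "(\<phi> s - \<phi> t) * (s - t) \<le> \<beta> * (s - t)\<^sup>2" if "t < s" for s t
  proof -
    have "\<And>x. DERIV \<phi> x :> deriv \<phi> x"
      using diff by (simp add: DERIV_deriv_iff_real_differentiable)
    from MVT2[OF that, of \<phi> "deriv \<phi>"] this obtain z where "\<phi> s - \<phi> t = (s - t) * deriv \<phi> z" by blast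
    then have "(\<phi> s - \<phi> t) * (s - t) = deriv \<phi> z * (s - t)\<^sup>2" by (simp add: power2_eq_square)
    also have "\<dots> \<le> \<beta> * (s - t)\<^sup>2" by (intro mult_right_mono le) simp
    finally show ?thesis .
  qed
  show ?thesis
  proof (cases t s rule: linorder_cases)
    case less
    then show ?thesis by (rule *)
  next
    case greater
    from *[OF this] show ?thesis by (simp add: power2_commute algebra_simps)
  qed simp
qed

lemma smooth_second_argument_differentiable:
  fixes f :: "'a::euclidean_space \<Rightarrow> real \<Rightarrow> real"
  assumes "smooth (\<lambda>(x, s). f x s)"
  shows "f x differentiable (at s)"
proof -
  have "Ck (Suc 0) (\<lambda>(x, s). f x s)" using assms unfolding smooth_def by blast
  then have "(\<lambda>(x, s). f x s) differentiable (at (x, s))" unfolding Ck.simps(2) by blast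
  then obtain D where "((\<lambda>(x, s). f x s) has_derivative D) (at (x, s))" unfolding differentiable_def by blast
  from has_derivative_compose[OF has_derivative_Pair[OF has_derivative_const has_derivative_ident], OF this]
  show ?thesis unfolding differentiable_def by auto
qed

theorem theorem6p3:
  fixes P :: "(real \<Rightarrow> real) measure" and N :: "(real \<Rightarrow> real) set"
    and lam p q \<alpha>1 \<alpha>2 \<alpha>3 \<beta> :: real
    and g h \<psi>1 \<psi>2 \<psi>3 \<psi>4 :: "real ^ 'n \<Rightarrow> real"
    and f :: "real ^ 'n \<Rightarrow> real \<Rightarrow> real"
    and \<Phi> :: "real \<Rightarrow> real \<Rightarrow> (real \<Rightarrow> real) \<Rightarrow> (real ^ 'n) L2 \<Rightarrow> (real ^ 'n) L2"
    and \<A> :: "real \<Rightarrow> (real \<Rightarrow> real) \<Rightarrow> (real ^ 'n) L2 set"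
    and S :: "real \<Rightarrow> (real ^ 'n) L2 \<Rightarrow> (real ^ 'n) L2"
    and \<A>0 :: "(real ^ 'n) L2 set"
  assumes "wiener_system P" and "N \<in> null_sets P"
    and "lam > 0" and "p \<ge> 2" and "1 / q + 1 / p = 1"
    and "h \<in> sobolev 2 2" and "h \<in> sobolev 2 p"
    and "g \<in> Lp 2"
    and "smooth (\<lambda>(x, s). f x s)"
    and "\<alpha>1 > 0" and "\<alpha>2 > 0" and "\<alpha>3 > 0" and "\<beta> > 0"
    and "\<psi>1 \<in> Lp 1" and "\<psi>1 \<in> Linf"
    and "\<psi>2 \<in> Lp 2" and "\<psi>2 \<in> Lp q"
    and "\<psi>3 \<in> Lp 2"
    and "p = 2 \<Longrightarrow> \<psi>4 \<in> Linf" and "p > 2 \<Longrightarrow> \<psi>4 \<in> Lp (p / (p - 2))"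
    and "\<And>x s. f x s * s \<le> - \<alpha>1 * \<bar>s\<bar> powr p + \<psi>1 x"
    and "\<And>x s. \<bar>f x s\<bar> \<le> \<alpha>2 * \<bar>s\<bar> powr (p - 1) + \<psi>2 x"
    and "\<And>x s. deriv (f x) s \<le> \<beta>"
    and "\<And>x s. onorm (frechet_derivative (\<lambda>x'. f x' s) (at x)) \<le> \<psi>3 x"
    \<comment> \<open>the case distinction is there because \<open>0 powr 0 = 0\<close>\<close>
    and "\<And>x s. \<bar>deriv (f x) s\<bar> \<le> \<alpha>3 * (if p = 2 then 1 else \<bar>s\<bar> powr (p - 2)) + \<psi>4 x"
    and "\<And>\<epsilon>. \<epsilon> > 0 \<Longrightarrow> generated_by_stochastic_equation P N lam f g h \<epsilon> (\<Phi> \<epsilon>)"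
    and "\<And>\<epsilon>. \<epsilon> > 0 \<Longrightarrow> random_attractor P N lam (\<Phi> \<epsilon>) (\<A> \<epsilon>)"
    and "\<And>\<epsilon>. \<epsilon> > 0 \<Longrightarrow> tempered P N lam (\<A> \<epsilon>)"
    and "generated_by_deterministic_equation lam f g S"
    and "global_attractor S \<A>0"
  shows "AE \<omega> in P. ((\<lambda>\<epsilon>. semidist (\<A> \<epsilon> \<omega>) \<A>0) \<longlongrightarrow> 0) (at_right 0)"
proof -
  note W = assms(1) and N = assms(2) and lam = assms(3) and p = assms(4) and h22 = assms(6) and h2p = assms(7)
    and smooth_f = assms(9) and dissipative = assms(21) and growth = assms(22) and deriv_le = assms(23)
  have abs2: "\<bar>r\<bar> powr 2 = r\<^sup>2" for r :: real by simp
  obtain g' where g': "g' \<in> borel_measurable borel" "AE x in lborel. g x = g' x" "integrable lborel (\<lambda>x. (g' x)\<^sup>2)"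
    using Lp_borel_representative[OF assms(8)] unfolding abs2 by blast
  have "h \<in> Lp 2" using h22 by (simp add: numeral_2_eq_2)
  then obtain h' where h': "h' \<in> borel_measurable borel" "AE x in lborel. h x = h' x" "integrable lborel (\<lambda>x. (h' x)\<^sup>2)"
    using Lp_borel_representative unfolding abs2[symmetric] by blast
  have hp: "integrable lborel (\<lambda>x. \<bar>h' x\<bar> powr p)"
  proof (rule integral_lebesgue_eq(2))
    show "integrable lebesgue (\<lambda>x. \<bar>h x\<bar> powr p)" using h2p by (simp add: numeral_2_eq_2 Lp_def)
    show "AE x in lborel. \<bar>h x\<bar> powr p = \<bar>h' x\<bar> powr p" using h'(2) by eventually_elim simp
    show "(\<lambda>x. \<bar>h' x\<bar> powr p) \<in> borel_measurable borel" using h'(1) by measurable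
  qed
  obtain L where L: "L \<in> Lp 2" "\<And>\<phi>. test_function \<phi> \<Longrightarrow> (\<integral>x. h x * laplacian \<phi> x \<partial>lebesgue) = (\<integral>x. L x * \<phi> x \<partial>lebesgue)"
    using sobolev_weak_laplacian[OF h22] by blast
  obtain L' where L': "L' \<in> borel_measurable borel" "AE x in lborel. L x = L' x" "integrable lborel (\<lambda>x. (L' x)\<^sup>2)"
    using Lp_borel_representative[OF L(1)] unfolding abs2 by blast
  obtain \<psi>1' where \<psi>1': "\<psi>1' \<in> borel_measurable borel" "AE x in lborel. \<psi>1 x = \<psi>1' x" "integrable lborel (\<lambda>x. \<bar>\<psi>1' x\<bar> powr 1)"
    using Lp_borel_representative[OF assms(14)] by blast
  obtain \<psi>2' where \<psi>2': "\<psi>2' \<in> borel_measurable borel" "AE x in lborel. \<psi>2 x = \<psi>2' x" "integrable lborel (\<lambda>x. (\<psi>2' x)\<^sup>2)"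
    using Lp_borel_representative[OF assms(16)] unfolding abs2 by blast
  interpret reaction_diffusion_equation lam p \<alpha>1 \<alpha>2 \<beta> f g' h' L' \<psi>1' \<psi>2' g h
  proof
    show "continuous_on UNIV (\<lambda>(x, s). f x s)" by (rule smooth_continuous[OF smooth_f])
    show "AE x in lborel. \<forall>s. f x s * s \<le> - \<alpha>1 * \<bar>s\<bar> powr p + \<psi>1' x"
      using \<psi>1'(2) by eventually_elim (metis dissipative)
    show "AE x in lborel. \<forall>s. \<bar>f x s\<bar> \<le> \<alpha>2 * \<bar>s\<bar> powr (p - 1) + \<psi>2' x"
      using \<psi>2'(2) by eventually_elim (metis growth)
    show "(f x s - f x t) * (s - t) \<le> \<beta> * (s - t)\<^sup>2" for x s t
      by (rule one_sided_Lipschitz[OF smooth_second_argument_differentiable[OF smooth_f] deriv_le])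
    show "integrable lborel (\<lambda>x. \<bar>\<psi>1' x\<bar>)" using \<psi>1'(3) by simp
    show "(\<integral>x. h' x * laplacian \<phi> x \<partial>lborel) = (\<integral>x. L' x * \<phi> x \<partial>lborel)" if \<phi>: "test_function \<phi>" for \<phi>
    proof -
      have [measurable]: "\<phi> \<in> borel_measurable borel" "laplacian \<phi> \<in> borel_measurable borel"
        by (rule test_function_bounds[OF \<phi>], assumption)+
      note [measurable] = h'(1) L'(1)
      have "(\<integral>x. h x * laplacian \<phi> x \<partial>lebesgue) = (\<integral>x. h' x * laplacian \<phi> x \<partial>lborel)"
        by (rule integral_lebesgue_eq(1)) (measurable, rule AE_mp[OF h'(2)], simp)
      moreover have "(\<integral>x. L x * \<phi> x \<partial>lebesgue) = (\<integral>x. L' x * \<phi> x \<partial>lborel)"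
        by (rule integral_lebesgue_eq(1)) (measurable, rule AE_mp[OF L'(2)], simp)
      ultimately show ?thesis using L(2)[OF \<phi>] by simp
    qed
  qed (fact lam p assms(10,11,13) g' h' L' hp \<psi>1'(1) \<psi>2'(1,3))+
  \<comment> \<open>one set of full measure, for all \<open>\<epsilon>\<close> at once\<close>
  from AE_orbit_avoids_null_set[OF W N] AE_ou_growth[OF W lam p] AE_space show ?thesis
  proof eventually_elim
    case (elim \<omega>)
    then obtain Q where Q: "\<And>n::nat. integral {- real n..0} (\<lambda>t. exp (lam * t) * ((ou lam (shift t \<omega>))\<^sup>2 + \<bar>ou lam (shift t \<omega>)\<bar> powr p)) \<le> Q"
      by blast
    show ?case
      by (rule attractors_converge[OF assms(26-30) path_0[OF W elim(3)] _ _ Q]) (use elim in auto)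
  qed
qed

end
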